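(* Let $L\ge 2$. Assume that the elliptic a posteriori error estimator $\eta(\cdot,\cdot)$ of the context exists, and that the Green's function bounds with constants $\kappa_0,\kappa_1,\kappa_1',\gamma\ge 0$ stated in the context hold. Let $u_h^j\in V_h$, $j=0,1,\dots,M$, be the sequence of approximations to $u(t_j)$ generated by the $L$-step extrapolated backward Euler/finite element method described in the context, where $u$ is the solution of the parabolic problem. Let $\psi^j$, $\Delta^i\psi^j$, $\Delta^iu_h^j$, $\Delta^i\hat f^j$, $\eta_{\mathrm{ell}}^j$, $\eta_{\mathrm{ell},i}^j$, $\sigma_j$, $\mu_{j,i}$ be as defined in the context. Then $$\|u(T)-u_h^M\|_{\infty,\Omega}\le \eta^M:=\eta_{\mathrm{init}}+\eta_f+\eta_t+\eta_{\mathrm{ell}},$$ where $$\eta_{\mathrm{init}}:=\kappa_0\sigma_0\|u^0-u_h^0\|_{\infty,\Omega},\qquad \eta_f:=\kappa_0\sum_{j=1}^M\sigma_j\int_{I_j}\|(f-\hat f)(s)\|_{\infty,\Omega}\,\mathrm{d}s,$$ $$\eta_t:=\sum_{j=1}^M\sigma_j\left(\mu_{j,L-2}\left\|\frac{\Delta^{L-2}\psi^j}{2L-5}+\frac{2}{\tau_j}\Delta^{L-1}u_h^j\right\|_{\infty,\Omega}+\frac{\mu_{j,L-1}}{2L-3}\|\Delta^{L-1}\psi^j\|_{\infty,\Omega}\right)$$ and $$\eta_{\mathrm{ell}}:=\kappa_0\left\{\sigma_0\,\eta_{\mathrm{ell}}^0+\eta_{\mathrm{ell}}^M\right\}+\k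appa_0\sum_{j=1}^M\sigma_j\sum_{i=1}^{L-1}\eta_{\mathrm{ell},i}^j\,\|P_{i-1}\|_{1,(-1,1)}.$$
   Context: **Parabolic problem.** $\Omega\subset\mathbb{R}^n$ is an open domain with Lipschitz boundary, $V=H_0^1(\Omega)$, $H=L_2(\Omega)$, $V^*=H^{-1}(\Omega)$. $\mathcal{L}$ is a second-order linear elliptic operator with associated bilinear form $a(\cdot,\cdot):V\times V\to\mathbb{R}$; $(\cdot,\cdot)$ is the $L_2(\Omega)$ scalar product, $\langle\cdot,\cdot\rangle$ the duality pairing of $V^*$ and $V$, $\|\cdot\|_{q,D}$ the norm of $L_q(D)$. Put $\mathcal{K}v=\partial_tv+\mathcal{L}v$ and $W_2^1(0,T;V,H)=\{v\in L_2(0,T;V): v'\in L_2(0,T;V^* )\}$. Given $u^0\in H$ and $f\in L_2(0,T;H)$ (continuous in time, so that it can be interpolated in time), the function $u\in W_2^1(0,T;V,H)$ is the unique solution of $\frac{\mathrm d}{\mathrm dt}(u(t),\chi)+a(u(t),\chi)=(f(t),\chi)$ for all $\chi\in V$, $t\in(0,T]$, with $u(0)=u^0$. It is assumed that $u^0=0$ on $\partial\Omega$, that $u^0$ is Hölder continuous on $\bar\Omega$, and that the data are such that $u$ is continuous on $\bar\Omega\times[0,T]$. **Time mesh.** $0=t_0<t_1<\dots<t_M=T$, $I_j=(t_{j-1},t_j)$, $\tau_j=t_j-t_{j-1}$; for $\xi\in[0,1]$, $t_{j-\xi}:=t_j-\xi\tau_j$ and $v^{j-\xi}:=v(t_{j-\xi})$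 for a function $v$ of time. $\hat f$ is the continuous function on $[0,T]$ with values in $L_2(\Omega)$ which on each $\bar I_j$ is the polynomial in time of degree at most $L-1$ interpolating $f$ at $t_{j-1}$, $t_j$ and at $L-2$ further points of $I_j$. **Space discretisation.** $V_h$ is a finite-dimensional (finite element) subspace of $V$; $a_h(\cdot,\cdot)$ and $(\cdot,\cdot)_h$ are approximations of $a(\cdot,\cdot)$ and $(\cdot,\cdot)$ (possibly involving quadrature); the discrete problems below are understood to be uniquely solvable. $u_h^0\in V_h$ is an approximation of $u^0$. **Method.** Let $\mathbf{B}=(b_{im})\in\mathbb{R}^{L\times(L-1)}$, $b_{im}=i^{-m}$, and for $\ell=1,\dots,L$ let $\alpha_\ell=\det(\mathbf{e}^\ell\,|\,\mathbf{B})/\det(\mathbf{1}\,|\,\mathbf{B})$, where $\mathbf{e}^\ell$ is the $\ell$-th unit vector of $\mathbb{R}^L$, $\mathbf{1}=(1,\dots,1)^{\mathsf T}$, and $(\mathbf{c}\,|\,\mathbf{B})$ is the $L\times L$ matrix with first column $\mathbf{c}$ followed by the columns of $\mathbf{B}$. For each $\ell=1,\dots,L$ set $v_\ell^0=u_h^0$ and, for $j=1,\dots,M$ and $k=\ell-1,\ell-2,\dots,0$, let $v_\ell^{j-k/\ell}\in V_h$ solve $$\left(\frac{v_\ell^{j-k/\ell}-v_\ell^{j-(k+1)/\ell}}{\tau_j/\ell},\chi\right)_h+a_h\left(v_\ell^{j-k/\ell},\chi\right)=\left(\hat f^{\,j-k/\ell},\chi\right)_h\quad\forall\chi\in V_h.$$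 Then $u_h^j:=\sum_{\ell=1}^L\alpha_\ell v_\ell^j$, $j=1,\dots,M$. **Elliptic estimator (assumption).** There is a functional $\eta$ such that for every $g\in H$, if $y\in V$ satisfies $a(y,\chi)=(g,\chi)$ for all $\chi\in V$ and $y_h\in V_h$ satisfies $a_h(y_h,\chi)=(g,\chi)_h$ for all $\chi\in V_h$, then $\|y_h-y\|_{\infty,\Omega}\le\eta(y_h,g)$. **Green's function (assumption).** For fixed $x$ the Green's function $\mathcal{G}$ (depending on $x$) associated with $\mathcal{K}$ solves $\partial_t\mathcal{G}+\mathcal{L}^*\mathcal{G}=0$ in $\Omega\times\mathbb{R}^+$, $\mathcal{G}|_{\partial\Omega}=0$, $\mathcal{G}(0)=\delta(\cdot-x)$, and for all $\varphi\in W_2^1(0,T;V,H)$ one has $\varphi(x,t)=(\varphi(0),\mathcal{G}(t))+\int_0^t\langle(\mathcal{K}\varphi)(s),\mathcal{G}(t-s)\rangle\,\mathrm{d}s$. There are non-negative constants $\kappa_0,\kappa_1,\kappa_1',\gamma$ such that, for all $x\in\bar\Omega$ and $t\in[0,T]$, $$\|\mathcal{G}(t)\|_{1,\Omega}\le\kappa_0\mathrm{e}^{-\gamma t},\qquad \|\partial_t\mathcal{G}(t)\|_{1,\Omega}\le\left(\frac{\kappa_1}{t}+\kappa_1'\right)\mathrm{e}^{-\gamma t}.$$ **Temporal reconstruction.** $P_i$ is the Legendre polynomial of degree $i$ on $[-1,1]$ (normalised by $P_i(1)=1$), $N_{i+1}(\xi):=\int_{-1}^{\xi}P_i(\zeta)\,\mathrm{d}\zeta$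 for $i\ge1$, and $\xi_j(s)=2(s-t_{j-1/2})/\tau_j$ maps $\bar I_j$ onto $[-1,1]$. Any function $\varphi$ that is continuous on $[0,T]$ and polynomial in time of degree at most $L-1$ on each $\bar I_j$ is written uniquely as $$\varphi=\Delta^0\varphi^j+\Delta^1\varphi^j\,P_1\circ\xi_j+\sum_{i=2}^{L-1}\Delta^i\varphi^j\,N_i\circ\xi_j\quad\text{on }\bar I_j,$$ with $\Delta^0\varphi^j=(\varphi^j+\varphi^{j-1})/2$ and $\Delta^1\varphi^j=(\varphi^j-\varphi^{j-1})/2$. This defines $\Delta^i\hat f^j$, $i=0,\dots,L-1$. For $j=0,\dots,M$ let $\psi^j\in V_h$ be defined by $(\psi^j,\chi)_h=a_h(u_h^j,\chi)-(\hat f(t_j),\chi)_h$ for all $\chi\in V_h$; together with the nodal values $u_h^j$ this gives $\Delta^0\psi^j,\Delta^1\psi^j,\Delta^0u_h^j,\Delta^1u_h^j$. For $L>2$ the remaining coefficients are defined recursively, for $j=1,\dots,M$, by $$\frac{\Delta^2\psi^j}{3}:=\Delta^0\psi^j+\frac{2\Delta^1u_h^j}{\tau_j},\qquad \frac{\Delta^{i+2}\psi^j}{2i+3}:=\frac{\Delta^i\psi^j}{2i-1}+\frac{2}{\tau_j}\Delta^{i+1}u_h^j,\quad i=1,\dots,L-3,$$ where for $i=2,\dots,L-1$ the function $\Delta^iu_h^j\in V_h$ is the solution of $a_h(\Delta^iu_h^j,\chi)=(\Delta^i\psi^j+\Delta^i\hat f^j,\chi)_h$ for all $\chi\in V_h$.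 These coefficients define piecewise polynomial functions $u_h,\psi\in C^0([0,T],V_h)$ extending the nodal values $u_h^j,\psi^j$. **Estimator quantities.** $\sigma_j:=\exp(-\gamma(T-t_j))$, $j=0,\dots,M$; $\ \eta_{\mathrm{ell}}^j:=\eta\big(u_h^j,\hat f(t_j)+\psi^j\big)$, $j=0,\dots,M$; $\ \eta_{\mathrm{ell},i}^j:=\eta\big(\Delta^iu_h^j,\Delta^i\hat f^j+\Delta^i\psi^j\big)$, $i=0,\dots,L-1$, $j=1,\dots,M$; $\ \mu_{j,0}:=\kappa_0\tau_j$ and, for $i\ge1$, $$\mu_{j,i}:=\min\left\{\frac{\kappa_0\tau_j}{2}\|P_i\|_{1,(-1,1)},\ \frac{\kappa_1}{\tau_j}\int_{I_j}\frac{(t_j-t)(t-t_{j-1})}{T-t}\,\mathrm{d}t+\kappa_1'\frac{\tau_j^2}{24}\right\}.$$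
   Formalization: For L=2 the term Δ^{L-2}ψ^j/(2L-5) is taken as +Δ^0ψ^j; in μ_{j,i} the factor τ_j²/24 becomes τ_j²/6 for i=1 and τ_j²/16 for i=2 (printed values fail); solvability of a(y,χ)=(g,χ) in V for every g in L_2(Ω) is assumed. *)

theory Defs
  imports
    "HOL-Analysis.Analysis"
    "HOL-Probability.Essential_Supremum"
    "HOL-Computational_Algebra.Polynomial"
    "Jordan_Normal_Form.Determinant"
begin

section \<open>Domains, Lebesgue and Sobolev spaces\<close>

text \<open>Near each boundary point the domain is, after a rotation taking \<open>\<nu>\<close> to the last coordinate
  direction, the strict epigraph of a Lipschitz function \<open>g\<close> of the remaining coordinates.\<close>

definition lipschitz_boundary :: "'a::euclidean_space set \<Rightarrow> bool" where
  "lipschitz_boundary \<Omega> \<longleftrightarrow>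
     (\<forall>p\<in>frontier \<Omega>. \<exists>r>0. \<exists>\<nu> g C. norm \<nu> = 1 \<and> C-lipschitz_on {z. inner z \<nu> = 0} g \<and>
        \<Omega> \<inter> ball p r = {y \<in> ball p r. g (y - inner y \<nu> *\<^sub>R \<nu>) < inner y \<nu>})"

definition hoelder_on :: "'a::metric_space set \<Rightarrow> ('a \<Rightarrow> real) \<Rightarrow> bool" where
  "hoelder_on S g \<longleftrightarrow>
     (\<exists>C \<alpha>. 0 < \<alpha> \<and> \<alpha> \<le> 1 \<and> (\<forall>x\<in>S. \<forall>y\<in>S. \<bar>g x - g y\<bar> \<le> C * dist x y powr \<alpha>))"

text \<open>Elements of the function spaces are functions, not equivalence classes; the norms below are
  therefore seminorms, vanishing on functions that are zero almost everywhere in \<open>\<Omega>\<close>.\<close>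

definition L2 :: "'a::euclidean_space set \<Rightarrow> ('a \<Rightarrow> real) set" where
  "L2 \<Omega> = {v. v \<in> borel_measurable (lebesgue_on \<Omega>) \<and> integrable (lebesgue_on \<Omega>) (\<lambda>y. (v y)\<^sup>2)}"

definition L2_inner :: "'a::euclidean_space set \<Rightarrow> ('a \<Rightarrow> real) \<Rightarrow> ('a \<Rightarrow> real) \<Rightarrow> real" where
  "L2_inner \<Omega> v w = (LINT y|lebesgue_on \<Omega>. v y * w y)"

definition L2_norm :: "'a::euclidean_space set \<Rightarrow> ('a \<Rightarrow> real) \<Rightarrow> real" where
  "L2_norm \<Omega> v = sqrt (L2_inner \<Omega> v v)"

definition L1_norm :: "'a::euclidean_space set \<Rightarrow> ('a \<Rightarrow> real) \<Rightarrow> ennreal" where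
  "L1_norm \<Omega> v = (\<integral>\<^sup>+y. ennreal \<bar>v y\<bar> \<partial>lebesgue_on \<Omega>)"

definition Linf_norm :: "'a::euclidean_space set \<Rightarrow> ('a \<Rightarrow> real) \<Rightarrow> ennreal" where
  "Linf_norm \<Omega> v = esssup (lebesgue_on \<Omega>) (\<lambda>y. ennreal \<bar>v y\<bar>)"

text \<open>\<open>D bs\<close> is the iterated partial derivative of \<open>f\<close> in the basis directions listed in \<open>bs\<close>.\<close>

definition smooth :: "('a::euclidean_space \<Rightarrow> real) \<Rightarrow> bool" where
  "smooth f \<longleftrightarrow>
     (\<exists>D :: 'a list \<Rightarrow> 'a \<Rightarrow> real. D [] = f \<and>
        (\<forall>bs x. (D bs has_derivative (\<lambda>h. \<Sum>b\<in>Basis. inner h b * D (b # bs) x)) (at x)))"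

definition compact_support_in :: "'a::euclidean_space set \<Rightarrow> ('a \<Rightarrow> real) \<Rightarrow> bool" where
  "compact_support_in \<Omega> f \<longleftrightarrow> compact (closure {y. f y \<noteq> 0}) \<and> closure {y. f y \<noteq> 0} \<subseteq> \<Omega>"

definition test_function :: "'a::euclidean_space set \<Rightarrow> ('a \<Rightarrow> real) \<Rightarrow> bool" where
  "test_function \<Omega> f \<longleftrightarrow> smooth f \<and> compact_support_in \<Omega> f"

definition weak_gradient :: "'a::euclidean_space set \<Rightarrow> ('a \<Rightarrow> real) \<Rightarrow> ('a \<Rightarrow> 'a) \<Rightarrow> bool" where
  "weak_gradient \<Omega> v w \<longleftrightarrow>
     (\<forall>b\<in>Basis. (\<lambda>y. inner (w y) b) \<in> L2 \<Omega> \<and>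
        (\<forall>\<phi>. test_function \<Omega> \<phi> \<longrightarrow>
           (LINT y|lebesgue_on \<Omega>. v y * frechet_derivative \<phi> (at y) b) =
           - (LINT y|lebesgue_on \<Omega>. inner (w y) b * \<phi> y)))"

definition H1 :: "'a::euclidean_space set \<Rightarrow> ('a \<Rightarrow> real) set" where
  "H1 \<Omega> = {v \<in> L2 \<Omega>. \<exists>w. weak_gradient \<Omega> v w}"

definition grad :: "'a::euclidean_space set \<Rightarrow> ('a \<Rightarrow> real) \<Rightarrow> 'a \<Rightarrow> 'a" where
  "grad \<Omega> v = (SOME w. weak_gradient \<Omega> v w)"

definition H1_norm :: "'a::euclidean_space set \<Rightarrow> ('a \<Rightarrow> real) \<Rightarrow> real" where
  "H1_norm \<Omega> v =
     sqrt ((L2_norm \<Omega> v)\<^sup>2 + (\<Sum>b\<in>Basis. (L2_norm \<Omega> (\<lambda>y. inner (grad \<Omega> v y) b))\<^sup>2))"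

definition H10 :: "'a::euclidean_space set \<Rightarrow> ('a \<Rightarrow> real) set" where
  "H10 \<Omega> = {v \<in> H1 \<Omega>. \<forall>\<epsilon>>0. \<exists>\<phi>. test_function \<Omega> \<phi> \<and> H1_norm \<Omega> (\<lambda>y. v y - \<phi> y) < \<epsilon>}"

section \<open>Bochner spaces on the time interval\<close>

text \<open>Dual of a space \<open>X\<close> of functions with seminorm \<open>nrm\<close>. Only the values of a functional on \<open>X\<close>
  matter.\<close>

definition dual_space :: "('b \<Rightarrow> real) set \<Rightarrow> (('b \<Rightarrow> real) \<Rightarrow> real) \<Rightarrow> (('b \<Rightarrow> real) \<Rightarrow> real) set" where
  "dual_space X nrm =
     {w. (\<forall>v\<in>X. \<forall>v'\<in>X. w (\<lambda>y. v y + v' y) = w v + w v') \<and>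
         (\<forall>v\<in>X. \<forall>r. w (\<lambda>y. r * v y) = r * w v) \<and>
         (\<exists>C. \<forall>v\<in>X. \<bar>w v\<bar> \<le> C * nrm v)}"

definition dual_norm :: "('b \<Rightarrow> real) set \<Rightarrow> (('b \<Rightarrow> real) \<Rightarrow> real) \<Rightarrow> (('b \<Rightarrow> real) \<Rightarrow> real) \<Rightarrow> real" where
  "dual_norm X nrm w = Sup {\<bar>w v\<bar> |v. v \<in> X \<and> nrm v \<le> 1}"

text \<open>\<open>L\<^sub>2(0,T;X)\<close>: strongly measurable functions, i.e. almost everywhere limits of \<open>X\<close>-valued simple
  functions, with square integrable norm.\<close>

definition bochner_L2 :: "real \<Rightarrow> ('b \<Rightarrow> real) set \<Rightarrow> (('b \<Rightarrow> real) \<Rightarrow> real) \<Rightarrow> (real \<Rightarrow> 'b \<Rightarrow> real) \<Rightarrow> bool" where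
  "bochner_L2 T X nrm v \<longleftrightarrow>
     (AE t in lebesgue_on {0<..<T}. v t \<in> X) \<and>
     (\<exists>s. (\<forall>n::nat. finite (range (s n)) \<and> range (s n) \<subseteq> X \<and> (\<forall>z. s n -` {z} \<in> sets lebesgue)) \<and>
          (AE t in lebesgue_on {0<..<T}. (\<lambda>n. nrm (\<lambda>y. v t y - s n t y)) \<longlonglongrightarrow> 0)) \<and>
     integrable (lebesgue_on {0<..<T}) (\<lambda>t. (nrm (v t))\<^sup>2)"

definition continuous_into_L2 :: "'a::euclidean_space set \<Rightarrow> real \<Rightarrow> (real \<Rightarrow> 'a \<Rightarrow> real) \<Rightarrow> bool" where
  "continuous_into_L2 \<Omega> T v \<longleftrightarrow>
     (\<forall>t\<in>{0..T}. v t \<in> L2 \<Omega> \<and>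
        ((\<lambda>s. L2_norm \<Omega> (\<lambda>y. v s y - v t y)) \<longlongrightarrow> 0) (at t within {0..T}))"

text \<open>\<open>W21 \<Omega> T v w\<close>: \<open>v \<in> W\<^sub>2\<^sup>1(0,T;V,H)\<close> with \<open>V = H10 \<Omega>\<close>, \<open>H = L2 \<Omega>\<close> and distributional time
  derivative \<open>v' = w \<in> L\<^sub>2(0,T;V\<^sup>*)\<close>. As usual \<open>v\<close> denotes the representative that is continuous
  into \<open>H\<close>.\<close>

definition W21 :: "'a::euclidean_space set \<Rightarrow> real \<Rightarrow> (real \<Rightarrow> 'a \<Rightarrow> real) \<Rightarrow> (real \<Rightarrow> ('a \<Rightarrow> real) \<Rightarrow> real) \<Rightarrow> bool" where
  "W21 \<Omega> T v w \<longleftrightarrow>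
     bochner_L2 T (H10 \<Omega>) (H1_norm \<Omega>) v \<and>
     bochner_L2 T (dual_space (H10 \<Omega>) (H1_norm \<Omega>)) (dual_norm (H10 \<Omega>) (H1_norm \<Omega>)) w \<and>
     (\<forall>\<zeta>\<in>H10 \<Omega>. \<forall>\<theta>. test_function {0<..<T} \<theta> \<longrightarrow>
        (LINT t|lebesgue_on {0<..<T}. L2_inner \<Omega> (v t) \<zeta> * deriv \<theta> t) =
        - (LINT t|lebesgue_on {0<..<T}. w t \<zeta> * \<theta> t)) \<and>
     continuous_into_L2 \<Omega> T v"

section \<open>The parabolic problem and its Green's function\<close>

text \<open>The operator is \<open>\<L> v = - div (A \<nabla>v + v d) + b \<cdot> \<nabla>v + c v\<close>.\<close>

definition elliptic_coefficients ::
  "(real^'n) set \<Rightarrow> (real^'n \<Rightarrow> real^'n^'n) \<Rightarrow> (real^'n \<Rightarrow> real^'n) \<Rightarrow> (real^'n \<Rightarrow> real^'n) \<Rightarrow> (real^'n \<Rightarrow> real) \<Rightarrow> bool" where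
  "elliptic_coefficients \<Omega> A d b c \<longleftrightarrow>
     A \<in> borel_measurable (lebesgue_on \<Omega>) \<and> d \<in> borel_measurable (lebesgue_on \<Omega>) \<and>
     b \<in> borel_measurable (lebesgue_on \<Omega>) \<and> c \<in> borel_measurable (lebesgue_on \<Omega>) \<and>
     (\<exists>K. AE y in lebesgue_on \<Omega>. norm (A y) \<le> K \<and> norm (d y) \<le> K \<and> norm (b y) \<le> K \<and> \<bar>c y\<bar> \<le> K) \<and>
     (\<exists>\<alpha>>0. AE y in lebesgue_on \<Omega>. \<forall>\<xi>. \<alpha> * (norm \<xi>)\<^sup>2 \<le> inner (A y *v \<xi>) \<xi>)"

definition elliptic_form ::
  "(real^'n) set \<Rightarrow> (real^'n \<Rightarrow> real^'n^'n) \<Rightarrow> (real^'n \<Rightarrow> real^'n) \<Rightarrow> (real^'n \<Rightarrow> real^'n) \<Rightarrow> (real^'n \<Rightarrow> real) \<Rightarrow>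
   (real^'n \<Rightarrow> real) \<Rightarrow> (real^'n \<Rightarrow> real) \<Rightarrow> real" where
  "elliptic_form \<Omega> A d b c v w =
     (LINT y|lebesgue_on \<Omega>.
        inner (A y *v grad \<Omega> v y + v y *\<^sub>R d y) (grad \<Omega> w y)
        + (inner (b y) (grad \<Omega> v y) + c y * v y) * w y)"

text \<open>Here \<open>d/dt (u(t),\<zeta>) = \<langle>u'(t),\<zeta>\<rangle>\<close>, and the equation is an identity in \<open>V\<^sup>*\<close> for almost every
  \<open>t\<close>.\<close>

definition parabolic_solution ::
  "'a::euclidean_space set \<Rightarrow> (('a \<Rightarrow> real) \<Rightarrow> ('a \<Rightarrow> real) \<Rightarrow> real) \<Rightarrow> real \<Rightarrow>
   ('a \<Rightarrow> real) \<Rightarrow> (real \<Rightarrow> 'a \<Rightarrow> real) \<Rightarrow> (real \<Rightarrow> 'a \<Rightarrow> real) \<Rightarrow> bool" where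
  "parabolic_solution \<Omega> a T u0 f u \<longleftrightarrow>
     (\<exists>u'. W21 \<Omega> T u u' \<and>
        (AE t in lebesgue_on {0<..<T}. \<forall>\<zeta>\<in>H10 \<Omega>. u' t \<zeta> + a (u t) \<zeta> = L2_inner \<Omega> (f t) \<zeta>)) \<and>
     (AE y in lebesgue_on \<Omega>. u 0 y = u0 y)"

text \<open>\<open>G x t\<close> is the Green's function with singularity \<open>\<delta>(\<cdot> - x)\<close> at \<open>t = 0\<close>, and \<open>G' x t\<close> its
  \<open>L\<^sub>2\<close>-valued time derivative. The initial condition is understood in the sense of measures.
  An element of \<open>W\<^sub>2\<^sup>1(0,T;V,H)\<close> has, at a given \<open>t\<close>, values only up to null sets and its image under
  \<open>\<partial>\<^sub>t + \<L>\<close> need not be integrable against the Green's function up to its singularity. The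
  representation formula is therefore required at almost every \<open>x\<close> for which its integral exists.\<close>

definition greens_function ::
  "'a::euclidean_space set \<Rightarrow> (('a \<Rightarrow> real) \<Rightarrow> ('a \<Rightarrow> real) \<Rightarrow> real) \<Rightarrow> real \<Rightarrow>
   ('a \<Rightarrow> real \<Rightarrow> 'a \<Rightarrow> real) \<Rightarrow> ('a \<Rightarrow> real \<Rightarrow> 'a \<Rightarrow> real) \<Rightarrow> bool" where
  "greens_function \<Omega> a T G G' \<longleftrightarrow>
     (\<forall>x\<in>closure \<Omega>.
        (\<forall>t>0. G x t \<in> H10 \<Omega> \<and> G' x t \<in> L2 \<Omega> \<and>
           ((\<lambda>s. L2_norm \<Omega> (\<lambda>y. (G x s y - G x t y) / (s - t) - G' x t y)) \<longlongrightarrow> 0) (at t) \<and>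
           (\<forall>\<zeta>\<in>H10 \<Omega>. L2_inner \<Omega> (G' x t) \<zeta> + a \<zeta> (G x t) = 0)) \<and>
        (\<forall>\<phi>. continuous_on UNIV \<phi> \<and> compact_support_in \<Omega> \<phi> \<longrightarrow>
           ((\<lambda>t. L2_inner \<Omega> \<phi> (G x t)) \<longlongrightarrow> \<phi> x) (at_right 0))) \<and>
     (\<forall>\<phi> \<phi>'. W21 \<Omega> T \<phi> \<phi>' \<longrightarrow>
        (\<forall>t\<in>{0<..T}. AE x in lebesgue_on \<Omega>.
           integrable (lebesgue_on {0<..<t}) (\<lambda>s. \<phi>' s (G x (t - s)) + a (\<phi> s) (G x (t - s))) \<longrightarrow>
           \<phi> t x = L2_inner \<Omega> (\<phi> 0) (G x t) +
             (LINT s|lebesgue_on {0<..<t}. \<phi>' s (G x (t - s)) + a (\<phi> s) (G x (t - s)))))"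

definition greens_function_bounds ::
  "'a::euclidean_space set \<Rightarrow> real \<Rightarrow> ('a \<Rightarrow> real \<Rightarrow> 'a \<Rightarrow> real) \<Rightarrow> ('a \<Rightarrow> real \<Rightarrow> 'a \<Rightarrow> real) \<Rightarrow>
   real \<Rightarrow> real \<Rightarrow> real \<Rightarrow> real \<Rightarrow> bool" where
  "greens_function_bounds \<Omega> T G G' \<kappa>0 \<kappa>1 \<kappa>1' \<gamma> \<longleftrightarrow>
     (\<forall>x\<in>closure \<Omega>. \<forall>t\<in>{0<..T}.
        L1_norm \<Omega> (G x t) \<le> ennreal (\<kappa>0 * exp (- \<gamma> * t)) \<and>
        L1_norm \<Omega> (G' x t) \<le> ennreal ((\<kappa>1 / t + \<kappa>1') * exp (- \<gamma> * t)))"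

section \<open>Discretisation\<close>

definition time_mesh :: "nat \<Rightarrow> real \<Rightarrow> (nat \<Rightarrow> real) \<Rightarrow> bool" where
  "time_mesh M T t \<longleftrightarrow> 1 \<le> M \<and> t 0 = 0 \<and> t M = T \<and> (\<forall>j<M. t j < t (Suc j))"

definition step :: "(nat \<Rightarrow> real) \<Rightarrow> nat \<Rightarrow> real" where
  "step t j = t j - t (j - 1)"

text \<open>\<open>mesh_at t j \<xi>\<close> is \<open>t\<^sub>j\<^sub>-\<^sub>\<xi>\<close>.\<close>

definition mesh_at :: "(nat \<Rightarrow> real) \<Rightarrow> nat \<Rightarrow> real \<Rightarrow> real" where
  "mesh_at t j \<xi> = t j - \<xi> * step t j"

definition interpolation_nodes :: "nat \<Rightarrow> nat \<Rightarrow> (nat \<Rightarrow> real) \<Rightarrow> (nat \<Rightarrow> nat \<Rightarrow> real) \<Rightarrow> bool" where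
  "interpolation_nodes L M t z \<longleftrightarrow>
     (\<forall>j\<in>{1..M}. z j 0 = t (j - 1) \<and> z j (L - 1) = t j \<and> (\<forall>k<L - 1. z j k < z j (Suc k)))"

definition time_interpolant ::
  "nat \<Rightarrow> nat \<Rightarrow> (nat \<Rightarrow> real) \<Rightarrow> (nat \<Rightarrow> nat \<Rightarrow> real) \<Rightarrow> (real \<Rightarrow> 'a \<Rightarrow> real) \<Rightarrow> (real \<Rightarrow> 'a \<Rightarrow> real) \<Rightarrow> bool" where
  "time_interpolant L M t z f fh \<longleftrightarrow>
     (\<forall>j\<in>{1..M}. \<forall>y. \<exists>p. degree p \<le> L - 1 \<and> (\<forall>s\<in>{t (j - 1)..t j}. fh s y = poly p s) \<and>
        (\<forall>k<L. fh (z j k) y = f (z j k) y))"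

definition finite_dim_subspace :: "('a \<Rightarrow> real) set \<Rightarrow> ('a \<Rightarrow> real) set \<Rightarrow> bool" where
  "finite_dim_subspace Vh V \<longleftrightarrow>
     (\<exists>(N::nat) e. (\<forall>i<N. e i \<in> V) \<and> Vh = {v. \<exists>c. v = (\<lambda>y. \<Sum>i<N. c i * e i y)})"

definition bilinear_form_on ::
  "('a \<Rightarrow> real) set \<Rightarrow> ('a \<Rightarrow> real) set \<Rightarrow> (('a \<Rightarrow> real) \<Rightarrow> ('a \<Rightarrow> real) \<Rightarrow> real) \<Rightarrow> bool" where
  "bilinear_form_on X Y B \<longleftrightarrow>
     (\<forall>v\<in>X. \<forall>v'\<in>X. \<forall>w\<in>Y. B (\<lambda>y. v y + v' y) w = B v w + B v' w) \<and>
     (\<forall>v\<in>X. \<forall>w\<in>Y. \<forall>w'\<in>Y. B v (\<lambda>y. w y + w' y) = B v w + B v w') \<and>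
     (\<forall>v\<in>X. \<forall>w\<in>Y. \<forall>r. B (\<lambda>y. r * v y) w = r * B v w \<and> B v (\<lambda>y. r * w y) = r * B v w)"

definition elliptic_estimator ::
  "'a::euclidean_space set \<Rightarrow> (('a \<Rightarrow> real) \<Rightarrow> ('a \<Rightarrow> real) \<Rightarrow> real) \<Rightarrow> ('a \<Rightarrow> real) set \<Rightarrow>
   (('a \<Rightarrow> real) \<Rightarrow> ('a \<Rightarrow> real) \<Rightarrow> real) \<Rightarrow> (('a \<Rightarrow> real) \<Rightarrow> ('a \<Rightarrow> real) \<Rightarrow> real) \<Rightarrow>
   (('a \<Rightarrow> real) \<Rightarrow> ('a \<Rightarrow> real) \<Rightarrow> ennreal) \<Rightarrow> bool" where
  "elliptic_estimator \<Omega> a Vh ah ih \<eta> \<longleftrightarrow>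
     (\<forall>g\<in>L2 \<Omega>. \<forall>y\<in>H10 \<Omega>. \<forall>yh\<in>Vh.
        (\<forall>\<zeta>\<in>H10 \<Omega>. a y \<zeta> = L2_inner \<Omega> g \<zeta>) \<longrightarrow> (\<forall>\<zeta>\<in>Vh. ah yh \<zeta> = ih g \<zeta>) \<longrightarrow>
        Linf_norm \<Omega> (\<lambda>p. yh p - y p) \<le> \<eta> yh g)"

text \<open>The matrix \<open>(c | B)\<close>; rows and columns of a library matrix are numbered from 0, so the row
  \<open>i = r + 1\<close> carries the entries \<open>i\<^sup>-\<^sup>m\<close> in columns \<open>m = 1, \<dots>, L - 1\<close>.\<close>

definition extrapolation_matrix :: "nat \<Rightarrow> (nat \<Rightarrow> real) \<Rightarrow> real mat" where
  "extrapolation_matrix L c = Matrix.mat L L (\<lambda>(r, m). if m = 0 then c (r + 1) else 1 / real (r + 1) ^ m)"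

definition extrapolation_weight :: "nat \<Rightarrow> nat \<Rightarrow> real" where
  "extrapolation_weight L l =
     Determinant.det (extrapolation_matrix L (\<lambda>i. if i = l then 1 else 0)) /
     Determinant.det (extrapolation_matrix L (\<lambda>_. 1))"

text \<open>Backward Euler method with \<open>l\<close> equal substeps per mesh interval; \<open>v\<close> is indexed by time.\<close>

definition backward_euler ::
  "('a \<Rightarrow> real) set \<Rightarrow> (('a \<Rightarrow> real) \<Rightarrow> ('a \<Rightarrow> real) \<Rightarrow> real) \<Rightarrow> (('a \<Rightarrow> real) \<Rightarrow> ('a \<Rightarrow> real) \<Rightarrow> real) \<Rightarrow>
   nat \<Rightarrow> (nat \<Rightarrow> real) \<Rightarrow> (real \<Rightarrow> 'a \<Rightarrow> real) \<Rightarrow> ('a \<Rightarrow> real) \<Rightarrow> nat \<Rightarrow> (real \<Rightarrow> 'a \<Rightarrow> real) \<Rightarrow> bool" where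
  "backward_euler Vh ah ih M t fh uh0 l v \<longleftrightarrow>
     v (t 0) = uh0 \<and>
     (\<forall>j\<in>{1..M}. \<forall>k<l.
        let new = v (mesh_at t j (real k / real l)); old = v (mesh_at t j (real (k + 1) / real l)) in
        new \<in> Vh \<and>
        (\<forall>\<zeta>\<in>Vh. ih (\<lambda>y. (new y - old y) / (step t j / real l)) \<zeta> + ah new \<zeta>
                 = ih (fh (mesh_at t j (real k / real l))) \<zeta>))"

definition extrapolated_euler ::
  "('a \<Rightarrow> real) set \<Rightarrow> (('a \<Rightarrow> real) \<Rightarrow> ('a \<Rightarrow> real) \<Rightarrow> real) \<Rightarrow> (('a \<Rightarrow> real) \<Rightarrow> ('a \<Rightarrow> real) \<Rightarrow> real) \<Rightarrow>
   nat \<Rightarrow> nat \<Rightarrow> (nat \<Rightarrow> real) \<Rightarrow> (real \<Rightarrow> 'a \<Rightarrow> real) \<Rightarrow> (nat \<Rightarrow> 'a \<Rightarrow> real) \<Rightarrow> bool" where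
  "extrapolated_euler Vh ah ih L M t fh uh \<longleftrightarrow>
     uh 0 \<in> Vh \<and>
     (\<exists>v. (\<forall>l\<in>{1..L}. backward_euler Vh ah ih M t fh (uh 0) l (v l)) \<and>
          (\<forall>j\<in>{1..M}. uh j = (\<lambda>y. \<Sum>l=1..L. extrapolation_weight L l * v l (t j) y)))"

section \<open>Temporal reconstruction\<close>

fun legendre :: "nat \<Rightarrow> real \<Rightarrow> real" where
  "legendre 0 x = 1"
| "legendre (Suc 0) x = x"
| "legendre (Suc (Suc i)) x =
     ((2 * real i + 3) * x * legendre (Suc i) x - (real i + 1) * legendre i x) / (real i + 2)"

lemma legendre_at_1: "legendre i 1 = 1"
  by (induction i rule: induct_nat_012) (auto simp: field_simps)

definition legendre_antideriv :: "nat \<Rightarrow> real \<Rightarrow> real" where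
  "legendre_antideriv i \<xi> = integral {-1..\<xi>} (legendre (i - 1))"

definition ref_coord :: "(nat \<Rightarrow> real) \<Rightarrow> nat \<Rightarrow> real \<Rightarrow> real" where
  "ref_coord t j s = 2 * (s - mesh_at t j (1/2)) / step t j"

definition legendre_expansion ::
  "nat \<Rightarrow> nat \<Rightarrow> (nat \<Rightarrow> real) \<Rightarrow> (real \<Rightarrow> 'a \<Rightarrow> real) \<Rightarrow> (nat \<Rightarrow> nat \<Rightarrow> 'a \<Rightarrow> real) \<Rightarrow> bool" where
  "legendre_expansion L M t v \<Delta>v \<longleftrightarrow>
     (\<forall>j\<in>{1..M}. \<forall>s\<in>{t (j - 1)..t j}. \<forall>y.
        v s y = \<Delta>v j 0 y + \<Delta>v j 1 y * legendre 1 (ref_coord t j s)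
                + (\<Sum>i=2..L - 1. \<Delta>v j i y * legendre_antideriv i (ref_coord t j s)))"

definition nodal_coefficients :: "nat \<Rightarrow> (nat \<Rightarrow> 'a \<Rightarrow> real) \<Rightarrow> (nat \<Rightarrow> nat \<Rightarrow> 'a \<Rightarrow> real) \<Rightarrow> bool" where
  "nodal_coefficients M v \<Delta>v \<longleftrightarrow>
     (\<forall>j\<in>{1..M}. \<Delta>v j 0 = (\<lambda>y. (v j y + v (j - 1) y) / 2) \<and> \<Delta>v j 1 = (\<lambda>y. (v j y - v (j - 1) y) / 2))"

text \<open>The factor of \<open>\<Delta>\<^sup>i\<psi>\<^sup>j\<close> in the coefficient of \<open>P\<^sub>i\<close> in \<open>\<psi> + \<partial>\<^sub>t u\<^sub>h\<close>: it is 1 for the constant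
  \<open>P\<^sub>0\<close>, and \<open>1 / (2 i - 1)\<close> for \<open>i \<ge> 1\<close> (from \<open>N\<^sub>i = (P\<^sub>i - P\<^sub>i\<^sub>-\<^sub>2) / (2 i - 1)\<close> if \<open>i \<ge> 2\<close>).
  For \<open>i = L - 2\<close> it is \<open>1 / (2 L - 5)\<close> unless \<open>L = 2\<close>.\<close>

definition residual_factor :: "nat \<Rightarrow> real" where
  "residual_factor i = (if i = 0 then 1 else 1 / (2 * real i - 1))"

definition reconstruction ::
  "('a \<Rightarrow> real) set \<Rightarrow> (('a \<Rightarrow> real) \<Rightarrow> ('a \<Rightarrow> real) \<Rightarrow> real) \<Rightarrow> (('a \<Rightarrow> real) \<Rightarrow> ('a \<Rightarrow> real) \<Rightarrow> real) \<Rightarrow>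
   nat \<Rightarrow> nat \<Rightarrow> (nat \<Rightarrow> real) \<Rightarrow> (real \<Rightarrow> 'a \<Rightarrow> real) \<Rightarrow> (nat \<Rightarrow> nat \<Rightarrow> 'a \<Rightarrow> real) \<Rightarrow>
   (nat \<Rightarrow> 'a \<Rightarrow> real) \<Rightarrow> (nat \<Rightarrow> 'a \<Rightarrow> real) \<Rightarrow>
   (nat \<Rightarrow> nat \<Rightarrow> 'a \<Rightarrow> real) \<Rightarrow> (nat \<Rightarrow> nat \<Rightarrow> 'a \<Rightarrow> real) \<Rightarrow> bool" where
  "reconstruction Vh ah ih L M t fh \<Delta>f uh \<psi> \<Delta>u \<Delta>\<psi> \<longleftrightarrow>
     (\<forall>j\<le>M. \<psi> j \<in> Vh \<and> (\<forall>\<zeta>\<in>Vh. ih (\<psi> j) \<zeta> = ah (uh j) \<zeta> - ih (fh (t j)) \<zeta>)) \<and>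
     nodal_coefficients M uh \<Delta>u \<and> nodal_coefficients M \<psi> \<Delta>\<psi> \<and>
     (\<forall>j\<in>{1..M}.
        (2 < L \<longrightarrow> (\<forall>y. \<Delta>\<psi> j 2 y / 3 = \<Delta>\<psi> j 0 y + 2 * \<Delta>u j 1 y / step t j)) \<and>
        (\<forall>i\<in>{1..L - 3}. \<forall>y.
           \<Delta>\<psi> j (i + 2) y / (2 * real i + 3) =
           \<Delta>\<psi> j i y / (2 * real i - 1) + 2 / step t j * \<Delta>u j (i + 1) y) \<and>
        (\<forall>i\<in>{2..L - 1}. \<Delta>u j i \<in> Vh \<and>
           (\<forall>\<zeta>\<in>Vh. ah (\<Delta>u j i) \<zeta> = ih (\<lambda>y. \<Delta>\<psi> j i y + \<Delta>f j i y) \<zeta>)))"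

section \<open>The estimator\<close>

definition norm1 :: "(real \<Rightarrow> real) \<Rightarrow> real" where
  "norm1 p = integral {-1..1} (\<lambda>\<xi>. \<bar>p \<xi>\<bar>)"

definition sigma :: "real \<Rightarrow> real \<Rightarrow> (nat \<Rightarrow> real) \<Rightarrow> nat \<Rightarrow> real" where
  "sigma \<gamma> T t j = exp (- \<gamma> * (T - t j))"

text \<open>Integrating by parts, \<open>\<integral> (P\<^sub>i \<circ> \<xi>\<^sub>j) G(T - s) ds\<close> over \<open>I\<^sub>j\<close> is \<open>\<tau>\<^sub>j / 2\<close> times the integral of
  \<open>N\<^sub>i\<^sub>+\<^sub>1 \<circ> \<xi>\<^sub>j\<close> against the time derivative of \<open>G\<close>, so that the factor of \<open>\<kappa>1'\<close> must be at least
  \<open>\<tau>\<^sub>j\<^sup>2 \<parallel>N\<^sub>i\<^sub>+\<^sub>1\<parallel>\<^sub>1 / 4\<close>. This is \<open>\<tau>\<^sub>j\<^sup>2 / 6\<close> for \<open>i = 1\<close>, \<open>\<tau>\<^sub>j\<^sup>2 / 16\<close> for \<open>i = 2\<close>, and less than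
  \<open>\<tau>\<^sub>j\<^sup>2 / 24\<close> for \<open>i \<ge> 3\<close>. The maximum is therefore the published constant \<open>1 / 24\<close> if \<open>i \<ge> 3\<close>; it
  differs for \<open>i = 1, 2\<close>, where \<open>1 / 24\<close> is too small.\<close>

definition mu :: "real \<Rightarrow> real \<Rightarrow> real \<Rightarrow> real \<Rightarrow> (nat \<Rightarrow> real) \<Rightarrow> nat \<Rightarrow> nat \<Rightarrow> real" where
  "mu \<kappa>0 \<kappa>1 \<kappa>1' T t j i =
     (if i = 0 then \<kappa>0 * step t j
      else min (\<kappa>0 * step t j / 2 * norm1 (legendre i))
               (\<kappa>1 / step t j * integral {t (j - 1)..t j} (\<lambda>s. (t j - s) * (s - t (j - 1)) / (T - s))
                + \<kappa>1' * (step t j)\<^sup>2 * max (1 / 24) (norm1 (legendre_antideriv (i + 1)) / 4)))"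

definition eta_init where
  "eta_init \<Omega> \<kappa>0 \<gamma> T t u0 uh =
     ennreal (\<kappa>0 * sigma \<gamma> T t 0) * Linf_norm \<Omega> (\<lambda>y. u0 y - uh 0 y)"

definition eta_f where
  "eta_f \<Omega> \<kappa>0 \<gamma> T M t f fh =
     ennreal \<kappa>0 * (\<Sum>j=1..M. ennreal (sigma \<gamma> T t j) *
       (\<integral>\<^sup>+s\<in>{t (j - 1)<..<t j}. Linf_norm \<Omega> (\<lambda>y. f s y - fh s y) \<partial>lborel))"

definition eta_t where
  "eta_t \<Omega> \<kappa>0 \<kappa>1 \<kappa>1' \<gamma> T L M t \<Delta>u \<Delta>\<psi> =
     (\<Sum>j=1..M. ennreal (sigma \<gamma> T t j) *
       (ennreal (mu \<kappa>0 \<kappa>1 \<kappa>1' T t j (L - 2)) *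
          Linf_norm \<Omega> (\<lambda>y. residual_factor (L - 2) * \<Delta>\<psi> j (L - 2) y + 2 / step t j * \<Delta>u j (L - 1) y)
        + ennreal (mu \<kappa>0 \<kappa>1 \<kappa>1' T t j (L - 1) / (2 * real L - 3)) * Linf_norm \<Omega> (\<Delta>\<psi> j (L - 1))))"

definition eta_ell where
  "eta_ell \<eta> \<kappa>0 \<gamma> T L M t fh \<Delta>f uh \<psi> \<Delta>u \<Delta>\<psi> =
     (let ell = (\<lambda>j. \<eta> (uh j) (\<lambda>y. fh (t j) y + \<psi> j y));
          elli = (\<lambda>j i. \<eta> (\<Delta>u j i) (\<lambda>y. \<Delta>f j i y + \<Delta>\<psi> j i y))
      in ennreal \<kappa>0 * (ennreal (sigma \<gamma> T t 0) * ell 0 + ell M)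
         + ennreal \<kappa>0 * (\<Sum>j=1..M. ennreal (sigma \<gamma> T t j) *
             (\<Sum>i=1..L - 1. elli j i * ennreal (norm1 (legendre (i - 1))))))"

end

theory Submission
  imports Defs
begin

text \<open>Let \<open>y\<close> be the elliptic reconstruction of the temporal reconstruction \<open>u\<^sub>h\<close>, that is
  \<open>a (y, \<chi>) = (fh + \<psi>, \<chi>)\<close> for all \<open>\<chi> \<in> V\<close> at every time. Then \<open>u - y\<close> lies in \<open>W\<^sub>2\<^sup>1(0,T;V,H)\<close> and
  its image under \<open>\<partial>\<^sub>t + \<L>\<close> is \<open>(f - fh) - (\<psi> + \<partial>\<^sub>t u\<^sub>h) - \<partial>\<^sub>t (y - u\<^sub>h)\<close>, so that the Green's
  function represents \<open>(u - y)(T)\<close>. The coefficients of \<open>y - u\<^sub>h\<close> are controlled by the elliptic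
  estimator. On each mesh interval \<open>\<psi> + \<partial>\<^sub>t u\<^sub>h\<close> telescopes to a combination of \<open>P\<^sub>L\<^sub>-\<^sub>2\<close> and \<open>P\<^sub>L\<^sub>-\<^sub>1\<close>;
  integration by parts in time moves the derivative to the Green's function, because the
  antiderivatives of \<open>P\<^sub>i\<close> vanish at the mesh points for \<open>i \<ge> 1\<close>. The initial value \<open>\<delta>\<close> of the
  Green's function forces \<open>\<kappa>0 \<ge> 1\<close>, which covers the term \<open>(y - u\<^sub>h)(T)\<close>, and excludes
  \<open>\<kappa>1 = \<kappa>1' = 0\<close>, which makes all weights in the estimator positive: a finite estimator then
  has finite terms, and the integrals in the representation exist.\<close>

section \<open>Seminormed function spaces\<close>

text \<open>A direct comparison of \<open>u\<close> with the discrete solution fails: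
  \<open>ah\<close> and \<open>ih\<close> are related to each other only on \<open>Vh\<close>,
  whereas the Green's function is a general element of \<open>H10 \<Omega>\<close>. Tested with the
  Green's function, the reconstruction gives an \<open>L2\<close> pairing with known data, and such
  pairings are what \<open>L1\<close> bounds on \<open>G\<close> and \<open>G'\<close> control. A
  stationary solution is a choice and need not depend linearly on its data, so solving anew at each
  time could produce jumps. The reconstruction is therefore assembled from finitely many chosen
  functions with continuous, piecewise polynomial coefficients, which also makes membership in
  \<open>W21\<close> a finite computation. On a mesh interval ending at \<open>T\<close> the bound
  \<open>\<kappa>1 / (T - s)\<close> need not be integrable; the zero of the antiderivative at
  \<open>T\<close> compensates it, and this is the origin of the kernel in \<open>mu\<close>.
  Finally, \<open>grad\<close> is a choice among weak gradients, so even additivity of the elliptic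
  form rests on their uniqueness almost everywhere, hence on a supply of bump functions.\<close>

locale fun_space =
  fixes X :: "('b \<Rightarrow> real) set"
  assumes zero_in [simp]: "(\<lambda>y. 0) \<in> X"
    and add_in: "v \<in> X \<Longrightarrow> w \<in> X \<Longrightarrow> (\<lambda>y. v y + w y) \<in> X"
    and scale_in: "v \<in> X \<Longrightarrow> (\<lambda>y. r * v y) \<in> X"
begin

lemma diff_in: "v \<in> X \<Longrightarrow> w \<in> X \<Longrightarrow> (\<lambda>y. v y - w y) \<in> X"
  using add_in[of v "\<lambda>y. (-1) * w y"] scale_in[of w "-1"] by simp

lemma sum_in: "(\<And>i. i \<in> I \<Longrightarrow> v i \<in> X) \<Longrightarrow> (\<lambda>y. \<Sum>i\<in>I. v i y) \<in> X"
  by (induction I rule: infinite_finite_induct) (auto intro: add_in)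

end

text \<open>The argument type is left open so that one development covers functions on the domain
  and, with functions as arguments, the functionals of a dual space.\<close>

locale seminorm_space = fun_space X for X :: "('b \<Rightarrow> real) set" +
  fixes nrm :: "('b \<Rightarrow> real) \<Rightarrow> real"
  assumes nrm_add: "v \<in> X \<Longrightarrow> w \<in> X \<Longrightarrow> nrm (\<lambda>y. v y + w y) \<le> nrm v + nrm w"
    and nrm_scale: "v \<in> X \<Longrightarrow> nrm (\<lambda>y. r * v y) = \<bar>r\<bar> * nrm v"
begin

lemma nrm_zero [simp]: "nrm (\<lambda>y. 0) = 0"
  using nrm_scale[of "\<lambda>y. 0" 0] by simp

lemma nrm_minus: "v \<in> X \<Longrightarrow> nrm (\<lambda>y. - v y) = nrm v"
  using nrm_scale[of v "-1"] by simp

lemma nrm_nonneg: "v \<in> X \<Longrightarrow> 0 \<le> nrm v"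
  using nrm_add[of v "\<lambda>y. (-1) * v y"] scale_in[of v "-1"] nrm_minus[of v] by simp

lemma nrm_diff_commute: "v \<in> X \<Longrightarrow> w \<in> X \<Longrightarrow> nrm (\<lambda>y. v y - w y) = nrm (\<lambda>y. w y - v y)"
  using nrm_minus[of "\<lambda>y. v y - w y"] diff_in[of v w] by simp

lemma nrm_triangle_diff: "v \<in> X \<Longrightarrow> w \<in> X \<Longrightarrow> \<bar>nrm v - nrm w\<bar> \<le> nrm (\<lambda>y. v y - w y)"
  using nrm_add[of "\<lambda>y. v y - w y" w] nrm_add[of "\<lambda>y. w y - v y" v] nrm_diff_commute[of v w] diff_in[of v w] diff_in[of w v]
  by auto

end

text \<open>Definiteness is absent because the \<open>L2\<close> form vanishes on functions that are
  zero almost everywhere.\<close>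

locale semi_inner_space = fun_space X for X :: "('b \<Rightarrow> real) set" +
  fixes B :: "('b \<Rightarrow> real) \<Rightarrow> ('b \<Rightarrow> real) \<Rightarrow> real"
  assumes B_sym: "v \<in> X \<Longrightarrow> w \<in> X \<Longrightarrow> B v w = B w v"
    and B_add: "v \<in> X \<Longrightarrow> v' \<in> X \<Longrightarrow> w \<in> X \<Longrightarrow> B (\<lambda>y. v y + v' y) w = B v w + B v' w"
    and B_scale: "v \<in> X \<Longrightarrow> w \<in> X \<Longrightarrow> B (\<lambda>y. r * v y) w = r * B v w"
    and B_nonneg: "v \<in> X \<Longrightarrow> 0 \<le> B v v"
begin

lemma B_add_right: "v \<in> X \<Longrightarrow> v' \<in> X \<Longrightarrow> w \<in> X \<Longrightarrow> B w (\<lambda>y. v y + v' y) = B w v + B w v'"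
  using B_add[of v v' w] B_sym add_in by metis

lemma B_scale_right: "v \<in> X \<Longrightarrow> w \<in> X \<Longrightarrow> B w (\<lambda>y. r * v y) = r * B w v"
  using B_scale[of v w r] B_sym scale_in by metis

lemma B_quadratic:
  assumes "v \<in> X" "w \<in> X"
  shows "B (\<lambda>y. v y + r * w y) (\<lambda>y. v y + r * w y) = B v v + 2 * r * B v w + r\<^sup>2 * B w w"
proof -
  have rw: "(\<lambda>y. r * w y) \<in> X" and s: "(\<lambda>y. v y + r * w y) \<in> X"
    using assms by (auto intro: add_in scale_in)
  show ?thesis
    using assms rw s B_add[of v "\<lambda>y. r * w y" "\<lambda>y. v y + r * w y"]
      B_add_right[of v "\<lambda>y. r * w y" v] B_add_right[of v "\<lambda>y. r * w y" "\<lambda>y. r * w y"]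
      B_scale[of w v r] B_scale_right[of w v r] B_scale[of w "\<lambda>y. r * w y" r] B_scale_right[of w w r] B_sym[of v w]
    by (simp add: power2_eq_square algebra_simps)
qed

text \<open>The form at \<open>v + r w\<close> is a nonnegative quadratic in \<open>r\<close>, so
  its discriminant cannot be positive.\<close>

lemma Cauchy_Schwarz:
  assumes "v \<in> X" "w \<in> X"
  shows "\<bar>B v w\<bar> \<le> sqrt (B v v) * sqrt (B w w)"
proof -
  have q: "0 \<le> B v v + 2 * r * B v w + r\<^sup>2 * B w w" for r
    using B_quadratic[OF assms, of r] B_nonneg[OF add_in[OF assms(1) scale_in[OF assms(2)]], of r] by simp
  have "(B v w)\<^sup>2 \<le> B v v * B w w"
  proof (cases "B w w = 0")
    case True
    have "B v w = 0"
    proof (rule ccontr)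
      assume n: "B v w \<noteq> 0"
      \<comment> \<open>For a null vector \<open>w\<close> the quadratic is affine in
        \<open>r\<close>; this \<open>r\<close> is the point at which it would equal -1.\<close>
      have "B v v + 2 * (- (B v v + 1) / (2 * B v w)) * B v w = -1"
        using n by (simp add: field_simps)
      then show False using q[of "- (B v v + 1) / (2 * B v w)"] True by simp
    qed
    then show ?thesis using B_nonneg assms True by simp
  next
    case False
    then have pos: "0 < B w w" using B_nonneg[OF assms(2)] by simp
    \<comment> \<open>The quadratic is evaluated at its minimiser
      \<open>r = - B v w / B w w\<close>.\<close>
    have "B v v + 2 * (- B v w / B w w) * B v w + (- B v w / B w w)\<^sup>2 * B w w = B v v - (B v w)\<^sup>2 / B w w"
      using pos by (simp add: field_simps power2_eq_square)
    then have "(B v w)\<^sup>2 / B w w \<le> B v v" using q[of "- B v w / B w w"] by simp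
    then show ?thesis using pos by (simp add: field_simps)
  qed
  then have "sqrt ((B v w)\<^sup>2) \<le> sqrt (B v v * B w w)" by (rule real_sqrt_le_mono)
  then show ?thesis by (simp add: real_sqrt_mult)
qed

lemma seminorm_space_sqrt: "seminorm_space X (\<lambda>v. sqrt (B v v))"
proof (unfold_locales)
  fix v w assume vw: "v \<in> X" "w \<in> X"
  have "B (\<lambda>y. v y + w y) (\<lambda>y. v y + w y) = B v v + 2 * B v w + B w w"
    using B_quadratic[OF vw, of 1] by simp
  also have "\<dots> \<le> (sqrt (B v v) + sqrt (B w w))\<^sup>2"
    using Cauchy_Schwarz[OF vw] B_nonneg vw by (simp add: power2_sum abs_le_iff)
  finally show "sqrt (B (\<lambda>y. v y + w y) (\<lambda>y. v y + w y)) \<le> sqrt (B v v) + sqrt (B w w)"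
    using B_nonneg vw by (intro real_le_lsqrt) (auto intro: add_in)
next
  fix v r assume v: "v \<in> X"
  have "B (\<lambda>y. r * v y) (\<lambda>y. r * v y) = r\<^sup>2 * B v v"
    using v scale_in[of v r] B_scale[of v "\<lambda>y. r * v y" r] B_scale_right[of v v r] by (simp add: power2_eq_square)
  then show "sqrt (B (\<lambda>y. r * v y) (\<lambda>y. r * v y)) = \<bar>r\<bar> * sqrt (B v v)"
    by (simp add: real_sqrt_mult)
qed

end

section \<open>Square integrable functions\<close>

lemma L2_measurable: "v \<in> L2 \<Omega> \<Longrightarrow> v \<in> borel_measurable (lebesgue_on \<Omega>)"
  by (simp add: L2_def)

lemma L2_integrable_mult:
  assumes "v \<in> L2 \<Omega>" "w \<in> L2 \<Omega>"
  shows "integrable (lebesgue_on \<Omega>) (\<lambda>y. v y * w y)"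
proof (rule Bochner_Integration.integrable_bound[where f="\<lambda>y. (v y)\<^sup>2 + (w y)\<^sup>2"])
  show "integrable (lebesgue_on \<Omega>) (\<lambda>y. (v y)\<^sup>2 + (w y)\<^sup>2)" using assms by (simp add: L2_def)
  show "(\<lambda>y. v y * w y) \<in> borel_measurable (lebesgue_on \<Omega>)" using assms by (auto simp: L2_def)
  have "\<bar>x * y\<bar> \<le> x\<^sup>2 + y\<^sup>2" for x y :: real
    using sum_squares_bound[of "\<bar>x\<bar>" "\<bar>y\<bar>"] mult_nonneg_nonneg[of "\<bar>x\<bar>" "\<bar>y\<bar>"]
    unfolding abs_mult power2_abs by linarith
  then show "AE y in lebesgue_on \<Omega>. norm (v y * w y) \<le> norm ((v y)\<^sup>2 + (w y)\<^sup>2)" by simp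
qed

lemma L2_bounded_mult:
  assumes "v \<in> L2 \<Omega>" "h \<in> borel_measurable (lebesgue_on \<Omega>)" "AE y in lebesgue_on \<Omega>. \<bar>h y\<bar> \<le> K"
  shows "(\<lambda>y. h y * v y) \<in> L2 \<Omega>"
proof -
  have "integrable (lebesgue_on \<Omega>) (\<lambda>y. (h y * v y)\<^sup>2)"
  proof (rule Bochner_Integration.integrable_bound[where f="\<lambda>y. K\<^sup>2 * (v y)\<^sup>2"])
    show "AE y in lebesgue_on \<Omega>. norm ((h y * v y)\<^sup>2) \<le> norm (K\<^sup>2 * (v y)\<^sup>2)"
      using assms(3)
    proof eventually_elim
      case (elim y)
      then have "(h y)\<^sup>2 \<le> K\<^sup>2" by (metis abs_le_square_iff abs_ge_self order_trans)
      then show ?case by (simp add: power_mult_distrib mult_right_mono)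
    qed
  qed (use assms in \<open>auto simp: L2_def\<close>)
  then show ?thesis using assms by (auto simp: L2_def)
qed

interpretation L2: fun_space "L2 \<Omega>" for \<Omega> :: "'a::euclidean_space set"
proof
  fix v w :: "'a \<Rightarrow> real" assume vw: "v \<in> L2 \<Omega>" "w \<in> L2 \<Omega>"
  have "integrable (lebesgue_on \<Omega>) (\<lambda>y. (v y)\<^sup>2 + (w y)\<^sup>2 + 2 * (v y * w y))"
    using vw L2_integrable_mult[OF vw] by (simp add: L2_def)
  then show "(\<lambda>y. v y + w y) \<in> L2 \<Omega>"
    using vw by (auto simp: L2_def power2_sum mult.assoc)
qed (auto simp: L2_def power_mult_distrib)

interpretation L2: semi_inner_space "L2 \<Omega>" "L2_inner \<Omega>" for \<Omega> :: "'a::euclidean_space set"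
proof
  fix v v' w :: "'a \<Rightarrow> real" assume "v \<in> L2 \<Omega>" "v' \<in> L2 \<Omega>" "w \<in> L2 \<Omega>"
  then show "L2_inner \<Omega> (\<lambda>y. v y + v' y) w = L2_inner \<Omega> v w + L2_inner \<Omega> v' w"
    by (simp add: L2_inner_def distrib_right L2_integrable_mult)
  show "L2_inner \<Omega> (\<lambda>y. r * v y) w = r * L2_inner \<Omega> v w" for r by (simp add: L2_inner_def mult.assoc)
qed (auto simp: L2_inner_def mult.commute)

interpretation L2: seminorm_space "L2 \<Omega>" "L2_norm \<Omega>" for \<Omega> :: "'a::euclidean_space set"
  using L2.seminorm_space_sqrt[of \<Omega>] unfolding L2_norm_def[abs_def] .

lemma L2_Cauchy_Schwarz: "v \<in> L2 \<Omega> \<Longrightarrow> w \<in> L2 \<Omega> \<Longrightarrow> \<bar>L2_inner \<Omega> v w\<bar> \<le> L2_norm \<Omega> v * L2_norm \<Omega> w"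
  using L2.Cauchy_Schwarz unfolding L2_norm_def .

lemma L2_inner_sum:
  assumes "finite I" "\<And>i. i \<in> I \<Longrightarrow> v i \<in> L2 \<Omega>" "w \<in> L2 \<Omega>"
  shows "L2_inner \<Omega> (\<lambda>y. \<Sum>i\<in>I. v i y) w = (\<Sum>i\<in>I. L2_inner \<Omega> (v i) w)"
  using assms
proof (induction I rule: finite_induct)
  case (insert i I)
  then show ?case using L2.B_add[of "v i" \<Omega> "\<lambda>y. \<Sum>i\<in>I. v i y" w] L2.sum_in[of I v \<Omega>] by simp
qed (simp add: L2_inner_def)

lemma L2_inner_diff: "v \<in> L2 \<Omega> \<Longrightarrow> v' \<in> L2 \<Omega> \<Longrightarrow> w \<in> L2 \<Omega> \<Longrightarrow> L2_inner \<Omega> (\<lambda>y. v y - v' y) w = L2_inner \<Omega> v w - L2_inner \<Omega> v' w"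
  by (simp add: L2_inner_def left_diff_distrib L2_integrable_mult)

lemma L2_inner_diff_right:
  "v \<in> L2 \<Omega> \<Longrightarrow> v' \<in> L2 \<Omega> \<Longrightarrow> w \<in> L2 \<Omega> \<Longrightarrow> L2_inner \<Omega> w (\<lambda>y. v y - v' y) = L2_inner \<Omega> w v - L2_inner \<Omega> w v'"
  by (simp add: L2_inner_def right_diff_distrib L2_integrable_mult)

lemma L2_inner_cong_AE:
  assumes "v \<in> L2 \<Omega>" "v' \<in> L2 \<Omega>" "w \<in> L2 \<Omega>" "AE y in lebesgue_on \<Omega>. v y = v' y"
  shows "L2_inner \<Omega> v w = L2_inner \<Omega> v' w"
  unfolding L2_inner_def
  using assms by (intro integral_cong_AE) (auto simp: L2_def)

lemma L2_inner_tendsto: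
  fixes F :: "real filter"
  assumes "\<And>s. v s \<in> L2 \<Omega>" "\<And>s. w s \<in> L2 \<Omega>" "v0 \<in> L2 \<Omega>" "w0 \<in> L2 \<Omega>"
    and v: "((\<lambda>s. L2_norm \<Omega> (\<lambda>y. v s y - v0 y)) \<longlongrightarrow> 0) F"
    and w: "((\<lambda>s. L2_norm \<Omega> (\<lambda>y. w s y - w0 y)) \<longlongrightarrow> 0) F"
  shows "((\<lambda>s. L2_inner \<Omega> (v s) (w s)) \<longlongrightarrow> L2_inner \<Omega> v0 w0) F"
proof -
  let ?n = "L2_norm \<Omega>" and ?dv = "\<lambda>s y. v s y - v0 y" and ?dw = "\<lambda>s y. w s y - w0 y"
  have "((\<lambda>s. ?n (?dv s) * ?n (?dw s) + ?n (?dv s) * ?n w0 + ?n v0 * ?n (?dw s)) \<longlongrightarrow> 0 * 0 + 0 * ?n w0 + ?n v0 * 0) F"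
    by (intro tendsto_intros v w)
  then have lim: "((\<lambda>s. ?n (?dv s) * ?n (?dw s) + ?n (?dv s) * ?n w0 + ?n v0 * ?n (?dw s)) \<longlongrightarrow> 0) F" by simp
  \<comment> \<open>Writing both arguments as limit plus perturbation leaves exactly the three
    pairings that contain a perturbation.\<close>
  have "norm (L2_inner \<Omega> (v s) (w s) - L2_inner \<Omega> v0 w0) \<le> ?n (?dv s) * ?n (?dw s) + ?n (?dv s) * ?n w0 + ?n v0 * ?n (?dw s)" for s
  proof -
    have d: "?dv s \<in> L2 \<Omega>" "?dw s \<in> L2 \<Omega>" using assms by (auto intro: L2.diff_in)
    have "L2_inner \<Omega> (v s) (w s) = L2_inner \<Omega> (?dv s) (w s) + L2_inner \<Omega> v0 (w s)"
      using L2.B_add[of "?dv s" \<Omega> v0 "w s"] d assms by simp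
    also have "L2_inner \<Omega> (?dv s) (w s) = L2_inner \<Omega> (?dv s) (?dw s) + L2_inner \<Omega> (?dv s) w0"
      using L2.B_add_right[of "?dw s" \<Omega> w0 "?dv s"] d assms by simp
    also have "L2_inner \<Omega> v0 (w s) = L2_inner \<Omega> v0 (?dw s) + L2_inner \<Omega> v0 w0"
      using L2.B_add_right[of "?dw s" \<Omega> w0 "v0"] d assms by simp
    finally show ?thesis
      using L2_Cauchy_Schwarz[OF d] L2_Cauchy_Schwarz[OF d(1) assms(4)] L2_Cauchy_Schwarz[OF assms(3) d(2)] by simp
  qed
  then have "((\<lambda>s. L2_inner \<Omega> (v s) (w s) - L2_inner \<Omega> v0 w0) \<longlongrightarrow> 0) F"
    by (intro Lim_null_comparison[OF _ lim] always_eventually allI)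
  then show ?thesis by (rule LIM_zero_cancel)
qed

lemma L1_norm_finite_integrable:
  assumes "g \<in> borel_measurable (lebesgue_on \<Omega>)" "L1_norm \<Omega> g \<le> ennreal K"
  shows "integrable (lebesgue_on \<Omega>) g"
proof (rule integrableI_bounded)
  have "(\<integral>\<^sup>+ x. ennreal (norm (g x)) \<partial>lebesgue_on \<Omega>) \<le> ennreal K" using assms unfolding L1_norm_def by simp
  also have "\<dots> < \<infinity>" by simp
  finally show "(\<integral>\<^sup>+ x. ennreal (norm (g x)) \<partial>lebesgue_on \<Omega>) < \<infinity>" .
qed fact

lemma Linf_norm_AE: "AE y in lebesgue_on \<Omega>. ennreal \<bar>v y\<bar> \<le> Linf_norm \<Omega> v"
  unfolding Linf_norm_def by (rule esssup_AE)

lemma Linf_norm_leI: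
  assumes "v \<in> borel_measurable (lebesgue_on \<Omega>)" "AE y in lebesgue_on \<Omega>. ennreal \<bar>v y\<bar> \<le> C"
  shows "Linf_norm \<Omega> v \<le> C"
  unfolding Linf_norm_def using assms by (intro esssup_I) auto

lemma Linf_norm_minus: "Linf_norm \<Omega> (\<lambda>y. v y - w y) = Linf_norm \<Omega> (\<lambda>y. w y - v y)"
  by (simp add: Linf_norm_def abs_minus_commute)

text \<open>Hoelder's inequality for the exponents infinity and 1. It turns the \<open>L1\<close>
  bounds on the Green's function and its time derivative into bounds on pairings with bounded
  functions.\<close>

lemma L2_inner_Linf_L1:
  assumes g: "g \<in> borel_measurable (lebesgue_on \<Omega>)" and vC: "Linf_norm \<Omega> v \<le> ennreal C" and gK: "L1_norm \<Omega> g \<le> ennreal K"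
    and C: "0 \<le> C" and K: "0 \<le> K"
  shows "\<bar>L2_inner \<Omega> v g\<bar> \<le> C * K"
proof -
  have gi: "integrable (lebesgue_on \<Omega>) g" using L1_norm_finite_integrable[OF g gK] .
  have ae: "AE y in lebesgue_on \<Omega>. \<bar>v y\<bar> \<le> C"
    using Linf_norm_AE[where \<Omega>=\<Omega> and v=v] by eventually_elim (metis vC C ennreal_le_iff order_trans)
  have nn: "ennreal (LINT y|lebesgue_on \<Omega>. \<bar>g y\<bar>) = L1_norm \<Omega> g"
    unfolding L1_norm_def using gi by (intro nn_integral_eq_integral[symmetric]) auto
  then have gb: "(LINT y|lebesgue_on \<Omega>. \<bar>g y\<bar>) \<le> K" using gK K by (metis ennreal_le_iff)
  have "\<bar>L2_inner \<Omega> v g\<bar> \<le> (LINT y|lebesgue_on \<Omega>. C * \<bar>g y\<bar>)"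
  proof (cases "integrable (lebesgue_on \<Omega>) (\<lambda>y. v y * g y)")
    case True
    have "\<bar>L2_inner \<Omega> v g\<bar> \<le> (LINT y|lebesgue_on \<Omega>. \<bar>v y * g y\<bar>)" 
      unfolding L2_inner_def by (rule integral_abs_bound)
    also have "\<dots> \<le> (LINT y|lebesgue_on \<Omega>. C * \<bar>g y\<bar>)"
    proof (rule integral_mono_AE)
      show "integrable (lebesgue_on \<Omega>) (\<lambda>y. \<bar>v y * g y\<bar>)" using True by (rule integrable_abs)
      show "AE y in lebesgue_on \<Omega>. \<bar>v y * g y\<bar> \<le> C * \<bar>g y\<bar>"
        using ae by eventually_elim (simp add: abs_mult mult_right_mono)
    qed (use gi in simp)
    finally show ?thesis .
  next
    \<comment> \<open>A product that is not integrable has integral 0 by convention, which satisfies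
      the bound.\<close>
    case False
    then show ?thesis using C gi by (simp add: L2_inner_def not_integrable_integral_eq integral_nonneg_AE)
  qed
  also have "\<dots> \<le> C * K" using gb C by (simp add: mult_left_mono)
  finally show ?thesis .
qed

section \<open>Smooth functions and the fundamental lemma\<close>

lemma smooth_add:
  assumes "smooth f" "smooth g"
  shows "smooth (\<lambda>y. f y + g y)"
proof -
  obtain D where D: "D [] = f" "\<forall>bs x. (D bs has_derivative (\<lambda>h. \<Sum>b\<in>Basis. inner h b * D (b # bs) x)) (at x)"
    using assms(1) unfolding smooth_def by (elim exE conjE)
  obtain E where E: "E [] = g" "\<forall>bs x. (E bs has_derivative (\<lambda>h. \<Sum>b\<in>Basis. inner h b * E (b # bs) x)) (at x)"
    using assms(2) unfolding smooth_def by (elim exE conjE)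
  have "((\<lambda>x. D bs x + E bs x) has_derivative (\<lambda>h. \<Sum>b\<in>Basis. inner h b * (D (b # bs) x + E (b # bs) x))) (at x)" for bs x
    using has_derivative_add[OF D(2)[rule_format, of bs x] E(2)[rule_format, of bs x]] by (simp add: distrib_left sum.distrib)
  with D(1) E(1) show ?thesis unfolding smooth_def by (intro exI[of _ "\<lambda>bs x. D bs x + E bs x"]) simp
qed

lemma smooth_scale:
  assumes "smooth f"
  shows "smooth (\<lambda>y. r * f y)"
proof -
  obtain D where D: "D [] = f" "\<forall>bs x. (D bs has_derivative (\<lambda>h. \<Sum>b\<in>Basis. inner h b * D (b # bs) x)) (at x)"
    using assms unfolding smooth_def by (elim exE conjE)
  have "((\<lambda>x. r * D bs x) has_derivative (\<lambda>h. \<Sum>b\<in>Basis. inner h b * (r * D (b # bs) x))) (at x)" for bs x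
    using has_derivative_mult_right[OF D(2)[rule_format], of r bs x] by (simp add: sum_distrib_left mult.left_commute)
  with D(1) show ?thesis unfolding smooth_def by (intro exI[of _ "\<lambda>bs x. r * D bs x"]) simp
qed

lemma smooth_derivativeE:
  assumes "smooth (f :: 'a::euclidean_space \<Rightarrow> real)"
  obtains f' where "\<And>b. continuous_on UNIV (f' b)" 
    "\<And>x. (f has_derivative (\<lambda>h. \<Sum>b\<in>Basis. inner h b * f' b x)) (at x)"
    "\<And>b x. b \<in> Basis \<Longrightarrow> frechet_derivative f (at x) b = f' b x"
proof -
  obtain D where D: "D [] = f" "\<forall>bs x. (D bs has_derivative (\<lambda>h. \<Sum>b\<in>Basis. inner h b * D (b # bs) x)) (at x)"
    using assms unfolding smooth_def by (elim exE conjE)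
  have der: "(f has_derivative (\<lambda>h. \<Sum>b\<in>Basis. inner h b * D [b] x)) (at x)" for x
    using D(2)[rule_format, of "[]" x] D(1) by simp
  show ?thesis
  proof (rule that[of "\<lambda>b. D [b]"])
    show "continuous_on UNIV (D [b])" for b
      using has_derivative_continuous[OF D(2)[rule_format, of "[b]"]] by (intro continuous_at_imp_continuous_on) simp
    show "frechet_derivative f (at x) b = D [b] x" if "b \<in> Basis" for b x
    proof -
      have "frechet_derivative f (at x) b = (\<Sum>c\<in>Basis. inner b c * D [c] x)"
        by (simp flip: frechet_derivative_at[OF der[of x]])
      also have "\<dots> = (\<Sum>c\<in>Basis. if c = b then D [c] x else 0)"
        using that by (intro sum.cong) (auto simp: inner_Basis)
      finally show ?thesis using that by simp
    qed
  qed (rule der)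
qed

lemma smooth_continuous: "smooth f \<Longrightarrow> continuous_on UNIV f"
proof (elim smooth_derivativeE)
  fix f' assume "\<And>x. (f has_derivative (\<lambda>h. \<Sum>b\<in>Basis. inner h b * f' b x)) (at x)"
  from has_derivative_continuous[OF this] show "continuous_on UNIV f" by (intro continuous_at_imp_continuous_on) simp
qed

text \<open>Iterating a choice of partial derivatives inside a set that is closed under them
  produces the whole family of iterated derivatives that \<open>smooth\<close> asks for.\<close>

lemma smoothI:
  assumes "f \<in> S"
    and "\<And>g. g \<in> S \<Longrightarrow> \<exists>d. (\<forall>b\<in>Basis. d b \<in> S) \<and> (\<forall>x. (g has_derivative (\<lambda>h. \<Sum>b\<in>Basis. inner h b * d b x)) (at x))"
  shows "smooth f"
proof -
  have "\<forall>g\<in>S. \<exists>d. (\<forall>b\<in>Basis. d b \<in> S) \<and> (\<forall>x. (g has_derivative (\<lambda>h. \<Sum>b\<in>Basis. inner h b * d b x)) (at x))"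
    using assms(2) by (intro ballI)
  from bchoice[OF this] obtain nxt where 
    "\<forall>g\<in>S. (\<forall>b\<in>Basis. nxt g b \<in> S) \<and> (\<forall>x. (g has_derivative (\<lambda>h. \<Sum>b\<in>Basis. inner h b * nxt g b x)) (at x))" ..
  then have nxt: "\<And>g b. g \<in> S \<Longrightarrow> b \<in> Basis \<Longrightarrow> nxt g b \<in> S" 
    "\<And>g x. g \<in> S \<Longrightarrow> (g has_derivative (\<lambda>h. \<Sum>b\<in>Basis. inner h b * nxt g b x)) (at x)" by blast+
  \<comment> \<open>The recursion runs over the list of directions. At a vector outside
    \<open>Basis\<close> it repeats the current function, which keeps \<open>D\<close> inside
    \<open>S\<close>; the sums over \<open>Basis\<close> never reach such entries.\<close>
  define D where "D = rec_list f (\<lambda>b bs g. if b \<in> Basis then nxt g b else g)"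
  have Ds: "D [] = f" "D (b # bs) = (if b \<in> Basis then nxt (D bs) b else D bs)" for b bs
    by (auto simp: D_def)
  have DS: "D bs \<in> S" for bs by (induction bs) (auto simp: Ds assms nxt)
  have "(D bs has_derivative (\<lambda>h. \<Sum>b\<in>Basis. inner h b * D (b # bs) x)) (at x)" for bs x
    using nxt(2)[OF DS] by (simp add: Ds cong: sum.cong)
  then show ?thesis unfolding smooth_def using Ds(1) by blast
qed

section \<open>Bump functions built from \<open>exp (- 1 / x)\<close>\<close>

definition flat :: "real poly \<Rightarrow> real \<Rightarrow> real" where
  "flat p x = (if 0 < x then poly p (1 / x) * exp (- 1 / x) else 0)"

lemma poly_times_exp_tendsto_0: "((\<lambda>x. poly p x * exp (- x)) \<longlongrightarrow> (0::real)) at_top"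
proof -
  have "((\<lambda>x. \<Sum>i\<le>degree p. coeff p i * (x ^ i / exp x)) \<longlongrightarrow> (\<Sum>i\<le>degree p. coeff p i * 0)) at_top"
    by (intro tendsto_intros tendsto_power_div_exp_0)
  moreover have "poly p x * exp (- x) = (\<Sum>i\<le>degree p. coeff p i * (x ^ i / exp x))" for x
    by (simp add: poly_altdef sum_distrib_right exp_minus divide_inverse mult.assoc)
  ultimately show ?thesis by simp
qed

text \<open>The polynomial factor closes the family under differentiation: the derivative of
  \<open>p(1/x) exp(-1/x)\<close> carries the factor \<open>(p - p')(1/x) / x^2\<close>. At 0 the
  exponential beats every power of \<open>1/x\<close>.\<close>

lemma DERIV_flat: "(flat p has_real_derivative flat (monom 1 2 * (p - pderiv p)) x) (at x)"
proof -
  consider "0 < x" | "x < 0" | "x = 0" by linarith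
  then show ?thesis
  proof cases
    case 1
    have "((\<lambda>x. poly p (1 / x) * exp (- 1 / x)) has_real_derivative flat (monom 1 2 * (p - pderiv p)) x) (at x)"
      using 1 by (auto intro!: derivative_eq_intros poly_DERIV[THEN DERIV_chain2] 
          simp: flat_def poly_monom power2_eq_square field_simps)
    then show ?thesis
      by (rule has_field_derivative_transform_within_open[of _ _ _ "{0<..}"]) (use 1 in \<open>auto simp: flat_def\<close>)
  next
    case 2
    have "((\<lambda>x. 0) has_real_derivative flat (monom 1 2 * (p - pderiv p)) x) (at x)" using 2 by (auto simp: flat_def)
    then show ?thesis
      by (rule has_field_derivative_transform_within_open[of _ _ _ "{..<0}"]) (use 2 in \<open>auto simp: flat_def\<close>)
  next
    case 3
    \<comment> \<open>The extra factor \<open>1/h\<close> of the difference quotient is absorbed by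
      multiplying the polynomial by its variable.\<close>
    have "((\<lambda>h. poly (pCons 0 p) (inverse h) * exp (- inverse h)) \<longlongrightarrow> 0) (at_right (0::real))"
      by (rule filterlim_compose[OF poly_times_exp_tendsto_0 filterlim_inverse_at_top_right])
    then have "((\<lambda>h. flat p h / h) \<longlongrightarrow> 0) (at_right 0)"
      by (rule Lim_transform_eventually) (auto simp: eventually_at_filter flat_def field_simps intro!: always_eventually)
    moreover have "((\<lambda>h. flat p h / h) \<longlongrightarrow> 0) (at_left 0)"
      by (rule Lim_transform_eventually[of "\<lambda>_. 0"]) (auto simp: eventually_at_filter flat_def intro!: always_eventually)
    ultimately have "((\<lambda>h. flat p h / h) \<longlongrightarrow> 0) (at 0)" by (simp add: filterlim_at_split)
    then show ?thesis using 3 by (simp add: DERIV_def flat_def)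
  qed
qed

text \<open>An algebra of functions that is closed under partial derivatives and contains bump functions.\<close>

inductive_set flat_algebra :: "('a::euclidean_space \<Rightarrow> real) set" where
  const: "(\<lambda>x. r) \<in> flat_algebra"
| flat: "(\<lambda>x. flat p (inner e x + r)) \<in> flat_algebra"
| add: "f \<in> flat_algebra \<Longrightarrow> g \<in> flat_algebra \<Longrightarrow> (\<lambda>x. f x + g x) \<in> flat_algebra"
| mult: "f \<in> flat_algebra \<Longrightarrow> g \<in> flat_algebra \<Longrightarrow> (\<lambda>x. f x * g x) \<in> flat_algebra"

lemma flat_algebra_derivative:
  assumes "f \<in> flat_algebra"
  shows "\<exists>d. (\<forall>b\<in>Basis. d b \<in> flat_algebra) \<and> (\<forall>x. (f has_derivative (\<lambda>h. \<Sum>b\<in>Basis. inner h b * d b x)) (at x))"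
  using assms
proof induction
  case (const r)
  show ?case by (intro exI[of _ "\<lambda>b x. 0"]) (auto intro: flat_algebra.const)
next
  case (flat p e r)
  let ?q = "monom 1 2 * (p - pderiv p)"
  have "((\<lambda>x. flat p (inner e x + r)) has_derivative (\<lambda>h. \<Sum>b\<in>Basis. inner h b * (inner e b * flat ?q (inner e x + r)))) (at x)" for x
  proof -
    have "((\<lambda>x. flat p (inner e x + r)) has_derivative (\<lambda>h. flat ?q (inner e x + r) * inner e h)) (at x)"
      by (rule has_derivative_compose[OF _ DERIV_flat[unfolded has_field_derivative_def], of "\<lambda>x. inner e x + r" "inner e"])
        (auto intro!: derivative_eq_intros)
    moreover have "flat ?q (inner e x + r) * inner e h = (\<Sum>b\<in>Basis. inner h b * (inner e b * flat ?q (inner e x + r)))" for h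
      by (subst euclidean_inner[of e h], subst sum_distrib_left) (simp add: mult_ac)
    ultimately show ?thesis by simp
  qed
  then show ?case
    by (intro exI[of _ "\<lambda>b x. inner e b * flat ?q (inner e x + r)"])
      (auto intro: flat_algebra.mult flat_algebra.const flat_algebra.flat)
next
  case (add f g)
  then obtain d d' where "\<forall>b\<in>Basis. d b \<in> flat_algebra" "\<forall>x. (f has_derivative (\<lambda>h. \<Sum>b\<in>Basis. inner h b * d b x)) (at x)"
    "\<forall>b\<in>Basis. d' b \<in> flat_algebra" "\<forall>x. (g has_derivative (\<lambda>h. \<Sum>b\<in>Basis. inner h b * d' b x)) (at x)" by blast
  then show ?case
    by (intro exI[of _ "\<lambda>b x. d b x + d' b x"])
      (auto simp: distrib_left sum.distrib intro!: flat_algebra.add has_derivative_add)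
next
  case (mult f g)
  then obtain d d' where d: "\<forall>b\<in>Basis. d b \<in> flat_algebra" "\<forall>x. (f has_derivative (\<lambda>h. \<Sum>b\<in>Basis. inner h b * d b x)) (at x)"
    "\<forall>b\<in>Basis. d' b \<in> flat_algebra" "\<forall>x. (g has_derivative (\<lambda>h. \<Sum>b\<in>Basis. inner h b * d' b x)) (at x)" by blast
  have "((\<lambda>x. f x * g x) has_derivative (\<lambda>h. \<Sum>b\<in>Basis. inner h b * (f x * d' b x + d b x * g x))) (at x)" for x
    using has_derivative_mult[OF d(2)[rule_format] d(4)[rule_format], of x]
    by (simp add: sum_distrib_left sum_distrib_right distrib_left sum.distrib mult_ac)
  with d mult.hyps show ?case
    by (intro exI[of _ "\<lambda>b x. f x * d' b x + d b x * g x"]) (auto intro!: flat_algebra.add flat_algebra.mult)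
qed

lemma flat_algebra_smooth: "f \<in> flat_algebra \<Longrightarrow> smooth f"
  using smoothI[of f flat_algebra] flat_algebra_derivative by blast

lemma flat_algebra_prod: "(\<And>i. i \<in> I \<Longrightarrow> f i \<in> flat_algebra) \<Longrightarrow> (\<lambda>x. \<Prod>i\<in>I. f i x) \<in> flat_algebra"
  by (induction I rule: infinite_finite_induct) (auto intro: flat_algebra.const flat_algebra.mult)

text \<open>A product of one-dimensional cutoffs that is positive exactly on the open box. Since
  \<open>flat 1\<close> tends to 1 at infinity, the factor \<open>Suc n\<close> drives the product
  to the indicator of the box.\<close>

definition bump :: "'a::euclidean_space \<Rightarrow> 'a \<Rightarrow> nat \<Rightarrow> 'a \<Rightarrow> real" where
  "bump a b n x = (\<Prod>e\<in>Basis. flat 1 (real (Suc n) * (inner x e - inner a e)) * flat 1 (real (Suc n) * (inner b e - inner x e)))"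

lemma smooth_bump: "smooth (bump a b n)"
proof -
  have "(\<lambda>x. flat 1 (inner (real (Suc n) *\<^sub>R e) x + (- real (Suc n) * inner a e)) * 
         flat 1 (inner (- real (Suc n) *\<^sub>R e) x + real (Suc n) * inner b e)) \<in> flat_algebra" for e
    by (intro flat_algebra.mult flat_algebra.flat)
  moreover have "inner (real (Suc n) *\<^sub>R e) x + (- real (Suc n) * inner a e) = real (Suc n) * (inner x e - inner a e)"
     "inner (- real (Suc n) *\<^sub>R e) x + real (Suc n) * inner b e = real (Suc n) * (inner b e - inner x e)" for e x
    by (simp_all add: inner_commute right_diff_distrib left_diff_distrib algebra_simps)
  ultimately have "(\<lambda>x. flat 1 (real (Suc n) * (inner x e - inner a e)) * flat 1 (real (Suc n) * (inner b e - inner x e))) \<in> flat_algebra" for e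
    by simp
  then show ?thesis unfolding bump_def by (intro flat_algebra_smooth flat_algebra_prod)
qed

lemma flat_1_bounds: "0 \<le> flat 1 x" "flat 1 x \<le> 1" "flat 1 x = 0 \<longleftrightarrow> x \<le> 0"
  by (auto simp: flat_def)

lemma bump_eq_0_iff: "bump a b n x = 0 \<longleftrightarrow> x \<notin> box a b"
  unfolding bump_def by (auto simp: flat_1_bounds mem_box mult_le_0_iff algebra_simps not_less simp del: of_nat_Suc)

lemma bump_bounds: "0 \<le> bump a b n x" "bump a b n x \<le> 1"
  unfolding bump_def by (auto intro!: prod_nonneg prod_le_1 mult_nonneg_nonneg mult_le_one flat_1_bounds)

lemma flat_1_scaled_tendsto:
  assumes "0 < x"
  shows "(\<lambda>n. flat 1 (real (Suc n) * x)) \<longlonglongrightarrow> 1"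
proof -
  have "(\<lambda>n. exp (- (1 / real (Suc n)) * (1 / x))) \<longlonglongrightarrow> exp (- 0 * (1 / x))"
    by (intro tendsto_intros lim_1_over_n[THEN LIMSEQ_Suc])
  then show ?thesis using assms by (simp add: flat_def)
qed

lemma bump_tendsto: "(\<lambda>n. bump a b n x) \<longlonglongrightarrow> indicator (box a b) x"
proof (cases "x \<in> box a b")
  case True
  have "(\<lambda>n. bump a b n x) \<longlonglongrightarrow> (\<Prod>e\<in>(Basis::'a set). 1 * 1)"
    unfolding bump_def using True by (intro tendsto_intros flat_1_scaled_tendsto) (auto simp: mem_box)
  then show ?thesis using True by simp
next
  case False
  then have "bump a b n x = 0" for n by (simp add: bump_eq_0_iff)
  then show ?thesis using False by simp
qed

lemma test_function_bump:
  assumes "cbox a b \<subseteq> \<Omega>"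
  shows "test_function \<Omega> (bump a b n)"
proof -
  have "closure {y. bump a b n y \<noteq> 0} \<subseteq> cbox a b"
    using box_subset_cbox by (intro closure_minimal) (auto simp: bump_eq_0_iff)
  moreover from this have "compact (closure {y. bump a b n y \<noteq> 0})"
    using compact_Int_closed[OF compact_cbox closed_closure] by (metis inf.absorb_iff2)
  ultimately show ?thesis unfolding test_function_def compact_support_in_def
    using assms smooth_bump by blast
qed

lemma lebesgue_on_L2_compact_support:
  fixes g :: "'a::euclidean_space \<Rightarrow> real"
  assumes g: "continuous_on UNIV g" and K: "compact K" "\<And>x. x \<notin> K \<Longrightarrow> g x = 0" and \<Omega>: "\<Omega> \<in> sets lebesgue"
  shows "g \<in> L2 \<Omega>"
proof -
  have "integrable lborel (\<lambda>x. indicator K x *\<^sub>R (g x)\<^sup>2)"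
    by (rule borel_integrable_compact[OF K(1)]) (intro continuous_intros continuous_on_subset[OF g]; simp)
  moreover have "(\<lambda>x. indicator K x *\<^sub>R (g x)\<^sup>2) = (\<lambda>x. (g x)\<^sup>2)" using K(2) by (auto simp: indicator_def fun_eq_iff)
  ultimately have "integrable lebesgue (\<lambda>x. (g x)\<^sup>2)"
    by (metis integrable_completion borel_measurable_integrable)
  then have "integrable (lebesgue_on \<Omega>) (\<lambda>x. (g x)\<^sup>2)"
    using \<Omega> integrable_mult_indicator[of \<Omega> lebesgue "\<lambda>x. (g x)\<^sup>2"] by (simp add: integrable_restrict_space)
  moreover have "g \<in> borel_measurable (lebesgue_on \<Omega>)"
    using continuous_imp_measurable_on_sets_lebesgue[OF continuous_on_subset[OF g] \<Omega>] by simp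
  ultimately show ?thesis by (simp add: L2_def)
qed

lemma indicator_cbox_L2: "(\<Omega> :: 'a::euclidean_space set) \<in> sets lebesgue \<Longrightarrow> indicator (cbox a b) \<in> L2 \<Omega>"
proof -
  assume \<Omega>: "\<Omega> \<in> sets lebesgue"
  have "integrable lebesgue (indicator (cbox a b) :: 'a \<Rightarrow> real)"
    by (simp add: integrable_indicator_iff emeasure_lborel_cbox_eq)
  then have "integrable (lebesgue_on \<Omega>) (indicator (cbox a b) :: 'a \<Rightarrow> real)"
    using \<Omega> integrable_mult_indicator[of \<Omega> lebesgue "indicator (cbox a b) :: 'a \<Rightarrow> real"] by (simp add: integrable_restrict_space)
  moreover have "(\<lambda>y. (indicator (cbox a b) y)\<^sup>2) = (indicator (cbox a b) :: 'a \<Rightarrow> real)" by (auto simp: indicator_def fun_eq_iff)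
  ultimately show ?thesis using borel_measurable_integrable by (auto simp: L2_def)
qed

text \<open>The bumps of the box are admissible test functions with values in [0,1], so
  orthogonality passes to the indicator of the box by dominated convergence.\<close>

lemma integral_cbox_eq_0:
  fixes \<Omega> :: "'a::euclidean_space set"
  assumes \<Omega>: "\<Omega> \<in> sets lebesgue" and h: "h \<in> L2 \<Omega>" and ortho: "\<And>\<phi>. test_function \<Omega> \<phi> \<Longrightarrow> (LINT y|lebesgue_on \<Omega>. h y * \<phi> y) = 0"
    and cb: "cbox a b \<subseteq> \<Omega>"
  shows "(LINT y|lebesgue_on \<Omega>. h y * indicator (cbox a b) y) = 0"
proof -
  have hi: "integrable (lebesgue_on \<Omega>) (\<lambda>y. h y * indicator (cbox a b) y)"
    by (rule L2_integrable_mult[OF h indicator_cbox_L2[OF \<Omega>]])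
  have hm: "h \<in> borel_measurable (lebesgue_on \<Omega>)" using h by (simp add: L2_def)
  have bm: "bump a b n \<in> borel_measurable (lebesgue_on \<Omega>)" for n
    using continuous_imp_measurable_on_sets_lebesgue[OF continuous_on_subset[OF smooth_continuous[OF smooth_bump]] \<Omega>] by simp
  have "(\<lambda>n. LINT y|lebesgue_on \<Omega>. h y * bump a b n y) \<longlonglongrightarrow> (LINT y|lebesgue_on \<Omega>. h y * indicator (cbox a b) y)"
  proof (rule integral_dominated_convergence[where w="\<lambda>y. \<bar>h y * indicator (cbox a b) y\<bar>"])
    \<comment> \<open>The pointwise limit is the indicator of the open box; it differs from that of
      the closed box only on the null boundary.\<close>
    have "cbox a b - box a b \<in> null_sets lebesgue"
      using negligible_frontier_interval negligible_iff_null_sets by blast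
    then have "AE y in lebesgue. y \<notin> cbox a b - box a b" by (rule AE_not_in)
    then have "AE y in lebesgue_on \<Omega>. y \<notin> cbox a b - box a b" using \<Omega> by (auto simp: AE_restrict_space_iff)
    then show "AE y in lebesgue_on \<Omega>. (\<lambda>n. h y * bump a b n y) \<longlonglongrightarrow> h y * indicator (cbox a b) y"
    proof eventually_elim
      case (elim y)
      then have "indicator (cbox a b) y = (indicator (box a b) y :: real)" 
        using box_subset_cbox[of a b] by (auto simp: indicator_def)
      then show ?case using bump_tendsto[of a b y] by (auto intro: tendsto_mult_left)
    qed
    show "AE y in lebesgue_on \<Omega>. norm (h y * bump a b n y) \<le> \<bar>h y * indicator (cbox a b) y\<bar>" for n
    proof (intro AE_I2)
      fix y
      show "norm (h y * bump a b n y) \<le> \<bar>h y * indicator (cbox a b) y\<bar>"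
        using bump_bounds[of a b n y] bump_eq_0_iff[of a b n y] box_subset_cbox[of a b]
        by (cases "y \<in> cbox a b") (auto simp: abs_mult mult_left_le)
    qed
  qed (use hm bm hi in auto)
  moreover have "(LINT y|lebesgue_on \<Omega>. h y * bump a b n y) = 0" for n
    using ortho test_function_bump[OF cb] by blast
  ultimately show ?thesis by (simp add: LIMSEQ_const_iff)
qed

text \<open>All integrals over boxes inside \<open>\<Omega>\<close> vanish, so Lebesgue's
  differentiation theorem forces \<open>h\<close> to vanish almost everywhere.\<close>

lemma fundamental_lemma:
  fixes \<Omega> :: "'a::euclidean_space set"
  assumes op: "open \<Omega>" and h: "h \<in> L2 \<Omega>" and ortho: "\<And>\<phi>. test_function \<Omega> \<phi> \<Longrightarrow> (LINT y|lebesgue_on \<Omega>. h y * \<phi> y) = 0"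
  shows "AE y in lebesgue_on \<Omega>. h y = 0"
proof -
  have \<Omega>: "\<Omega> \<in> sets lebesgue" using op by (simp add: lmeasurable_open)
  \<comment> \<open>Extension by 0 gives a function that is integrable over every box, also over
    those leaving \<open>\<Omega>\<close>.\<close>
  define H where "H y = indicator \<Omega> y * h y" for y
  have bi: "integrable (lebesgue_on (cbox a b)) H" 
    and be: "(LINT y|lebesgue_on \<Omega>. h y * indicator (cbox a b) y) = integral (cbox a b) H" for a b
  proof -
    have "integrable (lebesgue_on \<Omega>) (\<lambda>y. h y * indicator (cbox a b) y)"
      by (rule L2_integrable_mult[OF h indicator_cbox_L2[OF \<Omega>]])
    then have "integrable lebesgue (\<lambda>y. indicator \<Omega> y *\<^sub>R (h y * indicator (cbox a b) y))"
      using \<Omega> by (simp add: integrable_restrict_space)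
    moreover have e: "(\<lambda>y. indicator \<Omega> y *\<^sub>R (h y * indicator (cbox a b) y)) = (\<lambda>y. indicator (cbox a b) y *\<^sub>R H y)"
      by (auto simp: H_def fun_eq_iff)
    ultimately show i: "integrable (lebesgue_on (cbox a b)) H"
      by (simp add: integrable_restrict_space)
    have "(LINT y|lebesgue_on \<Omega>. h y * indicator (cbox a b) y) = (LINT y|lebesgue_on (cbox a b). H y)"
      using \<Omega> e by (simp add: integral_restrict_space)
    also have "\<dots> = integral (cbox a b) H" using i by (rule lebesgue_integral_eq_integral) simp
    finally show "(LINT y|lebesgue_on \<Omega>. h y * indicator (cbox a b) y) = integral (cbox a b) H" .
  qed
  \<comment> \<open>Differentiation of integrals along cubes that have \<open>x\<close> as their
    lower corner.\<close>
  obtain N where N: "negligible N" 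
    "\<And>x e. x \<notin> N \<Longrightarrow> 0 < e \<Longrightarrow> \<exists>d>0. \<forall>r. 0 < r \<and> r < d \<longrightarrow> norm (integral (cbox x (x + r *\<^sub>R One)) H /\<^sub>R r ^ DIM('a) - H x) < e"
    using integrable_ccontinuous_explicit[of H] integrable_on_lebesgue_on[OF bi] by (metis sets_completionI_sets sets_lborel borel_closed closed_cbox)
  have "h x = 0" if x: "x \<in> \<Omega>" "x \<notin> N" for x
  proof (rule ccontr)
    assume "h x \<noteq> 0"
    then have "0 < \<bar>H x\<bar>" using x by (simp add: H_def)
    from N(2)[OF x(2) this] obtain d where d: "d > 0" 
      "\<And>r. 0 < r \<Longrightarrow> r < d \<Longrightarrow> norm (integral (cbox x (x + r *\<^sub>R One)) H /\<^sub>R r ^ DIM('a) - H x) < \<bar>H x\<bar>" by blast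
    obtain e where e: "e > 0" "ball x e \<subseteq> \<Omega>" using op x open_contains_ball by blast
    \<comment> \<open>The first bound puts the cube into the range of the differentiation estimate;
      the second keeps it in the ball, since the distance from its corner is at most the sum of its
      \<open>DIM('a)\<close> edge lengths.\<close>
    define r where "r = min (d / 2) (e / (2 * DIM('a)))"
    have r: "0 < r" "r < d" "r * DIM('a) < e"
    proof -
      show "0 < r" "r < d" using d e by (auto simp: r_def min_less_iff_disj)
      have "r * DIM('a) \<le> e / (2 * DIM('a)) * DIM('a)" unfolding r_def by (intro mult_right_mono) auto
      also have "\<dots> < e" using e by simp
      finally show "r * DIM('a) < e" .
    qed
    have "cbox x (x + r *\<^sub>R One) \<subseteq> ball x e"
    proof
      fix y assume y: "y \<in> cbox x (x + r *\<^sub>R One)"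
      have "dist x y \<le> (\<Sum>b\<in>Basis. \<bar>inner (x - y) b\<bar>)" unfolding dist_norm by (rule norm_le_l1)
      also have "\<dots> \<le> (\<Sum>b\<in>(Basis::'a set). r)"
        using y by (intro sum_mono) (auto simp: mem_box inner_simps)
      also have "\<dots> < e" using r by (simp add: mult.commute)
      finally show "y \<in> ball x e" by simp
    qed
    then have "integral (cbox x (x + r *\<^sub>R One)) H = 0"
      using integral_cbox_eq_0[OF \<Omega> h ortho] e(2) be by (metis subset_trans)
    then show False using d(2)[OF r(1,2)] by simp
  qed
  moreover have "AE x in lebesgue_on \<Omega>. x \<notin> N"
  proof -
    have "AE x in lebesgue. x \<notin> N" using N(1) by (simp add: negligible_iff_null_sets AE_not_in)
    then show ?thesis using \<Omega> by (auto simp: AE_restrict_space_iff)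
  qed
  ultimately show ?thesis using AE_space[of "lebesgue_on \<Omega>"] by (auto elim!: eventually_elim2 simp: space_restrict_space)
qed

section \<open>Weak gradients and Sobolev spaces\<close>

lemma test_function_vanishes:
  assumes "test_function \<Omega> \<phi>" "x \<notin> closure {y. \<phi> y \<noteq> 0}"
  shows "\<phi> x = 0" "(\<phi> has_derivative (\<lambda>h. 0)) (at x)"
proof -
  have z: "\<phi> y = 0" if "y \<notin> closure {y. \<phi> y \<noteq> 0}" for y
    using that closure_subset[of "{y. \<phi> y \<noteq> 0}"] by blast
  show "\<phi> x = 0" using assms(2) by (rule z)
  show "(\<phi> has_derivative (\<lambda>h. 0)) (at x)"
  proof (rule has_derivative_transform_within_open)
    show "((\<lambda>y. 0) has_derivative (\<lambda>h. 0)) (at x)" by simp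
    show "open (- closure {y. \<phi> y \<noteq> 0})" by (simp add: open_Compl)
    show "x \<in> - closure {y. \<phi> y \<noteq> 0}" using assms(2) by blast
    show "0 = \<phi> y" if "y \<in> - closure {y. \<phi> y \<noteq> 0}" for y using z[OF ComplD[OF that]] by (rule sym)
  qed
qed

lemma test_function_L2:
  assumes "test_function \<Omega> \<phi>" "S \<in> sets lebesgue"
  shows "\<phi> \<in> L2 S"
  using assms(1)
  by (intro lebesgue_on_L2_compact_support[OF _ _ test_function_vanishes(1)[OF assms(1)] assms(2)])
    (auto simp: test_function_def compact_support_in_def smooth_continuous)

lemma test_function_partialE:
  assumes "test_function \<Omega> \<phi>"
  obtains d where "\<forall>b. continuous_on UNIV (d b)" 
    "\<forall>x. (\<phi> has_derivative (\<lambda>h. \<Sum>b\<in>Basis. inner h b * d b x)) (at x)"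
    "\<forall>b\<in>Basis. \<forall>x. frechet_derivative \<phi> (at x) b = d b x"
    "\<forall>b\<in>Basis. \<forall>x. x \<notin> closure {y. \<phi> y \<noteq> 0} \<longrightarrow> d b x = 0"
proof -
  obtain d where d: "\<And>b. continuous_on UNIV (d b)" 
    "\<And>x. (\<phi> has_derivative (\<lambda>h. \<Sum>b\<in>Basis. inner h b * d b x)) (at x)"
    "\<And>b x. b \<in> Basis \<Longrightarrow> frechet_derivative \<phi> (at x) b = d b x"
    using assms smooth_derivativeE unfolding test_function_def by blast
  have "d b x = 0" if "b \<in> Basis" "x \<notin> closure {y. \<phi> y \<noteq> 0}" for b x
    using d(3)[OF that(1), of x] frechet_derivative_at[OF test_function_vanishes(2)[OF assms that(2)], symmetric] by simp
  with d show ?thesis by (intro that[of d]) auto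
qed

lemma test_function_partial_L2:
  assumes \<phi>: "test_function \<Omega> \<phi>" and "S \<in> sets lebesgue" and b: "b \<in> Basis"
  shows "(\<lambda>y. frechet_derivative \<phi> (at y) b) \<in> L2 S"
proof -
  obtain d where "\<forall>b. continuous_on UNIV (d b)" 
    "\<forall>x. (\<phi> has_derivative (\<lambda>h. \<Sum>b\<in>Basis. inner h b * d b x)) (at x)"
    "\<forall>b\<in>Basis. \<forall>x. frechet_derivative \<phi> (at x) b = d b x"
    "\<forall>b\<in>Basis. \<forall>x. x \<notin> closure {y. \<phi> y \<noteq> 0} \<longrightarrow> d b x = 0"
    using \<phi> by (rule test_function_partialE)
  note d = this[rule_format]
  have "d b \<in> L2 S"
    using \<phi> by (intro lebesgue_on_L2_compact_support[OF d(1) _ d(4) assms(2)]) (auto simp: test_function_def compact_support_in_def b)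
  then show ?thesis using d(3)[OF b] by simp
qed

lemma compact_support_in_combine:
  assumes "compact_support_in \<Omega> f" "compact_support_in \<Omega> g" "\<And>y. f y = 0 \<Longrightarrow> g y = 0 \<Longrightarrow> h y = 0"
  shows "compact_support_in \<Omega> h"
proof -
  have "closure {y. h y \<noteq> 0} \<subseteq> closure {y. f y \<noteq> 0} \<union> closure {y. g y \<noteq> 0}"
    unfolding closure_Un[symmetric] using assms(3) by (intro closure_mono) auto
  moreover have "compact (closure {y. f y \<noteq> 0} \<union> closure {y. g y \<noteq> 0})"
    using assms by (intro compact_Un) (auto simp: compact_support_in_def)
  ultimately have "compact (closure {y. h y \<noteq> 0})"
    using compact_Int_closed[OF _ closed_closure] by (metis inf.absorb_iff2)
  then show ?thesis using \<open>closure {y. h y \<noteq> 0} \<subseteq> _\<close> assms unfolding compact_support_in_def by blast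
qed

lemma test_function_add: "test_function \<Omega> f \<Longrightarrow> test_function \<Omega> g \<Longrightarrow> test_function \<Omega> (\<lambda>y. f y + g y)"
  unfolding test_function_def using compact_support_in_combine[of \<Omega> f g "\<lambda>y. f y + g y"] smooth_add by auto

lemma test_function_scale: "test_function \<Omega> f \<Longrightarrow> test_function \<Omega> (\<lambda>y. r * f y)"
  unfolding test_function_def using compact_support_in_combine[of \<Omega> f f "\<lambda>y. r * f y"] smooth_scale by auto

text \<open>By translation invariance the difference quotients have integral 0.\<close>

lemma integral_partial_eq_0:
  fixes g :: "'a::euclidean_space \<Rightarrow> real"
  assumes cont: "continuous_on UNIV g" "continuous_on UNIV d" and K: "compact K" "\<And>x. x \<notin> K \<Longrightarrow> g x = 0" "\<And>x. x \<notin> K \<Longrightarrow> d x = 0"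
    and der: "\<And>x t. ((\<lambda>t. g (x + t *\<^sub>R b)) has_real_derivative d (x + t *\<^sub>R b)) (at t)" and b: "norm b = 1"
  shows "integral\<^sup>L lborel d = 0"
proof -
  obtain R where R: "\<And>x. x \<in> K \<Longrightarrow> norm x \<le> R" using compact_imp_bounded[OF K(1)] by (auto simp: bounded_iff)
  have "compact (d ` K)" using K(1) cont(2) continuous_on_subset compact_continuous_image by blast
  then obtain C0 where C0: "\<And>x. x \<in> K \<Longrightarrow> \<bar>d x\<bar> \<le> C0" using compact_imp_bounded by (fastforce simp: bounded_iff)
  define C where "C = max C0 0"
  have C: "\<bar>d x\<bar> \<le> C" "0 \<le> C" for x using C0[of x] K(3)[of x] by (cases "x \<in> K"; simp add: C_def)+
  have gi: "integrable lborel g"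
  proof -
    have "integrable lborel (\<lambda>x. indicator K x *\<^sub>R g x)"
      by (rule borel_integrable_compact[OF K(1)]) (rule continuous_on_subset[OF cont(1)]; simp)
    moreover have "(\<lambda>x. indicator K x *\<^sub>R g x) = g" using K(2) by (auto simp: indicator_def fun_eq_iff)
    ultimately show ?thesis by simp
  qed
  define r where "r n = 1 / real (Suc n)" for n
  have r: "0 < r n" "r n \<le> 1" for n by (auto simp: r_def)
  have r0: "r \<longlonglongrightarrow> 0" unfolding r_def by (rule lim_1_over_n[THEN LIMSEQ_Suc])
  have gm: "g \<in> borel_measurable borel" using cont(1) by (rule borel_measurable_continuous_onI)
  have gi': "integrable lborel (\<lambda>x. g (x + c))" for c
  proof -
    have "integrable (distr lborel borel ((+) c)) g" unfolding lborel_distr_plus by (rule gi)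
    then have "integrable lborel (\<lambda>x. g (c + x))" using gm by (subst (asm) integrable_distr_eq) auto
    then show ?thesis by (simp only: add.commute)
  qed
  have ge: "(LINT x|lborel. g (x + c)) = (LINT x|lborel. g x)" for c
  proof -
    have "(LINT x|lborel. g x) = (LINT x|distr lborel borel ((+) c). g x)" unfolding lborel_distr_plus ..
    also have "\<dots> = (LINT x|lborel. g (c + x))" using gm by (subst integral_distr) auto
    finally show ?thesis by (simp only: add.commute)
  qed
  have s0: "(LINT x|lborel. (g (x + r n *\<^sub>R b) - g x) / r n) = 0" for n
    using gi gi' ge by simp
  have "(\<lambda>n. LINT x|lborel. (g (x + r n *\<^sub>R b) - g x) / r n) \<longlonglongrightarrow> integral\<^sup>L lborel d"
  proof (rule integral_dominated_convergence[where w="\<lambda>x. C * indicator (cball 0 (R + 1)) x"])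
    show "d \<in> borel_measurable lborel" using borel_measurable_continuous_onI[OF cont(2)] by simp
    show "(\<lambda>x. (g (x + r n *\<^sub>R b) - g x) / r n) \<in> borel_measurable lborel" for n
      using borel_measurable_integrable[OF gi] borel_measurable_integrable[OF gi'[of "r n *\<^sub>R b"]] by simp
    show "integrable lborel (\<lambda>x::'a. C * indicator (cball 0 (R + 1)) x)"
      using emeasure_bounded_finite[OF bounded_cball, of "0::'a" "R + 1"] by (intro integrable_mult_right integrable_real_indicator) auto
    show "AE x in lborel. (\<lambda>n. (g (x + r n *\<^sub>R b) - g x) / r n) \<longlonglongrightarrow> d x"
    proof (rule AE_I2)
      fix x
      have "((\<lambda>h. (g (x + h *\<^sub>R b) - g x) / h) \<longlongrightarrow> d x) (at 0)"
        using der[of x 0] by (simp add: DERIV_def)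
      moreover have "filterlim r (at 0) sequentially"
        using r0 r by (auto simp: filterlim_at less_imp_neq[symmetric])
      ultimately show "(\<lambda>n. (g (x + r n *\<^sub>R b) - g x) / r n) \<longlonglongrightarrow> d x" by (rule filterlim_compose)
    qed
    show "AE x in lborel. norm ((g (x + r n *\<^sub>R b) - g x) / r n) \<le> C * indicator (cball 0 (R + 1)) x" for n
    proof (rule AE_I2)
      fix x
      \<comment> \<open>The mean value theorem bounds the difference quotients uniformly in
        \<open>n\<close>, which supplies the dominating function.\<close>
      obtain t where "g (x + r n *\<^sub>R b) - g (x + 0 *\<^sub>R b) = (r n - 0) * d (x + t *\<^sub>R b)"
        using MVT2[OF r(1)[of n], of "\<lambda>t. g (x + t *\<^sub>R b)" "\<lambda>t. d (x + t *\<^sub>R b)"] der by blast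
      then have "(g (x + r n *\<^sub>R b) - g x) / r n = d (x + t *\<^sub>R b)" using r(1)[of n] by simp
      then have 1: "norm ((g (x + r n *\<^sub>R b) - g x) / r n) \<le> C" using C by simp
      show "norm ((g (x + r n *\<^sub>R b) - g x) / r n) \<le> C * indicator (cball 0 (R + 1)) x"
      proof (cases "x \<in> cball 0 (R + 1)")
        case False
        then have nx: "R + 1 < norm x" by simp
        \<comment> \<open>The shift has length at most 1, so for \<open>x\<close> outside the ball
          of radius \<open>R + 1\<close> both \<open>x\<close> and the shifted point miss
          \<open>K\<close>.\<close>
        have "norm x \<le> norm (x + r n *\<^sub>R b) + norm (r n *\<^sub>R b)" using norm_triangle_ineq4[of "x + r n *\<^sub>R b" "r n *\<^sub>R b"] by simp
        then have "R < norm (x + r n *\<^sub>R b)" using nx r[of n] b by simp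
        then have "g x = 0" "g (x + r n *\<^sub>R b) = 0" using K(2) R nx by fastforce+
        then show ?thesis using False by simp
      qed (use 1 in simp)
    qed
  qed
  then show ?thesis unfolding s0 by (rule LIMSEQ_unique[OF _ tendsto_const])
qed

text \<open>The product \<open>\<phi> \<theta>\<close> has compact support, so the integral of its
  partial derivative is 0; the product rule turns this into integration by parts.\<close>

lemma weak_gradient_test_function:
  fixes \<Omega> :: "'a::euclidean_space set"
  assumes \<Omega>: "\<Omega> \<in> sets lebesgue" and \<phi>: "test_function \<Omega> \<phi>"
  shows "weak_gradient \<Omega> \<phi> (\<lambda>y. \<Sum>b\<in>Basis. frechet_derivative \<phi> (at y) b *\<^sub>R b)"
proof -
  have in_b: "inner (\<Sum>c\<in>Basis. frechet_derivative \<phi> (at y) c *\<^sub>R c) b = frechet_derivative \<phi> (at y) b" if "b \<in> Basis" for b y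
    using that by (simp add: inner_sum_left inner_Basis if_distrib cong: if_cong)
  have "(LINT y|lebesgue_on \<Omega>. \<phi> y * frechet_derivative \<theta> (at y) b) = - (LINT y|lebesgue_on \<Omega>. frechet_derivative \<phi> (at y) b * \<theta> y)"
    if b: "b \<in> Basis" and \<theta>: "test_function \<Omega> \<theta>" for b \<theta>
  proof -
  obtain p where "\<forall>b. continuous_on UNIV (p b)" 
    "\<forall>x. (\<phi> has_derivative (\<lambda>h. \<Sum>b\<in>Basis. inner h b * p b x)) (at x)"
    "\<forall>b\<in>Basis. \<forall>x. frechet_derivative \<phi> (at x) b = p b x"
    "\<forall>b\<in>Basis. \<forall>x. x \<notin> closure {y. \<phi> y \<noteq> 0} \<longrightarrow> p b x = 0"
    using \<phi> by (rule test_function_partialE)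
  note p = this[rule_format]
  obtain q where "\<forall>b. continuous_on UNIV (q b)" 
    "\<forall>x. (\<theta> has_derivative (\<lambda>h. \<Sum>b\<in>Basis. inner h b * q b x)) (at x)"
    "\<forall>b\<in>Basis. \<forall>x. frechet_derivative \<theta> (at x) b = q b x"
    "\<forall>b\<in>Basis. \<forall>x. x \<notin> closure {y. \<theta> y \<noteq> 0} \<longrightarrow> q b x = 0"
    using \<theta> by (rule test_function_partialE)
  note q = this[rule_format]
    let ?K = "closure {y. \<phi> y \<noteq> 0}"
    let ?d = "\<lambda>x. \<phi> x * q b x + p b x * \<theta> x"
    have K: "compact ?K" "?K \<subseteq> \<Omega>" using \<phi> by (auto simp: test_function_def compact_support_in_def)
    have c: "continuous_on UNIV \<phi>" "continuous_on UNIV \<theta>" using \<phi> \<theta> by (auto simp: test_function_def smooth_continuous)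
    have bs: "(\<Sum>c\<in>Basis. inner (r *\<^sub>R b) c * f c) = r * f b" for r and f :: "'a \<Rightarrow> real"
    proof -
      have "(\<Sum>c\<in>Basis. inner (r *\<^sub>R b) c * f c) = (\<Sum>c\<in>Basis. if c = b then r * f c else 0)"
        using b by (intro sum.cong) (auto simp: inner_Basis)
      then show ?thesis using b by simp
    qed
    have z: "?d x = 0" if "x \<notin> ?K" for x using test_function_vanishes(1)[OF \<phi> that] p(4)[OF b that] by simp
    have "integral\<^sup>L lborel ?d = 0"
    proof (rule integral_partial_eq_0[of "\<lambda>x. \<phi> x * \<theta> x" _ ?K b])
      fix x t
      have l: "((\<lambda>t. x + t *\<^sub>R b) has_derivative (\<lambda>h. h *\<^sub>R b)) (at t)" by (auto intro!: derivative_eq_intros)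
      have "((\<lambda>t. \<phi> (x + t *\<^sub>R b)) has_real_derivative p b (x + t *\<^sub>R b)) (at t)"
        unfolding has_field_derivative_def
        by (rule has_derivative_eq_rhs[OF has_derivative_compose[OF l p(2)[of "x + t *\<^sub>R b"]]]) (rule ext, simp only: bs mult.commute)
      moreover have "((\<lambda>t. \<theta> (x + t *\<^sub>R b)) has_real_derivative q b (x + t *\<^sub>R b)) (at t)"
        unfolding has_field_derivative_def
        by (rule has_derivative_eq_rhs[OF has_derivative_compose[OF l q(2)[of "x + t *\<^sub>R b"]]]) (rule ext, simp only: bs mult.commute)
      ultimately show "((\<lambda>t. \<phi> (x + t *\<^sub>R b) * \<theta> (x + t *\<^sub>R b)) has_real_derivative ?d (x + t *\<^sub>R b)) (at t)"
        by (auto intro!: derivative_eq_intros)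
      show "continuous_on UNIV (\<lambda>x. \<phi> x * \<theta> x)" "continuous_on UNIV ?d" by (intro continuous_intros c p q)+
      show "compact ?K" by (rule K)
      show "norm b = 1" using b by simp
      show "?d x = 0" if "x \<notin> ?K" for x using that by (rule z)
      show "\<phi> x * \<theta> x = 0" if "x \<notin> ?K" for x using test_function_vanishes(1)[OF \<phi> that] by simp
    qed
    \<comment> \<open>The integrand vanishes off the support of \<open>\<phi>\<close>, which lies in
      \<open>\<Omega>\<close>, so integration over the whole space and over \<open>\<Omega>\<close>
      agree.\<close>
    moreover have "integral\<^sup>L lborel ?d = (LINT y|lebesgue_on \<Omega>. ?d y)"
    proof -
      have "continuous_on UNIV ?d" by (intro continuous_intros c p q)
      then have "?d \<in> borel_measurable lborel" using borel_measurable_continuous_onI by simp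
      then have "integral\<^sup>L lborel ?d = integral\<^sup>L lebesgue ?d" by (simp only: integral_completion)
      moreover have "?d x = indicator \<Omega> x *\<^sub>R ?d x" for x using z[of x] K(2) by (cases "x \<in> \<Omega>") auto
      then have "integral\<^sup>L lebesgue ?d = integral\<^sup>L lebesgue (\<lambda>x. indicator \<Omega> x *\<^sub>R ?d x)"
        by (intro Bochner_Integration.integral_cong refl)
      moreover have "integral\<^sup>L lebesgue (\<lambda>x. indicator \<Omega> x *\<^sub>R ?d x) = (LINT y|lebesgue_on \<Omega>. ?d y)"
        using \<Omega> by (intro integral_restrict_space[symmetric]) simp
      ultimately show ?thesis by (simp only:)
    qed
    moreover have "integrable (lebesgue_on \<Omega>) (\<lambda>y. \<phi> y * q b y)" "integrable (lebesgue_on \<Omega>) (\<lambda>y. p b y * \<theta> y)"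
      using L2_integrable_mult[OF test_function_L2[OF \<phi> \<Omega>] test_function_partial_L2[OF \<theta> \<Omega> b]]
        L2_integrable_mult[OF test_function_partial_L2[OF \<phi> \<Omega> b] test_function_L2[OF \<theta> \<Omega>]] b
      by (simp_all add: p(3) q(3))
    ultimately have "(LINT y|lebesgue_on \<Omega>. \<phi> y * q b y) + (LINT y|lebesgue_on \<Omega>. p b y * \<theta> y) = 0" by simp
    then show ?thesis using b by (simp add: p(3) q(3))
  qed
  then show ?thesis unfolding weak_gradient_def
    using test_function_partial_L2[OF \<phi> \<Omega>] by (simp add: in_b)
qed

lemma test_function_H1: "\<Omega> \<in> sets lebesgue \<Longrightarrow> test_function \<Omega> \<phi> \<Longrightarrow> \<phi> \<in> H1 \<Omega>"
  unfolding H1_def using test_function_L2 weak_gradient_test_function by blast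

lemma weak_gradient_add:
  assumes \<Omega>: "\<Omega> \<in> sets lebesgue" and "v \<in> L2 \<Omega>" "v' \<in> L2 \<Omega>" "weak_gradient \<Omega> v w" "weak_gradient \<Omega> v' w'"
  shows "weak_gradient \<Omega> (\<lambda>y. v y + v' y) (\<lambda>y. w y + w' y)"
proof -
  have "integrable (lebesgue_on \<Omega>) (\<lambda>y. u y * frechet_derivative \<phi> (at y) b)"
    if "u \<in> L2 \<Omega>" "test_function \<Omega> \<phi>" "b \<in> Basis" for u \<phi> b
    using L2_integrable_mult[OF that(1) test_function_partial_L2[OF that(2) \<Omega> that(3)]] .
  moreover have "integrable (lebesgue_on \<Omega>) (\<lambda>y. u y * \<phi> y)" if "u \<in> L2 \<Omega>" "test_function \<Omega> \<phi>" for u \<phi>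
    using L2_integrable_mult[OF that(1) test_function_L2[OF that(2) \<Omega>]] .
  ultimately show ?thesis
    using assms(2-) L2.add_in[of "\<lambda>y. inner (w y) _" \<Omega> "\<lambda>y. inner (w' y) _"]
    unfolding weak_gradient_def by (simp add: inner_add_left distrib_right)
qed

lemma weak_gradient_scale:
  assumes "weak_gradient \<Omega> v w"
  shows "weak_gradient \<Omega> (\<lambda>y. r * v y) (\<lambda>y. r *\<^sub>R w y)"
  using assms unfolding weak_gradient_def by (auto simp: mult.assoc intro: L2.scale_in)

text \<open>Each component of \<open>w - w'\<close> is orthogonal to all test functions. Through
  this lemma the arbitrary choice made by \<open>grad\<close> becomes linear almost
  everywhere.\<close>

lemma weak_gradient_unique:
  fixes \<Omega> :: "'a::euclidean_space set"
  assumes op: "open \<Omega>" and w: "weak_gradient \<Omega> v w" "weak_gradient \<Omega> v w'"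
  shows "AE y in lebesgue_on \<Omega>. w y = w' y"
proof -
  have \<Omega>: "\<Omega> \<in> sets lebesgue" using op by (simp add: lmeasurable_open)
  have "AE y in lebesgue_on \<Omega>. inner (w y) b - inner (w' y) b = 0" if b: "b \<in> Basis" for b
  proof (rule fundamental_lemma[OF op])
    have l: "(\<lambda>y. inner (w y) b) \<in> L2 \<Omega>" "(\<lambda>y. inner (w' y) b) \<in> L2 \<Omega>" using w b by (auto simp: weak_gradient_def)
    then show "(\<lambda>y. inner (w y) b - inner (w' y) b) \<in> L2 \<Omega>" by (rule L2.diff_in)
    fix \<phi> assume \<phi>: "test_function \<Omega> \<phi>"
    show "(LINT y|lebesgue_on \<Omega>. (inner (w y) b - inner (w' y) b) * \<phi> y) = 0"
      using w b \<phi> L2_integrable_mult[OF l(1) test_function_L2[OF \<phi> \<Omega>]] L2_integrable_mult[OF l(2) test_function_L2[OF \<phi> \<Omega>]]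
      by (simp add: left_diff_distrib weak_gradient_def)
  qed
  then have "AE y in lebesgue_on \<Omega>. \<forall>b\<in>Basis. inner (w y) b - inner (w' y) b = 0"
    by (intro AE_finite_allI) auto
  then show ?thesis by eventually_elim (auto intro: euclidean_eqI)
qed

lemma grad_weak: "v \<in> H1 \<Omega> \<Longrightarrow> weak_gradient \<Omega> v (grad \<Omega> v)"
  unfolding grad_def H1_def using someI_ex[of "weak_gradient \<Omega> v"] by simp

lemma grad_L2: "v \<in> H1 \<Omega> \<Longrightarrow> b \<in> Basis \<Longrightarrow> (\<lambda>y. inner (grad \<Omega> v y) b) \<in> L2 \<Omega>"
  using grad_weak unfolding weak_gradient_def by blast

lemma H1_L2: "v \<in> H1 \<Omega> \<Longrightarrow> v \<in> L2 \<Omega>"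
  by (simp add: H1_def)

text \<open>The polarisation of \<open>H1_norm\<close>; it makes the triangle inequality for that
  norm a consequence of the Cauchy-Schwarz inequality.\<close>

definition H1_inner :: "'a::euclidean_space set \<Rightarrow> ('a \<Rightarrow> real) \<Rightarrow> ('a \<Rightarrow> real) \<Rightarrow> real" where
  "H1_inner \<Omega> v w = L2_inner \<Omega> v w + (\<Sum>b\<in>Basis. L2_inner \<Omega> (\<lambda>y. inner (grad \<Omega> v y) b) (\<lambda>y. inner (grad \<Omega> w y) b))"

lemma H1_norm_eq: "H1_norm \<Omega> v = sqrt (H1_inner \<Omega> v v)"
  unfolding H1_norm_def H1_inner_def L2_norm_def L2_inner_def
  by (simp add: integral_nonneg_AE)

context
  fixes \<Omega> :: "'a::euclidean_space set"
  assumes op: "open \<Omega>"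
begin

lemma \<Omega>_lebesgue: "\<Omega> \<in> sets lebesgue"
  using op by (simp add: lmeasurable_open)

lemma H1_add: "v \<in> H1 \<Omega> \<Longrightarrow> w \<in> H1 \<Omega> \<Longrightarrow> (\<lambda>y. v y + w y) \<in> H1 \<Omega>"
  unfolding H1_def using weak_gradient_add[OF \<Omega>_lebesgue] by (blast intro: L2.add_in)

lemma H1_scale: "v \<in> H1 \<Omega> \<Longrightarrow> (\<lambda>y. r * v y) \<in> H1 \<Omega>"
  unfolding H1_def using weak_gradient_scale by (blast intro: L2.scale_in)

lemma grad_add: "v \<in> H1 \<Omega> \<Longrightarrow> w \<in> H1 \<Omega> \<Longrightarrow> AE y in lebesgue_on \<Omega>. grad \<Omega> (\<lambda>y. v y + w y) y = grad \<Omega> v y + grad \<Omega> w y"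
  by (intro weak_gradient_unique[OF op grad_weak] weak_gradient_add[OF \<Omega>_lebesgue]) (auto intro: H1_L2 H1_add grad_weak)

lemma grad_scale: "v \<in> H1 \<Omega> \<Longrightarrow> AE y in lebesgue_on \<Omega>. grad \<Omega> (\<lambda>y. r * v y) y = r *\<^sub>R grad \<Omega> v y"
  by (intro weak_gradient_unique[OF op grad_weak] weak_gradient_scale) (auto intro: H1_scale grad_weak)

lemma H1_semi_inner_space: "semi_inner_space (H1 \<Omega>) (H1_inner \<Omega>)"
proof (unfold_locales)
  show "(\<lambda>y. 0) \<in> H1 \<Omega>"
    unfolding H1_def by (auto simp: weak_gradient_def intro!: exI[of _ "\<lambda>y. 0"])
  fix v v' w assume v: "v \<in> H1 \<Omega>"
  show "(\<lambda>y. r * v y) \<in> H1 \<Omega>" for r using v by (rule H1_scale)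
  show "0 \<le> H1_inner \<Omega> v v"
    unfolding H1_inner_def by (intro add_nonneg_nonneg sum_nonneg L2.B_nonneg grad_L2 H1_L2 v) auto
  assume w: "w \<in> H1 \<Omega>"
  show "(\<lambda>y. v y + w y) \<in> H1 \<Omega>" using v w by (rule H1_add)
  show "H1_inner \<Omega> v w = H1_inner \<Omega> w v"
    unfolding H1_inner_def using v w by (intro arg_cong2[of _ _ _ _ "(+)"] sum.cong L2.B_sym grad_L2 H1_L2) auto
  show "H1_inner \<Omega> (\<lambda>y. r * v y) w = r * H1_inner \<Omega> v w" for r
  proof -
    have "L2_inner \<Omega> (\<lambda>y. inner (grad \<Omega> (\<lambda>y. r * v y) y) b) (\<lambda>y. inner (grad \<Omega> w y) b) =
          r * L2_inner \<Omega> (\<lambda>y. inner (grad \<Omega> v y) b) (\<lambda>y. inner (grad \<Omega> w y) b)" if b: "b \<in> Basis" for b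
    proof -
      have "L2_inner \<Omega> (\<lambda>y. inner (grad \<Omega> (\<lambda>y. r * v y) y) b) (\<lambda>y. inner (grad \<Omega> w y) b) =
            L2_inner \<Omega> (\<lambda>y. r * inner (grad \<Omega> v y) b) (\<lambda>y. inner (grad \<Omega> w y) b)"
        using grad_scale[OF v, of r]
        by (intro L2_inner_cong_AE grad_L2 H1_scale v w b L2.scale_in) (auto elim!: eventually_mono)
      then show ?thesis by (simp add: L2.B_scale grad_L2 v w b)
    qed
    then show ?thesis
      unfolding H1_inner_def by (simp add: L2.B_scale H1_L2 v w distrib_left sum_distrib_left)
  qed
  assume v': "v' \<in> H1 \<Omega>"
  show "H1_inner \<Omega> (\<lambda>y. v y + v' y) w = H1_inner \<Omega> v w + H1_inner \<Omega> v' w"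
  proof -
    have "L2_inner \<Omega> (\<lambda>y. inner (grad \<Omega> (\<lambda>y. v y + v' y) y) b) (\<lambda>y. inner (grad \<Omega> w y) b) =
          L2_inner \<Omega> (\<lambda>y. inner (grad \<Omega> v y) b) (\<lambda>y. inner (grad \<Omega> w y) b) +
          L2_inner \<Omega> (\<lambda>y. inner (grad \<Omega> v' y) b) (\<lambda>y. inner (grad \<Omega> w y) b)" if b: "b \<in> Basis" for b
    proof -
      have "L2_inner \<Omega> (\<lambda>y. inner (grad \<Omega> (\<lambda>y. v y + v' y) y) b) (\<lambda>y. inner (grad \<Omega> w y) b) =
            L2_inner \<Omega> (\<lambda>y. inner (grad \<Omega> v y) b + inner (grad \<Omega> v' y) b) (\<lambda>y. inner (grad \<Omega> w y) b)"
        using grad_add[OF v v']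
        by (intro L2_inner_cong_AE grad_L2 H1_add v v' w b L2.add_in) (auto elim!: eventually_mono simp: inner_add_left)
      then show ?thesis by (simp add: L2.B_add grad_L2 v v' w b)
    qed
    then show ?thesis
      unfolding H1_inner_def by (simp add: L2.B_add H1_L2 v v' w sum.distrib)
  qed
qed

lemma H1_seminorm_space: "seminorm_space (H1 \<Omega>) (H1_norm \<Omega>)"
  using semi_inner_space.seminorm_space_sqrt[OF H1_semi_inner_space] unfolding H1_norm_eq[abs_def] .

lemma L2_norm_le_H1_norm:
  assumes "v \<in> H1 \<Omega>"
  shows "L2_norm \<Omega> v \<le> H1_norm \<Omega> v"
proof -
  have "0 \<le> L2_norm \<Omega> v" using assms H1_L2 L2.nrm_nonneg by blast
  then show ?thesis unfolding H1_norm_def by (intro real_le_rsqrt) (auto intro: sum_nonneg)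
qed

lemma H10_H1: "v \<in> H10 \<Omega> \<Longrightarrow> v \<in> H1 \<Omega>"
  by (simp add: H10_def)

lemma H10_seminorm_space: "seminorm_space (H10 \<Omega>) (H1_norm \<Omega>)"
proof -
  interpret H1: seminorm_space "H1 \<Omega>" "H1_norm \<Omega>" by (rule H1_seminorm_space)
  have tf: "\<phi> \<in> H1 \<Omega>" if "test_function \<Omega> \<phi>" for \<phi> using test_function_H1[OF \<Omega>_lebesgue that] .
  have t0: "test_function \<Omega> (\<lambda>y. 0)"
    by (auto simp: test_function_def compact_support_in_def smooth_def intro!: exI[of _ "\<lambda>bs x. 0"])
  show ?thesis
  proof (unfold_locales)
    show "(\<lambda>y. 0) \<in> H10 \<Omega>" unfolding H10_def using t0 H1.zero_in by (auto intro!: exI[of _ "\<lambda>y. 0"])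
    fix v assume v: "v \<in> H10 \<Omega>"
    show "H1_norm \<Omega> (\<lambda>y. r * v y) = \<bar>r\<bar> * H1_norm \<Omega> v" for r using v H10_H1 H1.nrm_scale by blast
    show "(\<lambda>y. r * v y) \<in> H10 \<Omega>" for r
      unfolding H10_def
    proof (intro CollectI conjI allI impI)
      show "(\<lambda>y. r * v y) \<in> H1 \<Omega>" using v H10_H1 H1_scale by blast
      fix e :: real assume "0 < e"
      \<comment> \<open>The added 1 keeps the tolerance meaningful for \<open>r = 0\<close>.\<close>
      then have "0 < e / (\<bar>r\<bar> + 1)" by simp
      then obtain \<phi> where \<phi>: "test_function \<Omega> \<phi>" "H1_norm \<Omega> (\<lambda>y. v y - \<phi> y) < e / (\<bar>r\<bar> + 1)" using v unfolding H10_def by blast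
      have d: "(\<lambda>y. v y - \<phi> y) \<in> H1 \<Omega>" using v tf[OF \<phi>(1)] by (blast intro: H1.diff_in H10_H1)
      have "H1_norm \<Omega> (\<lambda>y. r * v y - r * \<phi> y) = \<bar>r\<bar> * H1_norm \<Omega> (\<lambda>y. v y - \<phi> y)"
        using H1.nrm_scale[OF d, of r] by (simp add: right_diff_distrib)
      also have "\<dots> \<le> (\<bar>r\<bar> + 1) * H1_norm \<Omega> (\<lambda>y. v y - \<phi> y)" using H1.nrm_nonneg[OF d] by (intro mult_right_mono) auto
      also have "\<dots> < e" using \<phi>(2) by (simp add: pos_less_divide_eq mult.commute)
      finally show "\<exists>\<phi>. test_function \<Omega> \<phi> \<and> H1_norm \<Omega> (\<lambda>y. r * v y - \<phi> y) < e"
        using test_function_scale[OF \<phi>(1), of r] by blast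
    qed
    fix w assume w: "w \<in> H10 \<Omega>"
    show "H1_norm \<Omega> (\<lambda>y. v y + w y) \<le> H1_norm \<Omega> v + H1_norm \<Omega> w" using v w H10_H1 H1.nrm_add by blast
    show "(\<lambda>y. v y + w y) \<in> H10 \<Omega>"
      unfolding H10_def
    proof (intro CollectI conjI allI impI)
      show "(\<lambda>y. v y + w y) \<in> H1 \<Omega>" using v w H10_H1 H1_add by blast
      fix e :: real assume "0 < e"
      then have "0 < e / 2" by simp
      then obtain \<phi> \<theta> where \<phi>: "test_function \<Omega> \<phi>" "H1_norm \<Omega> (\<lambda>y. v y - \<phi> y) < e / 2"
        and \<theta>: "test_function \<Omega> \<theta>" "H1_norm \<Omega> (\<lambda>y. w y - \<theta> y) < e / 2" using v w unfolding H10_def by blast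
      have d: "(\<lambda>y. v y - \<phi> y) \<in> H1 \<Omega>" "(\<lambda>y. w y - \<theta> y) \<in> H1 \<Omega>"
        using v w tf[OF \<phi>(1)] tf[OF \<theta>(1)] by (blast intro: H1.diff_in H10_H1)+
      have "H1_norm \<Omega> (\<lambda>y. v y + w y - (\<phi> y + \<theta> y)) < e"
        using H1.nrm_add[OF d] \<phi>(2) \<theta>(2) by (simp add: algebra_simps)
      then show "\<exists>\<phi>. test_function \<Omega> \<phi> \<and> H1_norm \<Omega> (\<lambda>y. v y + w y - \<phi> y) < e"
        using test_function_add[OF \<phi>(1) \<theta>(1)] by blast
    qed
  qed
qed

end

section \<open>The elliptic form\<close>

context
  fixes \<Omega> :: "(real^'n) set" and A d b c
  assumes op: "open \<Omega>" and coeffs: "elliptic_coefficients \<Omega> A d b c"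
begin

text \<open>In components every term is a bounded coefficient times a product of two
  \<open>L2\<close> functions. Integrability is what makes the form additive, since a divergent
  integral would silently be 0.\<close>

lemma elliptic_integrand_integrable:
  assumes v: "v \<in> H1 \<Omega>" and w: "w \<in> H1 \<Omega>"
  shows "integrable (lebesgue_on \<Omega>) (\<lambda>y. inner (A y *v grad \<Omega> v y + v y *\<^sub>R d y) (grad \<Omega> w y)
           + (inner (b y) (grad \<Omega> v y) + c y * v y) * w y)"
proof -
  obtain K where K: "AE y in lebesgue_on \<Omega>. norm (A y) \<le> K \<and> norm (d y) \<le> K \<and> norm (b y) \<le> K \<and> \<bar>c y\<bar> \<le> K"
    using coeffs unfolding elliptic_coefficients_def by blast
  have m: "A \<in> borel_measurable (lebesgue_on \<Omega>)" "d \<in> borel_measurable (lebesgue_on \<Omega>)"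
     "b \<in> borel_measurable (lebesgue_on \<Omega>)" "c \<in> borel_measurable (lebesgue_on \<Omega>)"
    using coeffs unfolding elliptic_coefficients_def by blast+
  have nthR: "(\<lambda>x. vec_nth x i) \<in> borel_measurable (borel :: (real^'n) measure)" for i
    by (intro borel_measurable_continuous_onI continuous_intros)
  have nthM: "(\<lambda>x. vec_nth x i) \<in> borel_measurable (borel :: (real^'n^'n) measure)" for i
    by (intro borel_measurable_continuous_onI continuous_intros)
  have m': "(\<lambda>y. vec_nth (vec_nth (A y) i) j) \<in> borel_measurable (lebesgue_on \<Omega>)"
     "(\<lambda>y. vec_nth (d y) i) \<in> borel_measurable (lebesgue_on \<Omega>)"
     "(\<lambda>y. vec_nth (b y) i) \<in> borel_measurable (lebesgue_on \<Omega>)" for i j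
    using measurable_compose[OF measurable_compose[OF m(1) nthM] nthR] measurable_compose[OF m(2) nthR] measurable_compose[OF m(3) nthR]
    by auto
  have cb: "\<bar>vec_nth x i\<bar> \<le> K" if "norm x \<le> K" for x :: "real^'n" and i
    using component_le_norm_cart[of x i] that by simp
  have cbM: "\<bar>vec_nth (vec_nth B i) j\<bar> \<le> K" if "norm B \<le> K" for B :: "real^'n^'n" and i j
    using component_le_norm_cart[of "vec_nth B i" j] Finite_Cartesian_Product.norm_nth_le[of B i] that by simp
  have bd: "AE y in lebesgue_on \<Omega>. \<bar>vec_nth (vec_nth (A y) i) j\<bar> \<le> K"
    "AE y in lebesgue_on \<Omega>. \<bar>vec_nth (d y) i\<bar> \<le> K" "AE y in lebesgue_on \<Omega>. \<bar>vec_nth (b y) i\<bar> \<le> K"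
    "AE y in lebesgue_on \<Omega>. \<bar>c y\<bar> \<le> K" for i j
    by (rule eventually_mono[OF K]; blast intro: cb cbM)+
  have g: "(\<lambda>y. vec_nth (grad \<Omega> u y) i) \<in> L2 \<Omega>" if "u \<in> H1 \<Omega>" for u i
  proof -
    have "(axis i 1 :: real^'n) \<in> Basis" by (auto simp: Basis_vec_def)
    from grad_L2[OF that this] show ?thesis by (simp add: inner_axis)
  qed
  have "(\<lambda>y. inner (A y *v grad \<Omega> v y + v y *\<^sub>R d y) (grad \<Omega> w y) + (inner (b y) (grad \<Omega> v y) + c y * v y) * w y) =
    (\<lambda>y. (\<Sum>i\<in>UNIV. \<Sum>j\<in>UNIV. (vec_nth (vec_nth (A y) i) j * vec_nth (grad \<Omega> v y) j) * vec_nth (grad \<Omega> w y) i)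
       + (\<Sum>i\<in>UNIV. (vec_nth (d y) i * v y) * vec_nth (grad \<Omega> w y) i)
       + (\<Sum>i\<in>UNIV. (vec_nth (b y) i * vec_nth (grad \<Omega> v y) i) * w y) + (c y * v y) * w y)"
    by (simp add: fun_eq_iff inner_vec_def matrix_vector_mult_def sum_distrib_right sum_distrib_left distrib_right distrib_left sum.distrib mult_ac)
  moreover have "integrable (lebesgue_on \<Omega>) \<dots>"
    by (intro Bochner_Integration.integrable_add Bochner_Integration.integrable_sum L2_integrable_mult L2_bounded_mult[of _ _ _ K] g v w m m' bd H1_L2)
  ultimately show ?thesis by simp
qed

lemma elliptic_form_add:
  assumes v: "v \<in> H1 \<Omega>" and v': "v' \<in> H1 \<Omega>" and w: "w \<in> H1 \<Omega>"
  shows "elliptic_form \<Omega> A d b c (\<lambda>y. v y + v' y) w = elliptic_form \<Omega> A d b c v w + elliptic_form \<Omega> A d b c v' w"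
  unfolding elliptic_form_def Bochner_Integration.integral_add[OF elliptic_integrand_integrable[OF v w] elliptic_integrand_integrable[OF v' w], symmetric]
proof (rule integral_cong_AE)
  show "AE y in lebesgue_on \<Omega>.
       inner (A y *v grad \<Omega> (\<lambda>y. v y + v' y) y + (v y + v' y) *\<^sub>R d y) (grad \<Omega> w y) +
       (inner (b y) (grad \<Omega> (\<lambda>y. v y + v' y) y) + c y * (v y + v' y)) * w y =
       inner (A y *v grad \<Omega> v y + v y *\<^sub>R d y) (grad \<Omega> w y) + (inner (b y) (grad \<Omega> v y) + c y * v y) * w y +
       (inner (A y *v grad \<Omega> v' y + v' y *\<^sub>R d y) (grad \<Omega> w y) + (inner (b y) (grad \<Omega> v' y) + c y * v' y) * w y)"
    using grad_add[OF op v v'] by eventually_elim (simp add: algebra_simps inner_add_left inner_add_right matrix_vector_right_distrib)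
qed (use elliptic_integrand_integrable[OF H1_add[OF op v v'] w] elliptic_integrand_integrable[OF v w] elliptic_integrand_integrable[OF v' w]
   in \<open>auto intro: borel_measurable_integrable\<close>)

lemma elliptic_form_scale:
  assumes v: "v \<in> H1 \<Omega>" and w: "w \<in> H1 \<Omega>"
  shows "elliptic_form \<Omega> A d b c (\<lambda>y. r * v y) w = r * elliptic_form \<Omega> A d b c v w"
  unfolding elliptic_form_def integral_mult_right_zero[symmetric]
proof (rule integral_cong_AE)
  show "AE y in lebesgue_on \<Omega>.
       inner (A y *v grad \<Omega> (\<lambda>y. r * v y) y + (r * v y) *\<^sub>R d y) (grad \<Omega> w y) +
       (inner (b y) (grad \<Omega> (\<lambda>y. r * v y) y) + c y * (r * v y)) * w y =
       r * (inner (A y *v grad \<Omega> v y + v y *\<^sub>R d y) (grad \<Omega> w y) + (inner (b y) (grad \<Omega> v y) + c y * v y) * w y)"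
    using grad_scale[OF op v, of r] by eventually_elim (simp add: algebra_simps inner_add_left inner_add_right matrix_vector_mult_scaleR)
qed (use elliptic_integrand_integrable[OF H1_scale[OF op v] w] elliptic_integrand_integrable[OF v w]
   in \<open>auto intro: borel_measurable_integrable\<close>)

end

section \<open>Legendre polynomials\<close>

text \<open>A formal counterpart of \<open>legendre\<close> that makes \<open>pderiv\<close>,
  degrees and leading coefficients available.\<close>

fun legendre_poly :: "nat \<Rightarrow> real poly" where
  "legendre_poly 0 = 1"
| "legendre_poly (Suc 0) = [:0, 1:]"
| "legendre_poly (Suc (Suc i)) =
     Polynomial.smult (1 / (real i + 2)) (Polynomial.smult (2 * real i + 3) (pCons 0 (legendre_poly (Suc i))) - Polynomial.smult (real i + 1) (legendre_poly i))"

lemma poly_legendre_poly: "poly (legendre_poly i) x = legendre i x"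
  by (induction i rule: legendre_poly.induct) (auto simp: field_simps)

lemma legendre_poly_recurrence:
  "(real i + 2) * poly (legendre_poly (Suc (Suc i))) x = (2 * real i + 3) * (x * poly (legendre_poly (Suc i)) x) - (real i + 1) * poly (legendre_poly i) x"
proof -
  have "real i + 2 \<noteq> 0" by linarith
  then show ?thesis by simp
qed

lemma pderiv_legendre_poly_recurrence:
  "(real i + 2) * poly (pderiv (legendre_poly (Suc (Suc i)))) x = (2 * real i + 3) * (poly (legendre_poly (Suc i)) x + x * poly (pderiv (legendre_poly (Suc i))) x)
     - (real i + 1) * poly (pderiv (legendre_poly i)) x"
proof -
  have "real i + 2 \<noteq> 0" by linarith
  then have "Polynomial.smult (real i + 2) (legendre_poly (Suc (Suc i))) =
      Polynomial.smult (2 * real i + 3) (pCons 0 (legendre_poly (Suc i))) - Polynomial.smult (real i + 1) (legendre_poly i)"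
    by simp
  from arg_cong[OF this, of "\<lambda>p. poly (pderiv p) x"] show ?thesis
    by (simp add: pderiv_smult pderiv_diff pderiv_pCons distrib_left mult.left_commute del: legendre_poly.simps(3))
qed

declare legendre.simps(3) [simp del] legendre_poly.simps(3) [simp del]

abbreviation dlegendre :: "nat \<Rightarrow> real \<Rightarrow> real" where
  "dlegendre i x \<equiv> poly (pderiv (legendre_poly i)) x"

text \<open>Both relations are carried through one induction: the differentiated three-term
  recurrence gives the first after \<open>P_n'\<close> is eliminated by the second, and the second
  then follows from both hypotheses and the recurrence itself.\<close>

lemma dlegendre_relations:
  "dlegendre (Suc n) x = x * dlegendre n x + (real n + 1) * legendre n x"
  "x * dlegendre (Suc n) x - dlegendre n x = (real n + 1) * legendre (Suc n) x"
proof (induction n)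
  case 0
  { case 1 show ?case by (simp add: pderiv_pCons) }
  { case 2 show ?case by (simp add: pderiv_pCons) }
next
  case (Suc n)
  let ?P = "\<lambda>i. legendre i x" and ?D = "\<lambda>i. dlegendre i x"
  have r: "(real n + 2) * ?P (Suc (Suc n)) = (2 * real n + 3) * (x * ?P (Suc n)) - (real n + 1) * ?P n"
    using legendre_poly_recurrence[of n x] unfolding poly_legendre_poly .
  have d: "(real n + 2) * ?D (Suc (Suc n)) = (2 * real n + 3) * (?P (Suc n) + x * ?D (Suc n)) - (real n + 1) * ?D n"
    using pderiv_legendre_poly_recurrence[of n x] unfolding poly_legendre_poly .
  have n2: "real n + 2 \<noteq> 0" by linarith
  have Dn: "?D n = x * ?D (Suc n) - (real n + 1) * ?P (Suc n)" using Suc(2) by simp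
  have "(real n + 2) * ?D (Suc (Suc n)) = (real n + 2) * (x * ?D (Suc n) + (real n + 2) * ?P (Suc n))"
    unfolding d Dn by (simp add: algebra_simps)
  then have 1: "?D (Suc (Suc n)) = x * ?D (Suc n) + (real n + 2) * ?P (Suc n)" using n2 by simp
  then show "?D (Suc (Suc n)) = x * ?D (Suc n) + (real (Suc n) + 1) * ?P (Suc n)" by simp
  have "?D (Suc n) = x * (x * ?D (Suc n) - (real n + 1) * ?P (Suc n)) + (real n + 1) * ?P n"
    using Suc(1) unfolding Dn .
  then have "x * x * ?D (Suc n) - ?D (Suc n) = (real n + 1) * (x * ?P (Suc n) - ?P n)" by (simp add: algebra_simps)
  then have "x * ?D (Suc (Suc n)) - ?D (Suc n) = (real n + 1) * (x * ?P (Suc n) - ?P n) + (real n + 2) * (x * ?P (Suc n))"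
    unfolding 1 by (simp add: algebra_simps)
  also have "\<dots> = (real n + 2) * ?P (Suc (Suc n))" unfolding r by (simp add: algebra_simps)
  finally show "x * ?D (Suc (Suc n)) - ?D (Suc n) = (real (Suc n) + 1) * ?P (Suc (Suc n))" by simp
qed

lemma DERIV_legendre: "(legendre n has_real_derivative dlegendre n x) (at x within S)"
  using poly_DERIV[of "legendre_poly n" x] unfolding poly_legendre_poly[abs_def] by (rule has_field_derivative_at_within)

lemma continuous_on_legendre [continuous_intros]:
  "continuous_on S g \<Longrightarrow> continuous_on S (\<lambda>x. legendre n (g x))"
  unfolding poly_legendre_poly[symmetric] by (intro continuous_intros)

text \<open>Legendre's differential equation in divergence form. The two derivative relations
  rewrite \<open>(1 - x^2) P_n'\<close> as \<open>n (P_(n-1) - x P_n)\<close>, which is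
  differentiated without second derivatives.\<close>

lemma DERIV_one_minus_square_dlegendre:
  "((\<lambda>x. (1 - x\<^sup>2) * dlegendre n x) has_real_derivative - (real n * (real n + 1)) * legendre n x) (at x within S)"
proof (cases n)
  case 0
  then show ?thesis by simp
next
  case (Suc m)
  have "(1 - x\<^sup>2) * dlegendre n x = real n * (legendre m x - x * legendre n x)" for x
  proof -
    have D: "dlegendre m x = x * dlegendre n x - real n * legendre n x"
      using dlegendre_relations(2)[where n=m and x=x] unfolding Suc by (simp add: algebra_simps)
    have "dlegendre n x = x * (x * dlegendre n x - real n * legendre n x) + real n * legendre m x"
      using dlegendre_relations(1)[where n=m and x=x] unfolding D unfolding Suc by (simp add: algebra_simps)
    then show ?thesis by (simp add: power2_eq_square algebra_simps)
  qed
  moreover have "((\<lambda>x. real n * (legendre m x - x * legendre n x)) has_real_derivative 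
      real n * (dlegendre m x - (legendre n x + x * dlegendre n x))) (at x within S)"
    by (auto intro!: derivative_eq_intros DERIV_legendre)
  moreover have "real n * (dlegendre m x - (legendre n x + x * dlegendre n x)) = - (real n * (real n + 1)) * legendre n x"
    using dlegendre_relations(2)[of x m] unfolding Suc by (simp add: algebra_simps)
  ultimately show ?thesis by simp
qed

lemma legendre_minus_1: "legendre n (- 1) = (- 1) ^ n"
  by (induction n rule: induct_nat_012) (auto simp: field_simps legendre.simps(3))

text \<open>The function \<open>n (n + 1) P\<^sub>n\<^sup>2 + (1 - x\<^sup>2) P\<^sub>n'\<^sup>2\<close> has the derivative \<open>2 x P\<^sub>n'\<^sup>2\<close>, so it is
  maximal at the endpoints.\<close>

lemma abs_legendre_le_1:
  assumes x: "\<bar>x\<bar> \<le> 1"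
  shows "\<bar>legendre n x\<bar> \<le> 1"
proof (cases "n = 0")
  case False
  define F where "F x = real n * (real n + 1) * (legendre n x)\<^sup>2 + (1 - x\<^sup>2) * (dlegendre n x)\<^sup>2" for x
  have F': "(F has_real_derivative 2 * x * (dlegendre n x)\<^sup>2) (at x)" for x
  proof -
    let ?dd = "poly (pderiv (pderiv (legendre_poly n))) x"
    \<comment> \<open>Comparing the product rule with the divergence form expresses the second
      derivative by the first and the function.\<close>
    have "((\<lambda>x. (1 - x\<^sup>2) * dlegendre n x) has_real_derivative (1 - x\<^sup>2) * ?dd - 2 * x * dlegendre n x) (at x)"
      by (auto intro!: derivative_eq_intros)
    from DERIV_unique[OF this DERIV_one_minus_square_dlegendre[of n x UNIV]]
    have ode: "(1 - x\<^sup>2) * ?dd = 2 * x * dlegendre n x - real n * (real n + 1) * legendre n x" by simp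
    have "(F has_real_derivative real n * (real n + 1) * (2 * legendre n x * dlegendre n x) 
      + ((1 - x\<^sup>2) * (2 * dlegendre n x * ?dd) - 2 * x * (dlegendre n x)\<^sup>2)) (at x)"
      unfolding F_def by (auto intro!: derivative_eq_intros DERIV_legendre)
    moreover have "(1 - x\<^sup>2) * (2 * dlegendre n x * ?dd) = 2 * dlegendre n x * ((1 - x\<^sup>2) * ?dd)" by simp
    ultimately show ?thesis unfolding ode by (simp add: algebra_simps power2_eq_square)
  qed
  have end_val: "F 1 = real n * (real n + 1)" "F (- 1) = real n * (real n + 1)"
    by (simp_all add: F_def legendre_at_1 legendre_minus_1 power_mult[symmetric] flip: power_mult)
  have "F x \<le> real n * (real n + 1)"
  proof (cases "0 \<le> x")
    case True
    have "F x \<le> F 1"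
      using True x F' by (intro DERIV_nonneg_imp_nondecreasing[of x 1 F]) (auto intro!: exI[of _ "2 * _ * (dlegendre n _)\<^sup>2"] mult_nonneg_nonneg)
    then show ?thesis using end_val by simp
  next
    case False
    have "F (- 1) \<ge> F x"
    proof (rule DERIV_nonpos_imp_nonincreasing[of "- 1" x F])
      show "- 1 \<le> x" using x by simp
      fix y assume "- 1 \<le> y" "y \<le> x"
      then have "2 * y * (dlegendre n y)\<^sup>2 \<le> 0" using False mult_nonpos_nonneg[of "2 * y" "(dlegendre n y)\<^sup>2"] by simp
      with F'[of y] show "\<exists>D. (F has_real_derivative D) (at y) \<and> D \<le> 0" by blast
    qed
    then show ?thesis using end_val by simp
  qed
  \<comment> \<open>The other summand of \<open>F\<close> is nonnegative on [-1,1].\<close>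
  moreover have "real n * (real n + 1) * (legendre n x)\<^sup>2 \<le> F x"
    unfolding F_def using x by (simp add: abs_square_le_1 mult_nonneg_nonneg)
  ultimately have "real n * (real n + 1) * (legendre n x)\<^sup>2 \<le> real n * (real n + 1) * 1" by simp
  moreover have "0 < real n * (real n + 1)" using False by simp
  ultimately have "(legendre n x)\<^sup>2 \<le> 1" using mult_le_cancel_left_pos by blast
  then show ?thesis by (simp add: abs_square_le_1)
qed simp

text \<open>The bound is the value of \<open>P_n'\<close> at 1. It follows by induction in steps of
  two from \<open>P_(n+2)' = P_n' + (2 n + 3) P_(n+1)\<close> and the bound 1 on the Legendre
  polynomials.\<close>

lemma abs_dlegendre_le:
  assumes "\<bar>x\<bar> \<le> 1"
  shows "\<bar>dlegendre n x\<bar> \<le> real n * (real n + 1) / 2"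
proof (induction n rule: induct_nat_012)
  case (ge2 n)
  have "dlegendre (Suc (Suc n)) x = dlegendre n x + (2 * real n + 3) * legendre (Suc n) x"
    using dlegendre_relations(1)[of "Suc n" x] dlegendre_relations(2)[of x n] by (simp add: algebra_simps)
  moreover have "\<bar>(2 * real n + 3) * legendre (Suc n) x\<bar> \<le> (2 * real n + 3) * 1"
    unfolding abs_mult using abs_legendre_le_1[OF assms] by (intro mult_mono) auto
  ultimately have "\<bar>dlegendre (Suc (Suc n)) x\<bar> \<le> real n * (real n + 1) / 2 + (2 * real n + 3)"
    using ge2(1) abs_triangle_ineq[of "dlegendre n x" "(2 * real n + 3) * legendre (Suc n) x"] by simp
  also have "\<dots> = real (Suc (Suc n)) * (real (Suc (Suc n)) + 1) / 2" by (simp add: field_simps)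
  finally show ?case .
qed (auto simp: pderiv_pCons)

lemma legendre_integrable: "legendre n integrable_on {a..b}"
  by (intro integrable_continuous_real continuous_intros)

lemma DERIV_legendre_antideriv:
  assumes "- 1 < x"
  shows "(legendre_antideriv i has_real_derivative legendre (i - 1) x) (at x)"
proof -
  have "((\<lambda>u. integral {-1..u} (legendre (i - 1))) has_real_derivative legendre (i - 1) x) (at x within {-1..x+1})"
    using assms by (intro integral_has_real_derivative continuous_intros) auto
  moreover have "at x within {-1..x+1} = at x" using assms by (intro at_within_interior) auto
  ultimately show ?thesis unfolding legendre_antideriv_def[abs_def] by simp
qed

lemma continuous_on_legendre_antideriv: "continuous_on {-1..b} (legendre_antideriv i)"
  unfolding legendre_antideriv_def[abs_def] by (intro indefinite_integral_continuous_1 legendre_integrable)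

lemma legendre_antideriv_1: "- 1 \<le> x \<Longrightarrow> legendre_antideriv 1 x = x + 1"
proof -
  have "legendre 0 = (\<lambda>x. 1)" by (rule ext) simp
  then show "- 1 \<le> x \<Longrightarrow> legendre_antideriv 1 x = x + 1" by (simp add: legendre_antideriv_def)
qed

lemma legendre_antideriv_minus_1: "legendre_antideriv i (- 1) = 0"
  by (simp add: legendre_antideriv_def)

lemma legendre_antideriv_eqI:
  assumes "- 1 \<le> x" "\<And>y. (F has_real_derivative legendre (i - 1) y) (at y)"
  shows "legendre_antideriv i x = F x - F (- 1)"
  unfolding legendre_antideriv_def
  using assms by (intro integral_unique fundamental_theorem_of_calculus)
    (auto simp flip: has_real_derivative_iff_has_vector_derivative intro: has_field_derivative_at_within)

text \<open>The derivative relations give \<open>P_(i+2)' - P_i' = (2 i + 3) P_(i+1)\<close>. No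
  constant of integration appears because \<open>P_(i+2)\<close> and \<open>P_i\<close> have the
  same parity and agree at -1.\<close>

lemma legendre_antideriv_eq_diff:
  assumes "- 1 \<le> x"
  shows "legendre_antideriv (i + 2) x = (legendre (i + 2) x - legendre i x) / (2 * real i + 3)"
proof -
  have "((\<lambda>x. (legendre (i + 2) x - legendre i x) / (2 * real i + 3)) has_real_derivative legendre (i + 2 - 1) y) (at y)" for y
  proof -
    have "dlegendre (i + 2) y - dlegendre i y = (2 * real i + 3) * legendre (Suc i) y"
      using dlegendre_relations(1)[of "Suc i" y] dlegendre_relations(2)[of y i] by (simp add: algebra_simps)
    then have "(dlegendre (i + 2) y - dlegendre i y) / (2 * real i + 3) = legendre (i + 2 - 1) y" by (simp add: divide_eq_eq)
    then show ?thesis by (auto intro!: derivative_eq_intros DERIV_legendre)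
  qed
  from legendre_antideriv_eqI[OF assms this] show ?thesis by (simp add: legendre_minus_1)
qed

lemma legendre_antideriv_at_1: "legendre_antideriv (i + 2) 1 = 0"
  using legendre_antideriv_eq_diff[of 1 i] by (simp add: legendre_at_1)

text \<open>Legendre's equation gives \<open>N_(i+1) = - (1 - x^2) P_i' / (i (i + 1))\<close>, and
  the bound on \<open>P_i'\<close> cancels the denominator up to the factor 2. The factor
  \<open>1 - x^2\<close> becomes the numerator of the kernel in \<open>mu\<close>.\<close>

lemma abs_legendre_antideriv_le:
  assumes x: "\<bar>x\<bar> \<le> 1" and i: "1 \<le> i"
  shows "\<bar>legendre_antideriv (i + 1) x\<bar> \<le> (1 - x\<^sup>2) / 2"
proof -
  define c where "c = real i * (real i + 1)"
  have c: "0 < c" using i by (simp add: c_def)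
  have "((\<lambda>x. - ((1 - x\<^sup>2) * dlegendre i x) / c) has_real_derivative legendre (i + 1 - 1) y) (at y)" for y
    by (rule DERIV_cong[OF DERIV_cdivide[OF DERIV_minus[OF DERIV_one_minus_square_dlegendre[of i y UNIV]], of c]])
      (use c in \<open>simp add: c_def[symmetric]\<close>)
  from legendre_antideriv_eqI[OF _ this, of x] x have "legendre_antideriv (i + 1) x = - ((1 - x\<^sup>2) * dlegendre i x) / c" by simp
  then have "\<bar>legendre_antideriv (i + 1) x\<bar> = (1 - x\<^sup>2) * \<bar>dlegendre i x\<bar> / c"
    using c x by (simp add: abs_mult abs_square_le_1)
  also have "\<dots> \<le> (1 - x\<^sup>2) * (c / 2) / c"
    using abs_dlegendre_le[OF x, of i] c x by (intro divide_right_mono mult_left_mono) (auto simp: c_def abs_square_le_1)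
  also have "\<dots> = (1 - x\<^sup>2) / 2" using c by simp
  finally show ?thesis .
qed

text \<open>The recursion for the coefficients makes the sum telescope.\<close>

lemma residual_telescope:
  fixes p u :: "nat \<Rightarrow> real"
  assumes x: "- 1 \<le> x" and L: "2 \<le> L"
    and base: "2 < L \<Longrightarrow> p 2 / 3 = p 0 + r * u 1"
    and rec: "\<And>i. 1 \<le> i \<Longrightarrow> i \<le> L - 3 \<Longrightarrow> p (i + 2) / (2 * real i + 3) = p i / (2 * real i - 1) + r * u (i + 1)"
  shows "p 0 + x * p 1 + (\<Sum>i=2..L - 1. legendre_antideriv i x * p i) + (\<Sum>i=1..L - 1. r * legendre (i - 1) x * u i)
    = legendre (L - 2) x * (residual_factor (L - 2) * p (L - 2) + r * u (L - 1)) + legendre (L - 1) x * (p (L - 1) / (2 * real L - 3))"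
proof -
  \<comment> \<open>\<open>L - 2\<close> is replaced by a variable \<open>n\<close>: every
    truncation of the two sums has the same two-term form.\<close>
  have "n + 2 \<le> L \<Longrightarrow> p 0 + x * p 1 + (\<Sum>i=2..n + 1. legendre_antideriv i x * p i) + (\<Sum>i=1..n + 1. r * legendre (i - 1) x * u i)
    = legendre n x * (residual_factor n * p n + r * u (n + 1)) + legendre (n + 1) x * (p (n + 1) / (2 * real n + 1))" for n
  proof (induction n)
    case 0
    then show ?case by (simp add: residual_factor_def algebra_simps)
  next
    case (Suc n)
    \<comment> \<open>The coefficient recursion is chosen so that the part \<open>- P_n\<close> of
      \<open>N_(n+2)\<close> removes exactly the accumulated coefficient of
      \<open>P_n\<close>.\<close>
    have rn: "p (n + 2) / (2 * real n + 3) = residual_factor n * p n + r * u (n + 1)"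
      using base rec[of n] Suc.prems by (cases "n = 0") (auto simp: residual_factor_def numeral_2_eq_2)
    have N: "legendre_antideriv (n + 2) x * p (n + 2) = (legendre (n + 2) x - legendre n x) * (p (n + 2) / (2 * real n + 3))"
      using legendre_antideriv_eq_diff[OF x, of n] by simp
    have "p 0 + x * p 1 + (\<Sum>i=2..Suc n + 1. legendre_antideriv i x * p i) + (\<Sum>i=1..Suc n + 1. r * legendre (i - 1) x * u i) =
      (p 0 + x * p 1 + (\<Sum>i=2..n + 1. legendre_antideriv i x * p i) + (\<Sum>i=1..n + 1. r * legendre (i - 1) x * u i))
        + legendre_antideriv (n + 2) x * p (n + 2) + r * legendre (n + 1) x * u (n + 2)"
      by simp
    also have "\<dots> = legendre n x * (p (n + 2) / (2 * real n + 3)) + legendre (n + 1) x * (p (n + 1) / (2 * real n + 1))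
        + (legendre (n + 2) x - legendre n x) * (p (n + 2) / (2 * real n + 3)) + r * legendre (n + 1) x * u (n + 2)"
      using N Suc.IH Suc.prems by (simp only: rn)
    also have "\<dots> = legendre (Suc n) x * (residual_factor (Suc n) * p (Suc n) + r * u (Suc n + 1))
        + legendre (Suc n + 1) x * (p (Suc n + 1) / (2 * real (Suc n) + 1))"
      by (simp add: residual_factor_def algebra_simps diff_divide_distrib del: legendre.simps)
    finally show ?case .
  qed
  from this[of "L - 2"] L show ?thesis
    by (simp add: of_nat_diff numeral_2_eq_2 Suc_diff_Suc algebra_simps)
qed

section \<open>Bochner spaces\<close>

text \<open>Lebesgue measure is complete, so a function that equals a measurable limit off a null
  set is itself measurable; extension by 0 reduces the subset to the whole space.\<close>

lemma borel_measurable_lebesgue_on_AE_limit: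
  fixes g :: "'a::euclidean_space \<Rightarrow> real"
  assumes f: "\<And>n. f n \<in> borel_measurable (lebesgue_on S)" and S: "S \<in> sets lebesgue"
    and lim: "AE x in lebesgue_on S. (\<lambda>n::nat. f n x) \<longlonglongrightarrow> g x"
  shows "g \<in> borel_measurable (lebesgue_on S)"
proof -
  let ?l = "\<lambda>x. lim (\<lambda>n. f n x)"
  have "?l \<in> borel_measurable (lebesgue_on S)" using f by measurable
  then have "(\<lambda>x. if x \<in> S then ?l x else 0) \<in> borel_measurable lebesgue" using S by (simp add: borel_measurable_if)
  moreover have "AE x in lebesgue. (if x \<in> S then ?l x else 0) = (if x \<in> S then g x else 0)"
    using lim S by (auto simp: AE_restrict_space_iff limI elim!: eventually_mono)
  ultimately have "(\<lambda>x. if x \<in> S then g x else 0) \<in> borel_measurable lebesgue" by (rule borel_measurable_AE)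
  then show ?thesis using S by (simp add: borel_measurable_if)
qed

lemma integrable_lebesgue_on_bounded_interval:
  fixes g :: "real \<Rightarrow> real"
  assumes "g \<in> borel_measurable (lebesgue_on {a<..<b})" "AE t in lebesgue_on {a<..<b}. \<bar>g t\<bar> \<le> C"
  shows "integrable (lebesgue_on {a<..<b}) g"
proof -
  have "emeasure (lebesgue_on {a<..<b}) {a<..<b} < \<infinity>" 
    using emeasure_bounded_finite[of "{a<..<b}"] by (simp add: emeasure_restrict_space)
  then interpret finite_measure "lebesgue_on {a<..<b}" by (intro finite_measureI) simp
  show ?thesis using assms by (intro integrable_const_bound[of _ C]) auto
qed

lemma integrable_lebesgue_on_continuous:
  fixes g :: "real \<Rightarrow> real"
  assumes "continuous_on {a..b} g"
  shows "integrable (lebesgue_on {a<..<b}) g"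
proof -
  have "compact (g ` {a..b})" using assms by (intro compact_continuous_image) auto
  then obtain C where C: "\<And>t. t \<in> {a..b} \<Longrightarrow> \<bar>g t\<bar> \<le> C" using compact_imp_bounded by (fastforce simp: bounded_iff)
  show ?thesis
  proof (rule integrable_lebesgue_on_bounded_interval[of _ _ _ C])
    show "g \<in> borel_measurable (lebesgue_on {a<..<b})"
      by (intro continuous_imp_measurable_on_sets_lebesgue continuous_on_subset[OF assms]) auto
    show "AE t in lebesgue_on {a<..<b}. \<bar>g t\<bar> \<le> C" by (rule AE_I2) (auto intro: C simp: space_restrict_space)
  qed
qed

context seminorm_space
begin

text \<open>Strong measurability with its witnessing sequence exposed and phrased with
  \<open>simple_function\<close>, so that sums and images of simple functions come for free.\<close>

definition approximable :: "real \<Rightarrow> (real \<Rightarrow> 'b \<Rightarrow> real) \<Rightarrow> (nat \<Rightarrow> real \<Rightarrow> 'b \<Rightarrow> real) \<Rightarrow> bool" where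
  "approximable T v s \<longleftrightarrow> (\<forall>n. simple_function lebesgue (s n) \<and> range (s n) \<subseteq> X) \<and>
     (AE t in lebesgue_on {0<..<T}. v t \<in> X \<and> (\<lambda>n. nrm (\<lambda>y. v t y - s n t y)) \<longlonglongrightarrow> 0)"

lemma bochner_L2_iff:
  "bochner_L2 T X nrm v \<longleftrightarrow> (\<exists>s. approximable T v s) \<and> integrable (lebesgue_on {0<..<T}) (\<lambda>t. (nrm (v t))\<^sup>2)"
proof -
  have sf: "simple_function lebesgue f \<longleftrightarrow> finite (range f) \<and> (\<forall>z. f -` {z} \<in> sets lebesgue)" for f :: "real \<Rightarrow> 'b \<Rightarrow> real"
  proof -
    \<comment> \<open>Values that are not attained have the measurable preimage \<open>{}\<close>,
      so quantifying over all values or over the range makes no difference.\<close>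
    have "f -` {z} \<in> sets lebesgue \<or> z \<in> range f" for z
    proof (cases "z \<in> range f")
      case False
      then have "f -` {z} = {}" by auto
      then show ?thesis by simp
    qed simp
    then show ?thesis by (auto simp: simple_function_def)
  qed
  show ?thesis unfolding bochner_L2_def approximable_def sf AE_conj_iff by blast
qed

lemma approximable_measurable:
  assumes "approximable T v s"
  shows "(\<lambda>t. nrm (v t)) \<in> borel_measurable (lebesgue_on {0<..<T})"
proof (rule borel_measurable_lebesgue_on_AE_limit)
  have s: "simple_function lebesgue (s n)" "s n t \<in> X" for n t using assms unfolding approximable_def by auto
  show "(\<lambda>t. nrm (s n t)) \<in> borel_measurable (lebesgue_on {0<..<T})" for n
    using borel_measurable_simple_function[OF simple_function_compose[OF s(1), of nrm n]]
    by (simp add: measurable_restrict_space1 comp_def)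
  have "AE t in lebesgue_on {0<..<T}. v t \<in> X \<and> (\<lambda>n. nrm (\<lambda>y. v t y - s n t y)) \<longlonglongrightarrow> 0"
    using assms unfolding approximable_def by blast
  then show "AE t in lebesgue_on {0<..<T}. (\<lambda>n. nrm (s n t)) \<longlonglongrightarrow> nrm (v t)"
  proof eventually_elim
    case (elim t)
    have "(\<lambda>n. nrm (s n t) - nrm (v t)) \<longlonglongrightarrow> 0"
    proof (rule Lim_null_comparison)
      show "\<forall>\<^sub>F n in sequentially. norm (nrm (s n t) - nrm (v t)) \<le> nrm (\<lambda>y. v t y - s n t y)"
        using nrm_triangle_diff[of "s _ t" "v t"] nrm_diff_commute[of "s _ t" "v t"] s(2) elim by (intro always_eventually) auto
    qed (use elim in simp)
    then show ?case by (rule LIM_zero_cancel)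
  qed
qed simp

lemma bochner_L2_add:
  assumes "bochner_L2 T X nrm v" "bochner_L2 T X nrm w"
  shows "bochner_L2 T X nrm (\<lambda>t y. v t y + w t y)"
proof -
  obtain s where s: "approximable T v s" using assms(1) unfolding bochner_L2_iff by blast
  obtain r where r: "approximable T w r" using assms(2) unfolding bochner_L2_iff by blast
  have "range (s n) \<subseteq> X" "range (r n) \<subseteq> X" for n using s r unfolding approximable_def by blast+
  then have sX: "s n t \<in> X" "r n t \<in> X" for n t by blast+
  have vX: "AE t in lebesgue_on {0<..<T}. v t \<in> X" "AE t in lebesgue_on {0<..<T}. w t \<in> X"
    using s r unfolding approximable_def by auto
  have "approximable T (\<lambda>t y. v t y + w t y) (\<lambda>n t y. s n t y + r n t y)"
    unfolding approximable_def
  proof (intro conjI allI)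
    have "simple_function lebesgue (s n)" "simple_function lebesgue (r n)" for n using s r unfolding approximable_def by auto
    from simple_function_compose2[OF this, of "\<lambda>f g y. f y + g y"]
    show "simple_function lebesgue (\<lambda>t y. s n t y + r n t y)" for n .
    show "range (\<lambda>t y. s n t y + r n t y) \<subseteq> X" for n using sX by (auto intro: add_in)
    have "AE t in lebesgue_on {0<..<T}. (\<lambda>n. nrm (\<lambda>y. v t y - s n t y)) \<longlonglongrightarrow> 0" "AE t in lebesgue_on {0<..<T}. (\<lambda>n. nrm (\<lambda>y. w t y - r n t y)) \<longlonglongrightarrow> 0"
      using s r unfolding approximable_def by auto
    with vX show "AE t in lebesgue_on {0<..<T}. (\<lambda>y. v t y + w t y) \<in> X \<and> (\<lambda>n. nrm (\<lambda>y. v t y + w t y - (s n t y + r n t y))) \<longlonglongrightarrow> 0"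
    proof eventually_elim
      case (elim t)
      have d: "(\<lambda>y. v t y - s n t y) \<in> X" "(\<lambda>y. w t y - r n t y) \<in> X" for n using elim sX by (auto intro: diff_in)
      have eq: "(\<lambda>y. v t y + w t y - (s n t y + r n t y)) = (\<lambda>y. (v t y - s n t y) + (w t y - r n t y))" for n by auto
      have lim: "(\<lambda>n. nrm (\<lambda>y. v t y - s n t y) + nrm (\<lambda>y. w t y - r n t y)) \<longlonglongrightarrow> 0" using tendsto_add[OF elim(3,4)] by simp
      have "norm (nrm (\<lambda>y. v t y + w t y - (s n t y + r n t y))) \<le> nrm (\<lambda>y. v t y - s n t y) + nrm (\<lambda>y. w t y - r n t y)" for n
        unfolding eq using nrm_add[OF d[of n]] nrm_nonneg[OF add_in[OF d[of n]]] by simp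
      then have "(\<lambda>n. nrm (\<lambda>y. v t y + w t y - (s n t y + r n t y))) \<longlonglongrightarrow> 0"
        by (intro Lim_null_comparison[OF _ lim] always_eventually allI)
      then show ?case using elim add_in by blast
    qed
  qed
  moreover from this have m: "(\<lambda>t. nrm (\<lambda>y. v t y + w t y)) \<in> borel_measurable (lebesgue_on {0<..<T})" by (rule approximable_measurable)
  have "integrable (lebesgue_on {0<..<T}) (\<lambda>t. (nrm (\<lambda>y. v t y + w t y))\<^sup>2)"
  proof (rule Bochner_Integration.integrable_bound)
    show "integrable (lebesgue_on {0<..<T}) (\<lambda>t. 2 * (nrm (v t))\<^sup>2 + 2 * (nrm (w t))\<^sup>2)"
      using assms unfolding bochner_L2_iff by simp
    show "(\<lambda>t. (nrm (\<lambda>y. v t y + w t y))\<^sup>2) \<in> borel_measurable (lebesgue_on {0<..<T})" using m by simp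
    show "AE t in lebesgue_on {0<..<T}. norm ((nrm (\<lambda>y. v t y + w t y))\<^sup>2) \<le> norm (2 * (nrm (v t))\<^sup>2 + 2 * (nrm (w t))\<^sup>2)"
      using vX
    proof eventually_elim
      case (elim t)
      have "(nrm (\<lambda>y. v t y + w t y))\<^sup>2 \<le> (nrm (v t) + nrm (w t))\<^sup>2"
        using nrm_add[OF elim] nrm_nonneg[OF add_in[OF elim]] by (intro power_mono)
      also have "\<dots> \<le> 2 * (nrm (v t))\<^sup>2 + 2 * (nrm (w t))\<^sup>2"
        using sum_squares_bound[of "nrm (v t)" "nrm (w t)"] by (simp add: power2_sum)
      finally show ?case by simp
    qed
  qed
  ultimately show ?thesis unfolding bochner_L2_iff by blast
qed

text \<open>The values stay on the line through \<open>Y\<close>, so approximating the scalar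
  \<open>c\<close> by real simple functions is enough. The lemma serves both \<open>H10\<close> and
  its dual.\<close>

lemma bochner_L2_scalar:
  assumes Y: "Y \<in> X" and c: "c \<in> borel_measurable borel" and C: "\<And>t. \<bar>c t\<bar> \<le> C"
  shows "bochner_L2 T X nrm (\<lambda>t y. c t * Y y)"
proof -
  have cl: "c \<in> borel_measurable lebesgue" using c by (simp add: measurable_completion)
  obtain F where F: "\<forall>i. simple_function lebesgue (F i)" "\<forall>x\<in>space lebesgue. (\<lambda>i. F i x) \<longlonglongrightarrow> c x"
    using borel_measurable_implies_sequence_metric[OF cl, of 0] by blast
  have "approximable T (\<lambda>t y. c t * Y y) (\<lambda>n t y. F n t * Y y)"
    unfolding approximable_def
  proof (intro conjI allI AE_I2)
    show "simple_function lebesgue (\<lambda>t y. F n t * Y y)" for n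
      using simple_function_compose[OF F(1)[rule_format, of n], of "\<lambda>r y. r * Y y"] by (simp add: comp_def)
    show "range (\<lambda>t y. F n t * Y y) \<subseteq> X" for n using scale_in[OF Y] by auto
    fix t
    show "(\<lambda>y. c t * Y y) \<in> X" using Y by (rule scale_in)
    have "nrm (\<lambda>y. c t * Y y - F n t * Y y) = \<bar>c t - F n t\<bar> * nrm Y" for n
      using nrm_scale[OF Y, of "c t - F n t"] by (simp add: left_diff_distrib)
    moreover have "(\<lambda>n. \<bar>c t - F n t\<bar> * nrm Y) \<longlonglongrightarrow> \<bar>c t - c t\<bar> * nrm Y"
      using F(2) by (intro tendsto_intros) auto
    ultimately show "(\<lambda>n. nrm (\<lambda>y. c t * Y y - F n t * Y y)) \<longlonglongrightarrow> 0" by simp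
  qed
  moreover have "integrable (lebesgue_on {0<..<T}) (\<lambda>t. (nrm (\<lambda>y. c t * Y y))\<^sup>2)"
  proof (rule integrable_lebesgue_on_bounded_interval)
    have eq: "(nrm (\<lambda>y. c t * Y y))\<^sup>2 = (c t)\<^sup>2 * (nrm Y)\<^sup>2" for t using nrm_scale[OF Y, of "c t"] by (simp add: power_mult_distrib)
    show "(\<lambda>t. (nrm (\<lambda>y. c t * Y y))\<^sup>2) \<in> borel_measurable (lebesgue_on {0<..<T})"
      unfolding eq using measurable_restrict_space1[OF cl] by simp
    have "(c t)\<^sup>2 \<le> C\<^sup>2" for t using power_mono[OF C[of t] abs_ge_zero, of 2] by simp
    then show "AE t in lebesgue_on {0<..<T}. \<bar>(nrm (\<lambda>y. c t * Y y))\<^sup>2\<bar> \<le> C\<^sup>2 * (nrm Y)\<^sup>2"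
      unfolding eq by (auto intro!: mult_right_mono)
  qed
  ultimately show ?thesis unfolding bochner_L2_iff by blast
qed

section \<open>The dual of a seminormed space\<close>

abbreviation "dual \<equiv> dual_space X nrm"
abbreviation "dnrm \<equiv> dual_norm X nrm"

lemma dual_bdd: "w \<in> dual \<Longrightarrow> bdd_above {\<bar>w v\<bar> |v. v \<in> X \<and> nrm v \<le> 1}"
proof -
  assume "w \<in> dual"
  then obtain C where C: "\<And>v. v \<in> X \<Longrightarrow> \<bar>w v\<bar> \<le> C * nrm v" unfolding dual_space_def by blast
  have "\<bar>w v\<bar> \<le> \<bar>C\<bar>" if "v \<in> X" "nrm v \<le> 1" for v
  proof -
    have "\<bar>w v\<bar> \<le> \<bar>C\<bar> * nrm v" using C[OF that(1)] nrm_nonneg[OF that(1)] by (meson abs_ge_self mult_right_mono order_trans)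
    also have "\<dots> \<le> \<bar>C\<bar>" using that(2) by (simp add: mult_left_le)
    finally show ?thesis .
  qed
  then show ?thesis by (intro bdd_aboveI[of _ "\<bar>C\<bar>"]) auto
qed

lemma dual_norm_upper: "w \<in> dual \<Longrightarrow> v \<in> X \<Longrightarrow> nrm v \<le> 1 \<Longrightarrow> \<bar>w v\<bar> \<le> dnrm w"
  unfolding dual_norm_def using dual_bdd by (intro cSup_upper) auto

lemma dual_norm_least: "(\<And>v. v \<in> X \<Longrightarrow> nrm v \<le> 1 \<Longrightarrow> \<bar>w v\<bar> \<le> C) \<Longrightarrow> dnrm w \<le> C"
  unfolding dual_norm_def by (intro cSup_least) (auto intro!: exI[of _ "\<lambda>y. 0"])

lemma dual_bound:
  assumes w: "w \<in> dual" and v: "v \<in> X"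
  shows "\<bar>w v\<bar> \<le> dnrm w * nrm v"
proof (cases "nrm v = 0")
  case True
  \<comment> \<open>Such a \<open>v\<close> cannot be normalised, but any bound \<open>C\<close>
    makes \<open>w v\<close> vanish.\<close>
  obtain C where "\<bar>w v\<bar> \<le> C * nrm v" using w v unfolding dual_space_def by blast
  then show ?thesis using True by simp
next
  case False
  then have pos: "0 < nrm v" using nrm_nonneg[OF v] by simp
  have "\<bar>w (\<lambda>y. (1 / nrm v) * v y)\<bar> \<le> dnrm w"
    using pos nrm_scale[OF v, of "1 / nrm v"] by (intro dual_norm_upper w scale_in v) simp
  moreover have "w (\<lambda>y. (1 / nrm v) * v y) = (1 / nrm v) * w v" using w v unfolding dual_space_def by blast
  ultimately have "\<bar>w v\<bar> / nrm v \<le> dnrm w" using pos by (simp add: abs_mult)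
  then show ?thesis using pos by (simp add: pos_divide_le_eq)
qed

lemma seminorm_space_dual: "seminorm_space dual dnrm"
proof (unfold_locales)
  show "(\<lambda>v. 0) \<in> dual" by (auto simp: dual_space_def intro!: exI[of _ 0])
  fix v assume v: "v \<in> dual"
  show s: "(\<lambda>y. r * v y) \<in> dual" for r
  proof -
    obtain C where "\<And>x. x \<in> X \<Longrightarrow> \<bar>v x\<bar> \<le> C * nrm x" using v unfolding dual_space_def by blast
    then have "\<forall>x\<in>X. \<bar>r * v x\<bar> \<le> (\<bar>r\<bar> * C) * nrm x" by (simp add: abs_mult mult_left_mono mult.assoc)
    then show ?thesis using v unfolding dual_space_def by (auto simp: distrib_left mult.left_commute)
  qed
  have sc: "dnrm (\<lambda>y. r * w y) \<le> \<bar>r\<bar> * dnrm w" if "w \<in> dual" for r w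
    using dual_norm_upper[OF that] by (intro dual_norm_least) (auto simp: abs_mult intro: mult_left_mono)
  have nn: "0 \<le> dnrm w" if "w \<in> dual" for w
    using dual_norm_upper[OF that zero_in] by (simp add: order_trans[OF abs_ge_zero])
  show "dnrm (\<lambda>y. r * v y) = \<bar>r\<bar> * dnrm v" for r
  proof (cases "r = 0")
    case False
    \<comment> \<open>The reverse inequality is the same estimate applied to the rescaling by
      \<open>1 / r\<close>.\<close>
    have "dnrm (\<lambda>y. (1 / r) * (r * v y)) \<le> \<bar>1 / r\<bar> * dnrm (\<lambda>y. r * v y)" using s by (rule sc)
    then have "\<bar>r\<bar> * dnrm v \<le> dnrm (\<lambda>y. r * v y)" using False by (simp add: field_simps)
    with sc[OF v, of r] show ?thesis by simp
  qed (use sc[OF v, of 0] nn[OF s[of 0]] in simp)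
  fix w assume w: "w \<in> dual"
  show "(\<lambda>y. v y + w y) \<in> dual"
  proof -
    obtain C D where C: "\<And>x. x \<in> X \<Longrightarrow> \<bar>v x\<bar> \<le> C * nrm x" "\<And>x. x \<in> X \<Longrightarrow> \<bar>w x\<bar> \<le> D * nrm x" using v w unfolding dual_space_def by blast
    have "\<forall>x\<in>X. \<bar>v x + w x\<bar> \<le> (C + D) * nrm x"
    proof
      fix x assume "x \<in> X"
      from C(1)[OF this] C(2)[OF this] show "\<bar>v x + w x\<bar> \<le> (C + D) * nrm x"
        using abs_triangle_ineq[of "v x" "w x"] by (simp add: distrib_right)
    qed
    then show ?thesis using v w unfolding dual_space_def by (auto simp: distrib_left)
  qed
  show "dnrm (\<lambda>y. v y + w y) \<le> dnrm v + dnrm w"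
    using dual_norm_upper[OF v] dual_norm_upper[OF w]
    by (intro dual_norm_least order_trans[OF abs_triangle_ineq] add_mono) auto
qed

text \<open>Pairing with a fixed \<open>\<zeta>\<close> is continuous in the dual norm, so it
  carries the approximating simple functions to real ones. This integrability permits splitting the
  integrals that define distributional time derivatives.\<close>

lemma bochner_dual_integrable:
  assumes w: "bochner_L2 T dual dnrm w" and \<zeta>: "\<zeta> \<in> X" and \<theta>: "continuous_on UNIV \<theta>"
  shows "integrable (lebesgue_on {0<..<T}) (\<lambda>t. w t \<zeta> * \<theta> t)"
proof -
  interpret D: seminorm_space dual dnrm by (rule seminorm_space_dual)
  obtain s where s: "D.approximable T w s" using w unfolding D.bochner_L2_iff by blast
  have sD: "simple_function lebesgue (s n)" "s n t \<in> dual" for n t using s unfolding D.approximable_def by auto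
  have wD: "AE t in lebesgue_on {0<..<T}. w t \<in> dual" using s unfolding D.approximable_def by auto
  have m: "(\<lambda>t. w t \<zeta>) \<in> borel_measurable (lebesgue_on {0<..<T})"
  proof (rule borel_measurable_lebesgue_on_AE_limit)
    show "(\<lambda>t. s n t \<zeta>) \<in> borel_measurable (lebesgue_on {0<..<T})" for n
      using borel_measurable_simple_function[OF simple_function_compose[OF sD(1), of "\<lambda>l. l \<zeta>" n]]
      by (simp add: measurable_restrict_space1 comp_def)
    have "AE t in lebesgue_on {0<..<T}. w t \<in> dual \<and> (\<lambda>n. dnrm (\<lambda>y. w t y - s n t y)) \<longlonglongrightarrow> 0"
      using s unfolding D.approximable_def by blast
    then show "AE t in lebesgue_on {0<..<T}. (\<lambda>n. s n t \<zeta>) \<longlonglongrightarrow> w t \<zeta>"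
    proof eventually_elim
      case (elim t)
      have lim: "(\<lambda>n. dnrm (\<lambda>y. w t y - s n t y) * nrm \<zeta>) \<longlonglongrightarrow> 0"
        using tendsto_mult_right[of "\<lambda>n. dnrm (\<lambda>y. w t y - s n t y)" 0 sequentially "nrm \<zeta>"] elim by simp
      have "norm (s n t \<zeta> - w t \<zeta>) \<le> dnrm (\<lambda>y. w t y - s n t y) * nrm \<zeta>" for n
        using dual_bound[OF D.diff_in[of "w t" "s n t"] \<zeta>] elim sD by (simp add: abs_minus_commute)
      then have "(\<lambda>n. s n t \<zeta> - w t \<zeta>) \<longlonglongrightarrow> 0"
        by (intro Lim_null_comparison[OF _ lim] always_eventually allI)
      then show ?case by (rule LIM_zero_cancel)
    qed
  qed simp
  have \<theta>m: "\<theta> \<in> borel_measurable (lebesgue_on {0<..<T})"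
    by (intro continuous_imp_measurable_on_sets_lebesgue continuous_on_subset[OF \<theta>]) auto
  have "compact (\<theta> ` {0..T})" using \<theta> by (intro compact_continuous_image continuous_on_subset[OF \<theta>]) auto
  then obtain C where C: "\<And>t. t \<in> {0..T} \<Longrightarrow> \<bar>\<theta> t\<bar> \<le> C" using compact_imp_bounded by (fastforce simp: bounded_iff)
  show ?thesis
  proof (rule Bochner_Integration.integrable_bound)
    show "integrable (lebesgue_on {0<..<T}) (\<lambda>t. C * nrm \<zeta> * (1 + (dnrm (w t))\<^sup>2))"
      using w integrable_lebesgue_on_continuous[of 0 T "\<lambda>_. 1"] unfolding D.bochner_L2_iff by (intro integrable_mult_right Bochner_Integration.integrable_add) auto
    show "(\<lambda>t. w t \<zeta> * \<theta> t) \<in> borel_measurable (lebesgue_on {0<..<T})" using m \<theta>m by simp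
    show "AE t in lebesgue_on {0<..<T}. norm (w t \<zeta> * \<theta> t) \<le> norm (C * nrm \<zeta> * (1 + (dnrm (w t))\<^sup>2))"
      using wD AE_space
    proof eventually_elim
      case (elim t)
      have th: "\<bar>\<theta> t\<bar> \<le> C" using elim(2) by (intro C) (auto simp: space_restrict_space)
      \<comment> \<open>On a bounded interval square integrability of the dual norm yields
        integrability.\<close>
      have "dnrm (w t) \<le> 1 + (dnrm (w t))\<^sup>2"
        using sum_squares_bound[of "dnrm (w t)" 1] D.nrm_nonneg[OF elim(1)] by simp
      then have "\<bar>w t \<zeta>\<bar> \<le> (1 + (dnrm (w t))\<^sup>2) * nrm \<zeta>"
        using dual_bound[OF elim(1) \<zeta>] nrm_nonneg[OF \<zeta>] by (meson mult_right_mono order_trans)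
      with th have "\<bar>w t \<zeta>\<bar> * \<bar>\<theta> t\<bar> \<le> ((1 + (dnrm (w t))\<^sup>2) * nrm \<zeta>) * C" by (intro mult_mono) (auto intro: order_trans[OF abs_ge_zero])
      then have "norm (w t \<zeta> * \<theta> t) \<le> C * nrm \<zeta> * (1 + (dnrm (w t))\<^sup>2)" by (simp add: abs_mult mult_ac)
      also have "\<dots> \<le> norm (C * nrm \<zeta> * (1 + (dnrm (w t))\<^sup>2))" unfolding real_norm_def by (rule abs_ge_self)
      finally show ?case .
    qed
  qed
qed

end

section \<open>The space \<open>W\<^sub>2\<^sup>1(0,T;V,H)\<close>\<close>

lemma test_function_realE:
  assumes "test_function {0<..<T} (\<theta> :: real \<Rightarrow> real)"
  obtains \<theta>' where "continuous_on UNIV \<theta>'" "continuous_on UNIV \<theta>" "\<forall>x. (\<theta> has_real_derivative \<theta>' x) (at x)" "deriv \<theta> = \<theta>'" "\<theta> 0 = 0" "\<theta> T = 0"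
proof -
  obtain d where "\<forall>b. continuous_on UNIV (d b)" 
    "\<forall>x. (\<theta> has_derivative (\<lambda>h. \<Sum>b\<in>Basis. inner h b * d b x)) (at x)"
    "\<forall>b\<in>Basis. \<forall>x. frechet_derivative \<theta> (at x) b = d b x"
    "\<forall>b\<in>Basis. \<forall>x. x \<notin> closure {y. \<theta> y \<noteq> 0} \<longrightarrow> d b x = 0"
    using assms by (rule test_function_partialE)
  note d = this[rule_format]
  have D: "(\<theta> has_real_derivative d 1 x) (at x)" for x
    using d(2)[of x] by (simp add: has_field_derivative_def mult_commute_abs)
  have z: "\<theta> x = 0" if "x \<notin> {0<..<T}" for x
    using assms that closure_subset[of "{y. \<theta> y \<noteq> 0}"] unfolding test_function_def compact_support_in_def by blast
  show ?thesis
  proof (rule that)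
    show "continuous_on UNIV (d 1)" by (rule d)
    show "continuous_on UNIV \<theta>" using D DERIV_isCont by (intro continuous_at_imp_continuous_on) blast
    show "\<forall>x. (\<theta> has_real_derivative d 1 x) (at x)" using D by blast
    show "deriv \<theta> = d 1" using D by (auto intro!: DERIV_imp_deriv)
    show "\<theta> 0 = 0" "\<theta> T = 0" using z by auto
  qed
qed

lemma continuous_on_L2_inner:
  fixes v w :: "real \<Rightarrow> 'a::euclidean_space \<Rightarrow> real"
  assumes vw: "\<And>t. t \<in> S \<Longrightarrow> v t \<in> L2 \<Omega>" "\<And>t. t \<in> S \<Longrightarrow> w t \<in> L2 \<Omega>"
    and lim: "\<And>t. t \<in> S \<Longrightarrow> ((\<lambda>s. L2_norm \<Omega> (\<lambda>y. v s y - v t y)) \<longlongrightarrow> 0) (at t within S)"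
      "\<And>t. t \<in> S \<Longrightarrow> ((\<lambda>s. L2_norm \<Omega> (\<lambda>y. w s y - w t y)) \<longlongrightarrow> 0) (at t within S)"
  shows "continuous_on S (\<lambda>t. L2_inner \<Omega> (v t) (w t))"
  unfolding continuous_on_def
proof
  fix t assume t: "t \<in> S"
  \<comment> \<open>\<open>L2_inner_tendsto\<close> asks for membership at every parameter; outside
    \<open>S\<close> the functions are replaced by 0, which the limit within \<open>S\<close> does
    not see.\<close>
  define V W where "V s = (if s \<in> S then v s else (\<lambda>y. 0))" and "W s = (if s \<in> S then w s else (\<lambda>y. 0))" for s
  have e: "\<forall>\<^sub>F s in at t within S. s \<in> S" by (simp add: eventually_at_filter)
  have "((\<lambda>s. L2_inner \<Omega> (V s) (W s)) \<longlongrightarrow> L2_inner \<Omega> (v t) (w t)) (at t within S)"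
  proof (rule L2_inner_tendsto)
    show "((\<lambda>s. L2_norm \<Omega> (\<lambda>y. V s y - v t y)) \<longlongrightarrow> 0) (at t within S)"
      by (rule Lim_transform_eventually[OF lim(1)[OF t]]) (rule eventually_mono[OF e], simp add: V_def)
    show "((\<lambda>s. L2_norm \<Omega> (\<lambda>y. W s y - w t y)) \<longlongrightarrow> 0) (at t within S)"
      by (rule Lim_transform_eventually[OF lim(2)[OF t]]) (rule eventually_mono[OF e], simp add: W_def)
  qed (use vw t in \<open>simp_all add: V_def W_def\<close>)
  moreover have "\<forall>\<^sub>F s in at t within S. L2_inner \<Omega> (V s) (W s) = L2_inner \<Omega> (v s) (w s)"
    by (rule eventually_mono[OF e]) (simp add: V_def W_def)
  ultimately show "((\<lambda>s. L2_inner \<Omega> (v s) (w s)) \<longlongrightarrow> L2_inner \<Omega> (v t) (w t)) (at t within S)"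
    by (rule Lim_transform_eventually)
qed

lemma continuous_into_L2_inner:
  assumes "continuous_into_L2 \<Omega> T v" "continuous_into_L2 \<Omega> T w"
  shows "continuous_on {0..T} (\<lambda>t. L2_inner \<Omega> (v t) (w t))"
  using assms unfolding continuous_into_L2_def by (intro continuous_on_L2_inner) auto

lemma continuous_into_L2_const: "Y \<in> L2 \<Omega> \<Longrightarrow> continuous_into_L2 \<Omega> T (\<lambda>t. Y)"
  unfolding continuous_into_L2_def by simp

lemma continuous_into_L2_add:
  assumes "continuous_into_L2 \<Omega> T v" "continuous_into_L2 \<Omega> T w"
  shows "continuous_into_L2 \<Omega> T (\<lambda>t y. v t y + w t y)"
  unfolding continuous_into_L2_def
proof (intro ballI conjI)
  fix t assume t: "t \<in> {0..T}"
  have L: "v s \<in> L2 \<Omega>" "w s \<in> L2 \<Omega>" if "s \<in> {0..T}" for s using assms that unfolding continuous_into_L2_def by auto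
  show "(\<lambda>y. v t y + w t y) \<in> L2 \<Omega>" using L[OF t] by (rule L2.add_in)
  have lim: "((\<lambda>s. L2_norm \<Omega> (\<lambda>y. v s y - v t y) + L2_norm \<Omega> (\<lambda>y. w s y - w t y)) \<longlongrightarrow> 0) (at t within {0..T})"
    using assms t unfolding continuous_into_L2_def by (auto intro: tendsto_add_zero)
  show "((\<lambda>s. L2_norm \<Omega> (\<lambda>y. v s y + w s y - (v t y + w t y))) \<longlongrightarrow> 0) (at t within {0..T})"
  proof (rule Lim_null_comparison[OF _ lim])
    have "norm (L2_norm \<Omega> (\<lambda>y. v s y + w s y - (v t y + w t y))) \<le> L2_norm \<Omega> (\<lambda>y. v s y - v t y) + L2_norm \<Omega> (\<lambda>y. w s y - w t y)"
      if s: "s \<in> {0..T}" for s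
    proof -
      have d: "(\<lambda>y. v s y - v t y) \<in> L2 \<Omega>" "(\<lambda>y. w s y - w t y) \<in> L2 \<Omega>" using L[OF s] L[OF t] by (auto intro: L2.diff_in)
      have eq: "(\<lambda>y. v s y + w s y - (v t y + w t y)) = (\<lambda>y. (v s y - v t y) + (w s y - w t y))" by auto
      show ?thesis unfolding eq using L2.nrm_add[OF d] L2.nrm_nonneg[OF L2.add_in[OF d]] by simp
    qed
    then show "\<forall>\<^sub>F s in at t within {0..T}. norm (L2_norm \<Omega> (\<lambda>y. v s y + w s y - (v t y + w t y))) \<le> L2_norm \<Omega> (\<lambda>y. v s y - v t y) + L2_norm \<Omega> (\<lambda>y. w s y - w t y)"
      by (auto simp: eventually_at_filter)
  qed
qed

text \<open>The point is to split the two sides of the weak derivative identity: continuity into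
  \<open>L2\<close> makes the left integrands integrable, and \<open>bochner_dual_integrable\<close>
  the right ones.\<close>

lemma W21_add:
  assumes op: "open \<Omega>" and v: "W21 \<Omega> T v v'" and w: "W21 \<Omega> T w w'"
  shows "W21 \<Omega> T (\<lambda>t y. v t y + w t y) (\<lambda>t \<zeta>. v' t \<zeta> + w' t \<zeta>)"
proof -
  interpret V: seminorm_space "H10 \<Omega>" "H1_norm \<Omega>" using op by (rule H10_seminorm_space)
  interpret D: seminorm_space "dual_space (H10 \<Omega>) (H1_norm \<Omega>)" "dual_norm (H10 \<Omega>) (H1_norm \<Omega>)" by (rule V.seminorm_space_dual)
  have cv: "continuous_into_L2 \<Omega> T v" "continuous_into_L2 \<Omega> T w" using v w unfolding W21_def by auto
  have "(LINT t|lebesgue_on {0<..<T}. L2_inner \<Omega> (\<lambda>y. v t y + w t y) \<zeta> * deriv \<theta> t) =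
        - (LINT t|lebesgue_on {0<..<T}. (v' t \<zeta> + w' t \<zeta>) * \<theta> t)"
    if \<zeta>: "\<zeta> \<in> H10 \<Omega>" and \<theta>: "test_function {0<..<T} \<theta>" for \<zeta> \<theta>
  proof -
    obtain \<theta>' where th: "continuous_on UNIV \<theta>'" "continuous_on UNIV \<theta>" "deriv \<theta> = \<theta>'" using \<theta> by (rule test_function_realE)
    have zL: "\<zeta> \<in> L2 \<Omega>" using H1_L2[OF H10_H1[OF op \<zeta>]] .
    have i: "integrable (lebesgue_on {0<..<T}) (\<lambda>t. L2_inner \<Omega> (u t) \<zeta> * \<theta>' t)" if "continuous_into_L2 \<Omega> T u" for u
      by (intro integrable_lebesgue_on_continuous continuous_on_mult continuous_into_L2_inner[OF that continuous_into_L2_const[OF zL]] continuous_on_subset[OF th(1)]) auto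
    have "(LINT t|lebesgue_on {0<..<T}. L2_inner \<Omega> (\<lambda>y. v t y + w t y) \<zeta> * deriv \<theta> t) =
          (LINT t|lebesgue_on {0<..<T}. L2_inner \<Omega> (v t) \<zeta> * \<theta>' t + L2_inner \<Omega> (w t) \<zeta> * \<theta>' t)"
    proof (rule Bochner_Integration.integral_cong[OF refl])
      fix t assume "t \<in> space (lebesgue_on {0<..<T})"
      then have "v t \<in> L2 \<Omega>" "w t \<in> L2 \<Omega>" using cv unfolding continuous_into_L2_def by (auto simp: space_restrict_space)
      then show "L2_inner \<Omega> (\<lambda>y. v t y + w t y) \<zeta> * deriv \<theta> t = L2_inner \<Omega> (v t) \<zeta> * \<theta>' t + L2_inner \<Omega> (w t) \<zeta> * \<theta>' t"
        using zL th(3) by (simp add: L2.B_add distrib_right)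
    qed
    also have "\<dots> = (LINT t|lebesgue_on {0<..<T}. L2_inner \<Omega> (v t) \<zeta> * \<theta>' t) + (LINT t|lebesgue_on {0<..<T}. L2_inner \<Omega> (w t) \<zeta> * \<theta>' t)"
      using i[OF cv(1)] i[OF cv(2)] by (rule Bochner_Integration.integral_add)
    also have "\<dots> = - (LINT t|lebesgue_on {0<..<T}. v' t \<zeta> * \<theta> t) - (LINT t|lebesgue_on {0<..<T}. w' t \<zeta> * \<theta> t)"
      using v w \<zeta> \<theta> th(3) unfolding W21_def by auto
    also have "\<dots> = - (LINT t|lebesgue_on {0<..<T}. v' t \<zeta> * \<theta> t + w' t \<zeta> * \<theta> t)"
      using v w V.bochner_dual_integrable[OF _ \<zeta> th(2)] unfolding W21_def by (subst Bochner_Integration.integral_add) auto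
    finally show ?thesis by (simp add: distrib_right)
  qed
  then show ?thesis
    using v w V.bochner_L2_add D.bochner_L2_add continuous_into_L2_add[OF cv] unfolding W21_def by blast
qed

text \<open>The building block of the reconstruction: a fixed spatial function with a scalar
  coefficient in time. The finite set \<open>S\<close> admits kinks at mesh points, and
  \<open>c'\<close> acts in the dual through the \<open>L2\<close> pairing with
  \<open>Y\<close>.\<close>

lemma W21_elementary:
  assumes op: "open \<Omega>" and Y: "Y \<in> H10 \<Omega>" and T: "0 \<le> T"
    and c: "continuous_on UNIV c" "\<And>t. \<bar>c t\<bar> \<le> C" and S: "finite S"
    and der: "\<And>t. t \<in> {0<..<T} - S \<Longrightarrow> (c has_real_derivative c' t) (at t)"
    and c': "c' \<in> borel_measurable borel" "\<And>t. \<bar>c' t\<bar> \<le> C'"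
  shows "W21 \<Omega> T (\<lambda>t y. c t * Y y) (\<lambda>t \<zeta>. c' t * L2_inner \<Omega> Y \<zeta>)"
proof -
  interpret V: seminorm_space "H10 \<Omega>" "H1_norm \<Omega>" using op by (rule H10_seminorm_space)
  interpret D: seminorm_space "dual_space (H10 \<Omega>) (H1_norm \<Omega>)" "dual_norm (H10 \<Omega>) (H1_norm \<Omega>)" by (rule V.seminorm_space_dual)
  have HL: "v \<in> L2 \<Omega>" if "v \<in> H10 \<Omega>" for v using H1_L2[OF H10_H1[OF op that]] .
  note YL = HL[OF Y]
  have "\<bar>L2_inner \<Omega> Y v\<bar> \<le> L2_norm \<Omega> Y * H1_norm \<Omega> v" if v: "v \<in> H10 \<Omega>" for v
    using L2_Cauchy_Schwarz[OF YL HL[OF v]] L2_norm_le_H1_norm[OF op H10_H1[OF op v]] L2.nrm_nonneg[OF YL]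
    by (meson mult_left_mono order_trans)
  then have ell: "L2_inner \<Omega> Y \<in> dual_space (H10 \<Omega>) (H1_norm \<Omega>)"
    unfolding dual_space_def using HL YL by (auto simp: L2.B_add_right L2.B_scale_right)
  have cm: "c \<in> borel_measurable borel" using c(1) by (rule borel_measurable_continuous_onI)
  have ibp: "(LINT t|lebesgue_on {0<..<T}. c t * deriv \<theta> t) = - (LINT t|lebesgue_on {0<..<T}. c' t * \<theta> t)"
    if \<theta>: "test_function {0<..<T} \<theta>" for \<theta>
  proof -
    obtain \<theta>' where th: "continuous_on UNIV \<theta>'" "continuous_on UNIV \<theta>" "\<forall>x. (\<theta> has_real_derivative \<theta>' x) (at x)" "deriv \<theta> = \<theta>'" "\<theta> 0 = 0" "\<theta> T = 0"
      using \<theta> by (rule test_function_realE)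
    have i1: "integrable (lebesgue_on {0<..<T}) (\<lambda>t. c t * \<theta>' t)"
      by (intro integrable_lebesgue_on_continuous continuous_on_mult continuous_on_subset[OF th(1)] continuous_on_subset[OF c(1)]) auto
    have "compact (\<theta> ` {0..T})" using th(2) by (intro compact_continuous_image continuous_on_subset[OF th(2)]) auto
    then obtain E where E: "\<And>t. t \<in> {0..T} \<Longrightarrow> \<bar>\<theta> t\<bar> \<le> E" using compact_imp_bounded by (fastforce simp: bounded_iff)
    have i2: "integrable (lebesgue_on {0<..<T}) (\<lambda>t. c' t * \<theta> t)"
    proof (rule integrable_lebesgue_on_bounded_interval[of _ _ _ "C' * E"])
      have "\<theta> \<in> borel_measurable borel" using th(2) by (rule borel_measurable_continuous_onI)
      then have "(\<lambda>t. c' t * \<theta> t) \<in> borel_measurable borel" using c'(1) by simp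
      then show "(\<lambda>t. c' t * \<theta> t) \<in> borel_measurable (lebesgue_on {0<..<T})"
        by (intro measurable_restrict_space1) (simp add: measurable_completion)
      show "AE t in lebesgue_on {0<..<T}. \<bar>c' t * \<theta> t\<bar> \<le> C' * E"
      proof (rule AE_I2)
        fix t assume "t \<in> space (lebesgue_on {0<..<T})"
        then have "\<bar>\<theta> t\<bar> \<le> E" by (intro E) (auto simp: space_restrict_space)
        then show "\<bar>c' t * \<theta> t\<bar> \<le> C' * E"
          unfolding abs_mult using c'(2)[of t] by (intro mult_mono) (auto intro: order_trans[OF abs_ge_zero])
      qed
    qed
    \<comment> \<open>Fundamental theorem with finitely many exceptional points; the boundary terms
      drop out because \<open>\<theta>\<close> vanishes at 0 and \<open>T\<close>.\<close>
    have "((\<lambda>t. c' t * \<theta> t + c t * \<theta>' t) has_integral (c T * \<theta> T - c 0 * \<theta> 0)) {0..T}"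
    proof (rule fundamental_theorem_of_calculus_interior_strong[OF S T])
      show "continuous_on {0..T} (\<lambda>t. c t * \<theta> t)" by (intro continuous_on_mult continuous_on_subset[OF th(2)] continuous_on_subset[OF c(1)]) auto
      fix t assume t: "t \<in> {0<..<T} - S"
      have "((\<lambda>t. c t * \<theta> t) has_real_derivative c' t * \<theta> t + c t * \<theta>' t) (at t)"
        using DERIV_mult[OF der[OF t] th(3)[rule_format, of t]] by (simp add: mult.commute)
      then show "((\<lambda>t. c t * \<theta> t) has_vector_derivative c' t * \<theta> t + c t * \<theta>' t) (at t)"
        by (simp add: has_real_derivative_iff_has_vector_derivative)
    qed
    then have "((\<lambda>t. c' t * \<theta> t + c t * \<theta>' t) has_integral 0) {0<..<T}"
      using th by (simp add: has_integral_Icc_iff_Ioo)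
    moreover have "((\<lambda>t. c' t * \<theta> t + c t * \<theta>' t) has_integral (LINT t|lebesgue_on {0<..<T}. c' t * \<theta> t + c t * \<theta>' t)) {0<..<T}"
      using i1 i2 by (intro has_integral_integral_lebesgue_on) auto
    ultimately have "(LINT t|lebesgue_on {0<..<T}. c' t * \<theta> t + c t * \<theta>' t) = 0" by (rule has_integral_unique[symmetric])
    then show ?thesis using i1 i2 th(4) by simp
  qed
  have "continuous_into_L2 \<Omega> T (\<lambda>t y. c t * Y y)"
    unfolding continuous_into_L2_def
  proof (intro ballI conjI)
    fix t
    show "(\<lambda>y. c t * Y y) \<in> L2 \<Omega>" using YL by (rule L2.scale_in)
    have "(c \<longlongrightarrow> c t) (at t)" using c(1) by (simp add: continuous_on_def)
    then have ct: "(c \<longlongrightarrow> c t) (at t within {0..T})" by (rule tendsto_within_subset) simp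
    have "((\<lambda>s. \<bar>c s - c t\<bar> * L2_norm \<Omega> Y) \<longlongrightarrow> \<bar>c t - c t\<bar> * L2_norm \<Omega> Y) (at t within {0..T})"
      by (intro tendsto_intros ct)
    moreover have "L2_norm \<Omega> (\<lambda>y. c s * Y y - c t * Y y) = \<bar>c s - c t\<bar> * L2_norm \<Omega> Y" for s
      using L2.nrm_scale[OF YL, of "c s - c t"] by (simp add: left_diff_distrib)
    ultimately show "((\<lambda>s. L2_norm \<Omega> (\<lambda>y. c s * Y y - c t * Y y)) \<longlongrightarrow> 0) (at t within {0..T})" by simp
  qed
  moreover have "(LINT t|lebesgue_on {0<..<T}. L2_inner \<Omega> (\<lambda>y. c t * Y y) \<zeta> * deriv \<theta> t) =
        - (LINT t|lebesgue_on {0<..<T}. c' t * L2_inner \<Omega> Y \<zeta> * \<theta> t)"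
    if \<zeta>: "\<zeta> \<in> H10 \<Omega>" and \<theta>: "test_function {0<..<T} \<theta>" for \<zeta> \<theta>
  proof -
    have eq: "L2_inner \<Omega> (\<lambda>y. c t * Y y) \<zeta> * deriv \<theta> t = L2_inner \<Omega> Y \<zeta> * (c t * deriv \<theta> t)"
      "c' t * L2_inner \<Omega> Y \<zeta> * \<theta> t = L2_inner \<Omega> Y \<zeta> * (c' t * \<theta> t)" for t
      using L2.B_scale[OF YL HL[OF \<zeta>]] by simp_all
    show ?thesis unfolding eq integral_mult_right_zero ibp[OF \<theta>] by simp
  qed
  ultimately show ?thesis
    unfolding W21_def using V.bochner_L2_scalar[OF Y cm c(2)] D.bochner_L2_scalar[OF ell c'(1) c'(2)] by blast
qed

section \<open>Integrals over a mesh interval\<close>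

text \<open>Affine substitution, obtained by differentiating the indefinite integral of
  \<open>p\<close> along the affine map; the chain-rule factor \<open>2 / (b - a)\<close> is
  compensated in front.\<close>

lemma has_integral_reference_interval:
  fixes p :: "real \<Rightarrow> real"
  assumes "a < b" and p: "continuous_on {-1..1} p"
  shows "((\<lambda>s. p ((2 * s - a - b) / (b - a))) has_integral (b - a) / 2 * integral {-1..1} p) {a..b}"
proof -
  let ?x = "\<lambda>s. (2 * s - a - b) / (b - a)"
  let ?F = "\<lambda>s. (b - a) / 2 * integral {-1..?x s} p"
  have ends: "?x a = -1" "?x b = 1" using assms(1) by (simp_all add: field_simps)
  have rng: "?x s \<in> {-1..1}" if "s \<in> {a..b}" for s using that assms(1) by (simp add: field_simps)
  have "((\<lambda>s. p (?x s)) has_integral (?F b - ?F a)) {a..b}"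
  proof (rule fundamental_theorem_of_calculus_interior)
    show "continuous_on {a..b} ?F"
    proof (intro continuous_on_mult continuous_on_const continuous_on_compose2[where f="?x" and g="\<lambda>x. integral {-1..x} p"])
      show "continuous_on {-1..1} (\<lambda>x. integral {-1..x} p)" by (intro indefinite_integral_continuous_1 integrable_continuous_real p)
      show "continuous_on {a..b} ?x" using assms(1) by (intro continuous_intros) auto
    qed (use rng in auto)
    fix s assume s: "s \<in> {a<..<b}"
    then have x: "?x s \<in> {-1<..<1}" using assms(1) by (simp add: field_simps)
    have D': "((\<lambda>x. integral {-1..x} p) has_real_derivative p y) (at y)" if y: "y \<in> {-1<..<1}" for y
    proof -
      have "((\<lambda>x. integral {-1..x} p) has_real_derivative p y) (at y within {-1..1})"
        using y by (intro integral_has_real_derivative p) auto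
      moreover have "at y within {-1..1} = at y" using y by (intro at_within_interior) auto
      ultimately show ?thesis by simp
    qed
    note D = D'[OF x]
    have "(?x has_real_derivative 2 / (b - a)) (at s)" by (rule DERIV_cdivide) (auto intro!: derivative_eq_intros)
    from DERIV_cmult[OF DERIV_chain2[OF D this], of "(b - a) / 2"] assms(1)
    have "(?F has_real_derivative p (?x s)) (at s)" by simp
    then show "(?F has_vector_derivative p (?x s)) (at s)" by (simp add: has_real_derivative_iff_has_vector_derivative)
  qed (use assms in simp)
  then show ?thesis unfolding ends by simp
qed

lemma ref_coord_eq: "0 < step t j \<Longrightarrow> ref_coord t j s = (2 * s - t (j - 1) - t j) / (t j - t (j - 1))"
  by (simp add: ref_coord_def mesh_at_def step_def field_simps)

text \<open>The integrand is continuous and equals 1 at the right endpoint. Positivity is what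
  allows finiteness of a weighted elliptic term to be passed to the term itself.\<close>

lemma norm1_legendre_pos: "0 < norm1 (legendre i)"
proof -
  have c: "continuous_on {-1..1} (\<lambda>x. \<bar>legendre i x\<bar>)" by (intro continuous_intros)
  have "0 \<le> norm1 (legendre i)" unfolding norm1_def by (intro integral_nonneg integrable_continuous_real c) auto
  moreover have "norm1 (legendre i) \<noteq> 0"
  proof
    assume "norm1 (legendre i) = 0"
    then have "\<forall>x\<in>{-1..1}. \<bar>legendre i x\<bar> = 0"
      unfolding norm1_def using integral_eq_0_iff[OF c] by simp
    then show False using legendre_at_1[of i] by force
  qed
  ultimately show ?thesis by simp
qed

section \<open>Estimates for the Green's function\<close>

locale green_bounds =
  fixes \<Omega> :: "'a::euclidean_space set" and a and T :: real and G G' :: "'a \<Rightarrow> real \<Rightarrow> 'a \<Rightarrow> real" and \<kappa>0 \<kappa>1 \<kappa>1' \<gamma> :: real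
  assumes op: "open \<Omega>" and ne: "\<Omega> \<noteq> {}" and T: "0 < T"
    and green: "greens_function \<Omega> a T G G'" and bounds: "greens_function_bounds \<Omega> T G G' \<kappa>0 \<kappa>1 \<kappa>1' \<gamma>"
    and nonneg: "0 \<le> \<kappa>0" "0 \<le> \<kappa>1" "0 \<le> \<kappa>1'" "0 \<le> \<gamma>"
begin

lemma G_H10: "x \<in> closure \<Omega> \<Longrightarrow> 0 < t \<Longrightarrow> G x t \<in> H10 \<Omega>"
  using green unfolding greens_function_def by blast

lemma G_L2: "x \<in> closure \<Omega> \<Longrightarrow> 0 < t \<Longrightarrow> G x t \<in> L2 \<Omega>"
  using G_H10 H10_H1[OF op] H1_L2 by blast

lemma G'_L2: "x \<in> closure \<Omega> \<Longrightarrow> 0 < t \<Longrightarrow> G' x t \<in> L2 \<Omega>"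
  using green unfolding greens_function_def by blast

lemma G_quotient:
  assumes "x \<in> closure \<Omega>" "0 < t"
  shows "((\<lambda>s. L2_norm \<Omega> (\<lambda>y. (G x s y - G x t y) / (s - t) - G' x t y)) \<longlongrightarrow> 0) (at t)"
  using assms green unfolding greens_function_def by blast

lemma eventually_pos_at: "0 < t \<Longrightarrow> \<forall>\<^sub>F s in at t. 0 < s \<and> s \<noteq> (t::real)"
  using eventually_at_topological[of "\<lambda>s. 0 < s \<and> s \<noteq> t" t UNIV] by (auto intro!: exI[of _ "{0<..}"])

lemma G_quotient_L2: "x \<in> closure \<Omega> \<Longrightarrow> 0 < t \<Longrightarrow> 0 < s \<Longrightarrow> (\<lambda>y. (G x s y - G x t y) / (s - t)) \<in> L2 \<Omega>"
  using L2.scale_in[OF L2.diff_in[OF G_L2[of x s] G_L2[of x t]], of "1 / (s - t)"] by (simp add: field_simps)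

text \<open>The difference quotients of \<open>G\<close> converge in \<open>L2\<close>, and pairing
  with a fixed \<open>L2\<close> function is continuous by the Cauchy-Schwarz inequality.\<close>

lemma DERIV_L2_inner_G:
  assumes x: "x \<in> closure \<Omega>" and t: "0 < t" and w: "w \<in> L2 \<Omega>"
  shows "((\<lambda>s. L2_inner \<Omega> w (G x s)) has_real_derivative L2_inner \<Omega> w (G' x t)) (at t)"
proof -
  let ?q = "\<lambda>s y. (G x s y - G x t y) / (s - t)"
  have lim: "((\<lambda>s. L2_norm \<Omega> w * L2_norm \<Omega> (\<lambda>y. ?q s y - G' x t y)) \<longlongrightarrow> 0) (at t)"
    using tendsto_mult_left[OF G_quotient[OF x t], of "L2_norm \<Omega> w"] by simp
  have b: "norm ((L2_inner \<Omega> w (G x s) - L2_inner \<Omega> w (G x t)) / (s - t) - L2_inner \<Omega> w (G' x t)) \<le> L2_norm \<Omega> w * L2_norm \<Omega> (\<lambda>y. ?q s y - G' x t y)"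
    if s: "0 < s" for s
  proof -
    have q: "?q s \<in> L2 \<Omega>" "G' x t \<in> L2 \<Omega>" using G_quotient_L2[OF x t s] G'_L2[OF x t] .
    have gd: "G x s \<in> L2 \<Omega>" "G x t \<in> L2 \<Omega>" using G_L2 x t s by auto
    have "L2_inner \<Omega> w (\<lambda>y. ?q s y - G' x t y) = L2_inner \<Omega> w (?q s) - L2_inner \<Omega> w (G' x t)"
      using q w by (rule L2_inner_diff_right)
    moreover have "L2_inner \<Omega> w (?q s) = (L2_inner \<Omega> w (G x s) - L2_inner \<Omega> w (G x t)) / (s - t)"
    proof -
      have "L2_inner \<Omega> w (?q s) = (1 / (s - t)) * L2_inner \<Omega> w (\<lambda>y. G x s y - G x t y)"
        using L2.B_scale_right[OF L2.diff_in[OF gd] w, of "1 / (s - t)"] by simp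
      also have "L2_inner \<Omega> w (\<lambda>y. G x s y - G x t y) = L2_inner \<Omega> w (G x s) - L2_inner \<Omega> w (G x t)"
        using gd w by (rule L2_inner_diff_right)
      finally show ?thesis by simp
    qed
    ultimately show ?thesis using L2_Cauchy_Schwarz[OF w L2.diff_in[OF q]] by simp
  qed
  have "((\<lambda>s. (L2_inner \<Omega> w (G x s) - L2_inner \<Omega> w (G x t)) / (s - t) - L2_inner \<Omega> w (G' x t)) \<longlongrightarrow> 0) (at t)"
    by (rule Lim_null_comparison[OF eventually_mono[OF eventually_pos_at[OF t] b] lim]) simp
  then show ?thesis by (simp add: has_field_derivative_iff LIM_zero_iff)
qed

text \<open>The increment is \<open>s - t\<close> times a difference quotient whose norm stays
  bounded near \<open>t\<close>. Strong continuity is what pairings with a function that also varies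
  in time require.\<close>

lemma G_continuous:
  assumes x: "x \<in> closure \<Omega>" and t: "0 < t"
  shows "((\<lambda>s. L2_norm \<Omega> (\<lambda>y. G x s y - G x t y)) \<longlongrightarrow> 0) (at t)"
proof -
  let ?q = "\<lambda>s y. (G x s y - G x t y) / (s - t)"
  have "((\<lambda>s. \<bar>s - t\<bar> * (L2_norm \<Omega> (\<lambda>y. ?q s y - G' x t y) + L2_norm \<Omega> (G' x t))) \<longlongrightarrow> \<bar>t - t\<bar> * (0 + L2_norm \<Omega> (G' x t))) (at t)"
    by (intro tendsto_intros G_quotient x t)
  then have lim: "((\<lambda>s. \<bar>s - t\<bar> * (L2_norm \<Omega> (\<lambda>y. ?q s y - G' x t y) + L2_norm \<Omega> (G' x t))) \<longlongrightarrow> 0) (at t)" by simp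
  have b: "norm (L2_norm \<Omega> (\<lambda>y. G x s y - G x t y)) \<le> \<bar>s - t\<bar> * (L2_norm \<Omega> (\<lambda>y. ?q s y - G' x t y) + L2_norm \<Omega> (G' x t))"
    if s: "0 < s \<and> s \<noteq> t" for s
  proof -
    have q: "?q s \<in> L2 \<Omega>" "G' x t \<in> L2 \<Omega>" using G_quotient_L2[OF x t] G'_L2[OF x t] s by auto
    have eq: "(\<lambda>y. G x s y - G x t y) = (\<lambda>y. (s - t) * ?q s y)" using s by (auto simp: fun_eq_iff)
    have "L2_norm \<Omega> (\<lambda>y. G x s y - G x t y) = \<bar>s - t\<bar> * L2_norm \<Omega> (?q s)"
      unfolding eq using L2.nrm_scale[OF q(1), of "s - t"] s by simp
    moreover have "L2_norm \<Omega> (?q s) \<le> L2_norm \<Omega> (\<lambda>y. ?q s y - G' x t y) + L2_norm \<Omega> (G' x t)"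
      using L2.nrm_add[OF L2.diff_in[OF q] q(2)] by simp
    ultimately show ?thesis using L2.nrm_nonneg[OF q(1)] by (simp add: mult_left_mono)
  qed
  show ?thesis by (rule Lim_null_comparison[OF eventually_mono[OF eventually_pos_at[OF t] b] lim])
qed

section \<open>Pairings with the Green's function and constraints on its constants\<close>

lemma G_L1: "x \<in> closure \<Omega> \<Longrightarrow> 0 < t \<Longrightarrow> t \<le> T \<Longrightarrow> L1_norm \<Omega> (G x t) \<le> ennreal (\<kappa>0 * exp (- \<gamma> * t))"
  using bounds unfolding greens_function_bounds_def by simp

lemma G'_L1: "x \<in> closure \<Omega> \<Longrightarrow> 0 < t \<Longrightarrow> t \<le> T \<Longrightarrow> L1_norm \<Omega> (G' x t) \<le> ennreal ((\<kappa>1 / t + \<kappa>1') * exp (- \<gamma> * t))"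
  using bounds unfolding greens_function_bounds_def by simp

lemma G_pairing:
  assumes "x \<in> closure \<Omega>" "0 < t" "t \<le> T" "0 \<le> C" "Linf_norm \<Omega> w \<le> ennreal C"
  shows "\<bar>L2_inner \<Omega> w (G x t)\<bar> \<le> C * (\<kappa>0 * exp (- \<gamma> * t))"
  using assms nonneg by (intro L2_inner_Linf_L1 G_L1 L2_measurable G_L2) auto

lemma G'_pairing:
  assumes "x \<in> closure \<Omega>" "0 < t" "t \<le> T" "0 \<le> C" "Linf_norm \<Omega> w \<le> ennreal C"
  shows "\<bar>L2_inner \<Omega> w (G' x t)\<bar> \<le> C * ((\<kappa>1 / t + \<kappa>1') * exp (- \<gamma> * t))"
  using assms nonneg by (intro L2_inner_Linf_L1 G'_L1 L2_measurable G'_L2) auto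

text \<open>The Dirac initial condition is tested with continuous functions of compact support. A
  tent has value 1 at \<open>x\<close>, and its support shrinks to \<open>x\<close> as
  \<open>k\<close> grows.\<close>

definition tent :: "'a \<Rightarrow> nat \<Rightarrow> 'a \<Rightarrow> real" where
  "tent x k y = max 0 (1 - real (Suc k) * dist x y)"

lemma tent_props: "continuous_on UNIV (tent x k)" "0 \<le> tent x k y" "tent x k y \<le> 1" "tent x k x = 1"
  unfolding tent_def[abs_def] by (auto intro!: continuous_intros)

lemma tent_tendsto_0: assumes "y \<noteq> x" shows "(\<lambda>k. tent x k y) \<longlonglongrightarrow> 0"
proof -
  have "\<forall>\<^sub>F k in sequentially. tent x k y = 0"
  proof -
    obtain n where n: "1 / dist x y \<le> real n" using real_arch_simple by blast
    have "tent x k y = 0" if "n \<le> k" for k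
    proof -
      have "1 / dist x y \<le> real (Suc k)" using n that by linarith
      then have "1 \<le> real (Suc k) * dist x y" using assms by (simp add: pos_divide_le_eq)
      then show ?thesis by (simp add: tent_def)
    qed
    then show ?thesis unfolding eventually_sequentially by blast
  qed
  then show ?thesis by (rule tendsto_eventually)
qed

lemma tent_compact_support:
  assumes x: "x \<in> \<Omega>"
  shows "\<exists>n. \<forall>k\<ge>n. compact_support_in \<Omega> (tent x k)"
proof -
  obtain e where e: "0 < e" "cball x e \<subseteq> \<Omega>" using op x open_contains_cball by blast
  obtain n where n: "1 / e \<le> real n" using real_arch_simple by blast
  have "compact_support_in \<Omega> (tent x k)" if k: "n \<le> k" for k
  proof -
    have "1 / e \<le> real (Suc k)" using n k by linarith
    then have ke: "1 \<le> real (Suc k) * e" using e by (simp add: pos_divide_le_eq)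
    have "{y. tent x k y \<noteq> 0} \<subseteq> cball x e"
    proof
      fix y assume "y \<in> {y. tent x k y \<noteq> 0}"
      then have "real (Suc k) * dist x y < 1" by (auto simp: tent_def max_def split: if_splits)
      then have "real (Suc k) * dist x y < real (Suc k) * e" using ke by linarith
      then show "y \<in> cball x e" by simp
    qed
    then have "closure {y. tent x k y \<noteq> 0} \<subseteq> cball x e" by (intro closure_minimal) auto
    moreover from this have "compact (closure {y. tent x k y \<noteq> 0})"
      using compact_Int_closed[OF compact_cball closed_closure] by (metis inf.absorb_iff2)
    ultimately show ?thesis unfolding compact_support_in_def using e by blast
  qed
  then show ?thesis by blast
qed

lemma tent_delta:
  assumes x: "x \<in> \<Omega>" and "compact_support_in \<Omega> (tent x k)"
  shows "((\<lambda>t. L2_inner \<Omega> (tent x k) (G x t)) \<longlongrightarrow> 1) (at_right 0)"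
proof -
  have "x \<in> closure \<Omega>" using x closure_subset by blast
  then have "\<forall>\<phi>. continuous_on UNIV \<phi> \<and> compact_support_in \<Omega> \<phi> \<longrightarrow> ((\<lambda>t. L2_inner \<Omega> \<phi> (G x t)) \<longlongrightarrow> \<phi> x) (at_right 0)"
    using green unfolding greens_function_def by blast
  from this[rule_format, of "tent x k"] show ?thesis using assms(2) tent_props(1,4) by simp
qed

lemma tent_L2: "compact_support_in \<Omega> (tent x k) \<Longrightarrow> tent x k \<in> L2 \<Omega>"
  using closure_subset[of "{y. tent x k y \<noteq> 0}"] \<Omega>_lebesgue[OF op]
  by (intro lebesgue_on_L2_compact_support[OF tent_props(1), of "closure {y. tent x k y \<noteq> 0}"]) (auto simp: compact_support_in_def)

text \<open>The pairing of a tent with \<open>G x t\<close> tends to 1 as \<open>t\<close> tends to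
  0, while the \<open>L1\<close> bound keeps it below \<open>\<kappa>0\<close>.\<close>

lemma kappa0_ge_1: "1 \<le> \<kappa>0"
proof -
  obtain x where x: "x \<in> \<Omega>" using ne by blast
  then have xc: "x \<in> closure \<Omega>" using closure_subset by blast
  obtain k where k: "compact_support_in \<Omega> (tent x k)" using tent_compact_support[OF x] by blast
  have Linf: "Linf_norm \<Omega> (tent x k) \<le> ennreal 1"
    using tent_props[of x k] L2_measurable[OF tent_L2[OF k]] by (intro Linf_norm_leI AE_I2) auto
  have b: "L2_inner \<Omega> (tent x k) (G x t) \<le> \<kappa>0" if t: "0 < t" "t < T" for t
  proof -
    have "\<bar>L2_inner \<Omega> (tent x k) (G x t)\<bar> \<le> 1 * (\<kappa>0 * exp (- \<gamma> * t))"
      using xc t Linf by (intro G_pairing) auto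
    also have "\<dots> \<le> \<kappa>0" using nonneg t by (simp add: mult_left_le)
    finally show ?thesis by simp
  qed
  show ?thesis
  proof (rule tendsto_upperbound[OF tent_delta[OF x k]])
    show "\<forall>\<^sub>F t in at_right 0. L2_inner \<Omega> (tent x k) (G x t) \<le> \<kappa>0"
      using b T by (auto simp: eventually_at_right_field)
  qed simp
qed

text \<open>Otherwise \<open>G\<close> would be constant in time and hence equal to its initial value \<open>\<delta>\<close>.\<close>

lemma kappa1_pos: "0 < \<kappa>1 \<or> 0 < \<kappa>1'"
proof (rule ccontr)
  assume "\<not> (0 < \<kappa>1 \<or> 0 < \<kappa>1')"
  then have k0: "\<kappa>1 = 0" "\<kappa>1' = 0" using nonneg by auto
  obtain x where x: "x \<in> \<Omega>" using ne by blast
  then have xc: "x \<in> closure \<Omega>" using closure_subset by blast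
  \<comment> \<open>If both constants are 0, the time derivative of every such pairing vanishes on
    \<open>(0,T]\<close>, so its value at \<open>T\<close> is its limit at 0.\<close>
  have const: "L2_inner \<Omega> (tent x k) (G x T) = 1" if k: "compact_support_in \<Omega> (tent x k)" for k
  proof -
    have Linf: "Linf_norm \<Omega> (tent x k) \<le> ennreal 1"
      using tent_props[of x k] L2_measurable[OF tent_L2[OF k]] by (intro Linf_norm_leI AE_I2) auto
    have D: "((\<lambda>s. L2_inner \<Omega> (tent x k) (G x s)) has_real_derivative 0) (at t)" if "0 < t" "t \<le> T" for t
    proof -
      have "\<bar>L2_inner \<Omega> (tent x k) (G' x t)\<bar> \<le> 1 * ((\<kappa>1 / t + \<kappa>1') * exp (- \<gamma> * t))"
        using xc that Linf by (intro G'_pairing) auto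
      then have "L2_inner \<Omega> (tent x k) (G' x t) = 0" using k0 by simp
      then show ?thesis using DERIV_L2_inner_G[OF xc that(1) tent_L2[OF k]] by simp
    qed
    have eq: "L2_inner \<Omega> (tent x k) (G x t) = L2_inner \<Omega> (tent x k) (G x T)" if t: "0 < t" "t < T" for t
    proof -
      have "continuous_on {t..T} (\<lambda>s. L2_inner \<Omega> (tent x k) (G x s))"
        using t by (intro continuous_at_imp_continuous_on ballI DERIV_isCont[OF D]) auto
      then show ?thesis using D t by (intro DERIV_isconst_end[symmetric]) auto
    qed
    have "((\<lambda>t. L2_inner \<Omega> (tent x k) (G x T)) \<longlongrightarrow> 1) (at_right (0::real))"
      using tent_delta[OF x k] by (rule Lim_transform_eventually) (use eq T in \<open>auto simp: eventually_at_right_field\<close>)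
    from tendsto_unique[OF trivial_limit_at_right_real tendsto_const this] show ?thesis .
  qed
  obtain n where n: "\<And>k. n \<le> k \<Longrightarrow> compact_support_in \<Omega> (tent x k)" using tent_compact_support[OF x] by blast
  have gm: "G x T \<in> borel_measurable (lebesgue_on \<Omega>)" using L2_measurable[OF G_L2[OF xc T]] .
  have tm: "tent x k \<in> borel_measurable (lebesgue_on \<Omega>)" for k
    using continuous_imp_measurable_on_sets_lebesgue[OF continuous_on_subset[OF tent_props(1)] \<Omega>_lebesgue[OF op]] by simp
  have gi: "integrable (lebesgue_on \<Omega>) (G x T)" using L1_norm_finite_integrable[OF gm G_L1[OF xc T]] by simp
  \<comment> \<open>The tents tend to 0 away from the single point \<open>x\<close>, so by dominated
    convergence their pairings with the integrable \<open>G x T\<close> tend to 0 and cannot all be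
    1.\<close>
  have "(\<lambda>k. LINT y|lebesgue_on \<Omega>. tent x k y * G x T y) \<longlonglongrightarrow> (LINT y|lebesgue_on \<Omega>. 0)"
  proof (rule integral_dominated_convergence[where w="\<lambda>y. \<bar>G x T y\<bar>"])
    have "AE y in lebesgue_on \<Omega>. y \<noteq> x"
    proof -
      have "AE y in lebesgue. y \<noteq> x" using AE_not_in[of "{x}" lebesgue] negligible_sing[of x] by (simp add: negligible_iff_null_sets)
      then show ?thesis using \<Omega>_lebesgue[OF op] by (auto simp: AE_restrict_space_iff)
    qed
    then show "AE y in lebesgue_on \<Omega>. (\<lambda>k. tent x k y * G x T y) \<longlonglongrightarrow> 0"
      by eventually_elim (use tendsto_mult_right[OF tent_tendsto_0] in fastforce)
    show "AE y in lebesgue_on \<Omega>. norm (tent x k y * G x T y) \<le> \<bar>G x T y\<bar>" for k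
      using tent_props[of x k] by (intro AE_I2) (simp add: abs_mult mult_left_le_one_le)
  qed (use gm tm gi in auto)
  moreover have "\<forall>\<^sub>F k in sequentially. (LINT y|lebesgue_on \<Omega>. tent x k y * G x T y) = 1"
    unfolding eventually_sequentially using const n by (auto simp: L2_inner_def)
  ultimately have "(\<lambda>k::nat. 1::real) \<longlonglongrightarrow> (LINT y|lebesgue_on \<Omega>. 0)" by (rule Lim_transform_eventually)
  then show False by (simp add: LIMSEQ_const_iff)
qed

lemma continuous_on_L2_inner_G:
  assumes x: "x \<in> closure \<Omega>" and w: "w \<in> L2 \<Omega>"
  shows "continuous_on {..<T} (\<lambda>s. L2_inner \<Omega> w (G x (T - s)))"
proof (intro continuous_at_imp_continuous_on ballI)
  fix s assume "s \<in> {..<T}"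
  then have "isCont (\<lambda>r. L2_inner \<Omega> w (G x r)) (T - s)" using DERIV_isCont[OF DERIV_L2_inner_G[OF x _ w]] by simp
  then show "isCont (\<lambda>s. L2_inner \<Omega> w (G x (T - s))) s" by (rule isCont_o2[where f="\<lambda>s. T - s" and g="\<lambda>r. L2_inner \<Omega> w (G x r)", rotated]) simp
qed

section \<open>Integrals of pairings over one mesh interval\<close>

context
  fixes t :: "nat \<Rightarrow> real" and j :: nat
  assumes tj: "0 \<le> t (j - 1)" "t (j - 1) < t j" "t j \<le> T"
begin

abbreviation "\<tau> \<equiv> step t j"

lemma step_pos: "0 < \<tau>" using tj by (simp add: step_def)

lemma ref_coord_bounds: "s \<in> {t (j - 1)<..<t j} \<Longrightarrow> ref_coord t j s \<in> {-1<..<1}"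
  "s \<in> {t (j - 1)..t j} \<Longrightarrow> ref_coord t j s \<in> {-1..1}"
  using tj by (auto simp: ref_coord_eq[OF step_pos] field_simps)

lemma ref_coord_ends: "ref_coord t j (t (j - 1)) = -1" "ref_coord t j (t j) = 1"
  using tj by (auto simp: ref_coord_eq[OF step_pos] field_simps)

lemma DERIV_ref_coord: "(ref_coord t j has_real_derivative 2 / \<tau>) (at s within S)"
  unfolding ref_coord_def[abs_def] using step_pos by (auto intro!: derivative_eq_intros)

lemma continuous_on_ref_coord: "continuous_on S (ref_coord t j)"
  unfolding ref_coord_def[abs_def] using step_pos by (auto intro!: continuous_intros)

lemma has_integral_ref_coord:
  assumes "continuous_on {-1..1} p"
  shows "((\<lambda>s. p (ref_coord t j s)) has_integral \<tau> / 2 * integral {-1..1} p) {t (j - 1)..t j}"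
  using has_integral_reference_interval[OF tj(2) assms] by (simp add: ref_coord_eq[OF step_pos] step_def)

lemma exp_le_sigma: "s \<le> t j \<Longrightarrow> exp (- \<gamma> * (T - s)) \<le> sigma \<gamma> T t j"
  unfolding sigma_def using nonneg by (simp add: mult_left_mono)

lemma sigma_pos: "0 < sigma \<gamma> T t j"
  by (simp add: sigma_def)

text \<open>If \<open>t j = T\<close>, the factor \<open>T - s\<close> cancels except at
  \<open>s = T\<close>, where division by 0 returns 0; otherwise the denominator stays
  positive.\<close>

lemma kernel_integrable: "(\<lambda>s. (t j - s) * (s - t (j - 1)) / (T - s)) integrable_on {t (j - 1)..t j}"
proof (cases "t j = T")
  case True
  have "(\<lambda>s. s - t (j - 1)) integrable_on {t (j - 1)..t j}" by (intro integrable_continuous_real continuous_intros)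
  then show ?thesis by (rule integrable_spike_finite[of "{T}", rotated 2]) (use True in auto)
next
  case False
  then show ?thesis using tj by (intro integrable_continuous_real continuous_intros) auto
qed

context
  fixes x w C
  assumes x: "x \<in> closure \<Omega>" and w: "w \<in> L2 \<Omega>" and C: "0 \<le> C" "Linf_norm \<Omega> w \<le> ennreal C"
begin

lemma pairing_sigma:
  assumes "s \<in> {t (j - 1)..t j}" "s < T"
  shows "\<bar>L2_inner \<Omega> w (G x (T - s))\<bar> \<le> C * \<kappa>0 * sigma \<gamma> T t j"
proof -
  have "\<bar>L2_inner \<Omega> w (G x (T - s))\<bar> \<le> C * (\<kappa>0 * exp (- \<gamma> * (T - s)))"
    using assms tj by (intro G_pairing x C) auto
  also have "\<dots> \<le> C * (\<kappa>0 * sigma \<gamma> T t j)"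
    using assms C nonneg exp_le_sigma[of s] by (intro mult_left_mono) auto
  finally show ?thesis by (simp add: mult_ac)
qed

text \<open>Before \<open>T\<close> the pairing is continuous in time, and the \<open>L1\<close>
  bound keeps it bounded up to \<open>T\<close> in spite of the singularity of the Green's function
  there.\<close>

lemma weighted_pairing_integrable:
  "integrable (lebesgue_on {t (j - 1)<..<t j}) (\<lambda>s. legendre i (ref_coord t j s) * L2_inner \<Omega> w (G x (T - s)))"
proof (rule integrable_lebesgue_on_bounded_interval[of _ _ _ "1 * (C * \<kappa>0 * sigma \<gamma> T t j)"])
  have "continuous_on {t (j - 1)<..<t j} (\<lambda>s. legendre i (ref_coord t j s) * L2_inner \<Omega> w (G x (T - s)))"
    using tj by (intro continuous_on_mult continuous_on_legendre continuous_on_ref_coord continuous_on_subset[OF continuous_on_L2_inner_G[OF x w]]) auto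
  then show "(\<lambda>s. legendre i (ref_coord t j s) * L2_inner \<Omega> w (G x (T - s))) \<in> borel_measurable (lebesgue_on {t (j - 1)<..<t j})"
    by (rule continuous_imp_measurable_on_sets_lebesgue) auto
  show "AE s in lebesgue_on {t (j - 1)<..<t j}. \<bar>legendre i (ref_coord t j s) * L2_inner \<Omega> w (G x (T - s))\<bar> \<le> 1 * (C * \<kappa>0 * sigma \<gamma> T t j)"
  proof (rule AE_I2)
    fix s assume "s \<in> space (lebesgue_on {t (j - 1)<..<t j})"
    then have s: "s \<in> {t (j - 1)<..<t j}" by (simp add: space_restrict_space)
    show "\<bar>legendre i (ref_coord t j s) * L2_inner \<Omega> w (G x (T - s))\<bar> \<le> 1 * (C * \<kappa>0 * sigma \<gamma> T t j)"
      unfolding abs_mult using s tj ref_coord_bounds(1)[OF s] by (intro mult_mono abs_legendre_le_1 pairing_sigma) (auto simp: abs_le_iff)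
  qed
qed

lemma weighted_pairing_L1_bound:
  "(LINT s|lebesgue_on {t (j - 1)<..<t j}. \<bar>legendre i (ref_coord t j s) * L2_inner \<Omega> w (G x (T - s))\<bar>)
     \<le> C * sigma \<gamma> T t j * (\<kappa>0 * \<tau> / 2 * norm1 (legendre i))"
proof -
  let ?I = "{t (j - 1)<..<t j}"
  have li: "integrable (lebesgue_on ?I) (\<lambda>s. \<bar>legendre i (ref_coord t j s)\<bar>)"
    by (intro integrable_lebesgue_on_continuous continuous_intros continuous_on_ref_coord)
  have "(LINT s|lebesgue_on ?I. \<bar>legendre i (ref_coord t j s) * L2_inner \<Omega> w (G x (T - s))\<bar>)
     \<le> (LINT s|lebesgue_on ?I. (C * \<kappa>0 * sigma \<gamma> T t j) * \<bar>legendre i (ref_coord t j s)\<bar>)"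
  proof (rule integral_mono)
    show "integrable (lebesgue_on ?I) (\<lambda>s. \<bar>legendre i (ref_coord t j s) * L2_inner \<Omega> w (G x (T - s))\<bar>)"
      using weighted_pairing_integrable by (rule integrable_abs)
    fix s assume "s \<in> space (lebesgue_on ?I)"
    then have s: "s \<in> ?I" by (simp add: space_restrict_space)
    show "\<bar>legendre i (ref_coord t j s) * L2_inner \<Omega> w (G x (T - s))\<bar> \<le> (C * \<kappa>0 * sigma \<gamma> T t j) * \<bar>legendre i (ref_coord t j s)\<bar>"
      unfolding abs_mult using s tj pairing_sigma[of s] by (subst mult.commute) (intro mult_right_mono, auto)
  qed (use li in simp)
  also have "\<dots> = (C * \<kappa>0 * sigma \<gamma> T t j) * (LINT s|lebesgue_on ?I. \<bar>legendre i (ref_coord t j s)\<bar>)" by simp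
  also have "(LINT s|lebesgue_on ?I. \<bar>legendre i (ref_coord t j s)\<bar>) = \<tau> / 2 * norm1 (legendre i)"
  proof -
    have "((\<lambda>s. \<bar>legendre i (ref_coord t j s)\<bar>) has_integral (\<tau> / 2 * norm1 (legendre i))) ?I"
      using has_integral_ref_coord[of "\<lambda>x. \<bar>legendre i x\<bar>"] unfolding norm1_def
      by (simp add: has_integral_Icc_iff_Ioo continuous_intros)
    then show ?thesis using has_integral_integral_lebesgue_on[OF li] has_integral_unique by (metis lmeasurable_interval(2) fmeasurableD)
  qed
  finally show ?thesis by (simp add: mult_ac)
qed

text \<open>Integration by parts in time. For \<open>i \<ge> 1\<close> the antiderivative of
  \<open>P_i\<close> vanishes at both ends of the interval, so no boundary terms remain and only
  \<open>G'\<close> is left to be estimated.\<close>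

lemma weighted_pairing_ibp_bound:
  assumes i: "1 \<le> i"
  shows "\<bar>LINT s|lebesgue_on {t (j - 1)<..<t j}. legendre i (ref_coord t j s) * L2_inner \<Omega> w (G x (T - s))\<bar>
     \<le> C * sigma \<gamma> T t j * (\<kappa>1 / \<tau> * integral {t (j - 1)..t j} (\<lambda>s. (t j - s) * (s - t (j - 1)) / (T - s))
          + \<kappa>1' * \<tau>\<^sup>2 * (norm1 (legendre_antideriv (i + 1)) / 4))"
proof -
  let ?I = "{t (j - 1)<..<t j}" and ?J = "{t (j - 1)..t j}" and ?S = "sigma \<gamma> T t j"
  define N where "N s = legendre_antideriv (i + 1) (ref_coord t j s)" for s
  define g where "g s = L2_inner \<Omega> w (G x (T - s))" for s
  define g' where "g' s = L2_inner \<Omega> w (G' x (T - s))" for s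
  obtain k where k: "i = Suc k" using i by (cases i) auto
  have Nends: "N (t (j - 1)) = 0" "N (t j) = 0"
    unfolding N_def ref_coord_ends k using legendre_antideriv_minus_1 legendre_antideriv_at_1[of k] by simp_all
  have Nc: "continuous_on ?J N"
    unfolding N_def by (rule continuous_on_compose2[OF continuous_on_legendre_antideriv[of 1] continuous_on_ref_coord]) (use ref_coord_bounds in auto)
  have ND: "(N has_real_derivative legendre i (ref_coord t j s) * (2 / \<tau>)) (at s)" if s: "s \<in> ?I" for s
    using DERIV_chain2[OF DERIV_legendre_antideriv[of "ref_coord t j s" "i + 1"] DERIV_ref_coord] ref_coord_bounds(1)[OF s] by (simp add: N_def[abs_def])
  have gD: "(g has_real_derivative - g' s) (at s)" if s: "s < T" for s
  proof -
    have "((\<lambda>s. T - s) has_real_derivative - 1) (at s)" by (auto intro!: derivative_eq_intros)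
    from DERIV_chain2[OF DERIV_L2_inner_G[OF x _ w, of "T - s"] this] show ?thesis using s by (simp add: g_def[abs_def] g'_def)
  qed
  \<comment> \<open>In the original variable \<open>1 - \<xi>^2\<close> is
    \<open>4 (t j - s) (s - t (j - 1)) / \<tau>^2\<close>, which turns the bound on \<open>N\<close>
    into the numerator of the kernel.\<close>
  have Nb: "\<tau> / 2 * \<bar>N s\<bar> \<le> (t j - s) * (s - t (j - 1)) / \<tau>" if s: "s \<in> ?J" for s
  proof -
    have "\<bar>N s\<bar> \<le> (1 - (ref_coord t j s)\<^sup>2) / 2"
      unfolding N_def using ref_coord_bounds(2)[OF s] i by (intro abs_legendre_antideriv_le) (auto simp: abs_le_iff)
    then have "\<tau> / 2 * \<bar>N s\<bar> \<le> \<tau> / 2 * ((1 - (ref_coord t j s)\<^sup>2) / 2)" using step_pos by (intro mult_left_mono) auto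
    also have "\<dots> = (t j - s) * (s - t (j - 1)) / \<tau>"
    proof -
      have r: "ref_coord t j s * \<tau> = 2 * s - t (j - 1) - t j" using ref_coord_eq[OF step_pos, of s] step_pos by (simp add: step_def)
      have "\<tau> * (\<tau> / 2 * ((1 - (ref_coord t j s)\<^sup>2) / 2)) = (\<tau>\<^sup>2 - (ref_coord t j s * \<tau>)\<^sup>2) / 4"
        by (simp add: power2_eq_square field_simps)
      also have "\<dots> = (t j - s) * (s - t (j - 1))" unfolding r by (simp add: step_def power2_eq_square field_simps)
      finally show ?thesis using step_pos by (simp add: field_simps)
    qed
    finally show ?thesis .
  qed
  have pr: "\<bar>g s\<bar> \<le> C * \<kappa>0 * ?S" if "s \<in> ?J" "s < T" for s using pairing_sigma[OF that] by (simp add: g_def)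
  have \<Phi>c: "continuous_on ?J (\<lambda>s. \<tau> / 2 * N s * g s)"
    unfolding continuous_on_def
  proof
    fix s assume s: "s \<in> ?J"
    have Ns: "(N \<longlongrightarrow> N s) (at s within ?J)" using Nc s by (simp add: continuous_on_def)
    show "((\<lambda>s. \<tau> / 2 * N s * g s) \<longlongrightarrow> \<tau> / 2 * N s * g s) (at s within ?J)"
    proof (cases "s < T")
      case True
      then have "(g \<longlongrightarrow> g s) (at s within ?J)"
        using DERIV_isCont[OF gD[OF True]] by (simp add: isCont_def tendsto_within_subset[of _ _ _ UNIV])
      then show ?thesis by (intro tendsto_intros Ns)
    next
      case False
      \<comment> \<open>Here \<open>s = T\<close> is the singular point. The pairing need not
        converge there, but it stays bounded while \<open>N\<close> tends to 0, and the value of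
        \<open>g\<close> at \<open>s\<close> is multiplied by 0.\<close>
      then have st: "s = t j" and tT: "t j = T" using s tj by auto
      have Ns0: "(N \<longlongrightarrow> 0) (at s within ?J)" using Ns unfolding st Nends .
      have "((\<lambda>r. \<tau> / 2 * \<bar>N r\<bar> * (C * \<kappa>0 * ?S)) \<longlongrightarrow> \<tau> / 2 * \<bar>0\<bar> * (C * \<kappa>0 * ?S)) (at s within ?J)"
        by (intro tendsto_mult tendsto_const tendsto_rabs Ns0)
      then have lim: "((\<lambda>r. \<tau> / 2 * \<bar>N r\<bar> * (C * \<kappa>0 * ?S)) \<longlongrightarrow> 0) (at s within ?J)" by simp
      have "norm (\<tau> / 2 * N r * g r) \<le> \<tau> / 2 * \<bar>N r\<bar> * (C * \<kappa>0 * ?S)" if "r \<in> ?J" "r \<noteq> s" for r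
      proof -
        have "\<bar>g r\<bar> \<le> C * \<kappa>0 * ?S" using that st tT by (intro pr) auto
        then have "\<tau> / 2 * \<bar>N r\<bar> * \<bar>g r\<bar> \<le> \<tau> / 2 * \<bar>N r\<bar> * (C * \<kappa>0 * ?S)" using step_pos by (intro mult_left_mono) auto
        then show ?thesis using step_pos by (simp add: abs_mult)
      qed
      then have "((\<lambda>s. \<tau> / 2 * N s * g s) \<longlongrightarrow> 0) (at s within ?J)"
        by (intro Lim_null_comparison[OF _ lim]) (auto simp: eventually_at_filter)
      moreover have "\<tau> / 2 * N s * g s = 0" unfolding st Nends by simp
      ultimately show ?thesis by (simp only:)
    qed
  qed
  have "((\<lambda>s. legendre i (ref_coord t j s) * g s - \<tau> / 2 * N s * g' s) has_integral (\<tau> / 2 * N (t j) * g (t j) - \<tau> / 2 * N (t (j - 1)) * g (t (j - 1)))) ?J"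
  proof (rule fundamental_theorem_of_calculus_interior[OF _ \<Phi>c])
    show "t (j - 1) \<le> t j" using tj by simp
    fix s assume s: "s \<in> ?I"
    have "((\<lambda>s. \<tau> / 2 * N s * g s) has_real_derivative (\<tau> / 2 * (legendre i (ref_coord t j s) * (2 / \<tau>))) * g s + - g' s * (\<tau> / 2 * N s)) (at s)"
      using s tj by (intro DERIV_mult DERIV_cmult ND gD) auto
    then have "((\<lambda>s. \<tau> / 2 * N s * g s) has_real_derivative legendre i (ref_coord t j s) * g s - \<tau> / 2 * N s * g' s) (at s)"
      using step_pos by (simp add: mult_ac)
    then show "((\<lambda>s. \<tau> / 2 * N s * g s) has_vector_derivative legendre i (ref_coord t j s) * g s - \<tau> / 2 * N s * g' s) (at s)"
      by (simp add: has_real_derivative_iff_has_vector_derivative)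
  qed
  then have h0: "((\<lambda>s. legendre i (ref_coord t j s) * g s - \<tau> / 2 * N s * g' s) has_integral 0) ?J" using Nends by simp
  define I where "I = (LINT s|lebesgue_on ?I. legendre i (ref_coord t j s) * g s)"
  have "((\<lambda>s. legendre i (ref_coord t j s) * g s) has_integral I) ?I"
    unfolding I_def g_def by (rule has_integral_integral_lebesgue_on[OF weighted_pairing_integrable]) simp
  then have h1: "((\<lambda>s. legendre i (ref_coord t j s) * g s) has_integral I) ?J" by (simp add: has_integral_Icc_iff_Ioo)
  \<comment> \<open>Subtracting the total derivative, whose integral is 0, moves the derivative from
    the Legendre factor to the Green's function.\<close>
  from has_integral_diff[OF h1 h0] have h2: "((\<lambda>s. \<tau> / 2 * N s * g' s) has_integral I) ?J" by simp
  \<comment> \<open>The singular part of the bound on \<open>G'\<close> is paired with the pointwise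
    estimate of \<open>N\<close>, whose zero at \<open>T\<close> cancels it. The bounded part keeps
    \<open>N\<close> itself, which produces the factor
    \<open>norm1 (legendre_antideriv (i + 1))\<close>.\<close>
  let ?b = "\<lambda>s. C * ?S * (\<kappa>1 / \<tau> * ((t j - s) * (s - t (j - 1)) / (T - s)) + \<kappa>1' * (\<tau> / 2) * \<bar>N s\<bar>)"
  have "((\<lambda>s. \<bar>N s\<bar>) has_integral \<tau> / 2 * norm1 (legendre_antideriv (i + 1))) ?J"
    unfolding N_def norm1_def by (intro has_integral_ref_coord continuous_intros continuous_on_legendre_antideriv)
  then have hb: "(?b has_integral C * ?S * (\<kappa>1 / \<tau> * integral ?J (\<lambda>s. (t j - s) * (s - t (j - 1)) / (T - s)) + \<kappa>1' * (\<tau> / 2) * (\<tau> / 2 * norm1 (legendre_antideriv (i + 1))))) ?J"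
    by (intro has_integral_mult_right has_integral_add integrable_integral kernel_integrable)
  have pb: "norm (\<tau> / 2 * N s * g' s) \<le> ?b s" if s: "s \<in> ?J" for s
  proof (cases "s < T")
    case True
    have "\<bar>g' s\<bar> \<le> C * ((\<kappa>1 / (T - s) + \<kappa>1') * exp (- \<gamma> * (T - s)))"
      unfolding g'_def using True s tj by (intro G'_pairing x C) auto
    also have "\<dots> \<le> C * ((\<kappa>1 / (T - s) + \<kappa>1') * ?S)"
      using True s nonneg C exp_le_sigma[of s] by (intro mult_left_mono) auto
    finally have gb: "\<bar>g' s\<bar> \<le> C * ?S * (\<kappa>1 / (T - s) + \<kappa>1')" by (simp add: mult_ac)
    have "norm (\<tau> / 2 * N s * g' s) = (\<tau> / 2 * \<bar>N s\<bar>) * \<bar>g' s\<bar>" using step_pos by (simp add: abs_mult)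
    also have "\<dots> \<le> (\<tau> / 2 * \<bar>N s\<bar>) * (C * ?S * (\<kappa>1 / (T - s) + \<kappa>1'))" using gb step_pos by (intro mult_left_mono) auto
    also have "\<dots> = C * ?S * (\<kappa>1 / (T - s) * (\<tau> / 2 * \<bar>N s\<bar>) + \<kappa>1' * (\<tau> / 2) * \<bar>N s\<bar>)" by (simp add: algebra_simps)
    also have "\<dots> \<le> C * ?S * (\<kappa>1 / (T - s) * ((t j - s) * (s - t (j - 1)) / \<tau>) + \<kappa>1' * (\<tau> / 2) * \<bar>N s\<bar>)"
      using C sigma_pos nonneg True Nb[OF s] by (intro mult_left_mono add_right_mono) auto
    also have "\<dots> = ?b s" by simp
    finally show ?thesis .
  next
    case False
    then have "s = t j" using s tj by auto
    then show ?thesis using Nends by simp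
  qed
  have "\<bar>I\<bar> \<le> C * ?S * (\<kappa>1 / \<tau> * integral ?J (\<lambda>s. (t j - s) * (s - t (j - 1)) / (T - s)) + \<kappa>1' * (\<tau> / 2) * (\<tau> / 2 * norm1 (legendre_antideriv (i + 1))))"
    using integral_norm_bound_integral[OF has_integral_integrable[OF h2] has_integral_integrable[OF hb] pb] 
    unfolding integral_unique[OF h2] integral_unique[OF hb] by simp
  then show ?thesis unfolding I_def g_def by (simp add: power2_eq_square mult_ac)
qed

text \<open>For \<open>i \<ge> 1\<close> both the direct estimate and the one by parts are
  available, hence the minimum in \<open>mu\<close>. For \<open>i = 0\<close> the antiderivative
  does not vanish at the right end, and the direct estimate with
  \<open>norm1 (legendre 0) = 2\<close> is used.\<close>

lemma weighted_pairing_bound: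
  "\<bar>LINT s|lebesgue_on {t (j - 1)<..<t j}. legendre i (ref_coord t j s) * L2_inner \<Omega> w (G x (T - s))\<bar>
     \<le> C * sigma \<gamma> T t j * mu \<kappa>0 \<kappa>1 \<kappa>1' T t j i"
proof -
  let ?I = "LINT s|lebesgue_on {t (j - 1)<..<t j}. legendre i (ref_coord t j s) * L2_inner \<Omega> w (G x (T - s))"
  have CS: "0 \<le> C * sigma \<gamma> T t j" using C sigma_pos by simp
  have 1: "\<bar>?I\<bar> \<le> C * sigma \<gamma> T t j * (\<kappa>0 * \<tau> / 2 * norm1 (legendre i))"
    using integral_abs_bound weighted_pairing_L1_bound by (rule order_trans)
  show ?thesis
  proof (cases "i = 0")
    case True
    have "norm1 (legendre 0) = 2" by (simp add: norm1_def)
    then show ?thesis using 1 True by (simp add: mu_def)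
  next
    case False
    have "\<bar>?I\<bar> \<le> C * sigma \<gamma> T t j * (\<kappa>1 / \<tau> * integral {t (j - 1)..t j} (\<lambda>s. (t j - s) * (s - t (j - 1)) / (T - s))
          + \<kappa>1' * \<tau>\<^sup>2 * (norm1 (legendre_antideriv (i + 1)) / 4))"
      using False by (intro weighted_pairing_ibp_bound) simp
    also have "\<dots> \<le> C * sigma \<gamma> T t j * (\<kappa>1 / \<tau> * integral {t (j - 1)..t j} (\<lambda>s. (t j - s) * (s - t (j - 1)) / (T - s))
          + \<kappa>1' * \<tau>\<^sup>2 * max (1 / 24) (norm1 (legendre_antideriv (i + 1)) / 4))"
      using CS nonneg by (intro mult_left_mono add_left_mono) auto
    finally show ?thesis using 1 False by (simp add: mu_def min_def)
  qed
qed

end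

text \<open>Both entries of the minimum are positive: the direct one because
  \<open>\<kappa>0 \<ge> 1\<close>, the other because the kernel has a positive integral and
  \<open>\<kappa>1\<close>, \<open>\<kappa>1'\<close> do not both vanish.\<close>

lemma mu_pos: "0 < mu \<kappa>0 \<kappa>1 \<kappa>1' T t j i"
proof (cases "i = 0")
  case True
  then show ?thesis using kappa0_ge_1 step_pos by (simp add: mu_def)
next
  case False
  let ?J = "{t (j - 1)..t j}"
  let ?k = "\<lambda>s. (t j - s) * (s - t (j - 1)) / (T - s)"
  \<comment> \<open>Replacing \<open>T - s\<close> by the larger \<open>T\<close> gives a continuous
    minorant of the kernel; if its integral were 0, it would vanish at the midpoint of the
    interval.\<close>
  let ?q = "\<lambda>s. (t j - s) * (s - t (j - 1)) / T"
  have qc: "continuous_on ?J ?q" using T by (intro continuous_intros) auto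
  have ki: "?k integrable_on ?J" by (rule kernel_integrable)
  have q0: "0 \<le> ?q s" if "s \<in> ?J" for s using that T by (intro divide_nonneg_pos mult_nonneg_nonneg) auto
  have "integral ?J ?q \<noteq> 0"
  proof
    assume "integral ?J ?q = 0"
    then have "\<forall>s\<in>?J. ?q s = 0" using integral_eq_0_iff[OF qc _ q0] tj by simp
    moreover have "(t (j - 1) + t j) / 2 \<in> ?J" using tj by simp
    ultimately have "?q ((t (j - 1) + t j) / 2) = 0" by blast
    then show False using tj T by simp
  qed
  from order.not_eq_order_implies_strict[OF not_sym[OF this] integral_nonneg[OF integrable_continuous_real[OF qc] q0]]
  have "0 < integral ?J ?q" .
  also have "\<dots> \<le> integral ?J ?k"
  proof (rule integral_le[OF integrable_continuous_real[OF qc] ki])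
    fix s assume s: "s \<in> ?J"
    show "?q s \<le> ?k s"
    proof (cases "s < T")
      case True
      then show ?thesis using s tj by (intro divide_left_mono mult_nonneg_nonneg) auto
    next
      case False
      then have "s = t j" using s tj by auto
      then show ?thesis by simp
    qed
  qed
  finally have kpos: "0 < integral ?J ?k" .
  have "0 < \<kappa>1 / \<tau> * integral ?J ?k + \<kappa>1' * \<tau>\<^sup>2 * max (1 / 24) (norm1 (legendre_antideriv (i + 1)) / 4)"
  proof -
    have m: "0 < \<tau>\<^sup>2 * max (1 / 24) (norm1 (legendre_antideriv (i + 1)) / 4)" using step_pos by (intro mult_pos_pos) (auto simp: less_max_iff_disj)
    have "0 \<le> \<kappa>1 / \<tau> * integral ?J ?k" "0 \<le> \<kappa>1' * (\<tau>\<^sup>2 * max (1 / 24) (norm1 (legendre_antideriv (i + 1)) / 4))"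
      using kpos m step_pos nonneg by (auto intro: mult_nonneg_nonneg)
    moreover have "0 < \<kappa>1 / \<tau> * integral ?J ?k \<or> 0 < \<kappa>1' * (\<tau>\<^sup>2 * max (1 / 24) (norm1 (legendre_antideriv (i + 1)) / 4))"
      using kappa1_pos kpos m step_pos by auto
    ultimately show ?thesis by (auto simp: mult.assoc)
  qed
  then show ?thesis using kappa0_ge_1 step_pos norm1_legendre_pos[of i] False by (simp add: mu_def)
qed

end

end

section \<open>Interpolation in time\<close>

text \<open>The weights must not depend on \<open>p\<close>. Synthetic division by the new node
  leaves a quotient of lower degree whose values at the old nodes are divided differences of
  \<open>p\<close>, so the basis can be extended node by node.\<close>

lemma lagrange_basis:
  fixes s :: "nat \<Rightarrow> real"
  assumes "inj_on s {..n}"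
  shows "\<exists>l. \<forall>p. degree p \<le> n \<longrightarrow> p = (\<Sum>k\<le>n. Polynomial.smult (poly p (s k)) (l k))"
  using assms
proof (induction n)
  case 0
  have "p = Polynomial.smult (poly p (s 0)) 1" if "degree p \<le> 0" for p
  proof -
    from that have "degree p = 0" by simp
    then obtain a where "p = [:a:]" by (rule degree_eq_zeroE)
    then show ?thesis by simp
  qed
  then show ?case by (intro exI[of _ "\<lambda>_. 1"]) simp
next
  case (Suc n)
  then have "inj_on s {..n}" by (auto intro: inj_on_subset)
  then obtain l where l: "\<And>p. degree p \<le> n \<Longrightarrow> p = (\<Sum>k\<le>n. Polynomial.smult (poly p (s k)) (l k))" using Suc.IH by blast
  define c where "c = s (Suc n)"
  have sc: "s k \<noteq> c" if "k \<le> n" for k using Suc.prems that unfolding c_def inj_on_def by fastforce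
  define q where "q k = Polynomial.smult (1 / (s k - c)) ([:-c, 1:] * l k)" for k
  \<comment> \<open>Each divided difference contributes \<open>- poly p c\<close> with weight
    \<open>q k\<close>; together with the remainder of the division this leaves the weight
    \<open>1 - (\<Sum>k\<le>n. q k)\<close> for the node \<open>c\<close>.\<close>
  have "p = (\<Sum>k\<le>n. Polynomial.smult (poly p (s k)) (q k)) + Polynomial.smult (poly p c) (1 - (\<Sum>k\<le>n. q k))" if p: "degree p \<le> Suc n" for p
  proof -
    have sm: "Polynomial.smult e (\<Sum>k\<le>n. q k) = (\<Sum>k\<le>n. Polynomial.smult e (q k))" for e
      by (rule poly_eqI) (simp add: coeff_sum sum_distrib_left)
    define r where "r = synthetic_div p c"
    have pr: "p = [:-c, 1:] * r + [:poly p c:]" unfolding r_def using synthetic_div_correct'[of c p] by simp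
    have "degree r \<le> n" unfolding r_def using p by (simp add: degree_synthetic_div)
    then have r: "r = (\<Sum>k\<le>n. Polynomial.smult (poly r (s k)) (l k))" by (rule l)
    have rk: "poly r (s k) = (poly p (s k) - poly p c) / (s k - c)" if "k \<le> n" for k
      using arg_cong[OF pr, of "\<lambda>p. poly p (s k)"] sc[OF that] by (simp add: field_simps)
    have "[:-c, 1:] * r = (\<Sum>k\<le>n. Polynomial.smult (poly r (s k)) ([:-c, 1:] * l k))"
      by (subst r) (simp only: sum_distrib_left mult_smult_right)
    also have "\<dots> = (\<Sum>k\<le>n. Polynomial.smult (poly p (s k)) (q k) - Polynomial.smult (poly p c) (q k))"
      using rk by (intro sum.cong refl) (simp add: q_def diff_divide_distrib smult_diff_left)
    finally have "[:-c, 1:] * r = (\<Sum>k\<le>n. Polynomial.smult (poly p (s k)) (q k)) - Polynomial.smult (poly p c) (\<Sum>k\<le>n. q k)"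
      by (simp only: sum_subtractf sm)
    moreover have "[:poly p c:] = Polynomial.smult (poly p c) 1" by simp
    ultimately show ?thesis using pr by (simp only: smult_diff_right)
  qed
  then show ?case
    by (intro exI[of _ "\<lambda>k. if k = Suc n then 1 - (\<Sum>k\<le>n. q k) else q k"]) (auto simp: c_def)
qed

section \<open>Membership of interpolants and expansion coefficients\<close>

context fun_space
begin

text \<open>The interpolating polynomial varies with the spatial point \<open>y\<close>, but its
  value at \<open>x\<close> is the same linear combination of the nodal values for every
  \<open>y\<close>.\<close>

lemma interpolant_in:
  assumes p: "\<And>y. \<exists>p. degree p \<le> n \<and> F y = poly p x \<and> (\<forall>k\<le>n. f k y = poly p (s k))"
    and f: "\<And>k. k \<le> n \<Longrightarrow> f k \<in> X" and s: "inj_on s {..n}"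
  shows "F \<in> X"
proof -
  obtain l where l: "\<And>p. degree p \<le> n \<Longrightarrow> p = (\<Sum>k\<le>n. Polynomial.smult (poly p (s k)) (l k))" using lagrange_basis[OF s] by blast
  have "F y = (\<Sum>k\<le>n. poly (l k) x * f k y)" for y
  proof -
    obtain p where p': "degree p \<le> n" "F y = poly p x" "\<And>k. k \<le> n \<Longrightarrow> f k y = poly p (s k)" using p by blast
    have "poly p x = (\<Sum>k\<le>n. poly p (s k) * poly (l k) x)"
      using arg_cong[OF l[OF p'(1)], of "\<lambda>p. poly p x"] by (simp add: poly_sum)
    then show ?thesis using p'(2,3) by (simp add: mult.commute)
  qed
  then have "F = (\<lambda>y. \<Sum>k\<le>n. poly (l k) x * f k y)" by (rule ext)
  also have "\<dots> \<in> X" by (intro sum_in scale_in f) simp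
  finally show ?thesis .
qed

text \<open>Coefficients are linear combinations of values: the highest one is extracted by a
  divided difference, and subtracting its term lowers the degree. The leading coefficients of the
  \<open>q i\<close> must be nonzero for this.\<close>

lemma expansion_coefficients_in:
  assumes q: "\<And>i. i \<le> n \<Longrightarrow> degree (q i) \<le> i \<and> coeff (q i) i \<noteq> (0::real)"
    and F: "\<And>x. x \<in> {-1..1} \<Longrightarrow> (\<lambda>y. \<Sum>i\<le>n. D i y * poly (q i) x) \<in> X"
  shows "i \<le> n \<Longrightarrow> D i \<in> X"
  using assms
proof (induction n arbitrary: i)
  case (0 i)
  obtain k where k: "q 0 = [:k:]" using 0(2)[of 0] degree_eq_zeroE by auto
  then have "k \<noteq> 0" using 0(2)[of 0] by auto
  then show ?case using scale_in[OF 0(3)[of 0], of "1 / k"] 0(1) k by (simp add: field_simps)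
next
  case (Suc n i)
  define s where "s k = real k / real (Suc n)" for k
  have s: "inj_on s {..Suc n}" "s k \<in> {-1..1}" if "k \<le> Suc n" for k
    using that by (auto simp: s_def inj_on_def field_simps)
  obtain l where l: "\<And>p. degree p \<le> Suc n \<Longrightarrow> p = (\<Sum>k\<le>Suc n. Polynomial.smult (poly p (s k)) (l k))"
    using lagrange_basis[OF s(1)[of 0]] by blast
  \<comment> \<open>These are the weights of the divided difference of order \<open>Suc n\<close>:
    applied to nodal values they return the leading coefficient and annihilate lower
    degrees.\<close>
  define w where "w k = coeff (l k) (Suc n)" for k
  have w: "(\<Sum>k\<le>Suc n. poly p (s k) * w k) = coeff p (Suc n)" if "degree p \<le> Suc n" for p
    using arg_cong[OF l[OF that], of "\<lambda>p. coeff p (Suc n)"] by (simp add: coeff_sum w_def)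
  have top: "D (Suc n) \<in> X"
  proof -
    have "(\<lambda>y. \<Sum>k\<le>Suc n. w k * (\<Sum>i\<le>Suc n. D i y * poly (q i) (s k))) \<in> X"
      by (intro sum_in scale_in Suc.prems(3) s) auto
    also have "(\<lambda>y. \<Sum>k\<le>Suc n. w k * (\<Sum>i\<le>Suc n. D i y * poly (q i) (s k))) = (\<lambda>y. coeff (q (Suc n)) (Suc n) * D (Suc n) y)"
    proof
      fix y
      have "(\<Sum>k\<le>Suc n. w k * (\<Sum>i\<le>Suc n. D i y * poly (q i) (s k))) = (\<Sum>i\<le>Suc n. D i y * (\<Sum>k\<le>Suc n. poly (q i) (s k) * w k))"
        unfolding sum_distrib_left by (subst sum.swap) (simp only: mult_ac)
      also have "\<dots> = (\<Sum>i\<le>Suc n. D i y * coeff (q i) (Suc n))"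
        using Suc.prems(2) by (intro sum.cong refl arg_cong2[of _ _ _ _ "(*)"] w) (meson atMost_iff order_trans)
      also have "\<dots> = D (Suc n) y * coeff (q (Suc n)) (Suc n)"
      proof -
        have "coeff (q i) (Suc n) = 0" if "i \<le> n" for i
          using Suc.prems(2)[of i] that by (intro coeff_eq_0) auto
        then show ?thesis by simp
      qed
      finally show "(\<Sum>k\<le>Suc n. w k * (\<Sum>i\<le>Suc n. D i y * poly (q i) (s k))) = coeff (q (Suc n)) (Suc n) * D (Suc n) y" by simp
    qed
    finally show ?thesis
      using scale_in[of "\<lambda>y. coeff (q (Suc n)) (Suc n) * D (Suc n) y" "1 / coeff (q (Suc n)) (Suc n)"] Suc.prems(2)[of "Suc n"] by simp
  qed
  have "(\<lambda>y. \<Sum>i\<le>n. D i y * poly (q i) x) \<in> X" if "x \<in> {-1..1}" for x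
    using diff_in[OF Suc.prems(3)[OF that] scale_in[OF top, of "poly (q (Suc n)) x"]] by (simp add: mult.commute)
  then have "D i \<in> X" if "i \<le> n" using Suc.IH[OF that Suc.prems(2)] by simp
  then show ?case using top Suc.prems(1) le_Suc_eq by auto
qed

end

lemma legendre_poly_degree: "degree (legendre_poly n) \<le> n \<and> 0 < coeff (legendre_poly n) n"
proof (induction n rule: induct_nat_012)
  case (ge2 n)
  have 0: "coeff (legendre_poly n) (Suc (Suc n)) = 0" using ge2 by (intro coeff_eq_0) auto
  have "degree (legendre_poly (Suc (Suc n))) \<le> Suc (Suc n)"
    unfolding legendre_poly.simps(3)
    by (intro order_trans[OF degree_smult_le] degree_diff_le order_trans[OF degree_smult_le] order_trans[OF degree_pCons_le]) (use ge2 in auto)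
  moreover have "coeff (legendre_poly (Suc (Suc n))) (Suc (Suc n)) = (2 * real n + 3) * coeff (legendre_poly (Suc n)) (Suc n) / (real n + 2)"
    unfolding legendre_poly.simps(3) using 0 by simp
  ultimately show ?case using ge2 by simp
qed auto

text \<open>The polynomials \<open>1, P\<^sub>1, N\<^sub>2, N\<^sub>3, \<dots>\<close>.\<close>

definition expansion_poly :: "nat \<Rightarrow> real poly" where
  "expansion_poly i = (if i \<le> 1 then legendre_poly i else Polynomial.smult (1 / (2 * real i - 1)) (legendre_poly i - legendre_poly (i - 2)))"

lemma expansion_poly_degree: "degree (expansion_poly i) \<le> i \<and> coeff (expansion_poly i) i \<noteq> 0"
proof (cases "i \<le> 1")
  case True
  then show ?thesis using legendre_poly_degree[of i] by (auto simp: expansion_poly_def)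
next
  case False
  then have i: "2 \<le> i" by simp
  have "coeff (legendre_poly (i - 2)) i = 0" using legendre_poly_degree[of "i - 2"] i by (intro coeff_eq_0) auto
  moreover have "degree (Polynomial.smult (1 / (2 * real i - 1)) (legendre_poly i - legendre_poly (i - 2))) \<le> i"
    using legendre_poly_degree[of i] legendre_poly_degree[of "i - 2"]
    by (intro order_trans[OF degree_smult_le] degree_diff_le) auto
  ultimately show ?thesis using legendre_poly_degree[of i] i by (auto simp: expansion_poly_def)
qed

lemma poly_expansion_poly:
  assumes "- 1 \<le> x"
  shows "poly (expansion_poly i) x = (if i \<le> 1 then legendre i x else legendre_antideriv i x)"
proof (cases "i \<le> 1")
  case False
  then obtain k where "i = k + 2" using le_Suc_ex[of 2 i] by (auto simp: add.commute)
  then show ?thesis using legendre_antideriv_eq_diff[OF assms, of k] by (simp add: expansion_poly_def poly_legendre_poly field_simps)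
qed (simp add: expansion_poly_def poly_legendre_poly)

lemma expansion_sum_eq:
  assumes "- 1 \<le> x" "2 \<le> L"
  shows "D 0 + D 1 * legendre 1 x + (\<Sum>i=2..L - 1. D i * legendre_antideriv i x) = (\<Sum>i\<le>L - 1. D i * poly (expansion_poly i) x)"
proof -
  have "{..L - 1} = {0, 1} \<union> {2..L - 1}" using assms(2) by auto
  then have "(\<Sum>i\<le>L - 1. D i * poly (expansion_poly i) x) = (\<Sum>i\<in>{0, 1} \<union> {2..L - 1}. D i * poly (expansion_poly i) x)" by simp
  also have "\<dots> = (\<Sum>i\<in>{0, 1}. D i * poly (expansion_poly i) x) + (\<Sum>i=2..L - 1. D i * poly (expansion_poly i) x)"
    by (intro sum.union_disjoint) auto
  also have "(\<Sum>i\<in>{0, 1}. D i * poly (expansion_poly i) x) = D 0 + D 1 * legendre 1 x"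
    by (simp add: poly_expansion_poly[OF assms(1)])
  also have "(\<Sum>i=2..L - 1. D i * poly (expansion_poly i) x) = (\<Sum>i=2..L - 1. D i * legendre_antideriv i x)"
    by (intro sum.cong refl) (simp add: poly_expansion_poly[OF assms(1)])
  finally show ?thesis by simp
qed

text \<open>With \<open>N_1 = 1 + \<xi>\<close> the linear term joins the antiderivatives, all of
  which vanish at -1; the constant left over is the value at the left end of the interval.\<close>

lemma expansion_shifted_eq:
  assumes "- 1 \<le> x" "2 \<le> L"
  shows "D 0 + D 1 * legendre 1 x + (\<Sum>i=2..L - 1. D i * legendre_antideriv i x) = (D 0 - D 1) + (\<Sum>i=1..L - 1. legendre_antideriv i x * D i)"
proof -
  have "(\<Sum>i=1..L - 1. legendre_antideriv i x * D i) = legendre_antideriv 1 x * D 1 + (\<Sum>i=2..L - 1. legendre_antideriv i x * D i)"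
    using assms(2) by (subst sum.atLeast_Suc_atMost) (auto simp: numeral_2_eq_2)
  then show ?thesis using legendre_antideriv_1[OF assms(1)] by (simp add: algebra_simps)
qed

section \<open>The elliptic reconstruction\<close>

lemma W21_zero:
  assumes "open \<Omega>" "0 \<le> T"
  shows "W21 \<Omega> T (\<lambda>t y. 0) (\<lambda>t \<zeta>. 0)"
proof -
  interpret V: seminorm_space "H10 \<Omega>" "H1_norm \<Omega>" using assms(1) by (rule H10_seminorm_space)
  show ?thesis
    using W21_elementary[OF assms(1) V.zero_in assms(2), of "\<lambda>_. 0" 0 "{}" "\<lambda>_. 0" 0] by simp
qed

lemma W21_sum:
  assumes "open \<Omega>" "0 \<le> T" "finite I" "\<And>k. k \<in> I \<Longrightarrow> W21 \<Omega> T (v k) (v' k)"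
  shows "W21 \<Omega> T (\<lambda>t y. \<Sum>k\<in>I. v k t y) (\<lambda>t \<zeta>. \<Sum>k\<in>I. v' k t \<zeta>)"
  using assms(3,4)
proof (induction I rule: finite_induct)
  case empty
  then show ?case using W21_zero[OF assms(1,2)] by simp
next
  case (insert k I)
  then show ?case using W21_add[OF assms(1), of T "v k" "v' k" "\<lambda>t y. \<Sum>k\<in>I. v k t y" "\<lambda>t \<zeta>. \<Sum>k\<in>I. v' k t \<zeta>"] by simp
qed

lemma L2_inner_divide: "v \<in> L2 \<Omega> \<Longrightarrow> w \<in> L2 \<Omega> \<Longrightarrow> L2_inner \<Omega> (\<lambda>y. v y / r) w = L2_inner \<Omega> v w / r"
  using L2.B_scale[of v \<Omega> w "1 / r"] by simp

locale scheme =
  fixes \<Omega> :: "(real^'n) set"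
    and A :: "real^'n \<Rightarrow> real^'n^'n" and d b :: "real^'n \<Rightarrow> real^'n" and c :: "real^'n \<Rightarrow> real"
    and a ah ih :: "(real^'n \<Rightarrow> real) \<Rightarrow> (real^'n \<Rightarrow> real) \<Rightarrow> real"
    and T :: real and u0 :: "real^'n \<Rightarrow> real" and f fh u :: "real \<Rightarrow> real^'n \<Rightarrow> real"
    and L M :: nat and t :: "nat \<Rightarrow> real" and z :: "nat \<Rightarrow> nat \<Rightarrow> real"
    and Vh :: "(real^'n \<Rightarrow> real) set" and \<eta> :: "(real^'n \<Rightarrow> real) \<Rightarrow> (real^'n \<Rightarrow> real) \<Rightarrow> ennreal"
    and G G' :: "real^'n \<Rightarrow> real \<Rightarrow> real^'n \<Rightarrow> real" and \<kappa>0 \<kappa>1 \<kappa>1' \<gamma> :: real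
    and uh \<psi> :: "nat \<Rightarrow> real^'n \<Rightarrow> real" and \<Delta>f \<Delta>u \<Delta>\<psi> :: "nat \<Rightarrow> nat \<Rightarrow> real^'n \<Rightarrow> real"
  assumes L: "2 \<le> L"
    and domain: "open \<Omega>" "connected \<Omega>" "\<Omega> \<noteq> {}" "lipschitz_boundary \<Omega>"
    and elliptic: "elliptic_coefficients \<Omega> A d b c" "a = elliptic_form \<Omega> A d b c"
      "\<forall>g\<in>L2 \<Omega>. \<exists>y\<in>H10 \<Omega>. \<forall>\<zeta>\<in>H10 \<Omega>. a y \<zeta> = L2_inner \<Omega> g \<zeta>"
    and data: "continuous_into_L2 \<Omega> T f" "u0 \<in> L2 \<Omega>" "\<forall>y\<in>frontier \<Omega>. u0 y = 0" "hoelder_on (closure \<Omega>) u0"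
    and solution: "parabolic_solution \<Omega> a T u0 f u"
      "continuous_on ({0..T} \<times> closure \<Omega>) (\<lambda>(s, y). u s y)"
    and mesh: "time_mesh M T t"
    and interpolant: "interpolation_nodes L M t z" "time_interpolant L M t z f fh" "legendre_expansion L M t fh \<Delta>f"
    and discrete_forms: "finite_dim_subspace Vh (H10 \<Omega>)" "bilinear_form_on Vh Vh ah" "bilinear_form_on (L2 \<Omega>) Vh ih"
    and estimator: "elliptic_estimator \<Omega> a Vh ah ih \<eta>"
    and green: "greens_function \<Omega> a T G G'" "greens_function_bounds \<Omega> T G G' \<kappa>0 \<kappa>1 \<kappa>1' \<gamma>"
      "0 \<le> \<kappa>0" "0 \<le> \<kappa>1" "0 \<le> \<kappa>1'" "0 \<le> \<gamma>"
    and euler: "extrapolated_euler Vh ah ih L M t fh uh"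
    and recon: "reconstruction Vh ah ih L M t fh \<Delta>f uh \<psi> \<Delta>u \<Delta>\<psi>"
begin

section \<open>The mesh and membership of the discrete quantities\<close>

lemma T_pos: "0 < T"
proof -
  have "n \<le> M \<Longrightarrow> 1 \<le> n \<Longrightarrow> 0 < t n" for n
  proof (induction n)
    case (Suc n)
    then show ?case using mesh unfolding time_mesh_def by (cases "n = 0") (auto simp: Suc_le_eq intro: less_trans)
  qed simp
  then show ?thesis using mesh unfolding time_mesh_def by auto
qed

lemma t_mono: "i \<le> j \<Longrightarrow> j \<le> M \<Longrightarrow> t i \<le> t j"
proof (induction j rule: dec_induct)
  case (step n)
  then show ?case using mesh unfolding time_mesh_def by (auto simp: Suc_le_eq intro: less_imp_le order_trans)
qed simp

lemma tj:
  assumes "j \<in> {1..M}"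
  shows "0 \<le> t (j - 1)" "t (j - 1) < t j" "t j \<le> T"
proof -
  have "t 0 \<le> t (j - 1)" "t j \<le> t M" using assms by (auto intro: t_mono)
  moreover have "t (j - 1) < t j"
  proof -
    obtain k where "j = Suc k" "k < M" using assms by (cases j) auto
    then show ?thesis using mesh unfolding time_mesh_def by simp
  qed
  ultimately show "0 \<le> t (j - 1)" "t (j - 1) < t j" "t j \<le> T" using assms mesh unfolding time_mesh_def by auto
qed

lemma pred_le_M: "j \<in> {1..M} \<Longrightarrow> j \<le> M" "j \<in> {1..M} \<Longrightarrow> j - 1 \<le> M"
  by auto

sublocale green_bounds \<Omega> a T G G' \<kappa>0 \<kappa>1 \<kappa>1' \<gamma>
  using domain green T_pos by unfold_locales

sublocale V: seminorm_space "H10 \<Omega>" "H1_norm \<Omega>"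
  using op by (rule H10_seminorm_space)

lemma H10_L2: "v \<in> H10 \<Omega> \<Longrightarrow> v \<in> L2 \<Omega>"
  using H10_H1[OF op] H1_L2 by blast

lemma a_add: "v \<in> H10 \<Omega> \<Longrightarrow> v' \<in> H10 \<Omega> \<Longrightarrow> w \<in> H10 \<Omega> \<Longrightarrow> a (\<lambda>y. v y + v' y) w = a v w + a v' w"
  unfolding elliptic(2) using elliptic_form_add[OF op elliptic(1)] H10_H1[OF op] by blast

lemma a_scale: "v \<in> H10 \<Omega> \<Longrightarrow> w \<in> H10 \<Omega> \<Longrightarrow> a (\<lambda>y. r * v y) w = r * a v w"
  unfolding elliptic(2) using elliptic_form_scale[OF op elliptic(1)] H10_H1[OF op] by blast

lemma a_diff:
  assumes "v \<in> H10 \<Omega>" "v' \<in> H10 \<Omega>" "w \<in> H10 \<Omega>"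
  shows "a (\<lambda>y. v y - v' y) w = a v w - a v' w"
  using a_add[OF assms(1) V.scale_in[OF assms(2), of "-1"] assms(3)] a_scale[OF assms(2,3), of "-1"] by simp

lemma a_sum:
  assumes "finite I" "\<And>i. i \<in> I \<Longrightarrow> v i \<in> H10 \<Omega>" "w \<in> H10 \<Omega>"
  shows "a (\<lambda>y. \<Sum>i\<in>I. v i y) w = (\<Sum>i\<in>I. a (v i) w)"
  using assms
proof (induction I rule: finite_induct)
  case empty
  then show ?case using a_scale[OF V.zero_in, of w 0] by simp
next
  case (insert i I)
  then show ?case using a_add[of "v i" "\<lambda>y. \<Sum>i\<in>I. v i y" w] V.sum_in[of I v] by simp
qed

lemma Vh_H10: "v \<in> Vh \<Longrightarrow> v \<in> H10 \<Omega>"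
proof -
  obtain N e where e: "\<And>i. i < N \<Longrightarrow> e i \<in> H10 \<Omega>" "Vh = {v. \<exists>c. v = (\<lambda>y. \<Sum>i<(N::nat). c i * e i y)}"
    using discrete_forms(1) unfolding finite_dim_subspace_def by blast
  show "v \<in> Vh \<Longrightarrow> v \<in> H10 \<Omega>" unfolding e(2) using e(1) by (auto intro!: V.sum_in V.scale_in)
qed

sublocale Vh: fun_space Vh
proof -
  obtain N e where e: "Vh = {v. \<exists>c. v = (\<lambda>y. \<Sum>i<(N::nat). c i * e i y)}"
    using discrete_forms(1) unfolding finite_dim_subspace_def by blast
  have mem: "(\<lambda>y. \<Sum>i<N. c i * e i y) \<in> Vh" for c unfolding e by blast
  show "fun_space Vh"
  proof
    show "(\<lambda>y. 0) \<in> Vh" using mem[of "\<lambda>_. 0"] by simp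
    fix v assume "v \<in> Vh"
    then obtain c where c: "v = (\<lambda>y. \<Sum>i<N. c i * e i y)" unfolding e by blast
    show "(\<lambda>y. r * v y) \<in> Vh" for r using mem[of "\<lambda>i. r * c i"] by (simp add: c sum_distrib_left mult.assoc)
    fix w assume "w \<in> Vh"
    then obtain c' where c': "w = (\<lambda>y. \<Sum>i<N. c' i * e i y)" unfolding e by blast
    show "(\<lambda>y. v y + w y) \<in> Vh" using mem[of "\<lambda>i. c i + c' i"] by (simp add: c c' distrib_right sum.distrib)
  qed
qed

lemma Vh_L2: "v \<in> Vh \<Longrightarrow> v \<in> L2 \<Omega>"
  using Vh_H10 H10_L2 by blast

lemma uh_Vh: "j \<le> M \<Longrightarrow> uh j \<in> Vh"
proof (cases "j = 0")
  case True
  then show ?thesis using euler unfolding extrapolated_euler_def by simp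
next
  case False
  assume "j \<le> M"
  with False have j: "j \<in> {1..M}" by simp
  obtain v where v: "\<And>l. l \<in> {1..L} \<Longrightarrow> backward_euler Vh ah ih M t fh (uh 0) l (v l)"
    "uh j = (\<lambda>y. \<Sum>l=1..L. extrapolation_weight L l * v l (t j) y)"
    using euler j unfolding extrapolated_euler_def by blast
  have "v l (t j) \<in> Vh" if l: "l \<in> {1..L}" for l
  proof -
    have "\<forall>k<l. v l (mesh_at t j (real k / real l)) \<in> Vh" using v(1)[OF l] j unfolding backward_euler_def Let_def by blast
    moreover have "0 < l" using l by simp
    ultimately have "v l (mesh_at t j (real 0 / real l)) \<in> Vh" by blast
    then show ?thesis by (simp add: mesh_at_def)
  qed
  then show ?thesis unfolding v(2) by (intro Vh.sum_in Vh.scale_in)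
qed

lemma psi: "j \<le> M \<Longrightarrow> \<psi> j \<in> Vh" "j \<le> M \<Longrightarrow> \<zeta> \<in> Vh \<Longrightarrow> ih (\<psi> j) \<zeta> = ah (uh j) \<zeta> - ih (fh (t j)) \<zeta>"
  using recon unfolding reconstruction_def by blast+

lemma Du01: "j \<in> {1..M} \<Longrightarrow> \<Delta>u j 0 = (\<lambda>y. (uh j y + uh (j - 1) y) / 2)" "j \<in> {1..M} \<Longrightarrow> \<Delta>u j 1 = (\<lambda>y. (uh j y - uh (j - 1) y) / 2)"
  using recon unfolding reconstruction_def nodal_coefficients_def by blast+

lemma Dpsi01: "j \<in> {1..M} \<Longrightarrow> \<Delta>\<psi> j 0 = (\<lambda>y. (\<psi> j y + \<psi> (j - 1) y) / 2)" "j \<in> {1..M} \<Longrightarrow> \<Delta>\<psi> j 1 = (\<lambda>y. (\<psi> j y - \<psi> (j - 1) y) / 2)"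
  using recon unfolding reconstruction_def nodal_coefficients_def by blast+

lemma Dpsi_2: "j \<in> {1..M} \<Longrightarrow> 2 < L \<Longrightarrow> \<Delta>\<psi> j 2 y / 3 = \<Delta>\<psi> j 0 y + 2 * \<Delta>u j 1 y / step t j"
  and Dpsi_rec: "j \<in> {1..M} \<Longrightarrow> i \<in> {1..L - 3} \<Longrightarrow>
    \<Delta>\<psi> j (i + 2) y / (2 * real i + 3) = \<Delta>\<psi> j i y / (2 * real i - 1) + 2 / step t j * \<Delta>u j (i + 1) y"
  and Du_high: "j \<in> {1..M} \<Longrightarrow> i \<in> {2..L - 1} \<Longrightarrow> \<Delta>u j i \<in> Vh"
    "j \<in> {1..M} \<Longrightarrow> i \<in> {2..L - 1} \<Longrightarrow> \<zeta> \<in> Vh \<Longrightarrow> ah (\<Delta>u j i) \<zeta> = ih (\<lambda>y. \<Delta>\<psi> j i y + \<Delta>f j i y) \<zeta>"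
  using recon unfolding reconstruction_def by blast+

lemma Vh_half: "v \<in> Vh \<Longrightarrow> (\<lambda>y. v y / 2) \<in> Vh"
  using Vh.scale_in[of v "1 / 2"] by simp

lemma Du_Vh: "j \<in> {1..M} \<Longrightarrow> i \<le> L - 1 \<Longrightarrow> \<Delta>u j i \<in> Vh"
proof -
  assume j: "j \<in> {1..M}" and i: "i \<le> L - 1"
  have u: "uh j \<in> Vh" "uh (j - 1) \<in> Vh" using j by (auto intro: uh_Vh)
  consider "i = 0" | "i = 1" | "i \<in> {2..L - 1}" using i by fastforce
  then show ?thesis
  proof cases
    case 1
    then show ?thesis using Vh_half[OF Vh.add_in[OF u]] Du01(1)[OF j] by simp
  next
    case 2
    show ?thesis unfolding 2 Du01(2)[OF j] by (rule Vh_half[OF Vh.diff_in[OF u]])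
  next
    case 3
    then show ?thesis using Du_high j by blast
  qed
qed

lemma Dpsi_Vh: "j \<in> {1..M} \<Longrightarrow> i \<le> L - 1 \<Longrightarrow> \<Delta>\<psi> j i \<in> Vh"
proof (induction i rule: induct_nat_012)
  case 0
  show ?case unfolding Dpsi01(1)[OF 0(1)]
    by (rule Vh_half[OF Vh.add_in[OF psi(1) psi(1)]]) (use 0 in auto)
next
  case 1
  show ?case unfolding One_nat_def[symmetric] Dpsi01(2)[OF 1(1)]
    by (rule Vh_half[OF Vh.diff_in[OF psi(1) psi(1)]]) (use 1 in auto)
next
  case (ge2 i)
  have iL: "i + 2 \<le> L - 1" using ge2.prems by simp
  have V: "\<Delta>\<psi> j i \<in> Vh" "\<Delta>u j (i + 1) \<in> Vh" using ge2 Du_Vh[of j "i + 1"] by auto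
  \<comment> \<open>The general factor \<open>1 / (2 i - 1)\<close> would be -1 at
    \<open>i = 0\<close>, whereas the recursion starts with the factor 1.\<close>
  define r where "r = (if i = 0 then 1 else 1 / (2 * real i - 1))"
  have "\<Delta>\<psi> j (i + 2) y = (2 * real i + 3) * (r * \<Delta>\<psi> j i y + 2 / step t j * \<Delta>u j (i + 1) y)" for y
  proof -
    have "\<Delta>\<psi> j (i + 2) y / (2 * real i + 3) = r * \<Delta>\<psi> j i y + 2 / step t j * \<Delta>u j (i + 1) y"
      using Dpsi_2[of j y] Dpsi_rec[of j i y] ge2.prems iL by (cases "i = 0") (auto simp: r_def numeral_2_eq_2)
    moreover have "2 * real i + 3 \<noteq> 0" by linarith
    ultimately show ?thesis by (metis nonzero_mult_div_cancel_left times_divide_eq_right)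
  qed
  then have "\<Delta>\<psi> j (i + 2) = (\<lambda>y. (2 * real i + 3) * (r * \<Delta>\<psi> j i y + 2 / step t j * \<Delta>u j (i + 1) y))" by (rule ext)
  also have "\<dots> \<in> Vh" by (intro Vh.scale_in Vh.add_in V)
  finally show ?case by simp
qed

text \<open>The interpolant is specified separately at every spatial point; membership in
  \<open>L2\<close> comes from writing it as a fixed linear combination of the functions
  \<open>f (z j k)\<close>.\<close>

lemma fh_L2:
  assumes j: "j \<in> {1..M}" and s: "s \<in> {t (j - 1)..t j}"
  shows "fh s \<in> L2 \<Omega>"
proof (rule L2.interpolant_in[of "L - 1" _ s "\<lambda>k. f (z j k)" "z j"])
  have z: "z j 0 = t (j - 1)" "z j (L - 1) = t j" "\<And>k. k < L - 1 \<Longrightarrow> z j k < z j (Suc k)"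
    using interpolant(1) j unfolding interpolation_nodes_def by auto
  have zm: "z j k < z j m" if "k < m" "m \<le> L - 1" for k m
    using that
  proof (induction m)
    case (Suc m)
    then show ?case using z(3)[of m] by (cases "k = m") auto
  qed simp
  show "inj_on (z j) {..L - 1}"
    by (rule inj_onI) (metis atMost_iff less_irrefl linorder_neqE_nat zm)
  show "f (z j k) \<in> L2 \<Omega>" if k: "k \<le> L - 1" for k
  proof -
    have "z j 0 \<le> z j k" using zm[of 0 k] k by (cases "k = 0") auto
    moreover have "z j k \<le> z j (L - 1)" using zm[of k "L - 1"] k by (cases "k = L - 1") auto
    ultimately show ?thesis using z tj[OF j] data(1) unfolding continuous_into_L2_def by auto
  qed
  show "\<exists>p. degree p \<le> L - 1 \<and> fh s y = poly p s \<and> (\<forall>k\<le>L - 1. f (z j k) y = poly p (z j k))" for y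
  proof -
    obtain p where p: "degree p \<le> L - 1" "\<forall>s\<in>{t (j - 1)..t j}. fh s y = poly p s" "\<forall>k<L. fh (z j k) y = f (z j k) y"
      using interpolant(2) j unfolding time_interpolant_def by blast
    have "f (z j k) y = poly p (z j k)" if k: "k \<le> L - 1" for k
    proof -
      have "z j 0 \<le> z j k" using zm[of 0 k] k by (cases "k = 0") auto
      moreover have "z j k \<le> z j (L - 1)" using zm[of k "L - 1"] k by (cases "k = L - 1") auto
      ultimately have "z j k \<in> {t (j - 1)..t j}" using z by simp
      moreover have "k < L" using k L by simp
      ultimately show ?thesis using p(2,3) by auto
    qed
    then show ?thesis using p s by blast
  qed
qed

lemma step_pos': "j \<in> {1..M} \<Longrightarrow> 0 < step t j"
  using tj by (auto simp: step_def)

lemma ref_coord_inverse: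
  assumes j: "j \<in> {1..M}" and x: "x \<in> {-1..1}"
  shows "\<exists>s\<in>{t (j - 1)..t j}. ref_coord t j s = x"
proof -
  define s where "s = (t (j - 1) + t j) / 2 + x * (t j - t (j - 1)) / 2"
  have "\<bar>x * (t j - t (j - 1))\<bar> \<le> 1 * \<bar>t j - t (j - 1)\<bar>" unfolding abs_mult using x by (intro mult_right_mono) auto
  then have "\<bar>x * (t j - t (j - 1))\<bar> \<le> t j - t (j - 1)" using tj(2)[OF j] by simp
  then have "s \<in> {t (j - 1)..t j}" unfolding s_def by (auto simp: abs_le_iff field_simps)
  moreover have "ref_coord t j s = x"
    using tj(2)[OF j] unfolding ref_coord_eq[OF step_pos'[OF j]] s_def by (simp add: field_simps)
  ultimately show ?thesis by blast
qed

lemma fh_expansion: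
  assumes "j \<in> {1..M}" "s \<in> {t (j - 1)..t j}"
  shows "fh s y = \<Delta>f j 0 y + \<Delta>f j 1 y * legendre 1 (ref_coord t j s) + (\<Sum>i=2..L - 1. \<Delta>f j i y * legendre_antideriv i (ref_coord t j s))"
  using interpolant(3) assms unfolding legendre_expansion_def by blast

lemma ref_coord_ge: "j \<in> {1..M} \<Longrightarrow> s \<in> {t (j - 1)..t j} \<Longrightarrow> - 1 \<le> ref_coord t j s"
  using ref_coord_bounds(2)[of t j, OF tj, of s] by auto

text \<open>The antiderivatives of index at least 2 vanish at both endpoints, so only the two nodal
  coefficients survive.\<close>

lemma fh_ends:
  assumes j: "j \<in> {1..M}"
  shows "fh (t (j - 1)) y = \<Delta>f j 0 y - \<Delta>f j 1 y" "fh (t j) y = \<Delta>f j 0 y + \<Delta>f j 1 y"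
proof -
  have N: "(\<Sum>i=2..L - 1. \<Delta>f j i y * legendre_antideriv i e) = 0" if "e = -1 \<or> e = 1" for e
  proof (intro sum.neutral ballI)
    fix i assume "i \<in> {2..L - 1}"
    then obtain k where "i = k + 2" by (metis atLeastAtMost_iff le_Suc_ex add.commute)
    then show "\<Delta>f j i y * legendre_antideriv i e = 0"
      using that legendre_antideriv_at_1[of k] legendre_antideriv_minus_1[of i] by auto
  qed
  show "fh (t (j - 1)) y = \<Delta>f j 0 y - \<Delta>f j 1 y"
    using fh_expansion[OF j, of "t (j - 1)" y] tj(2)[OF j] N[of "-1"] unfolding ref_coord_ends(1)[OF tj[OF j]] by simp
  show "fh (t j) y = \<Delta>f j 0 y + \<Delta>f j 1 y"
    using fh_expansion[OF j, of "t j" y] tj(2)[OF j] N[of 1] unfolding ref_coord_ends(2)[OF tj[OF j]] by simp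
qed

text \<open>The coefficients are known only through the expansion of \<open>fh\<close>, so they are
  recovered from its values at finitely many times of the interval.\<close>

lemma Df_L2:
  assumes j: "j \<in> {1..M}" and i: "i \<le> L - 1"
  shows "\<Delta>f j i \<in> L2 \<Omega>"
proof (rule L2.expansion_coefficients_in[OF _ _ i, where q=expansion_poly])
  fix x :: real assume x: "x \<in> {-1..1}"
  obtain s where s: "s \<in> {t (j - 1)..t j}" "ref_coord t j s = x" using ref_coord_inverse[OF j x] by blast
  have "fh s y = (\<Sum>i\<le>L - 1. \<Delta>f j i y * poly (expansion_poly i) x)" for y
    using fh_expansion[OF j s(1), of y] expansion_sum_eq[of x L "\<lambda>i. \<Delta>f j i y"] x L s(2) by simp
  then have "(\<lambda>y. \<Sum>i\<le>L - 1. \<Delta>f j i y * poly (expansion_poly i) x) = fh s" by auto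
  then show "(\<lambda>y. \<Sum>i\<le>L - 1. \<Delta>f j i y * poly (expansion_poly i) x) \<in> L2 \<Omega>" using fh_L2[OF j s(1)] by simp
qed (rule expansion_poly_degree)

lemma fh_nodal_L2: "j \<le> M \<Longrightarrow> fh (t j) \<in> L2 \<Omega>"
proof (cases "j = 0")
  case True
  have 1: "1 \<in> {1..M}" using mesh unfolding time_mesh_def by simp
  show ?thesis using fh_L2[OF 1, of "t 0"] tj(2)[OF 1] True by simp
next
  case False
  assume "j \<le> M"
  with False have j: "j \<in> {1..M}" by simp
  show ?thesis using fh_L2[OF j, of "t j"] tj(2)[OF j] by simp
qed

section \<open>Stationary problems and the coefficients of the elliptic reconstruction\<close>

definition ell_solution :: "(real^'n \<Rightarrow> real) \<Rightarrow> real^'n \<Rightarrow> real" where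
  "ell_solution g = (SOME y. y \<in> H10 \<Omega> \<and> (\<forall>\<zeta>\<in>H10 \<Omega>. a y \<zeta> = L2_inner \<Omega> g \<zeta>))"

lemma ell_solution:
  assumes "g \<in> L2 \<Omega>"
  shows "ell_solution g \<in> H10 \<Omega>" "\<zeta> \<in> H10 \<Omega> \<Longrightarrow> a (ell_solution g) \<zeta> = L2_inner \<Omega> g \<zeta>"
proof -
  have "\<exists>y. y \<in> H10 \<Omega> \<and> (\<forall>\<zeta>\<in>H10 \<Omega>. a y \<zeta> = L2_inner \<Omega> g \<zeta>)" using elliptic(3) assms by blast
  from someI_ex[OF this] show "ell_solution g \<in> H10 \<Omega>" "\<zeta> \<in> H10 \<Omega> \<Longrightarrow> a (ell_solution g) \<zeta> = L2_inner \<Omega> g \<zeta>"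
    unfolding ell_solution_def by blast+
qed

definition "ell_rhs j = (\<lambda>y. fh (t j) y + \<psi> j y)"
definition "ell_rhs_coeff j i = (\<lambda>y. \<Delta>f j i y + \<Delta>\<psi> j i y)"
definition "ell_val j = ell_solution (ell_rhs j)"
text \<open>For \<open>i = 1\<close> no new solution is chosen: a choice need not respect
  differences of data, and the half difference is what lets the reconstruction pass continuously
  from \<open>ell_val (j - 1)\<close> to \<open>ell_val j\<close>.\<close>

definition "ell_coeff j i = (if i = 1 then (\<lambda>y. (ell_val j y - ell_val (j - 1) y) / 2) else ell_solution (ell_rhs_coeff j i))"

lemma ell_rhs_L2: "j \<le> M \<Longrightarrow> ell_rhs j \<in> L2 \<Omega>"
  unfolding ell_rhs_def using fh_nodal_L2 psi(1) Vh_L2 by (blast intro: L2.add_in)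

lemma ell_rhs_coeff_L2: "j \<in> {1..M} \<Longrightarrow> i \<le> L - 1 \<Longrightarrow> ell_rhs_coeff j i \<in> L2 \<Omega>"
  unfolding ell_rhs_coeff_def using Df_L2 Dpsi_Vh Vh_L2 by (blast intro: L2.add_in)

lemma ell_val_H10: "j \<le> M \<Longrightarrow> ell_val j \<in> H10 \<Omega>" and a_ell_val: "j \<le> M \<Longrightarrow> \<zeta> \<in> H10 \<Omega> \<Longrightarrow> a (ell_val j) \<zeta> = L2_inner \<Omega> (ell_rhs j) \<zeta>"
  unfolding ell_val_def using ell_solution ell_rhs_L2 by blast+

text \<open>The half difference taken in \<open>ell_coeff j 1\<close> therefore solves the
  stationary problem with the right-hand side assigned to index 1.\<close>

lemma ell_rhs_coeff_1: "j \<in> {1..M} \<Longrightarrow> ell_rhs_coeff j 1 = (\<lambda>y. (ell_rhs j y - ell_rhs (j - 1) y) / 2)"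
proof
  fix y assume j: "j \<in> {1..M}"
  have "\<Delta>\<psi> j 1 y = (\<psi> j y - \<psi> (j - 1) y) / 2" using Dpsi01(2)[OF j] by simp
  moreover have "\<Delta>f j 1 y = (fh (t j) y - fh (t (j - 1)) y) / 2" using fh_ends[OF j, of y] by simp
  ultimately show "ell_rhs_coeff j 1 y = (ell_rhs j y - ell_rhs (j - 1) y) / 2" unfolding ell_rhs_coeff_def ell_rhs_def by (simp add: field_simps)
qed

lemma ell_coeff: assumes j: "j \<in> {1..M}" and i: "i \<in> {1..L - 1}"
  shows "ell_coeff j i \<in> H10 \<Omega>" "\<zeta> \<in> H10 \<Omega> \<Longrightarrow> a (ell_coeff j i) \<zeta> = L2_inner \<Omega> (ell_rhs_coeff j i) \<zeta>"
proof -
  have y: "ell_val j \<in> H10 \<Omega>" "ell_val (j - 1) \<in> H10 \<Omega>" and g: "ell_rhs j \<in> L2 \<Omega>" "ell_rhs (j - 1) \<in> L2 \<Omega>"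
    using j by (auto intro: ell_val_H10 ell_rhs_L2)
  show "ell_coeff j i \<in> H10 \<Omega>"
  proof (cases "i = 1")
    case True
    then show ?thesis using V.scale_in[OF V.diff_in[OF y], of "1 / 2"] by (simp add: ell_coeff_def)
  next
    case False
    then show ?thesis using ell_solution(1)[OF ell_rhs_coeff_L2[OF j]] i by (simp add: ell_coeff_def)
  qed
  show "a (ell_coeff j i) \<zeta> = L2_inner \<Omega> (ell_rhs_coeff j i) \<zeta>" if z: "\<zeta> \<in> H10 \<Omega>"
  proof (cases "i = 1")
    case True
    have "a (ell_coeff j i) \<zeta> = (1 / 2) * (a (ell_val j) \<zeta> - a (ell_val (j - 1)) \<zeta>)"
      using True a_scale[OF V.diff_in[OF y] z, of "1 / 2"] a_diff[OF y z] by (simp add: ell_coeff_def)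
    also have "\<dots> = (1 / 2) * (L2_inner \<Omega> (ell_rhs j) \<zeta> - L2_inner \<Omega> (ell_rhs (j - 1)) \<zeta>)" unfolding a_ell_val[OF pred_le_M(1)[OF j] z] a_ell_val[OF pred_le_M(2)[OF j] z] ..
    also have "\<dots> = L2_inner \<Omega> (ell_rhs_coeff j 1) \<zeta>"
      unfolding ell_rhs_coeff_1[OF j] using L2_inner_divide[OF L2.diff_in[OF g] H10_L2[OF z], of 2] L2_inner_diff[OF g H10_L2[OF z]] by simp
    finally show ?thesis using True by simp
  next
    case False
    then show ?thesis using ell_solution(2)[OF ell_rhs_coeff_L2[OF j]] i z by (simp add: ell_coeff_def)
  qed
qed

lemma ih_add: "v \<in> L2 \<Omega> \<Longrightarrow> v' \<in> L2 \<Omega> \<Longrightarrow> w \<in> Vh \<Longrightarrow> ih (\<lambda>y. v y + v' y) w = ih v w + ih v' w"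
  and ih_scale: "v \<in> L2 \<Omega> \<Longrightarrow> w \<in> Vh \<Longrightarrow> ih (\<lambda>y. r * v y) w = r * ih v w"
  and ah_add: "v \<in> Vh \<Longrightarrow> v' \<in> Vh \<Longrightarrow> w \<in> Vh \<Longrightarrow> ah (\<lambda>y. v y + v' y) w = ah v w + ah v' w"
  and ah_scale: "v \<in> Vh \<Longrightarrow> w \<in> Vh \<Longrightarrow> ah (\<lambda>y. r * v y) w = r * ah v w"
  using discrete_forms(2,3) unfolding bilinear_form_on_def by blast+

lemma ah_uh: "j \<le> M \<Longrightarrow> \<zeta> \<in> Vh \<Longrightarrow> ah (uh j) \<zeta> = ih (ell_rhs j) \<zeta>"
  unfolding ell_rhs_def using ih_add[OF fh_nodal_L2 Vh_L2[OF psi(1)], of j j \<zeta>] psi(2)[of j \<zeta>] by simp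

lemma estimator_rule:
  "\<lbrakk>g \<in> L2 \<Omega>; y \<in> H10 \<Omega>; yh \<in> Vh; \<forall>\<zeta>\<in>H10 \<Omega>. a y \<zeta> = L2_inner \<Omega> g \<zeta>; \<forall>\<zeta>\<in>Vh. ah yh \<zeta> = ih g \<zeta>\<rbrakk>
    \<Longrightarrow> Linf_norm \<Omega> (\<lambda>p. yh p - y p) \<le> \<eta> yh g"
  using estimator unfolding elliptic_estimator_def by blast

lemma estimator_nodal: "j \<le> M \<Longrightarrow> Linf_norm \<Omega> (\<lambda>p. uh j p - ell_val j p) \<le> \<eta> (uh j) (ell_rhs j)"
  by (intro estimator_rule ell_rhs_L2 ell_val_H10 uh_Vh ballI a_ell_val ah_uh)

text \<open>For \<open>i \<ge> 2\<close> the discrete equation is part of the recursion. For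
  \<open>i = 1\<close> it is half the difference of the two nodal equations, by linearity of the
  discrete forms.\<close>

lemma estimator_coefficient:
  assumes j: "j \<in> {1..M}" and i: "i \<in> {1..L - 1}"
  shows "Linf_norm \<Omega> (\<lambda>p. \<Delta>u j i p - ell_coeff j i p) \<le> \<eta> (\<Delta>u j i) (ell_rhs_coeff j i)"
proof -
  have "ah (\<Delta>u j i) \<zeta> = ih (ell_rhs_coeff j i) \<zeta>" if z: "\<zeta> \<in> Vh" for \<zeta>
  proof (cases "i = 1")
    case True
    have u: "uh j \<in> Vh" "uh (j - 1) \<in> Vh" and g: "ell_rhs j \<in> L2 \<Omega>" "ell_rhs (j - 1) \<in> L2 \<Omega>" using j by (auto intro: uh_Vh ell_rhs_L2)
    have "ah (\<Delta>u j 1) \<zeta> = ah (\<lambda>y. (1 / 2) * (uh j y + (- 1) * uh (j - 1) y)) \<zeta>" using Du01(2)[OF j] by simp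
    also have "\<dots> = (1 / 2) * (ah (uh j) \<zeta> + (- 1) * ah (uh (j - 1)) \<zeta>)"
      unfolding ah_scale[OF Vh.add_in[OF u(1) Vh.scale_in[OF u(2)]] z] ah_add[OF u(1) Vh.scale_in[OF u(2)] z] ah_scale[OF u(2) z] ..
    also have "\<dots> = (1 / 2) * (ih (ell_rhs j) \<zeta> + (- 1) * ih (ell_rhs (j - 1)) \<zeta>)" unfolding ah_uh[OF pred_le_M(1)[OF j] z] ah_uh[OF pred_le_M(2)[OF j] z] ..
    also have "\<dots> = ih (\<lambda>y. (1 / 2) * (ell_rhs j y + (- 1) * ell_rhs (j - 1) y)) \<zeta>"
      unfolding ih_scale[OF L2.add_in[OF g(1) L2.scale_in[OF g(2)]] z] ih_add[OF g(1) L2.scale_in[OF g(2)] z] ih_scale[OF g(2) z] ..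
    also have "\<dots> = ih (ell_rhs_coeff j 1) \<zeta>" using ell_rhs_coeff_1[OF j] by simp
    finally show ?thesis using True by simp
  next
    case False
    then have "i \<in> {2..L - 1}" using i by auto
    from Du_high(2)[OF j this z] show ?thesis by (simp add: ell_rhs_coeff_def add.commute)
  qed
  then show ?thesis using j i by (intro estimator_rule ell_rhs_coeff_L2 ell_coeff Du_Vh ballI) auto
qed

end

lemma
  fixes E :: "'a::euclidean_space \<Rightarrow> real"
  assumes I: "I \<in> sets lebesgue" and J: "J \<in> sets lebesgue" and IJ: "I \<subseteq> J"
  shows integrable_indicator_lebesgue_on: "integrable (lebesgue_on J) (\<lambda>s. indicator I s * E s) \<longleftrightarrow> integrable (lebesgue_on I) E"
    and integral_indicator_lebesgue_on: "(LINT s|lebesgue_on J. indicator I s * E s) = (LINT s|lebesgue_on I. E s)"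
proof -
  have eq: "indicator J s * (indicator I s * E s) = indicator I s * E s" for s
    using IJ by (auto simp: indicator_def)
  show "integrable (lebesgue_on J) (\<lambda>s. indicator I s * E s) \<longleftrightarrow> integrable (lebesgue_on I) E"
    using I J by (simp add: integrable_restrict_space eq)
  show "(LINT s|lebesgue_on J. indicator I s * E s) = (LINT s|lebesgue_on I. E s)"
    using I J by (simp add: integral_restrict_space eq)
qed

section \<open>The reconstruction as one global sum in time\<close>

context scheme
begin

text \<open>With \<open>N\<^sub>1(\<xi>) = 1 + \<xi>\<close> the reconstruction of \<open>u\<^sub>h\<close> is a single sum over all mesh intervals: the
  coefficient functions \<open>N\<^sub>i \<circ> \<xi>\<^sub>j\<close> are continued by constants outside \<open>I\<^sub>j\<close>, namely by \<open>0\<close> except for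
  the value \<open>2\<close> of \<open>N\<^sub>1\<close> on the right.\<close>

definition "clamped_coord j s = max (- 1) (min 1 (ref_coord t j s))"
definition "time_coeff j i s = legendre_antideriv i (clamped_coord j s)"
definition "time_deriv j i s = indicator {t (j - 1)<..<t j} s * (2 / step t j * legendre (i - 1) (ref_coord t j s))"

definition "ell_recon s = (\<lambda>p. ell_val 0 p + (\<Sum>j=1..M. \<Sum>i=1..L - 1. time_coeff j i s * ell_coeff j i p))"

lemma clamped_coord_bounds: "clamped_coord j s \<in> {- 1..1}"
  by (auto simp: clamped_coord_def)

lemma ref_coord_less: "j \<in> {1..M} \<Longrightarrow> ref_coord t j s < - 1 \<longleftrightarrow> s < t (j - 1)" "j \<in> {1..M} \<Longrightarrow> 1 < ref_coord t j s \<longleftrightarrow> t j < s"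
  using tj(2)[of j] unfolding ref_coord_eq[OF step_pos'] by (auto simp: field_simps)

lemma clamped_coord_eq:
  assumes j: "j \<in> {1..M}"
  shows "s \<le> t (j - 1) \<Longrightarrow> clamped_coord j s = - 1" "t j \<le> s \<Longrightarrow> clamped_coord j s = 1" "s \<in> {t (j - 1)..t j} \<Longrightarrow> clamped_coord j s = ref_coord t j s"
proof -
  have "ref_coord t j s \<le> - 1" if "s \<le> t (j - 1)"
    using that ref_coord_ends(1)[of t j, OF tj[OF j]] ref_coord_less(1)[OF j, of s] by (cases "s = t (j - 1)") auto
  then show "s \<le> t (j - 1) \<Longrightarrow> clamped_coord j s = - 1" by (simp add: clamped_coord_def)
  have "1 \<le> ref_coord t j s" if "t j \<le> s"
    using that ref_coord_ends(2)[of t j, OF tj[OF j]] ref_coord_less(2)[OF j, of s] by (cases "s = t j") auto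
  then show "t j \<le> s \<Longrightarrow> clamped_coord j s = 1" by (simp add: clamped_coord_def)
  show "s \<in> {t (j - 1)..t j} \<Longrightarrow> clamped_coord j s = ref_coord t j s"
    using ref_coord_bounds(2)[of t j, OF tj[OF j], of s] by (auto simp: clamped_coord_def)
qed

lemma continuous_on_time_coeff:
  assumes j: "j \<in> {1..M}"
  shows "continuous_on UNIV (time_coeff j i)"
proof -
  have "continuous_on UNIV (clamped_coord j)"
    unfolding clamped_coord_def[abs_def] by (intro continuous_intros continuous_on_ref_coord[of t j, OF tj[OF j]])
  then show ?thesis
    unfolding time_coeff_def[abs_def] using clamped_coord_bounds by (intro continuous_on_compose2[OF continuous_on_legendre_antideriv[of 1]]) auto
qed

lemma time_coeff_bounded: "\<exists>C. \<forall>s. \<bar>time_coeff j i s\<bar> \<le> C"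
proof -
  have "compact (legendre_antideriv i ` {-1..1})" using continuous_on_legendre_antideriv by (intro compact_continuous_image) auto
  then obtain C where "\<forall>x\<in>{-1..1}. \<bar>legendre_antideriv i x\<bar> \<le> C" using compact_imp_bounded by (fastforce simp: bounded_iff)
  then show ?thesis unfolding time_coeff_def using clamped_coord_bounds by blast
qed

lemma time_deriv_bounded: assumes j: "j \<in> {1..M}" shows "\<bar>time_deriv j i s\<bar> \<le> 2 / step t j"
proof (cases "s \<in> {t (j - 1)<..<t j}")
  case True
  then have "\<bar>legendre (i - 1) (ref_coord t j s)\<bar> \<le> 1"
    using ref_coord_bounds(1)[of t j, OF tj[OF j], of s] by (intro abs_legendre_le_1) (auto simp: abs_le_iff)
  then have "2 / step t j * \<bar>legendre (i - 1) (ref_coord t j s)\<bar> \<le> 2 / step t j * 1"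
    using step_pos'[OF j] by (intro mult_left_mono) auto
  then show ?thesis using True step_pos'[OF j] by (simp add: time_deriv_def abs_mult)
next
  case False
  then show ?thesis using step_pos'[OF j] by (simp add: time_deriv_def)
qed

lemma time_deriv_measurable: assumes j: "j \<in> {1..M}" shows "time_deriv j i \<in> borel_measurable borel"
proof -
  have "continuous_on UNIV (\<lambda>s. legendre (i - 1) (ref_coord t j s))"
    by (intro continuous_intros continuous_on_ref_coord[of t j, OF tj[OF j]])
  then have "(\<lambda>s. legendre (i - 1) (ref_coord t j s)) \<in> borel_measurable borel" by (rule borel_measurable_continuous_onI)
  then show ?thesis unfolding time_deriv_def[abs_def] by measurable
qed

lemma DERIV_time_coeff:
  assumes j: "j \<in> {1..M}" and s: "s \<noteq> t (j - 1)" "s \<noteq> t j"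
  shows "(time_coeff j i has_real_derivative time_deriv j i s) (at s)"
proof -
  consider "s < t (j - 1)" | "s \<in> {t (j - 1)<..<t j}" | "t j < s" using s by force
  then show ?thesis
  proof cases
    case 1
    have "((\<lambda>s. legendre_antideriv i (- 1)) has_real_derivative time_deriv j i s) (at s)" using 1 by (simp add: time_deriv_def)
    then show ?thesis
      by (rule has_field_derivative_transform_within_open[of _ _ _ "{..<t (j - 1)}"]) (use 1 clamped_coord_eq(1)[OF j] in \<open>auto simp: time_coeff_def\<close>)
  next
    case 2
    have "((\<lambda>s. legendre_antideriv i (ref_coord t j s)) has_real_derivative time_deriv j i s) (at s)"
      using DERIV_chain2[OF DERIV_legendre_antideriv[of "ref_coord t j s" i] DERIV_ref_coord[of t j, OF tj[OF j]]]
        ref_coord_bounds(1)[of t j, OF tj[OF j], of s] 2 by (simp add: time_deriv_def mult.commute)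
    then show ?thesis
      by (rule has_field_derivative_transform_within_open[of _ _ _ "{t (j - 1)<..<t j}"]) (use 2 clamped_coord_eq(3)[OF j] in \<open>auto simp: time_coeff_def\<close>)
  next
    case 3
    have "((\<lambda>s. legendre_antideriv i 1) has_real_derivative time_deriv j i s) (at s)" using 3 by (simp add: time_deriv_def)
    then show ?thesis
      by (rule has_field_derivative_transform_within_open[of _ _ _ "{t j<..}"]) (use 3 clamped_coord_eq(2)[OF j] in \<open>auto simp: time_coeff_def\<close>)
  qed
qed

text \<open>The reconstruction is a finite sum of elementary products, so its membership in
  \<open>W21\<close> and its time derivative are read off term by term. The minus sign is put into
  the scalar coefficients, so that closure under addition suffices.\<close>

lemma W21_error:
  assumes "W21 \<Omega> T u u'"
  shows "W21 \<Omega> T (\<lambda>s p. u s p - ell_recon s p) (\<lambda>s \<zeta>. u' s \<zeta> - (\<Sum>j=1..M. \<Sum>i=1..L - 1. time_deriv j i s * L2_inner \<Omega> (ell_coeff j i) \<zeta>))"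
proof -
  have T0: "0 \<le> T" using T_pos by simp
  have y0: "W21 \<Omega> T (\<lambda>s p. (- 1) * ell_val 0 p) (\<lambda>s \<zeta>. 0 * L2_inner \<Omega> (ell_val 0) \<zeta>)"
    by (rule W21_elementary[OF op ell_val_H10 T0, of 0 "\<lambda>_. - 1" 1 "{}" "\<lambda>_. 0" 0]) auto
  have "W21 \<Omega> T (\<lambda>s p. (- time_coeff j i s) * ell_coeff j i p) (\<lambda>s \<zeta>. (- time_deriv j i s) * L2_inner \<Omega> (ell_coeff j i) \<zeta>)" if j: "j \<in> {1..M}" and i: "i \<in> {1..L - 1}" for j i
  proof -
    obtain C where C: "\<And>s. \<bar>time_coeff j i s\<bar> \<le> C" using time_coeff_bounded by blast
    show ?thesis
    proof (rule W21_elementary[OF op ell_coeff(1)[OF j i] T0, of "\<lambda>s. - time_coeff j i s" C "{t (j - 1), t j}" "\<lambda>s. - time_deriv j i s" "2 / step t j"])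
      show "continuous_on UNIV (\<lambda>s. - time_coeff j i s)" by (intro continuous_intros continuous_on_time_coeff j)
      show "((\<lambda>s. - time_coeff j i s) has_real_derivative - time_deriv j i s) (at s)" if "s \<in> {0<..<T} - {t (j - 1), t j}" for s
        using that by (intro DERIV_minus DERIV_time_coeff j) auto
    qed (use C time_deriv_bounded[OF j] time_deriv_measurable[OF j] in auto)
  qed
  then have "W21 \<Omega> T (\<lambda>s p. \<Sum>j=1..M. \<Sum>i=1..L - 1. (- time_coeff j i s) * ell_coeff j i p) (\<lambda>s \<zeta>. \<Sum>j=1..M. \<Sum>i=1..L - 1. (- time_deriv j i s) * L2_inner \<Omega> (ell_coeff j i) \<zeta>)"
    by (intro W21_sum op T0) auto
  note W = W21_add[OF op assms W21_add[OF op y0 this]]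
  have e1: "(\<lambda>s p. u s p - ell_recon s p) = (\<lambda>s p. u s p + ((- 1) * ell_val 0 p + (\<Sum>j=1..M. \<Sum>i=1..L - 1. (- time_coeff j i s) * ell_coeff j i p)))"
    by (intro ext) (simp add: ell_recon_def sum_negf)
  have e2: "(\<lambda>s \<zeta>. u' s \<zeta> - (\<Sum>j=1..M. \<Sum>i=1..L - 1. time_deriv j i s * L2_inner \<Omega> (ell_coeff j i) \<zeta>)) =
      (\<lambda>s \<zeta>. u' s \<zeta> + (0 * L2_inner \<Omega> (ell_val 0) \<zeta> + (\<Sum>j=1..M. \<Sum>i=1..L - 1. (- time_deriv j i s) * L2_inner \<Omega> (ell_coeff j i) \<zeta>)))"
    by (intro ext) (simp add: sum_negf)
  show ?thesis unfolding e1 e2 by (rule W)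
qed

text \<open>Past the interval only \<open>N_1 = 2\<close> survives, and twice the half difference is
  the full jump between the two nodal reconstructions.\<close>

lemma time_coeff_sum_right_end:
  assumes j: "j \<in> {1..M}" and s: "t j \<le> s"
  shows "(\<Sum>i=1..L - 1. time_coeff j i s * ell_coeff j i p) = ell_val j p - ell_val (j - 1) p"
proof -
  have "(\<Sum>i=1..L - 1. time_coeff j i s * ell_coeff j i p) = time_coeff j 1 s * ell_coeff j 1 p + (\<Sum>i=2..L - 1. time_coeff j i s * ell_coeff j i p)"
    using L by (subst sum.atLeast_Suc_atMost) (auto simp: numeral_2_eq_2)
  also have "(\<Sum>i=2..L - 1. time_coeff j i s * ell_coeff j i p) = 0"
  proof (intro sum.neutral ballI)
    fix i assume "i \<in> {2..L - 1}"
    then obtain k where "i = k + 2" by (metis atLeastAtMost_iff le_Suc_ex add.commute)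
    then show "time_coeff j i s * ell_coeff j i p = 0" using legendre_antideriv_at_1[of k] clamped_coord_eq(2)[OF j s] by (simp add: time_coeff_def)
  qed
  also have "time_coeff j 1 s * ell_coeff j 1 p = ell_val j p - ell_val (j - 1) p"
    using legendre_antideriv_1[of 1] clamped_coord_eq(2)[OF j s] by (simp add: time_coeff_def ell_coeff_def)
  finally show ?thesis by simp
qed

text \<open>Intervals already passed contribute differences of nodal reconstructions, which
  telescope up to \<open>ell_val (k - 1)\<close>; intervals still to come contribute 0, because
  their clamped coordinate is -1.\<close>

lemma ell_recon_eq:
  assumes k: "k \<in> {1..M}" and s: "s \<in> {t (k - 1)..t k}"
  shows "ell_recon s = (\<lambda>p. ell_val (k - 1) p + (\<Sum>i=1..L - 1. legendre_antideriv i (ref_coord t k s) * ell_coeff k i p))"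
proof
  fix p
  define S where "S j = (\<Sum>i=1..L - 1. time_coeff j i s * ell_coeff j i p)" for j
  have left: "(\<Sum>j=1..n. S j) = ell_val n p - ell_val 0 p" if "n \<le> k - 1" for n
    using that
  proof (induction n)
    case (Suc n)
    have n: "Suc n \<in> {1..M}" using Suc.prems k by auto
    have "t (Suc n) \<le> t (k - 1)" using Suc.prems k by (intro t_mono) auto
    then have "S (Suc n) = ell_val (Suc n) p - ell_val n p" using time_coeff_sum_right_end[OF n, of s p] s by (simp add: S_def)
    then show ?case using Suc by simp
  qed simp
  have right: "S j = 0" if j: "j \<in> {k + 1..M}" for j
  proof -
    have j': "j \<in> {1..M}" using j by auto
    have "t k \<le> t (j - 1)" using j by (intro t_mono) auto
    then have "clamped_coord j s = - 1" using clamped_coord_eq(1)[OF j'] s by auto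
    then show ?thesis by (simp add: S_def time_coeff_def legendre_antideriv_minus_1)
  qed
  have "{1..M} = ({1..k - 1} \<union> {k}) \<union> {k + 1..M}" using k by auto
  then have "(\<Sum>j=1..M. S j) = (\<Sum>j\<in>({1..k - 1} \<union> {k}) \<union> {k + 1..M}. S j)" by simp
  also have "\<dots> = (\<Sum>j\<in>{1..k - 1} \<union> {k}. S j) + (\<Sum>j\<in>{k + 1..M}. S j)" by (intro sum.union_disjoint) auto
  also have "(\<Sum>j\<in>{1..k - 1} \<union> {k}. S j) = (\<Sum>j=1..k - 1. S j) + S k" using k by (subst sum.union_disjoint) auto
  also have "(\<Sum>j\<in>{k + 1..M}. S j) = 0" using right by (intro sum.neutral) blast
  finally have "(\<Sum>j=1..M. S j) = ell_val (k - 1) p - ell_val 0 p + S k" using left[of "k - 1"] by simp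
  then show "ell_recon s p = ell_val (k - 1) p + (\<Sum>i=1..L - 1. legendre_antideriv i (ref_coord t k s) * ell_coeff k i p)"
    using clamped_coord_eq(3)[OF k s] by (simp add: ell_recon_def S_def time_coeff_def)
qed

lemma ell_recon_0: "ell_recon 0 = ell_val 0"
proof
  fix p
  have 1: "1 \<in> {1..M}" using mesh unfolding time_mesh_def by simp
  have t0: "t 0 = 0" using mesh unfolding time_mesh_def by simp
  have s: "0 \<in> {t (1 - 1)..t 1}" using tj(2)[OF 1] t0 by simp
  have r: "ref_coord t 1 0 = - 1" using ref_coord_ends(1)[of t 1, OF tj[OF 1]] t0 by simp
  show "ell_recon 0 p = ell_val 0 p" unfolding ell_recon_eq[OF 1 s] r by (simp add: legendre_antideriv_minus_1)
qed

lemma ell_recon_T: "ell_recon T = ell_val M"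
proof
  fix p
  have M: "M \<in> {1..M}" and tM: "t M = T" using mesh unfolding time_mesh_def by auto
  have s: "T \<in> {t (M - 1)..t M}" using tj(2)[OF M] tM by simp
  have "(\<Sum>i=1..L - 1. time_coeff M i T * ell_coeff M i p) = ell_val M p - ell_val (M - 1) p" using tM by (intro time_coeff_sum_right_end[OF M]) simp
  moreover have "time_coeff M i T = legendre_antideriv i (ref_coord t M T)" for i using clamped_coord_eq(3)[OF M s] by (simp add: time_coeff_def)
  ultimately show "ell_recon T p = ell_val M p" unfolding ell_recon_eq[OF M s] by simp
qed

lemma ell_recon_H10: "k \<in> {1..M} \<Longrightarrow> s \<in> {t (k - 1)..t k} \<Longrightarrow> ell_recon s \<in> H10 \<Omega>"
  unfolding ell_recon_eq by (intro V.add_in V.sum_in V.scale_in ell_val_H10 ell_coeff) auto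

lemma a_ell_recon:
  assumes k: "k \<in> {1..M}" and s: "s \<in> {t (k - 1)..t k}" and z: "\<zeta> \<in> H10 \<Omega>"
  shows "a (ell_recon s) \<zeta> = L2_inner \<Omega> (ell_rhs (k - 1)) \<zeta> + (\<Sum>i=1..L - 1. legendre_antideriv i (ref_coord t k s) * L2_inner \<Omega> (ell_rhs_coeff k i) \<zeta>)"
proof -
  let ?N = "\<lambda>i. legendre_antideriv i (ref_coord t k s)"
  have y: "(\<lambda>p. ?N i * ell_coeff k i p) \<in> H10 \<Omega>" if "i \<in> {1..L - 1}" for i using that k by (intro V.scale_in ell_coeff)
  have y0: "ell_val (k - 1) \<in> H10 \<Omega>" using k by (intro ell_val_H10) auto
  have "a (ell_recon s) \<zeta> = a (ell_val (k - 1)) \<zeta> + a (\<lambda>p. \<Sum>i=1..L - 1. ?N i * ell_coeff k i p) \<zeta>"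
    unfolding ell_recon_eq[OF k s] by (intro a_add y0 V.sum_in y z)
  also have "a (\<lambda>p. \<Sum>i=1..L - 1. ?N i * ell_coeff k i p) \<zeta> = (\<Sum>i=1..L - 1. a (\<lambda>p. ?N i * ell_coeff k i p) \<zeta>)"
    by (intro a_sum y z) auto
  also have "\<dots> = (\<Sum>i=1..L - 1. ?N i * L2_inner \<Omega> (ell_rhs_coeff k i) \<zeta>)"
    by (intro sum.cong refl) (simp add: a_scale[OF ell_coeff(1)[OF k] z] ell_coeff(2)[OF k _ z])
  finally show ?thesis using a_ell_val[OF pred_le_M(2)[OF k] z] by simp
qed

text \<open>The coefficient of \<open>P_(L-2)\<close> in
  \<open>\<psi> + \<partial>\<^sub>t u\<^sub>h\<close> on the interval with index \<open>k\<close>.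
  The only other coefficient that survives the telescoping is that of \<open>P_(L-1)\<close>, a
  multiple of \<open>\<Delta>\<psi> k (L - 1)\<close>.\<close>

definition "res_low k = (\<lambda>y. residual_factor (L - 2) * \<Delta>\<psi> k (L - 2) y + 2 / step t k * \<Delta>u k (L - 1) y)"

lemma res_low_L2: "k \<in> {1..M} \<Longrightarrow> res_low k \<in> L2 \<Omega>"
  unfolding res_low_def using L by (intro L2.add_in L2.scale_in Vh_L2 Dpsi_Vh Du_Vh) auto

text \<open>The image of \<open>u - y\<close> under the parabolic operator at time \<open>s\<close>,
  tested with \<open>\<zeta>\<close>. The terms are the interpolation defect of the data, the two
  telescoped Legendre terms, and the time derivative of \<open>y - u_h\<close>.\<close>

definition "resid k \<zeta> s = L2_inner \<Omega> (\<lambda>y. f s y - fh s y) \<zeta>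
   - (legendre (L - 2) (ref_coord t k s) * L2_inner \<Omega> (res_low k) \<zeta>
      + 1 / (2 * real L - 3) * (legendre (L - 1) (ref_coord t k s) * L2_inner \<Omega> (\<Delta>\<psi> k (L - 1)) \<zeta>)
      + (\<Sum>i=1..L - 1. 2 / step t k * (legendre (i - 1) (ref_coord t k s) * L2_inner \<Omega> (\<lambda>y. ell_coeff k i y - \<Delta>u k i y) \<zeta>)))"

lemma fh_inner:
  assumes k: "k \<in> {1..M}" and s: "s \<in> {t (k - 1)..t k}" and z: "\<zeta> \<in> L2 \<Omega>"
  shows "L2_inner \<Omega> (fh s) \<zeta> = L2_inner \<Omega> (fh (t (k - 1))) \<zeta> + (\<Sum>i=1..L - 1. legendre_antideriv i (ref_coord t k s) * L2_inner \<Omega> (\<Delta>f k i) \<zeta>)"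
proof -
  let ?N = "\<lambda>i. legendre_antideriv i (ref_coord t k s)"
  have "fh s y = fh (t (k - 1)) y + (\<Sum>i=1..L - 1. ?N i * \<Delta>f k i y)" for y
    using fh_expansion[OF k s, of y] expansion_shifted_eq[OF ref_coord_ge[OF k s] L, of "\<lambda>i. \<Delta>f k i y"] fh_ends(1)[OF k, of y] by simp
  then have eq: "fh s = (\<lambda>y. fh (t (k - 1)) y + (\<Sum>i=1..L - 1. ?N i * \<Delta>f k i y))" by (rule ext)
  have "L2_inner \<Omega> (fh s) \<zeta> = L2_inner \<Omega> (fh (t (k - 1))) \<zeta> + L2_inner \<Omega> (\<lambda>y. \<Sum>i=1..L - 1. ?N i * \<Delta>f k i y) \<zeta>"
    unfolding eq using k z by (intro L2.B_add fh_nodal_L2 L2.sum_in L2.scale_in Df_L2) auto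
  also have "L2_inner \<Omega> (\<lambda>y. \<Sum>i=1..L - 1. ?N i * \<Delta>f k i y) \<zeta> = (\<Sum>i=1..L - 1. L2_inner \<Omega> (\<lambda>y. ?N i * \<Delta>f k i y) \<zeta>)"
    using k z by (intro L2_inner_sum L2.scale_in Df_L2) auto
  also have "\<dots> = (\<Sum>i=1..L - 1. ?N i * L2_inner \<Omega> (\<Delta>f k i) \<zeta>)"
    using k z by (intro sum.cong refl L2.B_scale Df_L2) auto
  finally show ?thesis .
qed

text \<open>Pairing with \<open>\<zeta>\<close> turns the functions into numbers that obey the same
  recursion, so the scalar telescoping identity applies.\<close>

lemma psi_telescope:
  assumes k: "k \<in> {1..M}" and s: "s \<in> {t (k - 1)..t k}" and z: "\<zeta> \<in> L2 \<Omega>"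
  shows "L2_inner \<Omega> (\<psi> (k - 1)) \<zeta> + (\<Sum>i=1..L - 1. legendre_antideriv i (ref_coord t k s) * L2_inner \<Omega> (\<Delta>\<psi> k i) \<zeta>)
      + (\<Sum>i=1..L - 1. 2 / step t k * legendre (i - 1) (ref_coord t k s) * L2_inner \<Omega> (\<Delta>u k i) \<zeta>)
    = legendre (L - 2) (ref_coord t k s) * L2_inner \<Omega> (res_low k) \<zeta>
      + legendre (L - 1) (ref_coord t k s) * (L2_inner \<Omega> (\<Delta>\<psi> k (L - 1)) \<zeta> / (2 * real L - 3))"
proof -
  let ?x = "ref_coord t k s" and ?r = "2 / step t k"
  define P where "P i = L2_inner \<Omega> (\<Delta>\<psi> k i) \<zeta>" for i
  define U where "U i = L2_inner \<Omega> (\<Delta>u k i) \<zeta>" for i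
  have pL: "\<Delta>\<psi> k i \<in> L2 \<Omega>" and uL: "\<Delta>u k i \<in> L2 \<Omega>" if "i \<le> L - 1" for i
    using Vh_L2[OF Dpsi_Vh[OF k that]] Vh_L2[OF Du_Vh[OF k that]] .
  have comb: "L2_inner \<Omega> (\<lambda>y. c * \<Delta>\<psi> k i y + e * \<Delta>u k j y) \<zeta> = c * P i + e * U j" if "i \<le> L - 1" "j \<le> L - 1" for c e i j
    unfolding L2.B_add[OF L2.scale_in[OF pL[OF that(1)]] L2.scale_in[OF uL[OF that(2)]] z] L2.B_scale[OF pL[OF that(1)] z] L2.B_scale[OF uL[OF that(2)] z] P_def U_def ..
  have "\<psi> (k - 1) = (\<lambda>y. \<Delta>\<psi> k 0 y - \<Delta>\<psi> k 1 y)" unfolding Dpsi01[OF k] by (auto simp: field_simps)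
  then have p0: "L2_inner \<Omega> (\<psi> (k - 1)) \<zeta> = P 0 - P 1"
    using L2_inner_diff[OF pL pL z, of 0 1] L by (simp add: P_def)
  have base: "P 2 / 3 = P 0 + ?r * U 1" if "2 < L"
  proof -
    have "(\<lambda>y. \<Delta>\<psi> k 2 y / 3) = (\<lambda>y. 1 * \<Delta>\<psi> k 0 y + ?r * \<Delta>u k 1 y)" using Dpsi_2[OF k that] by (simp add: fun_eq_iff)
    then have "L2_inner \<Omega> (\<lambda>y. \<Delta>\<psi> k 2 y / 3) \<zeta> = 1 * P 0 + ?r * U 1" using comb[of 0 1 1 ?r] that by simp
    then show ?thesis using L2_inner_divide[OF pL z, of 2 3] that by (simp add: P_def)
  qed
  have rec: "P (i + 2) / (2 * real i + 3) = P i / (2 * real i - 1) + ?r * U (i + 1)" if i: "1 \<le> i" "i \<le> L - 3" for i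
  proof -
    have iL: "i + 2 \<le> L - 1" using i by linarith
    have "(\<lambda>y. \<Delta>\<psi> k (i + 2) y / (2 * real i + 3)) = (\<lambda>y. (1 / (2 * real i - 1)) * \<Delta>\<psi> k i y + ?r * \<Delta>u k (i + 1) y)"
      using Dpsi_rec[OF k, of i] i by (simp add: fun_eq_iff)
    then have "L2_inner \<Omega> (\<lambda>y. \<Delta>\<psi> k (i + 2) y / (2 * real i + 3)) \<zeta> = (1 / (2 * real i - 1)) * P i + ?r * U (i + 1)"
      using comb[of i "i + 1" "1 / (2 * real i - 1)" ?r] iL by simp
    then show ?thesis using L2_inner_divide[OF pL z, of "i + 2" "2 * real i + 3"] iL by (simp add: P_def)
  qed
  have w: "L2_inner \<Omega> (res_low k) \<zeta> = residual_factor (L - 2) * P (L - 2) + ?r * U (L - 1)"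
    unfolding res_low_def by (rule comb) auto
  have "P 0 + P 1 * legendre 1 ?x + (\<Sum>i=2..L - 1. P i * legendre_antideriv i ?x) = (P 0 - P 1) + (\<Sum>i=1..L - 1. legendre_antideriv i ?x * P i)"
    using ref_coord_ge[OF k s] L by (rule expansion_shifted_eq)
  moreover have "P 0 + ?x * P 1 + (\<Sum>i=2..L - 1. legendre_antideriv i ?x * P i) + (\<Sum>i=1..L - 1. ?r * legendre (i - 1) ?x * U i)
    = legendre (L - 2) ?x * (residual_factor (L - 2) * P (L - 2) + ?r * U (L - 1)) + legendre (L - 1) ?x * (P (L - 1) / (2 * real L - 3))"
    using ref_coord_ge[OF k s] L base rec by (rule residual_telescope)
  ultimately show ?thesis unfolding p0 w P_def[symmetric] U_def[symmetric] by (simp add: mult.commute)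
qed

text \<open>The time derivative of \<open>y\<close> is split into that of \<open>y - u_h\<close> and
  that of \<open>u_h\<close>; the latter telescopes against \<open>\<psi>\<close>, which enters
  through the elliptic form of \<open>y\<close>.\<close>

lemma integrand_eq:
  assumes k: "k \<in> {1..M}" and s: "s \<in> {t (k - 1)<..<t k}" and us: "u s \<in> H10 \<Omega>" and z: "\<zeta> \<in> H10 \<Omega>"
    and pde: "u'v + a (u s) \<zeta> = L2_inner \<Omega> (f s) \<zeta>"
  shows "u'v - (\<Sum>j=1..M. \<Sum>i=1..L - 1. time_deriv j i s * L2_inner \<Omega> (ell_coeff j i) \<zeta>) + a (\<lambda>p. u s p - ell_recon s p) \<zeta> = resid k \<zeta> s"
proof -
  let ?x = "ref_coord t k s" and ?r = "2 / step t k"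
  have sc: "s \<in> {t (k - 1)..t k}" using s by auto
  have zL: "\<zeta> \<in> L2 \<Omega>" using z by (rule H10_L2)
  \<comment> \<open>An interior point of the interval with index \<open>k\<close> lies in no other
    open mesh interval, so a single summand over \<open>j\<close> remains.\<close>
  have dd0: "time_deriv j i s = 0" if j: "j \<in> {1..M}" "j \<noteq> k" for j i
  proof -
    have "s \<notin> {t (j - 1)<..<t j}"
    proof (cases "j < k")
      case True
      then have "t j \<le> t (k - 1)" using k by (intro t_mono) auto
      then show ?thesis using s by auto
    next
      case False
      then have "t k \<le> t (j - 1)" using j by (intro t_mono) auto
      then show ?thesis using s by auto
    qed
    then show ?thesis by (simp add: time_deriv_def)
  qed
  have "(\<Sum>j=1..M. \<Sum>i=1..L - 1. time_deriv j i s * L2_inner \<Omega> (ell_coeff j i) \<zeta>) = (\<Sum>j=1..M. if j = k then (\<Sum>i=1..L - 1. time_deriv k i s * L2_inner \<Omega> (ell_coeff k i) \<zeta>) else 0)"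
    using dd0 by (intro sum.cong refl) auto
  also have "\<dots> = (\<Sum>i=1..L - 1. time_deriv k i s * L2_inner \<Omega> (ell_coeff k i) \<zeta>)" using k by simp
  also have "\<dots> = (\<Sum>i=1..L - 1. ?r * (legendre (i - 1) ?x * L2_inner \<Omega> (\<lambda>y. ell_coeff k i y - \<Delta>u k i y) \<zeta>)) + (\<Sum>i=1..L - 1. ?r * legendre (i - 1) ?x * L2_inner \<Omega> (\<Delta>u k i) \<zeta>)"
    unfolding sum.distrib[symmetric]
  proof (intro sum.cong refl)
    fix i assume i: "i \<in> {1..L - 1}"
    have "L2_inner \<Omega> (\<lambda>y. ell_coeff k i y - \<Delta>u k i y) \<zeta> = L2_inner \<Omega> (ell_coeff k i) \<zeta> - L2_inner \<Omega> (\<Delta>u k i) \<zeta>"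
      using i by (intro L2_inner_diff[OF H10_L2[OF ell_coeff(1)[OF k i]] Vh_L2[OF Du_Vh[OF k]] zL]) simp
    then have e: "L2_inner \<Omega> (ell_coeff k i) \<zeta> = L2_inner \<Omega> (\<lambda>y. ell_coeff k i y - \<Delta>u k i y) \<zeta> + L2_inner \<Omega> (\<Delta>u k i) \<zeta>" by simp
    have d: "time_deriv k i s = ?r * legendre (i - 1) ?x" using s by (simp add: time_deriv_def)
    show "time_deriv k i s * L2_inner \<Omega> (ell_coeff k i) \<zeta> = ?r * (legendre (i - 1) ?x * L2_inner \<Omega> (\<lambda>y. ell_coeff k i y - \<Delta>u k i y) \<zeta>) + ?r * legendre (i - 1) ?x * L2_inner \<Omega> (\<Delta>u k i) \<zeta>"
      unfolding e d by (simp add: distrib_left mult.assoc)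
  qed
  finally have ddsum: "(\<Sum>j=1..M. \<Sum>i=1..L - 1. time_deriv j i s * L2_inner \<Omega> (ell_coeff j i) \<zeta>) = \<dots>" .
  have asub: "a (\<lambda>p. u s p - ell_recon s p) \<zeta> = a (u s) \<zeta> - a (ell_recon s) \<zeta>" by (rule a_diff[OF us ell_recon_H10[OF k sc] z])
  have ell_rhs: "L2_inner \<Omega> (ell_rhs (k - 1)) \<zeta> = L2_inner \<Omega> (fh (t (k - 1))) \<zeta> + L2_inner \<Omega> (\<psi> (k - 1)) \<zeta>"
    unfolding ell_rhs_def by (rule L2.B_add[OF fh_nodal_L2[OF pred_le_M(2)[OF k]] Vh_L2[OF psi(1)[OF pred_le_M(2)[OF k]]] zL])
  have ell_rhs_coeff: "L2_inner \<Omega> (ell_rhs_coeff k i) \<zeta> = L2_inner \<Omega> (\<Delta>f k i) \<zeta> + L2_inner \<Omega> (\<Delta>\<psi> k i) \<zeta>" if "i \<in> {1..L - 1}" for i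
    unfolding ell_rhs_coeff_def using that by (intro L2.B_add[OF Df_L2[OF k] Vh_L2[OF Dpsi_Vh[OF k]] zL]) auto
  have "(\<Sum>i=1..L - 1. legendre_antideriv i ?x * L2_inner \<Omega> (ell_rhs_coeff k i) \<zeta>) =
        (\<Sum>i=1..L - 1. legendre_antideriv i ?x * L2_inner \<Omega> (\<Delta>f k i) \<zeta>) + (\<Sum>i=1..L - 1. legendre_antideriv i ?x * L2_inner \<Omega> (\<Delta>\<psi> k i) \<zeta>)"
    unfolding sum.distrib[symmetric] by (intro sum.cong refl) (simp add: ell_rhs_coeff distrib_left)
  then have arec: "a (ell_recon s) \<zeta> = L2_inner \<Omega> (fh s) \<zeta> + (L2_inner \<Omega> (\<psi> (k - 1)) \<zeta> + (\<Sum>i=1..L - 1. legendre_antideriv i ?x * L2_inner \<Omega> (\<Delta>\<psi> k i) \<zeta>))"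
    unfolding a_ell_recon[OF k sc z] ell_rhs fh_inner[OF k sc zL] by simp
  have "s \<in> {0..T}" using sc tj[OF k] by auto
  then have "f s \<in> L2 \<Omega>" using data(1) unfolding continuous_into_L2_def by blast
  then have fd: "L2_inner \<Omega> (\<lambda>y. f s y - fh s y) \<zeta> = L2_inner \<Omega> (f s) \<zeta> - L2_inner \<Omega> (fh s) \<zeta>"
    using fh_L2[OF k sc] zL by (rule L2_inner_diff)
  show ?thesis
    unfolding resid_def fd asub ddsum arec using psi_telescope[OF k sc zL] pde by simp
qed

end

section \<open>The error estimate\<close>

lemma ennreal_abs_add: "ennreal \<bar>p + q\<bar> \<le> ennreal \<bar>p\<bar> + ennreal \<bar>q\<bar>"
  by (simp flip: ennreal_plus add: abs_triangle_ineq ennreal_leI)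

lemma ennreal_abs_diff: "ennreal \<bar>p - q\<bar> \<le> ennreal \<bar>p\<bar> + ennreal \<bar>q\<bar>"
  using ennreal_abs_add[of p "- q"] by simp

lemma ennreal_abs_sum: "ennreal \<bar>\<Sum>i\<in>I. p i\<bar> \<le> (\<Sum>i\<in>I. ennreal \<bar>p i\<bar>)"
  by (simp add: sum_abs ennreal_leI)

lemma ennreal_sum_not_top:
  fixes g :: "'i \<Rightarrow> ennreal"
  assumes "finite I" "(\<Sum>i\<in>I. g i) \<noteq> top_class.top" "i \<in> I"
  shows "g i \<noteq> top_class.top"
  using assms member_le_sum[of i I g] by (auto simp: top_unique)

context scheme
begin

lemma sigma_pos': "0 < sigma \<gamma> T t k"
  by (simp add: sigma_def)

section \<open>Bounds on one mesh interval for a fixed point \<open>x\<close>\<close>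

context
  fixes x k
  assumes x: "x \<in> closure \<Omega>" and k: "k \<in> {1..M}"
begin

lemma piece_integrable:
  assumes "w \<in> L2 \<Omega>" "Linf_norm \<Omega> w \<noteq> top_class.top"
  shows "integrable (lebesgue_on {t (k - 1)<..<t k}) (\<lambda>s. legendre i (ref_coord t k s) * L2_inner \<Omega> w (G x (T - s)))"
  using assms weighted_pairing_integrable[of t k x w "enn2real (Linf_norm \<Omega> w)", OF tj[OF k] x]
  by (simp add: less_top[symmetric])

text \<open>The factor \<open>e\<close> stands for 1 in the term with \<open>P_(L-2)\<close> and for
  \<open>1 / (2 L - 3)\<close> in the term with \<open>P_(L-1)\<close>.\<close>

lemma piece_bound_mu:
  assumes w: "w \<in> L2 \<Omega>" "Linf_norm \<Omega> w \<noteq> top_class.top" and e: "0 \<le> e"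
  shows "ennreal \<bar>e * (LINT s|lebesgue_on {t (k - 1)<..<t k}. legendre i (ref_coord t k s) * L2_inner \<Omega> w (G x (T - s)))\<bar>
    \<le> ennreal (sigma \<gamma> T t k) * (ennreal (mu \<kappa>0 \<kappa>1 \<kappa>1' T t k i * e) * Linf_norm \<Omega> w)"
proof -
  define C where "C = enn2real (Linf_norm \<Omega> w)"
  have C: "0 \<le> C" "Linf_norm \<Omega> w = ennreal C" using w(2) by (auto simp: C_def less_top)
  let ?m = "mu \<kappa>0 \<kappa>1 \<kappa>1' T t k i"
  have m: "0 < ?m" by (rule mu_pos[of t k, OF tj[OF k]])
  have "\<bar>e * (LINT s|lebesgue_on {t (k - 1)<..<t k}. legendre i (ref_coord t k s) * L2_inner \<Omega> w (G x (T - s)))\<bar> \<le> e * (C * sigma \<gamma> T t k * ?m)"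
    unfolding abs_mult using e weighted_pairing_bound[of t k x w C i, OF tj[OF k] x w(1) C(1)] C(2) by (simp add: mult_left_mono)
  also have "\<dots> = sigma \<gamma> T t k * (?m * e * C)" by simp
  finally show ?thesis using C e m sigma_pos' by (simp add: ennreal_mult[symmetric] less_imp_le ennreal_leI)
qed

text \<open>Direct estimate without integration by parts; the factor \<open>2 / step t k\<close>
  from differentiating in time cancels \<open>step t k / 2\<close> from the change of
  variable.\<close>

lemma piece_bound_norm1:
  assumes w: "w \<in> L2 \<Omega>" "Linf_norm \<Omega> w \<noteq> top_class.top"
  shows "ennreal \<bar>2 / step t k * (LINT s|lebesgue_on {t (k - 1)<..<t k}. legendre i (ref_coord t k s) * L2_inner \<Omega> w (G x (T - s)))\<bar>
    \<le> ennreal \<kappa>0 * (ennreal (sigma \<gamma> T t k) * (Linf_norm \<Omega> w * ennreal (norm1 (legendre i))))"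
proof -
  define C where "C = enn2real (Linf_norm \<Omega> w)"
  have C: "0 \<le> C" "Linf_norm \<Omega> w = ennreal C" using w(2) by (auto simp: C_def less_top)
  let ?I = "LINT s|lebesgue_on {t (k - 1)<..<t k}. legendre i (ref_coord t k s) * L2_inner \<Omega> w (G x (T - s))"
  have "\<bar>?I\<bar> \<le> C * sigma \<gamma> T t k * (\<kappa>0 * step t k / 2 * norm1 (legendre i))"
    by (rule order_trans[OF integral_abs_bound weighted_pairing_L1_bound[of t k x w C i, OF tj[OF k] x w(1) C(1)]]) (simp add: C(2))
  then have "2 / step t k * \<bar>?I\<bar> \<le> 2 / step t k * (C * sigma \<gamma> T t k * (\<kappa>0 * step t k / 2 * norm1 (legendre i)))"
    using step_pos'[OF k] by (intro mult_left_mono) auto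
  also have "\<dots> = \<kappa>0 * (sigma \<gamma> T t k * (C * norm1 (legendre i)))" using step_pos'[OF k] by simp
  finally have "\<bar>2 / step t k * ?I\<bar> \<le> \<kappa>0 * (sigma \<gamma> T t k * (C * norm1 (legendre i)))" using step_pos'[OF k] by (simp add: abs_mult)
  then show ?thesis using C norm1_legendre_pos[of i] sigma_pos' nonneg by (simp add: ennreal_mult[symmetric] less_imp_le ennreal_leI)
qed

text \<open>Both arguments of the pairing vary in time. For \<open>f\<close> strong continuity into
  \<open>L2\<close> is used; for \<open>fh\<close> the expansion into fixed \<open>L2\<close>
  functions with continuous scalar coefficients. The result supplies measurability in time.\<close>

lemma defect_continuous:
  "continuous_on {t (k - 1)<..<t k} (\<lambda>s. L2_inner \<Omega> (\<lambda>y. f s y - fh s y) (G x (T - s)))"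
proof -
  let ?I = "{t (k - 1)<..<t k}"
  have sub: "?I \<subseteq> {0..T}" "?I \<subseteq> {..<T}" "?I \<subseteq> {t (k - 1)..t k}" using tj[OF k] by auto
  have GL: "G x (T - s) \<in> L2 \<Omega>" if "s \<in> ?I" for s using that sub(2) by (intro G_L2 x) auto
  have fL: "f s \<in> L2 \<Omega>" if "s \<in> ?I" for s using that sub(1) data(1) unfolding continuous_into_L2_def by blast
  have G_lim: "((\<lambda>r. L2_norm \<Omega> (\<lambda>y. G x (T - r) y - G x (T - s) y)) \<longlongrightarrow> 0) (at s within ?I)" if s: "s \<in> ?I" for s
  proof -
    have "((\<lambda>r. L2_norm \<Omega> (\<lambda>y. G x r y - G x (T - s) y)) \<longlongrightarrow> 0) (at (T - s))" using s sub(2) by (intro G_continuous x) auto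
    moreover have "filterlim (\<lambda>r. T - r) (at (T - s)) (at s within ?I)"
      unfolding filterlim_at by (intro conjI tendsto_intros) (auto simp: eventually_at_filter)
    ultimately show ?thesis by (rule filterlim_compose)
  qed
  have c1: "continuous_on ?I (\<lambda>s. L2_inner \<Omega> (f s) (G x (T - s)))"
  proof (rule continuous_on_L2_inner[OF fL GL _ G_lim])
    fix s assume s: "s \<in> ?I"
    then have "((\<lambda>r. L2_norm \<Omega> (\<lambda>y. f r y - f s y)) \<longlongrightarrow> 0) (at s within {0..T})"
      using data(1) sub(1) unfolding continuous_into_L2_def by blast
    then show "((\<lambda>r. L2_norm \<Omega> (\<lambda>y. f r y - f s y)) \<longlongrightarrow> 0) (at s within ?I)" using sub(1) by (rule tendsto_within_subset)
  qed
  have c2: "continuous_on ?I (\<lambda>s. L2_inner \<Omega> (fh (t (k - 1))) (G x (T - s)) + (\<Sum>i=1..L - 1. legendre_antideriv i (ref_coord t k s) * L2_inner \<Omega> (\<Delta>f k i) (G x (T - s))))"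
  proof (intro continuous_on_add continuous_on_sum continuous_on_mult)
    show "continuous_on ?I (\<lambda>s. L2_inner \<Omega> (fh (t (k - 1))) (G x (T - s)))"
      using continuous_on_L2_inner_G[OF x fh_nodal_L2[OF pred_le_M(2)[OF k]]] sub(2) by (rule continuous_on_subset)
    fix i assume i: "i \<in> {1..L - 1}"
    show "continuous_on ?I (\<lambda>s. legendre_antideriv i (ref_coord t k s))"
      by (rule continuous_on_compose2[OF continuous_on_legendre_antideriv[of 1] continuous_on_ref_coord[of t k, OF tj[OF k]]])
        (use ref_coord_bounds(1)[of t k, OF tj[OF k]] in force)
    have "\<Delta>f k i \<in> L2 \<Omega>" using i by (intro Df_L2 k) simp
    then show "continuous_on ?I (\<lambda>s. L2_inner \<Omega> (\<Delta>f k i) (G x (T - s)))"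
      using continuous_on_L2_inner_G[OF x] sub(2) continuous_on_subset by blast
  qed
  have eq: "L2_inner \<Omega> (\<lambda>y. f s y - fh s y) (G x (T - s)) = L2_inner \<Omega> (f s) (G x (T - s)) -
     (L2_inner \<Omega> (fh (t (k - 1))) (G x (T - s)) + (\<Sum>i=1..L - 1. legendre_antideriv i (ref_coord t k s) * L2_inner \<Omega> (\<Delta>f k i) (G x (T - s))))"
    if s: "s \<in> ?I" for s
  proof -
    have sc: "s \<in> {t (k - 1)..t k}" using s by auto
    show ?thesis unfolding L2_inner_diff[OF fL[OF s] fh_L2[OF k sc] GL[OF s]] fh_inner[OF k sc GL[OF s]] ..
  qed
  show ?thesis by (rule continuous_on_eq[OF continuous_on_diff[OF c1 c2] eq[symmetric]])
qed

text \<open>The constant is kept on the side of the pairing, which is known to be measurable in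
  time, so that it can be taken out of an integral there. For the norm on the right measurability in
  time is not established.\<close>

lemma defect_pointwise:
  assumes s: "s \<in> {t (k - 1)<..<t k}"
  shows "ennreal (\<bar>L2_inner \<Omega> (\<lambda>y. f s y - fh s y) (G x (T - s))\<bar> / (\<kappa>0 * sigma \<gamma> T t k)) \<le> Linf_norm \<Omega> (\<lambda>y. f s y - fh s y)"
proof (cases "Linf_norm \<Omega> (\<lambda>y. f s y - fh s y) = top_class.top")
  case False
  define C where "C = enn2real (Linf_norm \<Omega> (\<lambda>y. f s y - fh s y))"
  have C: "0 \<le> C" "Linf_norm \<Omega> (\<lambda>y. f s y - fh s y) = ennreal C" using False by (auto simp: C_def less_top)
  have "s \<in> {0..T}" using s tj[OF k] by auto
  then have "f s \<in> L2 \<Omega>" using data(1) unfolding continuous_into_L2_def by blast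
  then have fL: "(\<lambda>y. f s y - fh s y) \<in> L2 \<Omega>" using s by (intro L2.diff_in fh_L2[OF k]) auto
  have "\<bar>L2_inner \<Omega> (\<lambda>y. f s y - fh s y) (G x (T - s))\<bar> \<le> C * \<kappa>0 * sigma \<gamma> T t k"
    using s tj[OF k] C(2) by (intro pairing_sigma[of t k x "\<lambda>y. f s y - fh s y" C s, OF tj[OF k] x fL C(1)]) auto
  moreover have "0 < \<kappa>0 * sigma \<gamma> T t k" using kappa0_ge_1 sigma_pos' by simp
  ultimately have "\<bar>L2_inner \<Omega> (\<lambda>y. f s y - fh s y) (G x (T - s))\<bar> / (\<kappa>0 * sigma \<gamma> T t k) \<le> C" by (simp add: pos_divide_le_eq mult.assoc)
  then show ?thesis unfolding C(2) by (rule ennreal_leI)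
qed simp

lemma defect_nn_bound:
  "(\<integral>\<^sup>+s. ennreal \<bar>L2_inner \<Omega> (\<lambda>y. f s y - fh s y) (G x (T - s))\<bar> \<partial>lebesgue_on {t (k - 1)<..<t k})
    \<le> ennreal \<kappa>0 * (ennreal (sigma \<gamma> T t k) * (\<integral>\<^sup>+s\<in>{t (k - 1)<..<t k}. Linf_norm \<Omega> (\<lambda>y. f s y - fh s y) \<partial>lborel))"
proof -
  let ?I = "{t (k - 1)<..<t k}" and ?c = "\<kappa>0 * sigma \<gamma> T t k"
  let ?h = "\<lambda>s. L2_inner \<Omega> (\<lambda>y. f s y - fh s y) (G x (T - s))"
  have c: "0 < ?c" using kappa0_ge_1 sigma_pos' by simp
  have nz: "\<kappa>0 \<noteq> 0" "sigma \<gamma> T t k \<noteq> 0" using kappa0_ge_1 sigma_pos'[of k] by auto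
  have hm: "?h \<in> borel_measurable (lebesgue_on ?I)"
    by (intro continuous_imp_measurable_on_sets_lebesgue defect_continuous) auto
  have "(\<integral>\<^sup>+s. ennreal \<bar>?h s\<bar> \<partial>lebesgue_on ?I) = (\<integral>\<^sup>+s. ennreal ?c * ennreal (\<bar>?h s\<bar> / ?c) \<partial>lebesgue_on ?I)"
    using c by (intro nn_integral_cong) (simp add: ennreal_mult[symmetric] nz)
  also have "\<dots> = ennreal ?c * (\<integral>\<^sup>+s. ennreal (\<bar>?h s\<bar> / ?c) \<partial>lebesgue_on ?I)" using hm by (intro nn_integral_cmult) simp
  also have "\<dots> \<le> ennreal ?c * (\<integral>\<^sup>+s. Linf_norm \<Omega> (\<lambda>y. f s y - fh s y) \<partial>lebesgue_on ?I)"
    by (intro mult_left_mono nn_integral_mono defect_pointwise) (auto simp: space_restrict_space)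
  also have "(\<integral>\<^sup>+s. Linf_norm \<Omega> (\<lambda>y. f s y - fh s y) \<partial>lebesgue_on ?I) = (\<integral>\<^sup>+s\<in>?I. Linf_norm \<Omega> (\<lambda>y. f s y - fh s y) \<partial>lborel)"
    by (simp add: nn_integral_restrict_space nn_integral_completion)
  finally show ?thesis using nonneg sigma_pos' by (simp add: ennreal_mult less_imp_le mult.assoc)
qed

context
  assumes fin_f: "(\<integral>\<^sup>+s\<in>{t (k - 1)<..<t k}. Linf_norm \<Omega> (\<lambda>y. f s y - fh s y) \<partial>lborel) \<noteq> top_class.top"
    and fin_res_low: "Linf_norm \<Omega> (res_low k) \<noteq> top_class.top" and fin_psi: "Linf_norm \<Omega> (\<Delta>\<psi> k (L - 1)) \<noteq> top_class.top"
    and fin_ell: "\<And>i. i \<in> {1..L - 1} \<Longrightarrow> \<eta> (\<Delta>u k i) (ell_rhs_coeff k i) \<noteq> top_class.top"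
begin

lemma defect_integrable:
  "integrable (lebesgue_on {t (k - 1)<..<t k}) (\<lambda>s. L2_inner \<Omega> (\<lambda>y. f s y - fh s y) (G x (T - s)))"
proof (rule integrableI_bounded)
  show "(\<lambda>s. L2_inner \<Omega> (\<lambda>y. f s y - fh s y) (G x (T - s))) \<in> borel_measurable (lebesgue_on {t (k - 1)<..<t k})"
    by (intro continuous_imp_measurable_on_sets_lebesgue defect_continuous) auto
  show "(\<integral>\<^sup>+s. ennreal (norm (L2_inner \<Omega> (\<lambda>y. f s y - fh s y) (G x (T - s)))) \<partial>lebesgue_on {t (k - 1)<..<t k}) < \<infinity>"
    using order.strict_trans1[OF defect_nn_bound] fin_f by (simp add: ennreal_mult_less_top less_top)
qed

lemma coefficient_error:
  assumes i: "i \<in> {1..L - 1}"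
  shows "(\<lambda>y. ell_coeff k i y - \<Delta>u k i y) \<in> L2 \<Omega>" "Linf_norm \<Omega> (\<lambda>y. ell_coeff k i y - \<Delta>u k i y) \<le> \<eta> (\<Delta>u k i) (ell_rhs_coeff k i)"
    "Linf_norm \<Omega> (\<lambda>y. ell_coeff k i y - \<Delta>u k i y) \<noteq> top_class.top"
proof -
  show "(\<lambda>y. ell_coeff k i y - \<Delta>u k i y) \<in> L2 \<Omega>" using i by (intro L2.diff_in[OF H10_L2[OF ell_coeff(1)[OF k i]] Vh_L2[OF Du_Vh[OF k]]]) simp
  show le: "Linf_norm \<Omega> (\<lambda>y. ell_coeff k i y - \<Delta>u k i y) \<le> \<eta> (\<Delta>u k i) (ell_rhs_coeff k i)"
    using estimator_coefficient[OF k i] by (subst Linf_norm_minus)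
  show "Linf_norm \<Omega> (\<lambda>y. ell_coeff k i y - \<Delta>u k i y) \<noteq> top_class.top" using le fin_ell[OF i] by (auto simp: top_unique)
qed

text \<open>The residual is a finite combination of integrable pieces. The Legendre terms of
  \<open>\<psi> + \<partial>\<^sub>t u\<^sub>h\<close> use the weights \<open>mu\<close>; the
  elliptic terms use the direct estimate and then the estimator.\<close>

lemma resid_integral:
  "integrable (lebesgue_on {t (k - 1)<..<t k}) (\<lambda>s. resid k (G x (T - s)) s)"
  "ennreal \<bar>LINT s|lebesgue_on {t (k - 1)<..<t k}. resid k (G x (T - s)) s\<bar> \<le>
     ennreal \<kappa>0 * (ennreal (sigma \<gamma> T t k) * (\<integral>\<^sup>+s\<in>{t (k - 1)<..<t k}. Linf_norm \<Omega> (\<lambda>y. f s y - fh s y) \<partial>lborel))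
     + (ennreal (sigma \<gamma> T t k) * (ennreal (mu \<kappa>0 \<kappa>1 \<kappa>1' T t k (L - 2)) * Linf_norm \<Omega> (res_low k)
          + ennreal (mu \<kappa>0 \<kappa>1 \<kappa>1' T t k (L - 1) / (2 * real L - 3)) * Linf_norm \<Omega> (\<Delta>\<psi> k (L - 1)))
        + ennreal \<kappa>0 * (ennreal (sigma \<gamma> T t k) * (\<Sum>i=1..L - 1. \<eta> (\<Delta>u k i) (ell_rhs_coeff k i) * ennreal (norm1 (legendre (i - 1))))))"
proof -
  let ?M = "lebesgue_on {t (k - 1)<..<t k}" and ?S = "ennreal (sigma \<gamma> T t k)"
  let ?p = "\<lambda>i w s. legendre i (ref_coord t k s) * L2_inner \<Omega> w (G x (T - s))"
  let ?h = "\<lambda>s. L2_inner \<Omega> (\<lambda>y. f s y - fh s y) (G x (T - s))"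
  let ?e = "\<lambda>i y. ell_coeff k i y - \<Delta>u k i y"
  have pL: "\<Delta>\<psi> k (L - 1) \<in> L2 \<Omega>" by (intro Vh_L2 Dpsi_Vh k) simp
  note i1 = piece_integrable[OF res_low_L2[OF k] fin_res_low, of "L - 2"]
  note i2 = piece_integrable[OF pL fin_psi, of "L - 1"]
  have i3: "integrable ?M (?p (i - 1) (?e i))" if "i \<in> {1..L - 1}" for i using coefficient_error[OF that] by (intro piece_integrable)
  have i3': "integrable ?M (\<lambda>s. \<Sum>i=1..L - 1. 2 / step t k * ?p (i - 1) (?e i) s)"
    by (intro Bochner_Integration.integrable_sum integrable_mult_right i3)
  have i2': "integrable ?M (\<lambda>s. 1 / (2 * real L - 3) * ?p (L - 1) (\<Delta>\<psi> k (L - 1)) s)" using i2 by (rule integrable_mult_right)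
  note iw = Bochner_Integration.integrable_add[OF Bochner_Integration.integrable_add[OF i1 i2'] i3']
  show int: "integrable ?M (\<lambda>s. resid k (G x (T - s)) s)"
    unfolding resid_def by (rule Bochner_Integration.integrable_diff[OF defect_integrable iw])
  define I1 I2 where "I1 = integral\<^sup>L ?M (?p (L - 2) (res_low k))" and "I2 = 1 / (2 * real L - 3) * integral\<^sup>L ?M (?p (L - 1) (\<Delta>\<psi> k (L - 1)))"
  define I3 where "I3 i = 2 / step t k * integral\<^sup>L ?M (?p (i - 1) (?e i))" for i
  have "(LINT s|?M. resid k (G x (T - s)) s) = (LINT s|?M. ?h s) - (I1 + I2 + (\<Sum>i=1..L - 1. I3 i))"
  proof -
    have s3: "(LINT s|?M. (\<Sum>i=1..L - 1. 2 / step t k * ?p (i - 1) (?e i) s)) = (\<Sum>i=1..L - 1. I3 i)"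
    proof -
      have "(LINT s|?M. (\<Sum>i=1..L - 1. 2 / step t k * ?p (i - 1) (?e i) s)) = (\<Sum>i=1..L - 1. LINT s|?M. 2 / step t k * ?p (i - 1) (?e i) s)"
        by (rule Bochner_Integration.integral_sum) (rule integrable_mult_right[OF i3])
      then show ?thesis by (simp only: integral_mult_right_zero I3_def)
    qed
    have s2: "(LINT s|?M. 1 / (2 * real L - 3) * ?p (L - 1) (\<Delta>\<psi> k (L - 1)) s) = I2" unfolding I2_def by (rule integral_mult_right_zero)
    show ?thesis
      unfolding resid_def Bochner_Integration.integral_diff[OF defect_integrable iw]
        Bochner_Integration.integral_add[OF Bochner_Integration.integrable_add[OF i1 i2'] i3'] Bochner_Integration.integral_add[OF i1 i2'] s2 s3 I1_def ..
  qed
  then have "ennreal \<bar>LINT s|?M. resid k (G x (T - s)) s\<bar> \<le> ennreal \<bar>LINT s|?M. ?h s\<bar> + ennreal \<bar>I1 + I2 + (\<Sum>i=1..L - 1. I3 i)\<bar>"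
    by (simp only: ennreal_abs_diff)
  also have "\<dots> \<le> ennreal \<bar>LINT s|?M. ?h s\<bar> + (ennreal \<bar>I1\<bar> + ennreal \<bar>I2\<bar> + (\<Sum>i=1..L - 1. ennreal \<bar>I3 i\<bar>))"
    by (rule add_left_mono[OF order_trans[OF ennreal_abs_add add_mono[OF ennreal_abs_add ennreal_abs_sum]]])
  also have "\<dots> \<le> ennreal \<kappa>0 * (?S * (\<integral>\<^sup>+s\<in>{t (k - 1)<..<t k}. Linf_norm \<Omega> (\<lambda>y. f s y - fh s y) \<partial>lborel))
     + (?S * (ennreal (mu \<kappa>0 \<kappa>1 \<kappa>1' T t k (L - 2)) * Linf_norm \<Omega> (res_low k))
        + ?S * (ennreal (mu \<kappa>0 \<kappa>1 \<kappa>1' T t k (L - 1) / (2 * real L - 3)) * Linf_norm \<Omega> (\<Delta>\<psi> k (L - 1)))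
        + (\<Sum>i=1..L - 1. ennreal \<kappa>0 * (?S * (\<eta> (\<Delta>u k i) (ell_rhs_coeff k i) * ennreal (norm1 (legendre (i - 1)))))))"
  proof (intro add_mono sum_mono)
    have "ennreal \<bar>LINT s|?M. ?h s\<bar> \<le> (\<integral>\<^sup>+s. ennreal \<bar>?h s\<bar> \<partial>?M)"
      using integral_norm_bound_ennreal[OF defect_integrable] by simp
    also note defect_nn_bound
    finally show "ennreal \<bar>LINT s|?M. ?h s\<bar> \<le> ennreal \<kappa>0 * (?S * (\<integral>\<^sup>+s\<in>{t (k - 1)<..<t k}. Linf_norm \<Omega> (\<lambda>y. f s y - fh s y) \<partial>lborel))" .
    show "ennreal \<bar>I1\<bar> \<le> ?S * (ennreal (mu \<kappa>0 \<kappa>1 \<kappa>1' T t k (L - 2)) * Linf_norm \<Omega> (res_low k))"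
      using piece_bound_mu[OF res_low_L2[OF k] fin_res_low, of 1 "L - 2"] unfolding I1_def by simp
    have "0 \<le> 1 / (2 * real L - 3)" using L by simp
    from piece_bound_mu[OF pL fin_psi this, of "L - 1"]
    show "ennreal \<bar>I2\<bar> \<le> ?S * (ennreal (mu \<kappa>0 \<kappa>1 \<kappa>1' T t k (L - 1) / (2 * real L - 3)) * Linf_norm \<Omega> (\<Delta>\<psi> k (L - 1)))"
      unfolding I2_def by simp
    fix i assume i: "i \<in> {1..L - 1}"
    have "ennreal \<bar>I3 i\<bar> \<le> ennreal \<kappa>0 * (?S * (Linf_norm \<Omega> (?e i) * ennreal (norm1 (legendre (i - 1)))))"
      unfolding I3_def using coefficient_error[OF i] by (intro piece_bound_norm1)
    also have "\<dots> \<le> ennreal \<kappa>0 * (?S * (\<eta> (\<Delta>u k i) (ell_rhs_coeff k i) * ennreal (norm1 (legendre (i - 1)))))"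
      using coefficient_error(2)[OF i] by (intro mult_left_mono mult_right_mono) auto
    finally show "ennreal \<bar>I3 i\<bar> \<le> ennreal \<kappa>0 * (?S * (\<eta> (\<Delta>u k i) (ell_rhs_coeff k i) * ennreal (norm1 (legendre (i - 1)))))" .
  qed
  finally show "ennreal \<bar>LINT s|?M. resid k (G x (T - s)) s\<bar> \<le>
     ennreal \<kappa>0 * (?S * (\<integral>\<^sup>+s\<in>{t (k - 1)<..<t k}. Linf_norm \<Omega> (\<lambda>y. f s y - fh s y) \<partial>lborel))
     + (?S * (ennreal (mu \<kappa>0 \<kappa>1 \<kappa>1' T t k (L - 2)) * Linf_norm \<Omega> (res_low k)
          + ennreal (mu \<kappa>0 \<kappa>1 \<kappa>1' T t k (L - 1) / (2 * real L - 3)) * Linf_norm \<Omega> (\<Delta>\<psi> k (L - 1)))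
        + ennreal \<kappa>0 * (?S * (\<Sum>i=1..L - 1. \<eta> (\<Delta>u k i) (ell_rhs_coeff k i) * ennreal (norm1 (legendre (i - 1))))))"
    unfolding distrib_left sum_distrib_left .
qed

end

end

section \<open>Summation over the mesh and the final estimate\<close>

lemma mesh_interval:
  assumes s: "0 < s" "s < T" "s \<notin> t ` {0..M}"
  shows "\<exists>k\<in>{1..M}. s \<in> {t (k - 1)<..<t k}"
proof -
  have M: "t 0 = 0" "t M = T" using mesh unfolding time_mesh_def by auto
  define k where "k = (LEAST j. s < t j)"
  have k: "s < t k" unfolding k_def by (rule LeastI[of _ M]) (use M s in simp)
  have kM: "k \<le> M" unfolding k_def by (rule Least_le) (use M s in simp)
  have k0: "k \<noteq> 0" using k M s by (cases "k = 0") auto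
  then have "\<not> s < t (k - 1)" using not_less_Least[of "k - 1" "\<lambda>j. s < t j"] by (simp add: k_def)
  moreover have "s \<noteq> t (k - 1)" using s(3) kM by auto
  ultimately show ?thesis using k kM k0 by (intro bexI[of _ k]) auto
qed

lemma mesh_interval_unique:
  assumes j: "j \<in> {1..M}" and k: "k \<in> {1..M}" and s: "s \<in> {t (k - 1)<..<t k}" "s \<in> {t (j - 1)<..<t j}"
  shows "j = k"
proof (rule ccontr)
  assume "j \<noteq> k"
  then consider "j < k" | "k < j" by linarith
  then show False
  proof cases
    case 1
    then have "t j \<le> t (k - 1)" using k by (intro t_mono) auto
    then show False using s by auto
  next
    case 2
    then have "t k \<le> t (j - 1)" using j by (intro t_mono) auto
    then show False using s by auto
  qed
qed

lemma sum_indicator_mesh: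
  assumes k: "k \<in> {1..M}" and s: "s \<in> {t (k - 1)<..<t k}"
  shows "(\<Sum>j=1..M. indicator {t (j - 1)<..<t j} s * E j) = (E k :: real)"
proof -
  have "(\<Sum>j=1..M. indicator {t (j - 1)<..<t j} s * E j) = (\<Sum>j=1..M. if j = k then E k else 0)"
  proof (intro sum.cong refl)
    fix j assume j: "j \<in> {1..M}"
    show "indicator {t (j - 1)<..<t j} s * E j = (if j = k then E k else 0)"
    proof (cases "j = k")
      case False
      then have "s \<notin> {t (j - 1)<..<t j}" using mesh_interval_unique[OF j k s] by blast
      then show ?thesis using False by simp
    qed (use s in simp)
  qed
  then show ?thesis using k by simp
qed

context
  assumes fin: "\<And>k. k \<in> {1..M} \<Longrightarrow> (\<integral>\<^sup>+s\<in>{t (k - 1)<..<t k}. Linf_norm \<Omega> (\<lambda>y. f s y - fh s y) \<partial>lborel) \<noteq> top_class.top"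
     "\<And>k. k \<in> {1..M} \<Longrightarrow> Linf_norm \<Omega> (res_low k) \<noteq> top_class.top" "\<And>k. k \<in> {1..M} \<Longrightarrow> Linf_norm \<Omega> (\<Delta>\<psi> k (L - 1)) \<noteq> top_class.top"
     "\<And>k i. k \<in> {1..M} \<Longrightarrow> i \<in> {1..L - 1} \<Longrightarrow> \<eta> (\<Delta>u k i) (ell_rhs_coeff k i) \<noteq> top_class.top"
begin

text \<open>The formula for the Green's function applies only where its integrand is integrable. The
  finiteness assumptions give this at every \<open>x\<close> of \<open>\<Omega>\<close>, because the
  integrand agrees almost everywhere with the piecewise residual.\<close>

lemma representation:
  "AE x in lebesgue_on \<Omega>. u T x - ell_val M x = L2_inner \<Omega> (\<lambda>p. u 0 p - ell_val 0 p) (G x T)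
     + (\<Sum>k=1..M. LINT s|lebesgue_on {t (k - 1)<..<t k}. resid k (G x (T - s)) s)"
proof -
  obtain u' where W: "W21 \<Omega> T u u'" and pde: "AE s in lebesgue_on {0<..<T}. \<forall>\<zeta>\<in>H10 \<Omega>. u' s \<zeta> + a (u s) \<zeta> = L2_inner \<Omega> (f s) \<zeta>"
    using solution(1) unfolding parabolic_solution_def by blast
  let ?\<phi> = "\<lambda>s p. u s p - ell_recon s p"
  let ?\<phi>' = "\<lambda>s \<zeta>. u' s \<zeta> - (\<Sum>j=1..M. \<Sum>i=1..L - 1. time_deriv j i s * L2_inner \<Omega> (ell_coeff j i) \<zeta>)"
  let ?F = "\<lambda>x s. ?\<phi>' s (G x (T - s)) + a (?\<phi> s) (G x (T - s))"
  have "\<forall>\<phi> \<phi>'. W21 \<Omega> T \<phi> \<phi>' \<longrightarrow>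
        (\<forall>t\<in>{0<..T}. AE x in lebesgue_on \<Omega>.
           integrable (lebesgue_on {0<..<t}) (\<lambda>s. \<phi>' s (G x (t - s)) + a (\<phi> s) (G x (t - s))) \<longrightarrow>
           \<phi> t x = L2_inner \<Omega> (\<phi> 0) (G x t) +
             (LINT s|lebesgue_on {0<..<t}. \<phi>' s (G x (t - s)) + a (\<phi> s) (G x (t - s))))"
    using green(1) unfolding greens_function_def by blast
  from this[rule_format, OF W21_error[OF W], of T] T_pos
  have rep: "AE x in lebesgue_on \<Omega>. integrable (lebesgue_on {0<..<T}) (?F x) \<longrightarrow> ?\<phi> T x = L2_inner \<Omega> (?\<phi> 0) (G x T) + integral\<^sup>L (lebesgue_on {0<..<T}) (?F x)"
    by simp
  have uV: "AE s in lebesgue_on {0<..<T}. u s \<in> H10 \<Omega>" using W unfolding W21_def bochner_L2_def by blast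
  have nodes: "AE s in lebesgue_on {0<..<T}. s \<notin> t ` {0..M}"
  proof -
    have "t ` {0..M} \<in> null_sets lebesgue" using negligible_finite[of "t ` {0..M}"] by (simp add: negligible_iff_null_sets)
    then have "AE s in lebesgue. s \<notin> t ` {0..M}" by (rule AE_not_in)
    then show ?thesis by (auto simp: AE_restrict_space_iff elim!: eventually_mono)
  qed
  have main: "integrable (lebesgue_on {0<..<T}) (?F x) \<and> integral\<^sup>L (lebesgue_on {0<..<T}) (?F x) = (\<Sum>k=1..M. LINT s|lebesgue_on {t (k - 1)<..<t k}. resid k (G x (T - s)) s)"
    if x: "x \<in> \<Omega>" for x
  proof -
    have xc: "x \<in> closure \<Omega>" using x closure_subset by blast
    \<comment> \<open>The residuals of the single intervals are extended by 0 and added; the mesh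
      points that are lost form a null set.\<close>
    let ?E = "\<lambda>s. \<Sum>k=1..M. indicator {t (k - 1)<..<t k} s * resid k (G x (T - s)) s"
    have sub: "{t (k - 1)<..<t k} \<subseteq> {0<..<T}" if "k \<in> {1..M}" for k using tj[OF that] by auto
    have ri: "integrable (lebesgue_on {t (k - 1)<..<t k}) (\<lambda>s. resid k (G x (T - s)) s)" if k: "k \<in> {1..M}" for k
      using resid_integral(1)[OF xc k] fin k by blast
    have ii: "integrable (lebesgue_on {0<..<T}) (\<lambda>s. indicator {t (k - 1)<..<t k} s * resid k (G x (T - s)) s)" if k: "k \<in> {1..M}" for k
      using ri[OF k] sub[OF k] by (subst integrable_indicator_lebesgue_on) auto
    have Ei: "integrable (lebesgue_on {0<..<T}) ?E" using ii by (intro Bochner_Integration.integrable_sum)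
    have ae: "AE s in lebesgue_on {0<..<T}. ?E s = ?F x s"
      using pde uV nodes AE_space
    proof eventually_elim
      case (elim s)
      then have s: "0 < s" "s < T" by (auto simp: space_restrict_space)
      obtain k where k: "k \<in> {1..M}" "s \<in> {t (k - 1)<..<t k}" using mesh_interval[OF s elim(3)] by blast
      have z: "G x (T - s) \<in> H10 \<Omega>" using s by (intro G_H10 xc) simp
      have "?F x s = resid k (G x (T - s)) s" using elim(1) z by (intro integrand_eq[OF k elim(2) z]) blast
      then show ?case using sum_indicator_mesh[OF k, of "\<lambda>k. resid k (G x (T - s)) s"] by simp
    qed
    \<comment> \<open>Measurability is transferred along almost everywhere equality by viewing
      \<open>?E\<close> as a constant sequence with limit \<open>?F x\<close>.\<close>
    have Fm: "?F x \<in> borel_measurable (lebesgue_on {0<..<T})"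
    proof (rule borel_measurable_lebesgue_on_AE_limit)
      show "?E \<in> borel_measurable (lebesgue_on {0<..<T})" using Ei by (rule borel_measurable_integrable)
      show "AE s in lebesgue_on {0<..<T}. (\<lambda>n. ?E s) \<longlonglongrightarrow> ?F x s" using ae by eventually_elim simp
    qed simp
    have "integrable (lebesgue_on {0<..<T}) (?F x)"
      by (rule integrable_cong_AE_imp[OF Ei Fm ae])
    moreover have "integral\<^sup>L (lebesgue_on {0<..<T}) (?F x) = integral\<^sup>L (lebesgue_on {0<..<T}) ?E"
      by (rule integral_cong_AE[OF borel_measurable_integrable[OF Ei] Fm ae, symmetric])
    moreover have "\<dots> = (\<Sum>k=1..M. LINT s|lebesgue_on {t (k - 1)<..<t k}. resid k (G x (T - s)) s)"
    proof -
      have "integral\<^sup>L (lebesgue_on {0<..<T}) ?E = (\<Sum>k=1..M. LINT s|lebesgue_on {0<..<T}. indicator {t (k - 1)<..<t k} s * resid k (G x (T - s)) s)"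
        by (rule Bochner_Integration.integral_sum) (rule ii)
      also have "\<dots> = (\<Sum>k=1..M. LINT s|lebesgue_on {t (k - 1)<..<t k}. resid k (G x (T - s)) s)"
        by (intro sum.cong refl integral_indicator_lebesgue_on sub) auto
      finally show ?thesis .
    qed
    ultimately show ?thesis by simp
  qed
  show ?thesis
    using rep AE_space
  proof eventually_elim
    case (elim x)
    then have "x \<in> \<Omega>" by (simp add: space_restrict_space)
    from main[OF this] elim(1) show ?case by (simp add: ell_recon_T ell_recon_0)
  qed
qed

end

text \<open>The initial value splits as \<open>(u0 - uh 0) + (uh 0 - ell_val 0)\<close>, the first
  part measured directly and the second by the estimator. The equality of \<open>u 0\<close> and
  \<open>u0\<close> holds almost everywhere, which the \<open>L2\<close> pairing does not
  distinguish.\<close>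

lemma initial_bound:
  assumes x: "x \<in> closure \<Omega>" and fin_init: "Linf_norm \<Omega> (\<lambda>y. u0 y - uh 0 y) \<noteq> top_class.top" and fin_ell0: "\<eta> (uh 0) (ell_rhs 0) \<noteq> top_class.top"
  shows "ennreal \<bar>L2_inner \<Omega> (\<lambda>p. u 0 p - ell_val 0 p) (G x T)\<bar> \<le>
    ennreal (\<kappa>0 * sigma \<gamma> T t 0) * Linf_norm \<Omega> (\<lambda>y. u0 y - uh 0 y) + ennreal \<kappa>0 * (ennreal (sigma \<gamma> T t 0) * \<eta> (uh 0) (ell_rhs 0))"
proof -
  have GL: "G x T \<in> L2 \<Omega>" using T_pos by (intro G_L2 x)
  have s0: "sigma \<gamma> T t 0 = exp (- \<gamma> * T)" using mesh unfolding time_mesh_def sigma_def by simp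
  have pb: "ennreal \<bar>L2_inner \<Omega> w (G x T)\<bar> \<le> ennreal (\<kappa>0 * sigma \<gamma> T t 0) * Linf_norm \<Omega> w" if "Linf_norm \<Omega> w \<noteq> top_class.top" for w
  proof -
    define C where "C = enn2real (Linf_norm \<Omega> w)"
    have C: "0 \<le> C" "Linf_norm \<Omega> w = ennreal C" using that by (auto simp: C_def less_top)
    have "\<bar>L2_inner \<Omega> w (G x T)\<bar> \<le> C * (\<kappa>0 * exp (- \<gamma> * T))" using x T_pos C by (intro G_pairing) auto
    then show ?thesis unfolding C(2) using C(1) nonneg s0 by (simp add: ennreal_mult[symmetric] ennreal_leI mult_ac)
  qed
  have u0L: "u 0 \<in> L2 \<Omega>"
    using solution(1) T_pos unfolding parabolic_solution_def W21_def continuous_into_L2_def by auto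
  have L: "uh 0 \<in> L2 \<Omega>" "ell_val 0 \<in> L2 \<Omega>" by (auto intro: Vh_L2 uh_Vh H10_L2 ell_val_H10)
  have ae: "AE y in lebesgue_on \<Omega>. u 0 y = u0 y" using solution(1) unfolding parabolic_solution_def by blast
  have "L2_inner \<Omega> (\<lambda>p. u 0 p - ell_val 0 p) (G x T) = L2_inner \<Omega> (u 0) (G x T) - L2_inner \<Omega> (ell_val 0) (G x T)"
    by (rule L2_inner_diff[OF u0L L(2) GL])
  also have "L2_inner \<Omega> (u 0) (G x T) = L2_inner \<Omega> u0 (G x T)" by (rule L2_inner_cong_AE[OF u0L data(2) GL ae])
  also have "L2_inner \<Omega> u0 (G x T) - L2_inner \<Omega> (ell_val 0) (G x T) = L2_inner \<Omega> (\<lambda>y. u0 y - uh 0 y) (G x T) + L2_inner \<Omega> (\<lambda>y. uh 0 y - ell_val 0 y) (G x T)"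
    unfolding L2_inner_diff[OF data(2) L(1) GL] L2_inner_diff[OF L GL] by simp
  finally have eq: "L2_inner \<Omega> (\<lambda>p. u 0 p - ell_val 0 p) (G x T) = L2_inner \<Omega> (\<lambda>y. u0 y - uh 0 y) (G x T) + L2_inner \<Omega> (\<lambda>y. uh 0 y - ell_val 0 y) (G x T)" .
  have le: "Linf_norm \<Omega> (\<lambda>y. uh 0 y - ell_val 0 y) \<le> \<eta> (uh 0) (ell_rhs 0)" by (rule estimator_nodal) simp
  have "ennreal \<bar>L2_inner \<Omega> (\<lambda>y. uh 0 y - ell_val 0 y) (G x T)\<bar> \<le> ennreal (\<kappa>0 * sigma \<gamma> T t 0) * Linf_norm \<Omega> (\<lambda>y. uh 0 y - ell_val 0 y)"
    using le fin_ell0 by (intro pb) (auto simp: top_unique)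
  also have "\<dots> \<le> ennreal (\<kappa>0 * sigma \<gamma> T t 0) * \<eta> (uh 0) (ell_rhs 0)" using le by (rule mult_left_mono) simp
  also have "\<dots> = ennreal \<kappa>0 * (ennreal (sigma \<gamma> T t 0) * \<eta> (uh 0) (ell_rhs 0))"
    using nonneg by (simp add: ennreal_mult' mult.assoc)
  finally show ?thesis unfolding eq using pb[OF fin_init] by (intro order_trans[OF ennreal_abs_add] add_mono)
qed

lemma error_bound:
  "Linf_norm \<Omega> (\<lambda>y. u T y - uh M y) \<le>
           eta_init \<Omega> \<kappa>0 \<gamma> T t u0 uh + eta_f \<Omega> \<kappa>0 \<gamma> T M t f fh
           + eta_t \<Omega> \<kappa>0 \<kappa>1 \<kappa>1' \<gamma> T L M t \<Delta>u \<Delta>\<psi>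
           + eta_ell \<eta> \<kappa>0 \<gamma> T L M t fh \<Delta>f uh \<psi> \<Delta>u \<Delta>\<psi>" (is "_ \<le> ?rhs")
proof (cases "?rhs = top_class.top")
  case False
  let ?S = "\<lambda>k. ennreal (sigma \<gamma> T t k)"
  let ?f = "\<lambda>k. \<integral>\<^sup>+s\<in>{t (k - 1)<..<t k}. Linf_norm \<Omega> (\<lambda>y. f s y - fh s y) \<partial>lborel"
  let ?t = "\<lambda>k. ennreal (mu \<kappa>0 \<kappa>1 \<kappa>1' T t k (L - 2)) * Linf_norm \<Omega> (res_low k)
          + ennreal (mu \<kappa>0 \<kappa>1 \<kappa>1' T t k (L - 1) / (2 * real L - 3)) * Linf_norm \<Omega> (\<Delta>\<psi> k (L - 1))"
  let ?e = "\<lambda>k. \<Sum>i=1..L - 1. \<eta> (\<Delta>u k i) (ell_rhs_coeff k i) * ennreal (norm1 (legendre (i - 1)))"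
  have einit: "eta_init \<Omega> \<kappa>0 \<gamma> T t u0 uh = ennreal (\<kappa>0 * sigma \<gamma> T t 0) * Linf_norm \<Omega> (\<lambda>y. u0 y - uh 0 y)" by (simp add: eta_init_def)
  have ef: "eta_f \<Omega> \<kappa>0 \<gamma> T M t f fh = (\<Sum>k=1..M. ennreal \<kappa>0 * (?S k * ?f k))" by (simp add: eta_f_def sum_distrib_left)
  have et: "eta_t \<Omega> \<kappa>0 \<kappa>1 \<kappa>1' \<gamma> T L M t \<Delta>u \<Delta>\<psi> = (\<Sum>k=1..M. ?S k * ?t k)" by (simp add: eta_t_def res_low_def)
  have ee: "eta_ell \<eta> \<kappa>0 \<gamma> T L M t fh \<Delta>f uh \<psi> \<Delta>u \<Delta>\<psi> = ennreal \<kappa>0 * (?S 0 * \<eta> (uh 0) (ell_rhs 0) + \<eta> (uh M) (ell_rhs M)) + (\<Sum>k=1..M. ennreal \<kappa>0 * (?S k * ?e k))"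
    by (simp add: eta_ell_def Let_def ell_rhs_def ell_rhs_coeff_def sum_distrib_left)
  \<comment> \<open>In \<open>ennreal\<close> a zero weight times an infinite term is 0, so
    finiteness of a product says something about the term only when the weight is nonzero.\<close>
  have k0: "ennreal \<kappa>0 \<noteq> 0" "?S k \<noteq> 0" "ennreal (\<kappa>0 * sigma \<gamma> T t 0) \<noteq> 0" for k
    using kappa0_ge_1 sigma_pos'[of k] sigma_pos'[of 0] by (auto simp: ennreal_eq_0_iff not_le)
  have L3: "0 < 2 * real L - 3" using L by simp
  have ft: "eta_init \<Omega> \<kappa>0 \<gamma> T t u0 uh \<noteq> top_class.top" "(\<Sum>k=1..M. ennreal \<kappa>0 * (?S k * ?f k)) \<noteq> top_class.top" "(\<Sum>k=1..M. ?S k * ?t k) \<noteq> top_class.top"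
    "ennreal \<kappa>0 * (?S 0 * \<eta> (uh 0) (ell_rhs 0) + \<eta> (uh M) (ell_rhs M)) \<noteq> top_class.top" "(\<Sum>k=1..M. ennreal \<kappa>0 * (?S k * ?e k)) \<noteq> top_class.top"
    using False unfolding ef et ee by auto
  have fin_init: "Linf_norm \<Omega> (\<lambda>y. u0 y - uh 0 y) \<noteq> top_class.top" using ft(1) k0 unfolding einit by (auto simp: ennreal_mult_eq_top_iff)
  have fin_n: "\<eta> (uh 0) (ell_rhs 0) \<noteq> top_class.top" "\<eta> (uh M) (ell_rhs M) \<noteq> top_class.top" using ft(4) k0 by (auto simp: ennreal_mult_eq_top_iff)
  have fin_f: "?f k \<noteq> top_class.top" if "k \<in> {1..M}" for k
    using ennreal_sum_not_top[OF _ ft(2) that] k0 by (auto simp: ennreal_mult_eq_top_iff)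
  have tt: "?t k \<noteq> top_class.top" if "k \<in> {1..M}" for k
    using ennreal_sum_not_top[OF _ ft(3) that] k0 by (auto simp: ennreal_mult_eq_top_iff)
  have mpos: "0 < mu \<kappa>0 \<kappa>1 \<kappa>1' T t k i" if "k \<in> {1..M}" for k i by (rule mu_pos[of t k, OF tj[OF that]])
  have fin_res_low: "Linf_norm \<Omega> (res_low k) \<noteq> top_class.top" if "k \<in> {1..M}" for k
    using tt[OF that] mpos[OF that, of "L - 2"] by (auto simp: ennreal_mult_eq_top_iff ennreal_eq_0_iff)
  have fin_psi: "Linf_norm \<Omega> (\<Delta>\<psi> k (L - 1)) \<noteq> top_class.top" if "k \<in> {1..M}" for k
  proof -
    have "0 < mu \<kappa>0 \<kappa>1 \<kappa>1' T t k (L - 1) / (2 * real L - 3)" using mpos[OF that] L3 by simp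
    then show ?thesis using tt[OF that] by (auto simp: ennreal_mult_eq_top_iff ennreal_eq_0_iff not_le)
  qed
  have fin_ell: "\<eta> (\<Delta>u k i) (ell_rhs_coeff k i) \<noteq> top_class.top" if k: "k \<in> {1..M}" and i: "i \<in> {1..L - 1}" for k i
  proof -
    have "?e k \<noteq> top_class.top" using ennreal_sum_not_top[OF _ ft(5) k] k0 by (auto simp: ennreal_mult_eq_top_iff)
    from ennreal_sum_not_top[OF _ this i] show ?thesis using norm1_legendre_pos[of "i - 1"] by (auto simp: ennreal_mult_eq_top_iff ennreal_eq_0_iff)
  qed
  have M: "M \<le> M" by simp
  have nodal: "AE x in lebesgue_on \<Omega>. ennreal \<bar>uh M x - ell_val M x\<bar> \<le> \<eta> (uh M) (ell_rhs M)"
    using Linf_norm_AE[where \<Omega>=\<Omega> and v="\<lambda>p. uh M p - ell_val M p"] by eventually_elim (rule order_trans[OF _ estimator_nodal[OF M]])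
  have rep: "AE x in lebesgue_on \<Omega>. u T x - ell_val M x = L2_inner \<Omega> (\<lambda>p. u 0 p - ell_val 0 p) (G x T)
     + (\<Sum>k=1..M. LINT s|lebesgue_on {t (k - 1)<..<t k}. resid k (G x (T - s)) s)"
    by (rule representation[OF fin_f fin_res_low fin_psi fin_ell])
  have "AE x in lebesgue_on \<Omega>. ennreal \<bar>u T x - uh M x\<bar> \<le> ?rhs"
    using rep nodal AE_space
  proof eventually_elim
    case (elim x)
    then have x: "x \<in> closure \<Omega>" using closure_subset[of \<Omega>] by (auto simp: space_restrict_space)
    let ?J = "L2_inner \<Omega> (\<lambda>p. u 0 p - ell_val 0 p) (G x T)"
    let ?I = "\<lambda>k. LINT s|lebesgue_on {t (k - 1)<..<t k}. resid k (G x (T - s)) s"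
    have "u T x - uh M x = (?J + (\<Sum>k=1..M. ?I k)) - (uh M x - ell_val M x)" using elim(1) by simp
    then have "ennreal \<bar>u T x - uh M x\<bar> \<le> ennreal \<bar>?J + (\<Sum>k=1..M. ?I k)\<bar> + ennreal \<bar>uh M x - ell_val M x\<bar>"
      by (simp only: ennreal_abs_diff)
    also have "\<dots> \<le> (ennreal \<bar>?J\<bar> + (\<Sum>k=1..M. ennreal \<bar>?I k\<bar>)) + ennreal \<bar>uh M x - ell_val M x\<bar>"
      by (intro add_right_mono order_trans[OF ennreal_abs_add] add_left_mono ennreal_abs_sum)
    also have "\<dots> \<le> ((ennreal (\<kappa>0 * sigma \<gamma> T t 0) * Linf_norm \<Omega> (\<lambda>y. u0 y - uh 0 y) + ennreal \<kappa>0 * (?S 0 * \<eta> (uh 0) (ell_rhs 0)))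
        + (\<Sum>k=1..M. ennreal \<kappa>0 * (?S k * ?f k) + (?S k * ?t k + ennreal \<kappa>0 * (?S k * ?e k)))) + ennreal \<kappa>0 * \<eta> (uh M) (ell_rhs M)"
    proof (intro add_mono sum_mono)
      show "ennreal \<bar>?J\<bar> \<le> ennreal (\<kappa>0 * sigma \<gamma> T t 0) * Linf_norm \<Omega> (\<lambda>y. u0 y - uh 0 y) + ennreal \<kappa>0 * (?S 0 * \<eta> (uh 0) (ell_rhs 0))"
        using x fin_init fin_n(1) by (rule initial_bound)
      show "ennreal \<bar>?I k\<bar> \<le> ennreal \<kappa>0 * (?S k * ?f k) + (?S k * ?t k + ennreal \<kappa>0 * (?S k * ?e k))" if k: "k \<in> {1..M}" for k
        using x k fin_f[OF k] fin_res_low[OF k] fin_psi[OF k] fin_ell[OF k] by (rule resid_integral(2))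
      have "ennreal \<bar>uh M x - ell_val M x\<bar> \<le> 1 * \<eta> (uh M) (ell_rhs M)" using elim(2) by simp
      \<comment> \<open>The Green's function does not act on the elliptic error at time
        \<open>T\<close>; its weight 1 is raised to \<open>\<kappa>0\<close> to match the
        estimator.\<close>
      also have "\<dots> \<le> ennreal \<kappa>0 * \<eta> (uh M) (ell_rhs M)" using kappa0_ge_1 by (intro mult_right_mono) auto
      finally show "ennreal \<bar>uh M x - ell_val M x\<bar> \<le> ennreal \<kappa>0 * \<eta> (uh M) (ell_rhs M)" .
    qed
    also have "\<dots> = ?rhs" unfolding einit ef et ee by (simp add: sum.distrib distrib_left add_ac)
    finally show ?case .
  qed
  moreover have "(\<lambda>y. u T y - uh M y) \<in> borel_measurable (lebesgue_on \<Omega>)"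
  proof -
    have "u T \<in> L2 \<Omega>" using solution(1) T_pos unfolding parabolic_solution_def W21_def continuous_into_L2_def by auto
    then show ?thesis using L2_measurable[OF L2.diff_in[OF _ Vh_L2[OF uh_Vh[OF M]]]] by blast
  qed
  ultimately show ?thesis by (intro Linf_norm_leI)
next
  case True
  show ?thesis unfolding True by (rule top_greatest)
qed

end

theorem theorem1:
  fixes \<Omega> :: "(real^'n) set"
    and A :: "real^'n \<Rightarrow> real^'n^'n" and d b :: "real^'n \<Rightarrow> real^'n" and c :: "real^'n \<Rightarrow> real"
    and a ah ih :: "(real^'n \<Rightarrow> real) \<Rightarrow> (real^'n \<Rightarrow> real) \<Rightarrow> real"
    and T :: real and u0 :: "real^'n \<Rightarrow> real" and f fh u :: "real \<Rightarrow> real^'n \<Rightarrow> real"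
    and L M :: nat and t :: "nat \<Rightarrow> real" and z :: "nat \<Rightarrow> nat \<Rightarrow> real"
    and Vh :: "(real^'n \<Rightarrow> real) set" and \<eta> :: "(real^'n \<Rightarrow> real) \<Rightarrow> (real^'n \<Rightarrow> real) \<Rightarrow> ennreal"
    and G G' :: "real^'n \<Rightarrow> real \<Rightarrow> real^'n \<Rightarrow> real" and \<kappa>0 \<kappa>1 \<kappa>1' \<gamma> :: real
    and uh \<psi> :: "nat \<Rightarrow> real^'n \<Rightarrow> real" and \<Delta>f \<Delta>u \<Delta>\<psi> :: "nat \<Rightarrow> nat \<Rightarrow> real^'n \<Rightarrow> real"
  assumes "2 \<le> L"
    and domain: "open \<Omega>" "connected \<Omega>" "\<Omega> \<noteq> {}" "lipschitz_boundary \<Omega>"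
    and elliptic: "elliptic_coefficients \<Omega> A d b c" "a = elliptic_form \<Omega> A d b c"
      "\<forall>g\<in>L2 \<Omega>. \<exists>y\<in>H10 \<Omega>. \<forall>\<zeta>\<in>H10 \<Omega>. a y \<zeta> = L2_inner \<Omega> g \<zeta>"
    and data: "continuous_into_L2 \<Omega> T f" "u0 \<in> L2 \<Omega>" "\<forall>y\<in>frontier \<Omega>. u0 y = 0" "hoelder_on (closure \<Omega>) u0"
    and solution: "parabolic_solution \<Omega> a T u0 f u"
      "continuous_on ({0..T} \<times> closure \<Omega>) (\<lambda>(s, y). u s y)"
    and mesh: "time_mesh M T t"
    and interpolant: "interpolation_nodes L M t z" "time_interpolant L M t z f fh" "legendre_expansion L M t fh \<Delta>f"
    and discrete_forms: "finite_dim_subspace Vh (H10 \<Omega>)" "bilinear_form_on Vh Vh ah" "bilinear_form_on (L2 \<Omega>) Vh ih"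
    and estimator: "elliptic_estimator \<Omega> a Vh ah ih \<eta>"
    and green: "greens_function \<Omega> a T G G'" "greens_function_bounds \<Omega> T G G' \<kappa>0 \<kappa>1 \<kappa>1' \<gamma>"
      "0 \<le> \<kappa>0" "0 \<le> \<kappa>1" "0 \<le> \<kappa>1'" "0 \<le> \<gamma>"
    and euler: "extrapolated_euler Vh ah ih L M t fh uh"
    and recon: "reconstruction Vh ah ih L M t fh \<Delta>f uh \<psi> \<Delta>u \<Delta>\<psi>"
  shows "Linf_norm \<Omega> (\<lambda>y. u T y - uh M y) \<le>
           eta_init \<Omega> \<kappa>0 \<gamma> T t u0 uh + eta_f \<Omega> \<kappa>0 \<gamma> T M t f fh
           + eta_t \<Omega> \<kappa>0 \<kappa>1 \<kappa>1' \<gamma> T L M t \<Delta>u \<Delta>\<psi>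
           + eta_ell \<eta> \<kappa>0 \<gamma> T L M t fh \<Delta>f uh \<psi> \<Delta>u \<Delta>\<psi>"
proof -
  interpret scheme \<Omega> A d b c a ah ih T u0 f fh u L M t z Vh \<eta> G G' \<kappa>0 \<kappa>1 \<kappa>1' \<gamma> uh \<psi> \<Delta>f \<Delta>u \<Delta>\<psi>
    using assms by unfold_locales
  show ?thesis by (rule error_bound)
qed

end
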